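(* Let $\Omega\subset B_1\subset\mathbb{R}^d$ be an open set with $0\in\partial\Omega$ and let $\phi:B_1\to\mathbb{R}$ be a continuous function such that: (a) $\phi>0$ on $\Omega$ and $\phi\equiv 0$ on $B_1\setminus\Omega$; (b) $\phi$ is $L$-Lipschitz continuous on $B_1$, where $L>0$ is a given constant; (c) there is a constant $\kappa>0$ such that $\phi\ge\kappa\,\mathrm{dist}_{B_1\setminus\Omega}$ in $B_{1/2}$; (d) $\Delta\phi\ge 0$ in the sense of distributions in $B_1$; (e) there is a constant $\mu>0$ such that for every $x_0\in\partial\Omega\cap B_1$ we have $|B_r(x_0)\setminus\Omega|\ge\mu|B_r(x_0)|$ for every $r\in(0,1-|x_0|)$; (f) there is a constant $\Lambda>0$ such that for every $x_0\in\partial\Omega\cap B_1$ and every $r\in(0,1-|x_0|)$ we have $\big|\{0<\phi<rt\}\cap B_r(x_0)\big|\le\Lambda t|B_r|$ for every $t>0$; (g) there is a constant $\eta>0$ such that for every $x_0\in\partial\Omega\cap B_1$ and every $r\in(0,1-|x_0|)$ we have $\sup_{B_r(x_0)}\phi\ge\eta r$. Then the Boundary Harnack Principle holds in $\Omega$.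
   Context: $B_r(x_0)$ is the open ball of radius $r$ centered at $x_0$ in $\mathbb{R}^d$, $B_r=B_r(0)$; $|E|$ is the Lebesgue measure of $E$; $\mathrm{dist}_{B_1\setminus\Omega}(x)$ is the distance from $x$ to the set $B_1\setminus\Omega$. Definition (Boundary Harnack Principle). We say that the Boundary Harnack Principle holds in an open set $\Omega\subset B_1$ if there is a constant $\alpha>0$ such that, for every $u:B_1\to\mathbb{R}$ and $v:B_1\to\mathbb{R}$ which are continuous on $B_1$, positive and harmonic in $\Omega\cap B_1$, and vanishing identically on $B_1\setminus\Omega$, the ratio $\frac{u}{v}:\Omega\to\mathbb{R}$ can be extended to a $C^{0,\alpha}$-regular (i.e. $\alpha$-Hölder continuous) function on $B_\rho\cap\overline{\Omega}$, for some $\rho\in(0,1/2)$. *)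

theory Defs
  imports "HOL-Analysis.Analysis"
begin

definition partial_deriv ::
    "'a::euclidean_space \<Rightarrow> ('a \<Rightarrow> real) \<Rightarrow> 'a \<Rightarrow> real" where
  "partial_deriv i f x = frechet_derivative f (at x) i"

text \<open>
  \<open>Ck_on k S f\<close> is meant for open \<open>S\<close>, where it is the class \<open>C\<^sup>k(S)\<close>.
\<close>

primrec Ck_on :: "nat \<Rightarrow> 'a::euclidean_space set \<Rightarrow> ('a \<Rightarrow> real) \<Rightarrow> bool" where
  "Ck_on 0 S f \<longleftrightarrow> continuous_on S f"
| "Ck_on (Suc k) S f \<longleftrightarrow>
     f differentiable_on S \<and> (\<forall>i\<in>Basis. Ck_on k S (partial_deriv i f))"

definition laplacian :: "('a::euclidean_space \<Rightarrow> real) \<Rightarrow> 'a \<Rightarrow> real" where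
  "laplacian f x = (\<Sum>i\<in>Basis. partial_deriv i (partial_deriv i f) x)"

definition harmonic_on :: "'a::euclidean_space set \<Rightarrow> ('a \<Rightarrow> real) \<Rightarrow> bool" where
  "harmonic_on S f \<longleftrightarrow> Ck_on 2 S f \<and> (\<forall>x\<in>S. laplacian f x = 0)"

text \<open>Elements of \<open>C\<^sub>c\<^sup>\<infinity>(S)\<close>, extended by zero to the whole space.\<close>

definition test_function_on :: "'a::euclidean_space set \<Rightarrow> ('a \<Rightarrow> real) \<Rightarrow> bool" where
  "test_function_on S \<psi> \<longleftrightarrow>
     (\<forall>k. Ck_on k UNIV \<psi>) \<and>
     compact (closure {x. \<psi> x \<noteq> 0}) \<and> closure {x. \<psi> x \<noteq> 0} \<subseteq> S"

text \<open>
  \<open>\<Delta>f \<ge> 0\<close> in the sense of distributions in \<open>S\<close>. This is meant for \<open>f\<close> continuous (or locally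
  integrable) on the open set \<open>S\<close>, so that all the integrals below exist.
\<close>

definition distr_subharmonic_on :: "'a::euclidean_space set \<Rightarrow> ('a \<Rightarrow> real) \<Rightarrow> bool" where
  "distr_subharmonic_on S f \<longleftrightarrow>
     (\<forall>\<psi>. test_function_on S \<psi> \<and> (\<forall>x. \<psi> x \<ge> 0) \<longrightarrow>
        (LINT x:S|lborel. f x * laplacian \<psi> x) \<ge> 0)"

definition hoelder_on ::
    "real \<Rightarrow> 'a::metric_space set \<Rightarrow> ('a \<Rightarrow> 'b::metric_space) \<Rightarrow> bool" where
  "hoelder_on \<alpha> S f \<longleftrightarrow>
     (\<exists>C. \<forall>x\<in>S. \<forall>y\<in>S. dist (f x) (f y) \<le> C * dist x y powr \<alpha>)"

text \<open>
  Functions on \<open>B\<^sub>1\<close> are represented by functions on the whole space whose values outside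
  \<open>ball 0 1\<close> are irrelevant. The exponent \<open>\<alpha>\<close> is common to all \<open>u\<close>, \<open>v\<close>, whereas the radius \<open>\<rho>\<close>
  may depend on them.
\<close>

definition boundary_harnack_principle :: "'a::euclidean_space set \<Rightarrow> bool" where
  "boundary_harnack_principle \<Omega> \<longleftrightarrow>
     (\<exists>\<alpha>>0. \<forall>u v :: 'a \<Rightarrow> real.
        continuous_on (ball 0 1) u \<and> continuous_on (ball 0 1) v \<and>
        (\<forall>x\<in>\<Omega> \<inter> ball 0 1. u x > 0) \<and> (\<forall>x\<in>\<Omega> \<inter> ball 0 1. v x > 0) \<and>
        harmonic_on (\<Omega> \<inter> ball 0 1) u \<and> harmonic_on (\<Omega> \<inter> ball 0 1) v \<and>
        (\<forall>x\<in>ball 0 1 - \<Omega>. u x = 0) \<and> (\<forall>x\<in>ball 0 1 - \<Omega>. v x = 0) \<longrightarrow>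
        (\<exists>\<rho>. 0 < \<rho> \<and> \<rho> < 1/2 \<and>
          (\<exists>g :: 'a \<Rightarrow> real.
             (\<forall>x\<in>\<Omega> \<inter> ball 0 \<rho>. g x = u x / v x) \<and>
             hoelder_on \<alpha> (ball 0 \<rho> \<inter> closure \<Omega>) g)))"

end

theory Submission
 imports Defs "HOL-Probability.Probability"
begin

text \<open>
 The geometric heart is that points of \<open>{\<phi> \<ge> \<delta> r}\<close> near a boundary point can be joined inside
 \<open>{\<phi> > \<delta> r / 16}\<close> at a comparable scale. Otherwise two components would carry disjoint
 subharmonic functions of linear growth, and the complement of both has positive density. In the
 spirit of Alt, Caffarelli and Friedman, put \<open>N i s = E (f i (s X))\<^sup>2\<close> for a standard Gaussian \<open>X\<close>; a
 Friedland-Hayman inequality with a gain \<open>\<epsilon>\<close> (the gain comes from the density of the zero set)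
 makes \<open>N 1 s * N 2 s\<close> grow like \<open>s\<^bsup>4 + 4 \<epsilon>\<^esup>\<close>, against the linear growth. That inequality is
 deduced from the second-order Gaussian Poincare inequality, which forces a near-optimal function
 to be nearly affine, and from a numerical gap for affine functions.

 Connectivity gives Harnack chains, hence a polynomial growth bound and Carleson's estimate. For
 the boundary Harnack inequality we follow De Silva and Savin: if \<open>w \<ge> -1\<close> and \<open>w \<ge> 1\<close> on
 \<open>{\<phi> \<ge> \<delta> r}\<close>, then, as the strip \<open>{0 < \<phi> < \<delta> r}\<close> has small measure by (f), the mean value
 inequality improves the lower bound by a factor at half the scale; iterating, \<open>w \<ge> 0\<close>. Applied to
 \<open>u - a v\<close> and \<open>b v - u\<close> this gives geometric decay of the oscillation of \<open>u / v\<close>.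
\<close>

section \<open>Calculus of iterated partial derivatives\<close>

text \<open>The two-phase argument sits exactly on its borderline: the positive and negative parts
  of a coordinate have linear growth and N 1 s * N 2 s of exact order s^4. Only a strict gain gives
  a contradiction, and it has to come from the zero set. Gaussian averages replace the spherical
  ones of the classical formula because integration by parts then becomes Stein's identity: no
  traces, surface measures or eigenvalue problems occur. The obstacle is that the second-order
  inequality bounds the squared distance of a normalized F to the affine functions only by m^2 +
  \<epsilon>, where m is the mean of F, and the zero set keeps m away from 0. So F need not be a
  small perturbation of an affine function. The balance E (F |F|) = 0 is instead refuted by an
  explicit inequality in the single variable m / c, with c the slope of the affine part; this is the
  source of the interval arithmetic. The constants are fixed in the order \<epsilon> (gain), S
  (range of scales), \<eta> (admissible error), M (radius of the cutoff).\<close>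

abbreviation (input) pd :: "'a::euclidean_space => ('a => real) => 'a => real" where
 "pd \<equiv> partial_deriv"

abbreviation (input) nd :: "real => real" where
 "nd \<equiv> std_normal_density"

lemmas Lintegrable_add = Bochner_Integration.integrable_add
 and Lintegrable_bound = Bochner_Integration.integrable_bound
 and Lintegrable_diff = Bochner_Integration.integrable_diff
 and Lintegrable_sum = Bochner_Integration.integrable_sum
 and Lintegral_add = Bochner_Integration.integral_add
 and Lintegral_cong = Bochner_Integration.integral_cong
 and Lintegral_diff = Bochner_Integration.integral_diff
 and Lintegral_sum = Bochner_Integration.integral_sum

lemma partial_deriv_eq:
 "(f has_derivative f') (at x) ==> pd i f x = f' i"
 unfolding partial_deriv_def using frechet_derivative_at by metis

text \<open>\<open>frechet_derivative\<close> is a choice from the set of derivatives. Two functions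
  that agree near x have the same set, so the equation holds even where neither is
  differentiable.\<close>

lemma partial_deriv_cong_open:
 assumes "open S" "x : S" "!!y. y : S ==> f y = g y"
 shows "pd i f x = pd i g x"
proof -
 have "(f has_derivative f') (at x) \<longleftrightarrow> (g has_derivative f') (at x)" for f'
  using assms by (metis has_derivative_transform_within_open)
 then show ?thesis unfolding partial_deriv_def frechet_derivative_def by simp
qed

lemma Ck_on_SucD:
 assumes "open S" "Ck_on (Suc k) S f" shows "Ck_on k S f"
 using assms(2)
proof (induction k arbitrary: f)
 case 0
 then show ?case by (auto simp: differentiable_imp_continuous_on)
next
 case (Suc k)
 then show ?case by (metis Ck_on.simps(2))
qed

lemma Ck_on_le:
 assumes "open S" "Ck_on k S f" "j <= k" shows "Ck_on j S f"
 using assms(3,2)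
proof (induction k rule: dec_induct)
 case (step n)
 then show ?case using Ck_on_SucD[OF assms(1)] by blast
qed

lemma Ck_on_subset:
 assumes "T <= S" "Ck_on k S f" shows "Ck_on k T f"
 using assms(2)
proof (induction k arbitrary: f)
 case 0
 then show ?case using assms(1) by (auto intro: continuous_on_subset)
next
 case (Suc k)
 then show ?case using assms(1) by (auto intro: differentiable_on_subset)
qed

lemma differentiable_on_cong:
 assumes "f differentiable_on S" "!!x. x : S ==> f x = g x"
 shows "g differentiable_on S"
 unfolding differentiable_on_def differentiable_def
proof
 fix x assume x: "x : S"
 then obtain f' where "(f has_derivative f') (at x within S)"
  using assms(1) unfolding differentiable_on_def differentiable_def by blast
 then have "(g has_derivative f') (at x within S)"
  by (rule has_derivative_transform[OF x assms(2)[symmetric], rotated]) auto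
 then show "EX D. (g has_derivative D) (at x within S)" by blast
qed

lemma Ck_on_cong:
 assumes "open S" "!!x. x : S ==> f x = g x" "Ck_on k S f"
 shows "Ck_on k S g"
 using assms(2,3)
proof (induction k arbitrary: f g)
 case 0
 then show ?case by (auto cong: continuous_on_cong)
next
 case (Suc k)
 have "Ck_on k S (pd i g)" if "i : Basis" for i
 proof (rule Suc.IH)
  show "Ck_on k S (pd i f)" using Suc.prems(2) that by simp
  show "pd i f x = pd i g x" if "x : S" for x
   using partial_deriv_cong_open[OF assms(1) that] Suc.prems(1) by blast
 qed
 moreover have "g differentiable_on S"
  using Suc.prems differentiable_on_cong by (metis Ck_on.simps(2))
 ultimately show ?case by simp
qed

text \<open>The gluing principle behind every extension by zero below: the function is smooth on one
  open set for analytic reasons and vanishes identically on the other.\<close>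

lemma Ck_on_Un:
 assumes "open S" "open T" "Ck_on k S f" "Ck_on k T f"
 shows "Ck_on k (S \<union> T) f"
 using assms(3,4)
proof (induction k arbitrary: f)
 case 0
 then show ?case using assms(1,2) by (auto intro: continuous_on_open_Un)
next
 case (Suc k)
 then have "f differentiable_on (S \<union> T)"
  using assms(1,2) by (auto simp: differentiable_on_eq_differentiable_at open_Un)
 then show ?case using Suc by auto
qed

lemma Ck_on_has_derivative:
 assumes "Ck_on (Suc k) S f" "open S" "x : S"
 shows "(f has_derivative frechet_derivative f (at x)) (at x)"
proof -
 have "f differentiable (at x)"
  using assms by (simp add: differentiable_on_eq_differentiable_at)
 then show ?thesis by (rule frechet_derivative_works[THEN iffD1])
qed

lemma partial_deriv_expand:
 fixes f :: "'a::euclidean_space => real"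
 assumes "(f has_derivative f') (at x)"
 shows "f' v = (SUM i:Basis. (v \<bullet> i) * pd i f x)"
proof -
 have l: "linear f'" using assms has_derivative_linear by blast
 have "f' v = f' (SUM i:Basis. (v \<bullet> i) *\<^sub>R i)" by (simp add: euclidean_representation)
 also have "... = (SUM i:Basis. (v \<bullet> i) * f' i)"
  using l by (simp add: linear_sum linear_scale)
 finally show ?thesis using partial_deriv_eq[OF assms] by simp
qed

lemma Ck_on_const [simp]: "Ck_on k S (%x::'a::euclidean_space. c)"
proof (induction k arbitrary: c)
 case (Suc k)
 have "pd i (%x::'a. c) = (%x. 0)" for i
  by (rule ext) (simp add: partial_deriv_def)
 then show ?case using Suc by simp
qed simp

lemma Ck_on_add:
 assumes "open S" "Ck_on k S f" "Ck_on k S g"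
 shows "Ck_on k S (%x. f x + g x)"
 using assms(2,3)
proof (induction k arbitrary: f g)
 case 0
 then show ?case by (auto intro: continuous_intros)
next
 case (Suc k)
 have "Ck_on k S (pd i (%x. f x + g x))" if "i : Basis" for i
 proof (rule Ck_on_cong[OF assms(1)])
  show "Ck_on k S (%x. pd i f x + pd i g x)"
   using Suc that by auto
  show "pd i f x + pd i g x = pd i (%x. f x + g x) x"
   if "x : S" for x
   by (rule sym, rule trans, rule partial_deriv_eq, rule has_derivative_add,
     rule Ck_on_has_derivative[OF Suc.prems(1) assms(1) that],
     rule Ck_on_has_derivative[OF Suc.prems(2) assms(1) that])
     (simp add: partial_deriv_def)
 qed
 then show ?case using Suc.prems by (auto intro: differentiable_on_add)
qed

lemma Ck_on_mult:
 assumes "open S" "Ck_on k S f" "Ck_on k S g"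
 shows "Ck_on k S (%x. f x * g x)"
 using assms(2,3)
proof (induction k arbitrary: f g)
 case 0
 then show ?case by (auto intro: continuous_intros)
next
 case (Suc k)
 have "Ck_on k S (pd i (%x. f x * g x))" if "i : Basis" for i
 proof (rule Ck_on_cong[OF assms(1)])
  show "Ck_on k S (%x. f x * pd i g x + pd i f x * g x)"
   using Suc that Ck_on_SucD[OF assms(1)] by (auto intro!: Ck_on_add[OF assms(1)])
  show "f x * pd i g x + pd i f x * g x = pd i (%x. f x * g x) x"
   if "x : S" for x
   by (rule sym, rule trans, rule partial_deriv_eq, rule has_derivative_mult,
     rule Ck_on_has_derivative[OF Suc.prems(1) assms(1) that],
     rule Ck_on_has_derivative[OF Suc.prems(2) assms(1) that])
     (simp add: partial_deriv_def)
 qed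
 then show ?case using Suc.prems by (auto intro: differentiable_on_mult)
qed

lemma Ck_on_cmult: "open S ==> Ck_on k S f ==> Ck_on k S (%x. c * f x)"
 by (intro Ck_on_mult) auto

lemma Ck_on_diff:
 assumes "open S" "Ck_on k S f" "Ck_on k S g"
 shows "Ck_on k S (%x. f x - g x)"
 using Ck_on_add[OF assms(1,2) Ck_on_cmult[OF assms(1,3), of "-1"]] by simp

lemma Ck_on_sum:
 assumes "open S" "finite I" "!!i. i : I ==> Ck_on k S (f i)"
 shows "Ck_on k S (%x. SUM i:I. f i x)"
 using assms(2,3) by (induction I rule: finite_induct) (auto intro: Ck_on_add[OF assms(1)])

lemma Ck_on_affine_arg:
 fixes f :: "'a::euclidean_space => real"
 assumes "open S" "open T" "Ck_on k S f" "!!x. x : T ==> a + r *\<^sub>R x : S"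
 shows "Ck_on k T (%x. f (a + r *\<^sub>R x))"
 using assms(3)
proof (induction k arbitrary: f)
 case 0
 then have "continuous_on S f" by simp
 then have "continuous_on T (%x. f (a + r *\<^sub>R x))"
  by (rule continuous_on_compose2) (use assms(4) in \<open>auto intro!: continuous_intros\<close>)
 then show ?case by simp
next
 case (Suc k)
 have der: "((%x. f (a + r *\<^sub>R x)) has_derivative
   (%h. frechet_derivative f (at (a + r *\<^sub>R x)) (r *\<^sub>R h))) (at x)" if "x : T" for x
  by (rule has_derivative_compose[where f="%x. a + r *\<^sub>R x" and g=f and s=UNIV, simplified])
   (use Ck_on_has_derivative[OF Suc.prems assms(1) assms(4)[OF that]]
    in \<open>auto intro!: derivative_eq_intros\<close>)
 have "Ck_on k T (pd i (%x. f (a + r *\<^sub>R x)))" if "i : Basis" for i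
 proof (rule Ck_on_cong[OF assms(2)])
  show "Ck_on k T (%x. r * pd i f (a + r *\<^sub>R x))"
   using Suc that by (auto intro!: Ck_on_cmult[OF assms(2)])
  show "r * pd i f (a + r *\<^sub>R x) = pd i (%x. f (a + r *\<^sub>R x)) x"
   if "x : T" for x
  proof -
   have "linear (frechet_derivative f (at (a + r *\<^sub>R x)))"
    using Ck_on_has_derivative[OF Suc.prems assms(1) assms(4)[OF that]] has_derivative_linear
    by blast
   then show ?thesis
    using partial_deriv_eq[OF der[OF that], of i] by (simp add: partial_deriv_def linear_scale)
  qed
 qed
 moreover have "(%x. f (a + r *\<^sub>R x)) differentiable_on T"
  unfolding differentiable_on_eq_differentiable_at[OF assms(2)] differentiable_def using der by blast
 ultimately show ?case by simp
qed

lemma partial_deriv_affine_arg: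
 fixes f :: "'a::euclidean_space => real"
 assumes "f differentiable (at (a + r *\<^sub>R x))"
 shows "pd i (%x. f (a + r *\<^sub>R x)) x = r * pd i f (a + r *\<^sub>R x)"
proof -
 let ?D = "frechet_derivative f (at (a + r *\<^sub>R x))"
 have 1: "(f has_derivative ?D) (at (a + r *\<^sub>R x))"
  using assms frechet_derivative_works by blast
 have "((%x. f (a + r *\<^sub>R x)) has_derivative (%h. ?D (r *\<^sub>R h))) (at x)"
  by (rule has_derivative_compose[where f="%x. a + r *\<^sub>R x" and g=f and s=UNIV, simplified])
   (use 1 in \<open>auto intro!: derivative_eq_intros\<close>)
 moreover have "linear ?D" using 1 has_derivative_linear by blast
 ultimately show ?thesis
  using partial_deriv_eq[of "%x. f (a + r *\<^sub>R x)" "%h. ?D (r *\<^sub>R h)" x i]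
  by (simp add: linear_scale partial_deriv_def)
qed

text \<open>On the real line, whose only basis vector is \<open>1\<close>, \<open>pd 1\<close> is the ordinary derivative.\<close>

lemma Ck_on_compose_real:
 fixes f :: "'a::euclidean_space => real" and g :: "real => real"
 assumes "open S" "open T" "Ck_on k S f" "Ck_on k T g" "f ` S <= T"
 shows "Ck_on k S (%x. g (f x))"
 using assms(3,4)
proof (induction k arbitrary: g)
 case 0
 then show ?case using assms(5) by (auto intro: continuous_on_compose2)
next
 case (Suc k)
 have der: "((%x. g (f x)) has_derivative
   (%h. frechet_derivative g (at (f x)) (frechet_derivative f (at x) h))) (at x)" if "x : S" for x
 proof -
  have "f x : T" using assms(5) that by blast
  then show ?thesis
   using has_derivative_compose[OF Ck_on_has_derivative[OF Suc.prems(1) assms(1) that]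
    Ck_on_has_derivative[OF Suc.prems(2) assms(2)]] by blast
 qed
 have "Ck_on k S (pd i (%x. g (f x)))" if "i : Basis" for i
 proof (rule Ck_on_cong[OF assms(1)])
  show "Ck_on k S (%x. pd 1 g (f x) * pd i f x)"
   by (rule Ck_on_mult[OF assms(1) Suc.IH[where g="pd 1 g", OF Ck_on_SucD[OF assms(1) Suc.prems(1)]]])
     (use Suc.prems that in simp_all)
  show "pd 1 g (f x) * pd i f x = pd i (%x. g (f x)) x"
   if "x : S" for x
  proof -
   have "f x : T" using assms(5) that by blast
   then show ?thesis
    using partial_deriv_eq[OF der[OF that], of i]
     partial_deriv_expand[OF Ck_on_has_derivative[OF Suc.prems(2) assms(2)], of "f x"
      "frechet_derivative f (at x) i"]
    by (simp add: partial_deriv_def mult.commute)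
  qed
 qed
 moreover have "(%x. g (f x)) differentiable_on S"
  unfolding differentiable_on_eq_differentiable_at[OF assms(1)] differentiable_def using der by blast
 ultimately show ?case by simp
qed

lemma Ck_on_inner: "Ck_on k S (%x. x \<bullet> v)"
proof (cases k)
 case (Suc j)
 have "pd i (%x. x \<bullet> v) = (%x. i \<bullet> v)" for i
  by (rule ext, rule partial_deriv_eq) (auto intro!: derivative_eq_intros)
 moreover have "(%x. x \<bullet> v) differentiable_on S"
  by (rule bounded_linear_imp_differentiable_on[OF bounded_linear_inner_left])
 ultimately show ?thesis using Suc by simp
qed (auto intro!: continuous_intros)

lemma Ck_on_norm_sq:
 assumes "open S" shows "Ck_on k S (%x::'a::euclidean_space. x \<bullet> x)"
proof -
 have "Ck_on k S (%x::'a. SUM i:Basis. (x \<bullet> i) * (x \<bullet> i))"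
  by (intro Ck_on_sum Ck_on_mult assms Ck_on_inner finite_Basis)
 then show ?thesis by (subst euclidean_inner)
qed

lemma partial_deriv_mult:
 assumes "f differentiable (at x)" "g differentiable (at x)"
 shows "pd i (%x. f x * g x) x = f x * pd i g x + pd i f x * g x"
proof -
 note * = has_derivative_mult[OF assms[unfolded frechet_derivative_works]]
 show ?thesis unfolding partial_deriv_eq[OF *] by (simp add: partial_deriv_def)
qed

lemma partial_deriv_compose_real:
 fixes g :: "real => real"
 assumes "f differentiable (at x)" "(g has_real_derivative g') (at (f x))"
 shows "pd i (%x. g (f x)) x = g' * pd i f x"
proof -
 have "((%x. g (f x)) has_derivative (%h. g' * frechet_derivative f (at x) h)) (at x)"
  by (rule has_derivative_compose[where f=f and g=g and s=UNIV, simplified])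
   (use assms in \<open>auto simp: frechet_derivative_works has_field_derivative_def\<close>)
 then show ?thesis by (subst partial_deriv_eq) (auto simp: partial_deriv_def)
qed

lemma Ck_on_2_partial:
 assumes "Ck_on 2 S f" "open S" "x : S"
 shows "f differentiable (at x)" "i : Basis ==> pd i f differentiable (at x)"
 using assms by (auto simp: numeral_2_eq_2 differentiable_on_eq_differentiable_at)

lemma Ck_on_partial_deriv: "Ck_on (Suc k) S f ==> i : Basis ==> Ck_on k S (pd i f)"
 by simp

lemma Ck_on_laplacian:
 assumes "open S" "Ck_on (Suc (Suc k)) S f" shows "Ck_on k S (laplacian f)"
 unfolding laplacian_def[abs_def] using assms by (intro Ck_on_sum) auto

lemma Ck_on_continuous: "open S ==> Ck_on k S f ==> continuous_on S f"
 using Ck_on_le[of S k f 0] by auto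

section \<open>Laplacians of sums, products, compositions and dilations\<close>

lemma laplacian_cong_open:
 assumes "open S" "x : S" "!!y. y : S ==> f y = g y"
 shows "laplacian f x = laplacian g x"
 unfolding laplacian_def
 by (intro sum.cong refl partial_deriv_cong_open[OF assms(1,2)])
   (use partial_deriv_cong_open[OF assms(1)] assms(3) in blast)

lemma partial_deriv_add:
 assumes "f differentiable (at x)" "g differentiable (at x)"
 shows "pd i (%x. a * f x + b * g x) x = a * pd i f x + b * pd i g x"
proof -
 have "((%x. a * f x + b * g x) has_derivative
   (%h. a * frechet_derivative f (at x) h + b * frechet_derivative g (at x) h)) (at x)"
  using assms unfolding frechet_derivative_works by (auto intro!: derivative_eq_intros)
 then show ?thesis by (subst partial_deriv_eq) (auto simp: partial_deriv_def)
qed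

lemma laplacian_add:
 assumes "open S" "x : S" "Ck_on 2 S f" "Ck_on 2 S g"
 shows "laplacian (%x. a * f x + b * g x) x = a * laplacian f x + b * laplacian g x"
proof -
 have "pd i (pd i (%x. a * f x + b * g x)) x
   = a * pd i (pd i f) x + b * pd i (pd i g) x"
  if "i : Basis" for i
 proof -
  have "pd i (pd i (%x. a * f x + b * g x)) x
    = pd i (%x. a * pd i f x + b * pd i g x) x"
   by (rule partial_deriv_cong_open[OF assms(1,2)], rule partial_deriv_add)
     (auto intro: Ck_on_2_partial(1)[OF assms(3,1)] Ck_on_2_partial(1)[OF assms(4,1)])
  then show ?thesis
   using partial_deriv_add[OF Ck_on_2_partial(2)[OF assms(3,1,2) that]
     Ck_on_2_partial(2)[OF assms(4,1,2) that], of i a b] by simp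
 qed
 then show ?thesis unfolding laplacian_def by (simp add: sum.distrib sum_distrib_left)
qed

lemma laplacian_mult:
 assumes "open S" "x : S" "Ck_on 2 S f" "Ck_on 2 S g"
 shows "laplacian (%x. f x * g x) x = f x * laplacian g x + g x * laplacian f x
   + 2 * (SUM i:Basis. pd i f x * pd i g x)"
proof -
 have "pd i (pd i (%x. f x * g x)) x
   = f x * pd i (pd i g) x + g x * pd i (pd i f) x
    + 2 * (pd i f x * pd i g x)"
  if "i : Basis" for i
 proof -
  note d = Ck_on_2_partial(1)[OF assms(3,1)] Ck_on_2_partial(1)[OF assms(4,1)]
  note d2 = Ck_on_2_partial(2)[OF assms(3,1,2) that] Ck_on_2_partial(2)[OF assms(4,1,2) that]
  have "pd i (pd i (%x. f x * g x)) x
    = pd i (%x. 1 * (f x * pd i g x) + 1 * (pd i f x * g x)) x"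
   by (rule partial_deriv_cong_open[OF assms(1,2)]) (simp add: partial_deriv_mult d)
  also have "... = 1 * pd i (%x. f x * pd i g x) x
     + 1 * pd i (%x. pd i f x * g x) x"
   using d[OF assms(2)] d2 by (intro partial_deriv_add) (auto intro!: derivative_intros)
  finally show ?thesis
   using d[OF assms(2)] d2 by (simp add: partial_deriv_mult algebra_simps)
 qed
 then show ?thesis unfolding laplacian_def by (simp add: sum.distrib sum_distrib_left)
qed

lemma laplacian_compose_real:
 fixes b b' b'' :: "real => real"
 assumes "open S" "x : S" "Ck_on 2 S f"
  and b: "!!s. (b has_real_derivative b' s) (at s)" "!!s. (b' has_real_derivative b'' s) (at s)"
 shows "laplacian (%x. b (f x)) x
  = b' (f x) * laplacian f x + b'' (f x) * (SUM i:Basis. (pd i f x)^2)"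
proof -
 have "pd i (pd i (%x. b (f x))) x
   = b' (f x) * pd i (pd i f) x + b'' (f x) * (pd i f x)^2"
  if "i : Basis" for i
 proof -
  note d = Ck_on_2_partial(1)[OF assms(3,1)]
  note d2 = Ck_on_2_partial(2)[OF assms(3,1,2) that]
  have db: "(%x. b' (f x)) differentiable at x"
  proof -
   have "b' differentiable (at (f x))" using b(2) real_differentiable_def by blast
   then show ?thesis using d[OF assms(2)] differentiable_chain_at[of f x b'] by (simp add: o_def)
  qed
  have "pd i (pd i (%x. b (f x))) x
    = pd i (%x. b' (f x) * pd i f x) x"
   by (rule partial_deriv_cong_open[OF assms(1,2)]) (rule partial_deriv_compose_real[OF d b(1)])
  also have "... = b' (f x) * pd i (pd i f) x
    + pd i (%x. b' (f x)) x * pd i f x"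
   by (rule partial_deriv_mult[OF db d2])
  finally show ?thesis
   using partial_deriv_compose_real[OF d[OF assms(2)] b(2)] by (simp add: power2_eq_square)
 qed
 then show ?thesis unfolding laplacian_def by (simp add: sum.distrib sum_distrib_left)
qed

lemma laplacian_affine_arg:
 fixes f :: "'a::euclidean_space => real"
 assumes "open S" "Ck_on 2 S f" "a + r *\<^sub>R x : S"
 shows "laplacian (%x. f (a + r *\<^sub>R x)) x = r^2 * laplacian f (a + r *\<^sub>R x)"
proof -
 let ?T = "(%x. a + r *\<^sub>R x) -` S"
 have T: "open ?T" "x : ?T"
  using assms(1,3) by (auto intro!: open_vimage continuous_intros)
 have "pd i (pd i (%x. f (a + r *\<^sub>R x))) x
   = r^2 * pd i (pd i f) (a + r *\<^sub>R x)" if "i : Basis" for i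
 proof -
  have "pd i (pd i (%x. f (a + r *\<^sub>R x))) x
    = pd i (%x. r * pd i f (a + r *\<^sub>R x)) x"
   by (rule partial_deriv_cong_open[OF T], rule partial_deriv_affine_arg)
     (auto intro: Ck_on_2_partial(1)[OF assms(2,1)])
  also have "... = r * pd i (%x. pd i f (a + r *\<^sub>R x)) x"
  proof -
   have "(%x. pd i f (a + r *\<^sub>R x)) differentiable at x"
    using differentiable_chain_at[of "%x. a + r *\<^sub>R x" x "pd i f"]
     Ck_on_2_partial(2)[OF assms(2,1,3) that] by (simp add: o_def)
   then show ?thesis
    using partial_deriv_add[of _ x "%x. 0" i r 0] by simp
  qed
  also have "pd i (%x. pd i f (a + r *\<^sub>R x)) x
    = r * pd i (pd i f) (a + r *\<^sub>R x)"
   by (rule partial_deriv_affine_arg[OF Ck_on_2_partial(2)[OF assms(2,1,3) that]])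
  finally show ?thesis by (simp add: power2_eq_square)
 qed
 then show ?thesis unfolding laplacian_def by (simp add: sum_distrib_left)
qed

lemma has_real_derivative_line:
 fixes f :: "'a::euclidean_space => real"
 assumes "f differentiable (at (x + t *\<^sub>R v))"
 shows "((%t. f (x + t *\<^sub>R v)) has_real_derivative
   (SUM i:Basis. (v \<bullet> i) * pd i f (x + t *\<^sub>R v))) (at t)"
proof -
 let ?D = "frechet_derivative f (at (x + t *\<^sub>R v))"
 have 1: "(f has_derivative ?D) (at (x + t *\<^sub>R v))" using assms frechet_derivative_works by blast
 have "((%t. f (x + t *\<^sub>R v)) has_derivative (%h. ?D (h *\<^sub>R v))) (at t)"
  by (rule has_derivative_compose[where f="%t. x + t *\<^sub>R v" and g=f and s=UNIV, simplified])
   (use 1 in \<open>auto intro!: derivative_eq_intros\<close>)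
 moreover have "?D (h *\<^sub>R v) = h * (SUM i:Basis. (v \<bullet> i) * pd i f (x + t *\<^sub>R v))" for h
  using partial_deriv_expand[OF 1, of v] has_derivative_linear[OF 1] by (simp add: linear_scale)
 moreover have "(%h. h * c) = (*) c" for c :: real by (rule ext) (simp add: mult.commute)
 ultimately show ?thesis unfolding has_field_derivative_def by simp
qed

text \<open>The scale \<open>s\<close> is kept apart because Gaussian averages move their argument
  by multiples of a basis vector such as sqrt \<rho> times i.\<close>

lemma has_real_derivative_axis:
 assumes i: "i : Basis" and f: "!!y. f differentiable (at y)"
 shows "((%t. f (x + t *\<^sub>R (s *\<^sub>R i))) has_real_derivative
   s * pd i f (x + t *\<^sub>R (s *\<^sub>R i))) (at t)"
 using has_real_derivative_line[OF f, of x "s *\<^sub>R i" t] i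
 by (simp add: inner_Basis if_distrib if_distribR sum.delta cong: if_cong)

lemma DERIV_integral_dominated:
 fixes f f' :: "real => 'a => real"
 assumes "a < t" "t < b"
  and int: "!!s. a < s ==> s < b ==> integrable M (f s)"
  and der: "!!s x. a < s ==> s < b ==> x : space M ==> ((%s. f s x) has_real_derivative f' s x) (at s)"
  and bd: "!!s x. a < s ==> s < b ==> x : space M ==> \<bar>f' s x\<bar> <= B x"
  and B: "integrable M B"
 shows "integrable M (f' t)"
  "((%s. LINT x|M. f s x) has_real_derivative (LINT x|M. f' t x)) (at t)"
proof -
 \<comment> \<open>This sequence serves measurability only: \<open>f' t\<close> is the pointwise
   limit of these quotients, whose increments keep t + h below b.\<close>
 define X where "X n x = (f (t + inverse (real (Suc n)) * (b - t) / 2) x - f t x)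
   / (inverse (real (Suc n)) * (b - t) / 2)" for n x
 have lip: "\<bar>f s x - f r x\<bar> <= B x * \<bar>s - r\<bar>"
  if "a < s" "s < b" "a < r" "r < b" "x : space M" for s r x
 proof -
  have "norm (f s x - f r x) <= B x * norm (s - r)"
  proof (rule field_differentiable_bound[where S="{a<..<b}" and f'="%s. f' s x"])
   show "((%s. f s x) has_field_derivative f' z x) (at z within {a<..<b})" if "z : {a<..<b}" for z
    using der[of z x] \<open>x : space M\<close> that has_field_derivative_at_within by auto
  qed (use bd that in auto)
  then show ?thesis by simp
 qed
 have h: "a < t + inverse (real (Suc n)) * (b - t) / 2" "t + inverse (real (Suc n)) * (b - t) / 2 < b"
   "inverse (real (Suc n)) * (b - t) / 2 > 0" for n
 proof -
  show p: "inverse (real (Suc n)) * (b - t) / 2 > 0" using assms(2) by simp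
  then show "a < t + inverse (real (Suc n)) * (b - t) / 2" using assms(1) by linarith
  have "inverse (real (Suc n)) <= 1" by (simp add: field_simps)
  then have "inverse (real (Suc n)) * (b - t) <= b - t" using assms(2)
   by (intro mult_left_le_one_le) auto
  then show "t + inverse (real (Suc n)) * (b - t) / 2 < b" using assms(2)
   by (simp add: field_simps)
 qed
 have Xm: "X n : borel_measurable M" for n
  unfolding X_def using int h assms(1,2) by (intro borel_measurable_divide borel_measurable_diff) auto
 have Xlim: "(%n. X n x) \<longlonglongrightarrow> f' t x" if "x : space M" for x
 proof -
  have "((%h. (f (t + h) x - f t x) / h) \<longlongrightarrow> f' t x) (at 0)"
   using der[OF assms(1,2) that] by (simp add: DERIV_def)
  moreover have "filterlim (%n. inverse (real (Suc n)) * (b - t) / 2) (at 0) sequentially"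
  proof (rule filterlim_atI)
   have "(%n. inverse (real (Suc n)) * (b - t) / 2) \<longlonglongrightarrow> 0 * (b - t) / 2"
    by (intro tendsto_intros LIMSEQ_inverse_real_of_nat) auto
   then show "(%n. inverse (real (Suc n)) * (b - t) / 2) \<longlonglongrightarrow> 0" by simp
   show "\<forall>\<^sub>F n in sequentially. inverse (real (Suc n)) * (b - t) / 2 ~= 0"
    using h(3) by (auto intro!: always_eventually simp: less_imp_neq[symmetric])
  qed
  ultimately show ?thesis unfolding X_def by (rule filterlim_compose)
 qed
 have m: "f' t : borel_measurable M"
  by (rule borel_measurable_LIMSEQ_real[OF Xlim Xm])
 show "integrable M (f' t)"
  by (rule Lintegrable_bound[OF B m]) (use bd[OF assms(1,2)] in \<open>force intro!: AE_I2\<close>)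
 show "((%s. LINT x|M. f s x) has_real_derivative (LINT x|M. f' t x)) (at t)"
  unfolding DERIV_def tendsto_at_iff_sequentially o_def
 proof (intro allI impI)
  fix S :: "nat => real" assume S: "ALL n. S n : UNIV - {0}" "S \<longlonglongrightarrow> 0"
  have "\<forall>\<^sub>F n in sequentially. a - t < S n & S n < b - t"
   using order_tendstoD[OF S(2)] assms(1,2) by (intro eventually_conj) auto
  then obtain N where N: "!!n. n >= N ==> a - t < S n & S n < b - t"
   unfolding eventually_sequentially by blast
  \<comment> \<open>The shift discards the finitely many increments that leave the interval (a,
    b).\<close>
  define Y where "Y n = S (n + N)" for n
  have Y: "a < t + Y n" "t + Y n < b" "Y n ~= 0" for n
   using N[of "n + N"] S(1) unfolding Y_def by auto
  have "(%n. LINT x|M. (f (t + Y n) x - f t x) / Y n) \<longlonglongrightarrow> (LINT x|M. f' t x)"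
  proof (rule integral_dominated_convergence[OF m _ B])
   show "(%x. (f (t + Y n) x - f t x) / Y n) : borel_measurable M" for n
    using int Y assms(1,2) by (intro borel_measurable_divide borel_measurable_diff) auto
   show "AE x in M. (%n. (f (t + Y n) x - f t x) / Y n) \<longlonglongrightarrow> f' t x"
   proof (rule AE_I2)
    fix x assume x: "x : space M"
    have "((%h. (f (t + h) x - f t x) / h) \<longlongrightarrow> f' t x) (at 0)"
     using der[OF assms(1,2) x] by (simp add: DERIV_def)
    moreover have "filterlim Y (at 0) sequentially"
     using LIMSEQ_ignore_initial_segment[OF S(2), of N] Y(3)
     by (intro filterlim_atI) (auto simp: Y_def[abs_def])
    ultimately show "(%n. (f (t + Y n) x - f t x) / Y n) \<longlonglongrightarrow> f' t x"
     by (rule filterlim_compose)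
   qed
   show "AE x in M. norm ((f (t + Y n) x - f t x) / Y n) <= B x" for n
   proof (rule AE_I2)
    fix x assume x: "x : space M"
    have "\<bar>f (t + Y n) x - f t x\<bar> <= B x * \<bar>Y n\<bar>"
     using lip[OF Y(1,2) assms(1,2) x, of n] by simp
    then show "norm ((f (t + Y n) x - f t x) / Y n) <= B x"
     using Y(3)[of n] by (simp add: field_simps)
   qed
  qed
  also have "(%n. LINT x|M. (f (t + Y n) x - f t x) / Y n)
    = (%n. ((LINT x|M. f (t + Y n) x) - (LINT x|M. f t x)) / Y n)"
   using int Y assms(1,2) by (intro ext) (simp add: Lintegral_diff)
  finally show "(%n. ((LINT x|M. f (t + S n) x) - (LINT x|M. f t x)) / S n) \<longlonglongrightarrow> (LINT x|M. f' t x)"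
   unfolding Y_def by (rule LIMSEQ_offset)
 qed
qed

section \<open>Mean value inequalities\<close>

lemma lborel_affine_int:
 fixes f :: "'a::euclidean_space => real"
 assumes "r ~= 0" and [measurable]: "f : borel_measurable borel"
 shows "integrable lborel (%y. f (a + r *\<^sub>R y)) \<longleftrightarrow> integrable lborel f"
  and "(LINT y|lborel. f y) = \<bar>r\<bar> ^ DIM('a) * (LINT y|lborel. f (a + r *\<^sub>R y))"
proof -
 let ?D = "distr lborel borel (%y::'a. a + r *\<^sub>R y)"
 have L: "(lborel::'a measure) = density ?D (%_. \<bar>r\<bar> ^ DIM('a))"
  by (rule lborel_affine[OF assms(1)])
 have "integrable lborel f \<longleftrightarrow> integrable ?D (%y. \<bar>r\<bar> ^ DIM('a) *\<^sub>R f y)"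
  by (subst L, subst integrable_density) auto
 also have "... \<longleftrightarrow> integrable lborel (%y. f (a + r *\<^sub>R y))"
  using assms(1) by (subst integrable_distr_eq) auto
 finally show "integrable lborel (%y. f (a + r *\<^sub>R y)) \<longleftrightarrow> integrable lborel f" by simp
 have "(LINT y|lborel. f y) = (LINT y|?D. \<bar>r\<bar> ^ DIM('a) *\<^sub>R f y)"
  by (subst L, subst integral_density) auto
 also have "... = \<bar>r\<bar> ^ DIM('a) * (LINT y|lborel. f (a + r *\<^sub>R y))"
  by (subst integral_distr) auto
 finally show "(LINT y|lborel. f y) = \<bar>r\<bar> ^ DIM('a) * (LINT y|lborel. f (a + r *\<^sub>R y))" .
qed

lemma measurable_of_continuous_on_open:
 fixes g :: "'a::euclidean_space => real"
 assumes "open U" "continuous_on U g" "!!x. x \<notin> U ==> g x = 0"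
 shows "g : borel_measurable borel"
proof -
 have "(%x. indicator U x *\<^sub>R g x) : borel_measurable borel"
  using assms by (intro borel_measurable_continuous_on_indicator) auto
 moreover have "(%x. indicator U x *\<^sub>R g x) = g"
  using assms(3) by (auto simp: indicator_def fun_eq_iff)
 ultimately show ?thesis by simp
qed

lemma integrable_bounded_support:
 fixes g :: "'a::euclidean_space => real"
 assumes "g : borel_measurable borel" "!!x. \<bar>g x\<bar> <= C" "!!x. norm x > R ==> g x = 0"
 shows "integrable lborel g"
proof (rule Lintegrable_bound)
 show "integrable lborel (%x::'a. C * indicator (cball 0 R) x)"
  by (intro integrable_mult_right integrable_real_indicator) (auto simp: emeasure_lborel_cball_finite[simplified] emeasure_lborel_ball_finite[simplified])
 show "AE x in lborel. norm (g x) <= norm (C * indicator (cball 0 R) x)"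
  using assms(2,3) by (auto intro!: AE_I2 simp: indicator_def intro: order_trans[OF _ abs_ge_self])
qed (use assms in auto)

lemma Ck_on_1_UNIV:
 assumes "Ck_on 1 UNIV g"
 shows "g differentiable (at x)" "i : Basis ==> continuous_on UNIV (pd i g)"
 using assms by (auto simp: differentiable_on_def)

lemma bounded_continuous_compact_support:
 fixes g :: "'a::euclidean_space => real"
 assumes "continuous_on UNIV g" "!!x. norm x > R ==> g x = 0"
 shows "EX C>=0. ALL x. \<bar>g x\<bar> <= C"
proof -
 have "compact (g ` cball 0 R)"
  using assms(1) by (intro compact_continuous_image compact_cball) (auto intro: continuous_on_subset)
 then have "bounded (g ` cball 0 R)" by (rule compact_imp_bounded)
 then obtain C where "ALL y:g ` cball 0 R. norm y <= C" unfolding bounded_iff by blast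
 then have C: "norm (g x) <= C" if "x : cball 0 R" for x using that by blast
 have "\<bar>g x\<bar> <= max C 0" for x
  using C[of x] assms(2)[of x] by (cases "norm x <= R") auto
 then show ?thesis by (intro exI[of _ "max C 0"]) auto
qed

lemma partial_deriv_zero_outside:
 fixes g :: "'a::euclidean_space => real"
 assumes "!!x. norm x > R ==> g x = 0" "norm x > R"
 shows "pd i g x = 0"
proof -
 have "pd i g x = pd i (%x. 0) x"
  by (rule partial_deriv_cong_open[of "- cball 0 R"]) (use assms in auto)
 then show ?thesis by (simp add: partial_deriv_def)
qed

text \<open>By translation invariance the integral of g (x + s i) does not depend on s;
  differentiating it under the integral at s = 0 gives the claim without Fubini.\<close>

lemma integral_partial_deriv:
 fixes g :: "'a::euclidean_space => real"
 assumes g: "Ck_on 1 UNIV g" and supp: "!!x. norm x > R ==> g x = 0" and i: "i : Basis"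
 shows "(LINT x|lborel. pd i g x) = 0"
proof -
 have cg: "continuous_on UNIV g" using Ck_on_continuous[OF _ g] by simp
 have cp: "continuous_on UNIV (pd i g)" using Ck_on_1_UNIV(2)[OF g i] .
 have pz: "pd i g x = 0" if "norm x > R" for x
  using partial_deriv_zero_outside[OF supp that] .
 obtain C where C: "C >= 0" "ALL x. \<bar>pd i g x\<bar> <= C"
  using bounded_continuous_compact_support[OF cp pz] by auto
 obtain C' where C': "C' >= 0" "ALL x. \<bar>g x\<bar> <= C'"
  using bounded_continuous_compact_support[OF cg supp] by auto
 have ni: "norm i = 1" using i by simp
 have meas: "g : borel_measurable borel" using cg by (rule borel_measurable_continuous_onI)
 have const: "(LINT x|lborel. g (x + s *\<^sub>R i)) = (LINT x|lborel. g x)" for s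
  using lborel_affine_int(2)[of 1 g "s *\<^sub>R i"] meas by (simp add: add.commute)
 have "((%s. LINT x|lborel. g (x + s *\<^sub>R i)) has_real_derivative
   (LINT x|lborel. pd i g (x + 0 *\<^sub>R i))) (at 0)"
 proof (rule DERIV_integral_dominated(2)[where a="-1" and b=1 and B="%x. C * indicator (cball 0 (R+1)) x"])
  show "integrable lborel (%x. g (x + s *\<^sub>R i))" for s
   using lborel_affine_int(1)[of 1 g "s *\<^sub>R i"] integrable_bounded_support[OF meas C'(2)[rule_format] supp] meas
   by (simp add: add.commute)
  show "((%s. g (x + s *\<^sub>R i)) has_real_derivative pd i g (x + s *\<^sub>R i)) (at s)" for s x
  proof -
   have "(SUM j:Basis. (i \<bullet> j) * pd j g (x + s *\<^sub>R i)) = pd i g (x + s *\<^sub>R i)"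
    using i by (simp add: inner_Basis if_distrib if_distribR sum.delta cong: if_cong)
   then show ?thesis
    using has_real_derivative_line[OF Ck_on_1_UNIV(1)[OF g], where x=x and t=s and v=i] by simp
  qed
  show "\<bar>pd i g (x + s *\<^sub>R i)\<bar> <= C * indicator (cball 0 (R+1)) x"
   if "-1 < s" "s < 1" for s x
  proof (cases "norm x <= R + 1")
   case True
   then show ?thesis using C(2) by (simp add: indicator_def)
  next
   case False
   have "norm x <= norm (x + s *\<^sub>R i) + norm (s *\<^sub>R i)"
    by (metis add_diff_cancel_right' norm_triangle_ineq4)
   then have "norm (x + s *\<^sub>R i) > R" using False that ni by simp
   then have "pd i g (x + s *\<^sub>R i) = 0"
    by (rule pz)
   then show ?thesis using C(1) by simp
  qed
  show "integrable lborel (%x::'a. C * indicator (cball 0 (R+1)) x)"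
   by (intro integrable_mult_right integrable_real_indicator) (auto simp: emeasure_lborel_cball_finite[simplified] emeasure_lborel_ball_finite[simplified])
 qed auto
 then show ?thesis unfolding const using DERIV_unique[OF _ DERIV_const] by fastforce
qed

text \<open>\<open>posrat e a b\<close> is of class \<open>C\<^bsup>a-1\<^esup>\<close>; \<open>b = 0\<close> gives the powers of the positive part.\<close>

definition posrat :: "real => nat => nat => real => real" where
 "posrat e a b t = max 0 t ^ a / (max 0 t + e) ^ b"

section \<open>A smooth convex substitute for the positive part\<close>

lemma DERIV_zero_of_quadratic_bound:
 fixes g :: "real => real"
 assumes "!!t. \<bar>t\<bar> <= 1 ==> \<bar>g t\<bar> <= C * t^2"
 shows "(g has_real_derivative 0) (at 0)"
 unfolding DERIV_def
proof (rule Lim_null_comparison)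
 have g0: "g 0 = 0" using assms[of 0] by simp
 show "\<forall>\<^sub>F h in at 0. norm ((g (0 + h) - g 0) / h) <= C * \<bar>h\<bar>"
 proof -
  have "\<forall>\<^sub>F h in at (0::real). dist h 0 < 1" by (rule eventually_at_ball'[THEN eventually_mono]) auto
  then show ?thesis
  proof (rule eventually_mono[OF eventually_conj[OF _ eventually_neq_at_within[of 0]]])
   fix h :: real assume "dist h 0 < 1 & h ~= 0"
   then show "norm ((g (0 + h) - g 0) / h) <= C * \<bar>h\<bar>"
    using assms[of h] g0 by (simp add: field_simps power2_eq_square abs_mult)
  qed
 qed
 have "((%h::real. C * \<bar>h\<bar>) \<longlongrightarrow> C * \<bar>0\<bar>) (at 0)" by (intro tendsto_intros)
 then show "((%h::real. C * \<bar>h\<bar>) \<longlongrightarrow> 0) (at 0)" by simp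
qed

lemma posrat_deriv:
 assumes e: "e > 0" and a: "a >= 2"
 shows "(posrat e a b has_real_derivative
   (real a * posrat e (a - 1) b t - real b * posrat e a (b + 1) t)) (at t)"
proof -
 consider "t < 0" | "t = 0" | "t > 0" by linarith
 then show ?thesis
 proof cases
  case 1
  have "((%t. 0) has_real_derivative 0) (at t)" by simp
  then have "(posrat e a b has_real_derivative 0) (at t)"
   by (rule has_field_derivative_transform_within_open[where S="{..<0}"])
     (use 1 a in \<open>auto simp: posrat_def max_def\<close>)
  then show ?thesis using 1 a by (simp add: posrat_def max_def zero_power)
 next
  case 2
  \<comment> \<open>The formulas from the two sides meet here; a >= 2 makes the quotient
    quadratically small.\<close>
  have "(posrat e a b has_real_derivative 0) (at 0)"
  proof (rule DERIV_zero_of_quadratic_bound)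
   fix s :: real assume s: "\<bar>s\<bar> <= 1"
   have "max 0 s ^ a <= max 0 s ^ 2" using a s by (intro power_decreasing) auto
   also have "... <= s\<^sup>2" by (auto simp: max_def)
   finally have 1: "max 0 s ^ a <= s\<^sup>2" .
   have "e ^ b <= (max 0 s + e) ^ b" using e by (intro power_mono) auto
   then have "max 0 s ^ a / (max 0 s + e) ^ b <= s\<^sup>2 / e ^ b"
    using e 1 by (intro frac_le) auto
   moreover have "0 <= max 0 s ^ a / (max 0 s + e) ^ b" using e by (auto intro!: divide_nonneg_nonneg)
   ultimately show "\<bar>posrat e a b s\<bar> <= (1 / e ^ b) * s^2" by (simp add: posrat_def)
  qed
  then show ?thesis using 2 a by (simp add: posrat_def zero_power)
 next
  case 3
  obtain a' where a': "a = Suc a'" using a by (cases a) auto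
  have "((%t. t ^ a / (t + e) ^ b) has_real_derivative
    (real a * (t ^ a' / (t + e) ^ b) - real b * (t ^ a / (t + e) ^ (b + 1)))) (at t)"
  proof (cases b)
   case 0
   have "((%t. t ^ a) has_real_derivative real a * t ^ a') (at t)"
    using DERIV_pow[of a t] by (simp add: a')
   then show ?thesis using 0 by simp
  next
   case (Suc b')
   define p where "p = t + e"
   have p: "p ~= 0" using 3 e by (simp add: p_def)
   have d1: "((%t. t ^ a) has_real_derivative real a * t ^ a') (at t)"
    using DERIV_pow[of a t] by (simp add: a')
   have d2: "((%t. (t + e) ^ b) has_real_derivative real b * p ^ b') (at t)"
   proof -
    have "((%t. t + e) has_real_derivative 1) (at t)" by (auto intro!: derivative_eq_intros)
    from DERIV_chain'[OF this DERIV_pow[of b]] show ?thesis by (simp add: Suc p_def)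
   qed
   have "((%t. t ^ a / (t + e) ^ b) has_real_derivative
     (real a * t ^ a' * p ^ b - t ^ a * (real b * p ^ b')) / (p ^ b * p ^ b)) (at t)"
    using DERIV_divide[OF d1 d2] p by (simp add: p_def)
   moreover have "(real a * t ^ a' * p ^ b - t ^ a * (real b * p ^ b')) / (p ^ b * p ^ b)
     = real a * (t ^ a' / p ^ b) - real b * (t ^ a / p ^ (b + 1))"
    using p by (simp add: Suc diff_divide_distrib)
   ultimately show ?thesis by (simp add: p_def)
  qed
  then have "(posrat e a b has_real_derivative
    (real a * (t ^ a' / (t + e) ^ b) - real b * (t ^ a / (t + e) ^ (b + 1)))) (at t)"
   by (rule has_field_derivative_transform_within_open[where S="{0<..}"])
     (use 3 in \<open>auto simp: posrat_def max_def\<close>)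
  then show ?thesis using 3 a' by (simp add: posrat_def max_def)
 qed
qed

lemma Ck_on_real_step:
 fixes g :: "real => real"
 assumes "!!s. (g has_real_derivative g' s) (at s)" "Ck_on k UNIV g'"
 shows "Ck_on (Suc k) UNIV g"
proof -
 have "pd 1 g = g'"
  by (rule ext) (simp add: partial_deriv_eq[OF assms(1)[unfolded has_field_derivative_def]])
 moreover have "g differentiable_on UNIV"
  using assms(1) by (auto simp: differentiable_on_def has_field_derivative_def differentiable_def)
 ultimately show ?thesis using assms(2) by simp
qed

lemma posrat_Ck: "e > 0 ==> a >= Suc k ==> Ck_on k UNIV (posrat e a b)"
proof (induction k arbitrary: a b)
 case 0
 have "max 0 t + e ~= 0" for t using 0 by (auto simp: max_def)
 then show ?case unfolding posrat_def[abs_def] by (auto intro!: continuous_intros)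
next
 case (Suc k)
 show ?case
  by (rule Ck_on_real_step[OF posrat_deriv])
    (use Suc in \<open>auto intro!: Ck_on_diff Ck_on_cmult\<close>)
qed

lemma posrat_nonneg: "e > 0 ==> posrat e a b t >= 0"
 by (auto simp: posrat_def intro!: divide_nonneg_nonneg)

lemma posrat_nonpos_arg: "t <= 0 ==> a > 0 ==> posrat e a b t = 0"
 by (auto simp: posrat_def max_def)

text \<open>With y the positive part of s - e this is y^5 / (y + e)^4: it vanishes to fifth order at
  y = 0, hence is C^4, and is close to y - 4 e for large y. The shift by e makes it vanish for s <=
  e, so composed with a continuous f it is zero on the open set {f < e} and can be glued
  there.\<close>

definition smooth_pos :: "real => real => real" where
 "smooth_pos e s = posrat e 5 4 (s - e)"

definition smooth_pos1 :: "real => real => real" where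
 "smooth_pos1 e s = 5 * posrat e 4 4 (s - e) - 4 * posrat e 5 5 (s - e)"

definition smooth_pos2 :: "real => real => real" where
 "smooth_pos2 e s = 5 * (4 * posrat e 3 4 (s - e) - 4 * posrat e 4 5 (s - e))
   - 4 * (5 * posrat e 4 5 (s - e) - 5 * posrat e 5 6 (s - e))"

lemma smooth_pos_deriv:
 assumes "e > 0"
 shows "(smooth_pos e has_real_derivative smooth_pos1 e s) (at s)"
  "(smooth_pos1 e has_real_derivative smooth_pos2 e s) (at s)"
proof -
 have sh: "((%s. posrat e a b (s - e)) has_real_derivative
   (real a * posrat e (a - 1) b (s - e) - real b * posrat e a (b + 1) (s - e))) (at s)"
  if "a >= 2" for a b
  using DERIV_chain'[OF DERIV_diff[OF DERIV_ident DERIV_const] posrat_deriv[OF assms that]] by simp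
 show "(smooth_pos e has_real_derivative smooth_pos1 e s) (at s)"
  unfolding smooth_pos_def[abs_def] smooth_pos1_def using sh[of 5 4] by simp
 show "(smooth_pos1 e has_real_derivative smooth_pos2 e s) (at s)"
  unfolding smooth_pos1_def[abs_def] smooth_pos2_def
  by (rule derivative_eq_intros sh[THEN DERIV_cong] refl | simp)+
qed

lemma smooth_pos_Ck:
 assumes "e > 0" "k <= 4" shows "Ck_on k UNIV (smooth_pos e)"
proof -
 have "Ck_on k UNIV (%s. posrat e 5 4 (- e + 1 *\<^sub>R s))"
  by (rule Ck_on_affine_arg[where S=UNIV]) (use assms in \<open>auto intro: posrat_Ck\<close>)
 then show ?thesis by (simp add: smooth_pos_def[abs_def] add.commute)
qed

lemma smooth_pos1_eq:
 assumes "e > 0"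
 shows "smooth_pos1 e s = max 0 (s - e) ^ 4 * (max 0 (s - e) + 5 * e) / (max 0 (s - e) + e) ^ 5"
proof -
 define y where "y = max 0 (s - e)"
 have "y + e > 0" unfolding y_def using assms by auto
 moreover have "5 * (y ^ 4 / p ^ 4) - 4 * (y ^ 5 / p ^ 5) = y ^ 4 * (5 * p - 4 * y) / p ^ 5"
  if "p ~= 0" for p using that by (simp add: field_simps eval_nat_numeral)
 ultimately have "5 * (y ^ 4 / (y + e) ^ 4) - 4 * (y ^ 5 / (y + e) ^ 5)
   = y ^ 4 * (y + 5 * e) / (y + e) ^ 5" by (simp add: algebra_simps)
 then show ?thesis by (simp add: smooth_pos1_def posrat_def y_def)
qed

text \<open>Convexity: the four fractions combine to 20 e^2 y^3 / (y + e)^6. This makes compositions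
  with harmonic or subharmonic functions subharmonic.\<close>

lemma smooth_pos2_nonneg:
 assumes "e > 0" shows "smooth_pos2 e s >= 0"
proof -
 define y where "y = max 0 (s - e)"
 have y: "y + e > 0" "y >= 0" unfolding y_def using assms by auto
 have "5 * (4 * (y ^ 3 / p ^ 4) - 4 * (y ^ 4 / p ^ 5))
   - 4 * (5 * (y ^ 4 / p ^ 5) - 5 * (y ^ 5 / p ^ 6))
   = 20 * (p - y)^2 * y ^ 3 / p ^ 6" if "p ~= 0" for p
  using that by (simp add: field_simps eval_nat_numeral)
 from this[OF less_imp_neq[OF y(1), symmetric]]
 have "5 * (4 * (y ^ 3 / (y + e) ^ 4) - 4 * (y ^ 4 / (y + e) ^ 5))
   - 4 * (5 * (y ^ 4 / (y + e) ^ 5) - 5 * (y ^ 5 / (y + e) ^ 6))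
   = 20 * e^2 * y ^ 3 / (y + e) ^ 6" by simp
 also have "... >= 0" using y by simp
 finally show ?thesis by (simp add: smooth_pos2_def posrat_def y_def)
qed

lemma smooth_pos1_bounds:
 assumes "e > 0" shows "0 <= smooth_pos1 e s" "smooth_pos1 e s <= 1"
proof -
 define y where "y = max 0 (s - e)"
 have y: "y + e > 0" "y >= 0" unfolding y_def using assms by auto
 show "0 <= smooth_pos1 e s" unfolding smooth_pos1_eq[OF assms] y_def[symmetric]
  using y assms by simp
 have "(y + e) ^ 5 - y ^ 4 * (y + 5 * e) = 10 * y ^ 3 * e^2 + 10 * y^2 * e ^ 3 + 5 * y * e ^ 4 + e ^ 5"
  by (simp add: algebra_simps eval_nat_numeral)
 also have "... >= 0" using y assms by (intro add_nonneg_nonneg) auto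
 finally show "smooth_pos1 e s <= 1" unfolding smooth_pos1_eq[OF assms] y_def[symmetric]
  using y by (simp add: divide_le_eq)
qed

lemma smooth_pos_bounds:
 assumes "e > 0"
 shows "0 <= smooth_pos e s" "s <= e ==> smooth_pos e s = 0" "smooth_pos e s <= max 0 s"
  "smooth_pos e s >= s - 6 * e"
proof -
 show "0 <= smooth_pos e s" unfolding smooth_pos_def by (rule posrat_nonneg[OF assms])
 show "s <= e ==> smooth_pos e s = 0" unfolding smooth_pos_def by (rule posrat_nonpos_arg) auto
 define y where "y = max 0 (s - e)"
 have y: "y + e > 0" "y >= 0" unfolding y_def using assms by auto
 have b: "smooth_pos e s = y * (y / (y + e)) ^ 4"
  by (simp add: smooth_pos_def posrat_def y_def[symmetric] power_divide eval_nat_numeral)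
 have "(y / (y + e)) ^ 4 <= 1" using y assms by (intro power_le_one) (auto simp: divide_le_eq_1)
 then have "smooth_pos e s <= y" unfolding b using y by (simp add: mult_left_le)
 then show "smooth_pos e s <= max 0 s" using assms by (auto simp: y_def)
 \<comment> \<open>Bernoulli's inequality for the fourth power loses at most 4 e, and the shift
   inside y loses one more e.\<close>
 have "1 + real 4 * (- e / (y + e)) <= (1 + - e / (y + e)) ^ 4"
  using y assms by (intro Bernoulli_inequality) (simp add: le_divide_eq)
 also have "1 + - e / (y + e) = y / (y + e)" using y by (simp add: field_simps)
 finally have "y * (1 - 4 * e / (y + e)) <= smooth_pos e s"
  unfolding b using y by (intro mult_left_mono) auto
 moreover have "y * (1 - 4 * e / (y + e)) >= y - 4 * e"
  using y assms by (simp add: field_simps)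
 ultimately show "smooth_pos e s >= s - 6 * e" using assms by (auto simp: y_def max_def split: if_splits)
qed

section \<open>Mean values with a radial kernel\<close>

definition kern :: "'a::euclidean_space => real" where "kern y = posrat 1 2 0 (1 - y \<bullet> y)"
text \<open>A potential of the kernel: the gradient of \<open>kern3\<close> at y is - kern y times
  y. It replaces the Green function in the mean value computation, and no integral over spheres is
  needed.\<close>

definition kern3 :: "'a::euclidean_space => real" where "kern3 y = posrat 1 3 0 (1 - y \<bullet> y) / 6"

lemma kern_eq: "kern y = (max 0 (1 - (norm y)\<^sup>2))^2"
 by (simp add: kern_def posrat_def power2_norm_eq_inner)

lemma kern_bounds: "0 <= kern y" "kern y <= 1" "norm y >= 1 ==> kern y = 0"
 "norm y <= s ==> s <= 1 ==> kern y >= (1 - s\<^sup>2)\<^sup>2"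
proof -
 show "0 <= kern y" "kern y <= 1" by (auto simp: kern_eq intro!: power_le_one)
 show "kern y = 0" if "norm y >= 1"
 proof -
  have "1 <= (norm y)\<^sup>2" using that by (simp add: one_le_power)
  then show ?thesis by (simp add: kern_eq max_def)
 qed
 show "kern y >= (1 - s\<^sup>2)\<^sup>2" if "norm y <= s" "s <= 1"
 proof -
  have s0: "0 <= s" using that(1) norm_ge_zero order_trans by blast
  have "(norm y)^2 <= s\<^sup>2" using that by (intro power_mono) auto
  moreover have "s^2 <= 1" using s0 that(2) by (simp add: power_le_one)
  ultimately show ?thesis unfolding kern_eq by (intro power_mono) auto
 qed
qed

lemma kern_continuous [continuous_intros]: "continuous_on UNIV kern"
 unfolding kern_def[abs_def] posrat_def by (intro continuous_intros) auto

lemma kern_measurable [measurable]: "kern : borel_measurable borel"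
 by (rule borel_measurable_continuous_onI[OF kern_continuous])

lemma kern_integrable: "integrable lborel kern"
 by (rule integrable_bounded_support[where C=1 and R=1]) (auto simp: kern_bounds)

definition kern_mass :: "'a::euclidean_space itself => real" where
 "kern_mass _ = (LINT y|lborel. kern (y::'a))"

lemma kern_mass_pos: "kern_mass TYPE('a::euclidean_space) > 0"
proof -
 have "0 < (9/16) * measure lborel (ball (0::'a) (1/2))"
  using content_ball_pos[of "1/2" "0::'a"] by simp
 also have "... = (LINT y|lborel. (9/16) * indicator (ball (0::'a) (1/2)) y)"
  by simp
 also have "... <= (LINT y|lborel. kern (y::'a))"
 proof (rule integral_mono[OF _ kern_integrable])
  show "integrable lborel (%y. (9/16) * indicator (ball (0::'a) (1/2)) y :: real)"
   by (intro integrable_mult_right integrable_real_indicator) (auto simp: emeasure_lborel_cball_finite[simplified] emeasure_lborel_ball_finite[simplified])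
  show "(9/16) * indicator (ball (0::'a) (1/2)) y <= kern y" for y :: 'a
   using kern_bounds(4)[of y "1/2"] kern_bounds(1)[of y] by (auto simp: indicator_def power2_eq_square)
 qed
 finally show ?thesis unfolding kern_mass_def .
qed

lemma kern3_Ck: "Ck_on 2 UNIV (kern3 :: 'a::euclidean_space => real)"
proof -
 have "Ck_on 2 UNIV (%y::'a. posrat 1 3 0 (1 - y \<bullet> y))"
  by (rule Ck_on_compose_real[where T=UNIV])
    (auto intro!: Ck_on_diff Ck_on_norm_sq posrat_Ck)
 then show ?thesis unfolding kern3_def[abs_def] using Ck_on_cmult[of UNIV 2 _ "1/6"] by auto
qed

lemma kern3_bounds: "kern3 y >= 0" "norm y >= 1 ==> kern3 y = 0"
proof -
 show "kern3 y >= 0" unfolding kern3_def by (simp add: posrat_nonneg)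
 show "kern3 y = 0" if "norm y >= 1"
 proof -
  have "1 <= (norm y)\<^sup>2" using that by (simp add: one_le_power)
  then show ?thesis by (simp add: kern3_def posrat_nonpos_arg power2_norm_eq_inner)
 qed
qed

lemma partial_deriv_kern3:
 fixes y :: "'a::euclidean_space"
 assumes "i : Basis"
 shows "pd i kern3 y = - (y \<bullet> i) * kern y"
proof -
 have p: "(posrat 1 3 0 has_real_derivative 3 * posrat 1 2 0 (1 - y \<bullet> y)) (at (1 - y \<bullet> y))"
  using posrat_deriv[of 1 3 0 "1 - y \<bullet> y"] by simp
 have "((%y::'a. 1 - y \<bullet> y) has_derivative (%h. - 2 * (y \<bullet> h))) (at y)"
  by (auto intro!: derivative_eq_intros simp: inner_commute)
 from has_derivative_compose[OF this p[unfolded has_field_derivative_def]]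
 have "((%y::'a. posrat 1 3 0 (1 - y \<bullet> y)) has_derivative
   (%h. 3 * posrat 1 2 0 (1 - y \<bullet> y) * (- 2 * (y \<bullet> h)))) (at y)" by simp
 then have "((%y::'a. posrat 1 3 0 (1 - y \<bullet> y) / 6) has_derivative
   (%h. 3 * posrat 1 2 0 (1 - y \<bullet> y) * (- 2 * (y \<bullet> h)) / 6)) (at y)"
  by (auto intro!: derivative_eq_intros)
 from partial_deriv_eq[OF this, of i] show ?thesis
  by (simp add: kern3_def[abs_def] kern_def)
qed

text \<open>Only values of f in the closed ball of radius r enter: \<open>kern\<close> vanishes off
  the unit ball and so hides whatever f does elsewhere.\<close>

lemma integrable_kern_scaled:
 fixes f :: "'a::euclidean_space => real"
 assumes f: "continuous_on (ball x R) f" and r: "0 <= r" "r < R"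
 shows "(%y. f (x + r *\<^sub>R y) * kern y) : borel_measurable borel"
  and "integrable lborel (%y. f (x + r *\<^sub>R y) * kern y)"
proof -
 have sub: "x + r *\<^sub>R y : cball x r" if "norm y <= 1" for y
  using r that by (simp add: dist_norm mult_left_le)
 have "cball x r <= ball x R" using r by auto
 then have "continuous_on (cball x r) f" using f continuous_on_subset by blast
 then have "bounded (f ` cball x r)" by (intro compact_imp_bounded compact_continuous_image compact_cball)
 then obtain C where C: "ALL y:f ` cball x r. norm y <= C" unfolding bounded_iff by blast
 show m: "(%y. f (x + r *\<^sub>R y) * kern y) : borel_measurable borel"
 proof (rule measurable_of_continuous_on_open[of "ball 0 1"])
  have "continuous_on (ball 0 1) (%y. f (x + r *\<^sub>R y))"
  proof (rule continuous_on_compose2[OF f])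
   show "(%y. x + r *\<^sub>R y) ` ball 0 1 <= ball x R"
   proof safe
    fix y :: 'a assume "y : ball 0 1"
    then show "x + r *\<^sub>R y : ball x R" using sub[of y] r by auto
   qed
  qed (intro continuous_intros)
  then show "continuous_on (ball 0 1) (%y. f (x + r *\<^sub>R y) * kern y)"
   by (intro continuous_intros continuous_on_subset[OF kern_continuous]) auto
 qed (auto simp: kern_bounds)
 show "integrable lborel (%y. f (x + r *\<^sub>R y) * kern y)"
 proof (rule integrable_bounded_support[OF m, where C="max C 0" and R=1])
  show "\<bar>f (x + r *\<^sub>R y) * kern y\<bar> <= max C 0" for y
  proof (cases "norm y <= 1")
   case True
   then have "\<bar>f (x + r *\<^sub>R y)\<bar> <= C" using C sub[OF True] by force
   then have "\<bar>f (x + r *\<^sub>R y)\<bar> * \<bar>kern y\<bar> <= max C 0 * 1"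
    using kern_bounds(1,2)[of y] by (intro mult_mono) auto
   then show ?thesis by (simp add: abs_mult)
  qed (simp add: kern_bounds)
 qed (simp add: kern_bounds)
qed

text \<open>The weighted mean M s over radius s is nondecreasing. Its derivative is the integral of
  (y . grad f) (x + s y) kern y, and integrating by parts against \<open>kern3\<close> turns it into
  s times the integral of the Laplacian against \<open>kern3\<close>, which is nonnegative. At s = 0
  the mean is f x times the mass.\<close>

lemma submean_C2:
 fixes f :: "'a::euclidean_space => real"
 assumes f: "Ck_on 2 (ball x R) f" and lap: "!!y. y : ball x R ==> laplacian f y >= 0"
  and r: "0 < r" "r < R"
 shows "f x * kern_mass TYPE('a) <= (LINT y|lborel. f (x + r *\<^sub>R y) * kern y)"
proof -
 define R' where "R' = (r + R) / 2"
 have R': "r < R'" "R' < R" "0 < R'" using r by (auto simp: R'_def)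
 have f1: "Ck_on (Suc 1) (ball x R) f" using f by (simp add: numeral_2_eq_2)
 have fd: "f differentiable (at z)" if "z : ball x R" for z
  using Ck_on_2_partial(1)[OF f open_ball that] .
 have p1: "Ck_on 1 (ball x R) (pd i f)" if "i : Basis" for i
  using Ck_on_partial_deriv[OF f1 that] .
 have fc: "continuous_on (ball x R) f" using Ck_on_continuous[OF open_ball f] .
 have pc: "continuous_on (ball x R) (pd i f)" if "i : Basis" for i
  using Ck_on_continuous[OF open_ball p1[OF that]] .
 have sub: "x + s *\<^sub>R y : cball x R'" if "norm y <= 1" "-R' < s" "s < R'" for s y
 proof -
  have "\<bar>s\<bar> * norm y <= R' * 1" using that by (intro mult_mono) auto
  then show ?thesis by (simp add: dist_norm)
 qed
 have cb: "cball x R' <= ball x R" using R' by auto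
 have "bounded (pd i f ` cball x R')" if "i : Basis" for i
  using continuous_on_subset[OF pc[OF that] cb]
  by (intro compact_imp_bounded compact_continuous_image compact_cball)
 then have "ALL i:Basis. EX C. ALL z:cball x R'. \<bar>pd i f z\<bar> <= C"
  by (simp add: bounded_iff)
 then obtain C where C: "ALL i:Basis. ALL z:cball x R'. \<bar>pd i f z\<bar> <= C i" by metis
 define K where "K = (SUM i:(Basis::'a set). C i)"
 have C0: "0 <= C i" if "i : Basis" for i
 proof -
  have "x : cball x R'" using R' by simp
  then have "\<bar>pd i f x\<bar> <= C i" using C that by blast
  then show ?thesis by linarith
 qed
 have K0: "K >= 0" unfolding K_def using C0 by (intro sum_nonneg) auto
 define M where "M s = (LINT y|lborel. f (x + s *\<^sub>R y) * kern y)" for s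
 define M' where "M' s = (LINT y|lborel. (SUM i:Basis. (y \<bullet> i) * pd i f (x + s *\<^sub>R y)) * kern y)" for s
 have intg: "integrable lborel (%y. f (x + s *\<^sub>R y) * kern y)" if "-R' < s" "s < R'" for s
 proof (cases "s >= 0")
  case True
  then show ?thesis using integrable_kern_scaled(2)[OF fc, of s] that R' by auto
 next
  case False
  have "integrable lborel (%y. f (x + (-s) *\<^sub>R y) * kern y)"
   using integrable_kern_scaled(2)[OF fc, of "-s"] that R' False by auto
  then have "integrable lborel (%y. f (x + (-s) *\<^sub>R (0 + (-1) *\<^sub>R y)) * kern (0 + (-1) *\<^sub>R y :: 'a))"
   using integrable_kern_scaled(1)[OF fc, of "-s"] that R' False
   by (subst lborel_affine_int(1)[where f="%y. f (x + (-s) *\<^sub>R y) * kern y"]) auto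
  then show ?thesis by (simp add: kern_def)
 qed
 have dM: "integrable lborel (%y. (SUM i:Basis. (y \<bullet> i) * pd i f (x + s *\<^sub>R y)) * kern y)"
   "(M has_real_derivative M' s) (at s)" if s: "-R' < s" "s < R'" for s
  unfolding M_def M'_def
 proof -
  have h1: "((%s. f (x + s *\<^sub>R y) * kern y) has_real_derivative
    (SUM i:Basis. (y \<bullet> i) * pd i f (x + t *\<^sub>R y)) * kern y) (at t)"
   if "-R' < t" "t < R'" for t y
  proof (cases "norm y <= 1")
   case True
   then have "f differentiable (at (x + t *\<^sub>R y))" using fd sub[OF True that] cb by blast
   then show ?thesis by (intro DERIV_cmult_right has_real_derivative_line)
  qed (simp add: kern_bounds)
  have h2: "\<bar>(SUM i:Basis. (y \<bullet> i) * pd i f (x + t *\<^sub>R y)) * kern y\<bar> <= K * indicator (cball 0 1) y"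
   if "-R' < t" "t < R'" for t and y :: 'a
  proof (cases "norm y <= 1")
   case True
   have "\<bar>SUM i:Basis. (y \<bullet> i) * pd i f (x + t *\<^sub>R y)\<bar> <= K"
    unfolding K_def
   proof (rule order_trans[OF sum_abs], rule sum_mono)
    fix i :: 'a assume i: "i : Basis"
    have "\<bar>y \<bullet> i\<bar> <= 1" using Basis_le_norm[OF i, of y] True by simp
    then show "\<bar>(y \<bullet> i) * pd i f (x + t *\<^sub>R y)\<bar> <= C i"
     using C i sub[OF True that] C0[OF i]
     by (simp add: abs_mult mult_le_one[THEN order_trans] mult_mono[of _ 1 _ "C i", simplified])
   qed
   then have "\<bar>SUM i:Basis. (y \<bullet> i) * pd i f (x + t *\<^sub>R y)\<bar> * \<bar>kern y\<bar> <= K * 1"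
    using kern_bounds(1,2)[of y] K0 by (intro mult_mono) auto
   then show ?thesis using True by (simp add: abs_mult)
  qed (simp add: kern_bounds)
  have h3: "integrable lborel (%y::'a. K * indicator (cball 0 1) y)"
   by (intro integrable_mult_right integrable_real_indicator)
     (auto simp: emeasure_lborel_cball_finite[simplified])
  show "integrable lborel (%y. (SUM i:Basis. (y \<bullet> i) * pd i f (x + s *\<^sub>R y)) * kern y)"
   "((%s. LINT y|lborel. f (x + s *\<^sub>R y) * kern y) has_real_derivative
    (LINT y|lborel. (SUM i:Basis. (y \<bullet> i) * pd i f (x + s *\<^sub>R y)) * kern y)) (at s)"
   using DERIV_integral_dominated[OF s, of lborel "%s y. f (x + s *\<^sub>R y) * kern y", OF intg h1 h2 h3]
   by auto
 qed
 have M'0: "M' s >= 0" if s: "0 <= s" "s < R'" for s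
 proof -
  let ?T = "(%y. x + s *\<^sub>R y) -` ball x R"
  have T: "open ?T" by (intro open_vimage) (auto intro!: continuous_intros)
  have T1: "y : ?T" if "norm y <= 1" for y
  proof -
   have "x + s *\<^sub>R y : cball x R'" using s R' by (intro sub that) auto
   then show ?thesis using cb by auto
  qed
  \<comment> \<open>A compactly supported field, so each of its diagonal derivatives integrates to
    0; their sum is the difference of the two expressions for the derivative of M.\<close>
  define g where "g i y = pd i f (x + s *\<^sub>R y) * kern3 y" for i and y :: 'a
  have gz: "g i y = 0" if "norm y > 1" for i y using that by (simp add: g_def kern3_bounds)
  have gC: "Ck_on 1 UNIV (g i)" if i: "i : Basis" for i
  proof -
   have "Ck_on 1 ?T (%y. pd i f (x + s *\<^sub>R y))"
    by (rule Ck_on_affine_arg[OF open_ball T p1[OF i]]) auto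
   moreover have "Ck_on 1 ?T (kern3::'a => real)"
    by (rule Ck_on_subset[OF subset_UNIV Ck_on_le[OF open_UNIV kern3_Ck]]) simp
   ultimately have 1: "Ck_on 1 ?T (g i)" unfolding g_def[abs_def] by (intro Ck_on_mult[OF T])
   have "Ck_on 1 (- cball 0 1) (%y::'a. 0)" by (rule Ck_on_const)
   then have 2: "Ck_on 1 (- cball 0 1) (g i)"
    by (rule Ck_on_cong[rotated 2]) (auto simp: gz)
   have "?T \<union> - cball 0 1 = UNIV" using T1 by auto
   then show ?thesis using Ck_on_Un[OF T _ 1 2] by auto
  qed
  have pg: "pd i (g i) y = s * pd i (pd i f) (x + s *\<^sub>R y) * kern3 y
    - (y \<bullet> i) * pd i f (x + s *\<^sub>R y) * kern y" if i: "i : Basis" for i y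
  proof (cases "norm y <= 1")
   case True
   have z: "x + s *\<^sub>R y : ball x R" using T1[OF True] by simp
   have d: "pd i f differentiable (at (x + s *\<^sub>R y))"
    using Ck_on_2_partial(2)[OF f open_ball z i] .
   have d1: "(%y. pd i f (x + s *\<^sub>R y)) differentiable at y"
    using differentiable_chain_at[of "%y. x + s *\<^sub>R y" y "pd i f"] d by (simp add: o_def)
   have d2: "(kern3 :: 'a => real) differentiable at y"
    using Ck_on_2_partial(1)[OF kern3_Ck] by simp
   show ?thesis unfolding g_def
    by (subst partial_deriv_mult[OF d1 d2])
      (simp add: partial_deriv_affine_arg[OF d] partial_deriv_kern3[OF i] algebra_simps)
  next
   case False
   then have "pd i (g i) y = 0"
    by (intro partial_deriv_zero_outside[of 1]) (auto simp: gz)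
   then show ?thesis using False by (simp add: kern_bounds kern3_bounds)
  qed
  have int_a: "integrable lborel (%y. pd i (g i) y)" if i: "i : Basis" for i
  proof -
   have c: "continuous_on UNIV (pd i (g i))" using Ck_on_1_UNIV(2)[OF gC[OF i] i] .
   have z: "pd i (g i) y = 0" if "norm y > 1" for y
    using that by (intro partial_deriv_zero_outside[of 1]) (auto simp: gz)
   obtain D where "ALL y. \<bar>pd i (g i) y\<bar> <= D"
    using bounded_continuous_compact_support[OF c z] by auto
   then show ?thesis
    by (intro integrable_bounded_support[OF borel_measurable_continuous_onI[OF c], of D 1]) (auto simp: z)
  qed
  have "0 = (SUM i:Basis. LINT y|lborel. pd i (g i) y)"
   by (rule sum.neutral[symmetric]) (auto intro!: integral_partial_deriv[OF gC, of _ 1] gz)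
  also have "... = (LINT y|lborel. (SUM i:Basis. pd i (g i) y))"
   by (rule Lintegral_sum[symmetric]) (use int_a in auto)
  finally have z: "(LINT y|lborel. (SUM i:Basis. pd i (g i) y)) = 0" by simp
  have e: "(SUM i:Basis. (y \<bullet> i) * pd i f (x + s *\<^sub>R y)) * kern y
    = s * laplacian f (x + s *\<^sub>R y) * kern3 y - (SUM i:Basis. pd i (g i) y)" for y
   by (simp add: pg laplacian_def sum_subtractf sum_distrib_left sum_distrib_right)
  have ige: "s * laplacian f (x + s *\<^sub>R y) * kern3 y >= 0" for y
  proof (cases "norm y <= 1")
   case True
   then show ?thesis using lap T1[OF True] s kern3_bounds(1)[of y] by simp
  qed (simp add: kern3_bounds)
  have i1: "integrable lborel (%y. (SUM i:Basis. (y \<bullet> i) * pd i f (x + s *\<^sub>R y)) * kern y)"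
   using dM[of s] s R' by auto
  have "M' s + 0 = (LINT y|lborel. s * laplacian f (x + s *\<^sub>R y) * kern3 y)"
   unfolding M'_def z[symmetric]
   by (subst Lintegral_add[symmetric, OF i1])
     (use int_a in \<open>auto intro!: Lintegrable_sum simp: e\<close>)
  also have "... >= 0" using ige by (intro integral_nonneg_AE) auto
  finally show ?thesis by simp
 qed
 have "M 0 <= M r"
 proof (rule DERIV_nonneg_imp_nondecreasing[of 0 r M])
  show "EX y. (M has_real_derivative y) (at s) & 0 <= y" if "0 <= s" "s <= r" for s
  proof (intro exI conjI)
   show "(M has_real_derivative M' s) (at s)" using that R' by (intro dM) auto
   show "0 <= M' s" using that R' by (intro M'0) auto
  qed
 qed (use r in simp)
 then show ?thesis by (simp add: M_def kern_mass_def)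
qed

lemma mean_C2:
 fixes f :: "'a::euclidean_space => real"
 assumes f: "Ck_on 2 (ball x R) f" and lap: "!!y. y : ball x R ==> laplacian f y = 0"
  and r: "0 < r" "r < R"
 shows "f x * kern_mass TYPE('a) = (LINT y|lborel. f (x + r *\<^sub>R y) * kern y)"
proof (rule antisym)
 show "f x * kern_mass TYPE('a) <= (LINT y|lborel. f (x + r *\<^sub>R y) * kern y)"
  using submean_C2[OF f _ r] lap by simp
 have "(- 1 * f x + 0 * f x) * kern_mass TYPE('a)
   <= (LINT y|lborel. (- 1 * f (x + r *\<^sub>R y) + 0 * f (x + r *\<^sub>R y)) * kern y)"
 proof (rule submean_C2[where f="%x. - 1 * f x + 0 * f x", OF _ _ r])
  show "Ck_on 2 (ball x R) (%x. - 1 * f x + 0 * f x)"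
   by (intro Ck_on_add Ck_on_cmult f) auto
  show "0 <= laplacian (%x. - 1 * f x + 0 * f x) y" if "y : ball x R" for y
   using laplacian_add[OF open_ball that f f, of "-1" 0] lap[OF that] by simp
 qed
 then show "(LINT y|lborel. f (x + r *\<^sub>R y) * kern y) <= f x * kern_mass TYPE('a)" by simp
qed

section \<open>Harnack's inequality and truncated solutions\<close>

definition harnack_const :: "'a::euclidean_space itself => real" where
 "harnack_const _ = 16 / 9 * 4 ^ DIM('a)"

lemma harnack_const_gt1: "harnack_const TYPE('a::euclidean_space) > 1"
proof -
 have "1 <= (4::real) ^ DIM('a)" by (rule one_le_power) simp
 then show ?thesis unfolding harnack_const_def by linarith
qed

lemma laplacian_const [simp]: "laplacian (%x::'a::euclidean_space. c) y = 0"
proof -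
 have "pd i (%x::'a. c) = (%x. 0)" for i
  by (rule ext) (simp add: partial_deriv_def)
 then show ?thesis by (simp add: laplacian_def partial_deriv_def)
qed

text \<open>The mean at y over radius R/8 is compared with the mean at x over radius R/2. The small
  ball lies within R/4 of x, where the large kernel is at least (1 - 1/4)^2 = 9/16, and the two
  scalings differ by 4^d; this is \<open>harnack_const\<close>.\<close>

lemma harnack:
 fixes u :: "'a::euclidean_space => real"
 assumes u: "harmonic_on (ball x R) u" and nn: "!!y. y : ball x R ==> u y >= 0"
  and R: "0 < R" and y: "dist x y <= R / 8"
 shows "u y <= harnack_const TYPE('a) * u x"
proof -
 let ?c = "kern_mass TYPE('a)"
 have uC: "Ck_on 2 (ball x R) u" and lap: "!!z. z : ball x R ==> laplacian u z = 0"
  using u by (auto simp: harmonic_on_def)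
 have uc: "continuous_on (ball x R) u" using Ck_on_continuous[OF open_ball uC] .
 define g where "g p r w = u w * kern ((1/r) *\<^sub>R (w - p))" for p w :: 'a and r :: real
 have gz: "g p r w = 0" if "w \<notin> ball p r" "r > 0" for p w :: 'a and r
  using that by (simp add: g_def kern_bounds dist_norm norm_minus_commute)
 have gm: "g p r : borel_measurable borel" if "ball p r <= ball x R" "r > 0" for p r
 proof (rule measurable_of_continuous_on_open[OF open_ball])
  show "continuous_on (ball p r) (g p r)" unfolding g_def
   by (intro continuous_intros continuous_on_subset[OF uc that(1)]
     continuous_on_compose2[OF kern_continuous]) auto
 qed (use gz that in auto)
 have scale: "integrable lborel (g p r) & r ^ DIM('a) * (u p * ?c) = (LINT w|lborel. g p r w)"
  if p: "ball p (2 * r) <= ball x R" "r > 0" for p r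
 proof -
  have b: "ball p r <= ball x R" using p by force
  have "integrable lborel (%w. g p r (p + r *\<^sub>R w))"
   using integrable_kern_scaled(2)[OF continuous_on_subset[OF uc p(1)], of r] p(2) by (simp add: g_def)
  then have i: "integrable lborel (g p r)"
   using lborel_affine_int(1)[of r "g p r" p] gm[OF b p(2)] p(2) by simp
  have "u p * ?c = (LINT w|lborel. g p r (p + r *\<^sub>R w))"
  proof -
   have "laplacian u z = 0" if "z : ball p (2 * r)" for z using lap p(1) that by blast
   from mean_C2[OF Ck_on_subset[OF p(1) uC] this, of r] show ?thesis using p(2) by (simp add: g_def)
  qed
  then show ?thesis using i lborel_affine_int(2)[of r "g p r" p] gm[OF b p(2)] p(2) by simp
 qed
 have b1: "ball y (2 * (R/8)) <= ball x R"
 proof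
  fix w assume "w : ball y (2 * (R/8))"
  then show "w : ball x R" using dist_triangle[of x w y] y R by auto
 qed
 have b2: "ball x (2 * (R/2)) <= ball x R" by simp
 have "(LINT w|lborel. g y (R/8) w) <= (LINT w|lborel. 16/9 * g x (R/2) w)"
 proof (rule integral_mono)
  show "integrable lborel (g y (R/8))" using scale[OF b1] R by simp
  show "integrable lborel (%w. 16/9 * g x (R/2) w)" using scale[OF b2] R by simp
  show "g y (R/8) w <= 16/9 * g x (R/2) w" for w
  proof (cases "w : ball y (R/8)")
   case True
   have "dist x w <= dist x y + dist y w" by (rule dist_triangle)
   then have d: "dist x w <= R/4" using y True by simp
   then have "norm ((1 / (R/2)) *\<^sub>R (w - x)) <= 1/2"
    using R unfolding norm_scaleR by (simp add: dist_norm norm_minus_commute field_simps)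
   from kern_bounds(4)[OF this] have k: "9/16 <= kern ((1 / (R/2)) *\<^sub>R (w - x))"
    by (simp add: power2_eq_square)
   have "u w >= 0" using nn d R by auto
   then have "u w * kern ((1 / (R/8)) *\<^sub>R (w - y)) <= u w * 1"
    by (intro mult_left_mono kern_bounds)
   also have "... <= u w * (16/9 * kern ((1 / (R/2)) *\<^sub>R (w - x)))"
    using k \<open>u w >= 0\<close> by (intro mult_left_mono) auto
   finally show ?thesis unfolding g_def by (simp add: mult_ac)
  next
   case False
   have "g x (R/2) w >= 0"
   proof (cases "w : ball x (R/2)")
    case True
    then have "u w >= 0" using nn R by auto
    then show ?thesis by (simp add: g_def kern_bounds)
   next
    case False
    then show ?thesis using gz[of w x "R/2"] R by simp
   qed
   then show ?thesis using gz[OF False] R by simp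
  qed
 qed
 then have "(R/8) ^ DIM('a) * (u y * ?c) <= 16/9 * ((R/2) ^ DIM('a) * (u x * ?c))"
  using scale[OF b1] scale[OF b2] R by simp
 also have "(R/2) ^ DIM('a) = (R/8) ^ DIM('a) * 4 ^ DIM('a)"
  by (simp add: power_mult_distrib[symmetric])
 finally have "((R/8) ^ DIM('a) * ?c) * u y <= ((R/8) ^ DIM('a) * ?c) * (harnack_const TYPE('a) * u x)"
  by (simp add: harnack_const_def mult_ac)
 then show ?thesis
  by (rule mult_left_le_imp_le) (use R kern_mass_pos[where 'a='a] in simp)
qed

text \<open>The positive part is replaced by \<open>smooth_pos e\<close> of f. This is C^2 on the
  whole ball because it vanishes near the complement of the domain, and subharmonic by convexity;
  its deviation of at most 6 e disappears as e tends to 0.\<close>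

lemma submean_pos_part:
 fixes f :: "'a::euclidean_space => real"
 assumes O: "open \<Omega>" and fc: "continuous_on (ball x R) f"
  and h: "harmonic_on (\<Omega> Int ball x R) f"
  and out: "!!y. y : ball x R - \<Omega> ==> f y <= 0" and r: "0 < r" "r < R"
 shows "max 0 (f x) * kern_mass TYPE('a) <= (LINT y|lborel. max 0 (f (x + r *\<^sub>R y)) * kern y)"
proof -
 let ?c = "kern_mass TYPE('a)" and ?I = "LINT y|lborel. max 0 (f (x + r *\<^sub>R y)) * kern y"
 have hC: "Ck_on 2 (\<Omega> Int ball x R) f" and lap: "!!z. z : \<Omega> Int ball x R ==> laplacian f z = 0"
  using h by (auto simp: harmonic_on_def)
 have o1: "open (\<Omega> Int ball x R)" using O by auto
 have c0: "continuous_on (ball x R) (%y. max 0 (f y))" by (intro continuous_intros fc)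
 have "(max 0 (f x) - 6 * e) * ?c <= ?I" if e: "e > 0" for e
 proof -
  \<comment> \<open>An open neighbourhood, inside the ball, of the complement of \<Omega>, on which
    the truncated function is identically 0.\<close>
  define V where "V = ball x R Int f -` {..<e}"
  have oV: "open V" unfolding V_def using fc by (intro continuous_open_preimage) auto
  have V0: "smooth_pos e (f y) = 0" if "y : V" for y
   using that smooth_pos_bounds(2)[OF e] by (auto simp: V_def)
  have cover: "ball x R = (\<Omega> Int ball x R) \<union> V" using out e by (force simp: V_def)
  have C1: "Ck_on 2 (\<Omega> Int ball x R) (%y. smooth_pos e (f y))"
   by (rule Ck_on_compose_real[OF o1 open_UNIV hC smooth_pos_Ck[OF e]]) auto
  have C2: "Ck_on 2 V (%y. smooth_pos e (f y))"
   by (rule Ck_on_cong[OF oV _ Ck_on_const[of 2 V 0]]) (simp add: V0)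
  have C: "Ck_on 2 (ball x R) (%y. smooth_pos e (f y))"
   by (subst cover) (rule Ck_on_Un[OF o1 oV C1 C2])
  have L: "laplacian (%y. smooth_pos e (f y)) y >= 0" if "y : ball x R" for y
  proof (cases "y : V")
   case True
   have "laplacian (%y. smooth_pos e (f y)) y = laplacian (%y. 0) y"
    by (rule laplacian_cong_open[OF oV True]) (simp add: V0)
   then show ?thesis by simp
  next
   case False
   then have y: "y : \<Omega> Int ball x R" using cover that by blast
   show ?thesis
    unfolding laplacian_compose_real[OF o1 y hC smooth_pos_deriv[OF e]]
    using lap[OF y] smooth_pos2_nonneg[OF e] by (simp add: sum_nonneg)
  qed
  have "(max 0 (f x) - 6 * e) * ?c <= smooth_pos e (f x) * ?c"
   using smooth_pos_bounds(1,4)[OF e, of "f x"] e kern_mass_pos[where 'a='a]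
   by (intro mult_right_mono) auto
  also have "... <= (LINT y|lborel. smooth_pos e (f (x + r *\<^sub>R y)) * kern y)"
   by (rule submean_C2[OF C L r])
  also have "... <= ?I"
  proof (rule integral_mono)
   show "integrable lborel (%y. smooth_pos e (f (x + r *\<^sub>R y)) * kern y)"
    by (rule integrable_kern_scaled(2)[OF Ck_on_continuous[OF open_ball C]]) (use r in auto)
   show "integrable lborel (%y. max 0 (f (x + r *\<^sub>R y)) * kern y)"
    by (rule integrable_kern_scaled(2)[OF c0]) (use r in auto)
   show "smooth_pos e (f (x + r *\<^sub>R y)) * kern y <= max 0 (f (x + r *\<^sub>R y)) * kern y" for y
    by (intro mult_right_mono smooth_pos_bounds[OF e] kern_bounds)
  qed
  finally show ?thesis .
 qed
 note * = this
 show ?thesis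
 proof (rule field_le_epsilon)
  fix d :: real assume d: "d > 0"
  have c: "?c > 0" by (rule kern_mass_pos)
  have "(max 0 (f x) - 6 * (d / (6 * ?c))) * ?c <= ?I" using d c by (intro *) auto
  also have "(max 0 (f x) - 6 * (d / (6 * ?c))) * ?c = max 0 (f x) * ?c - d" using c by (simp add: field_simps)
  finally show "max 0 (f x) * ?c <= ?I + d" by simp
 qed
qed

section \<open>The standard Gaussian measure\<close>

definition gdens :: "'a::euclidean_space => real" where
 "gdens x = (PROD b:Basis. nd (x \<bullet> b))"

definition gauss :: "'a::euclidean_space measure" where
 "gauss = density lborel (%x. ennreal (gdens x))"

abbreviation Normal :: "real measure" where
 "Normal \<equiv> density lborel (%x. ennreal (nd x))"

lemma gdens_exp: "gdens (x::'a::euclidean_space) = (1 / sqrt (2 * pi)) ^ DIM('a) * exp (- (x \<bullet> x) / 2)"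
proof -
 have "gdens x = (PROD b:Basis. (1 / sqrt (2 * pi)) * exp (- (x \<bullet> b)\<^sup>2 / 2))"
  unfolding gdens_def by (intro prod.cong refl) (simp add: std_normal_density_def)
 also have "... = (1 / sqrt (2 * pi)) ^ DIM('a) * exp (SUM b:Basis. - (x \<bullet> b)\<^sup>2 / 2)"
  by (simp only: prod.distrib prod_constant exp_sum[OF finite_Basis])
 also have "(SUM b:Basis. - (x \<bullet> b)\<^sup>2 / 2) = - (x \<bullet> x) / 2"
  by (subst euclidean_inner) (simp add: power2_eq_square sum_divide_distrib sum_negf)
 finally show ?thesis .
qed

lemma gdens_pos: "gdens x > 0"
 by (simp add: gdens_exp)

lemma gdens_measurable [measurable]: "gdens : borel_measurable borel"
 unfolding gdens_def[abs_def] by measurable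

lemma sets_gauss [simp, measurable_cong]: "sets gauss = sets borel"
 by (simp add: gauss_def)

lemma space_gauss [simp]: "space gauss = UNIV"
 by (simp add: gauss_def)

lemma prob_space_Normal: "prob_space Normal"
 by (rule prob_space_normal_density) simp

lemma emeasure_gauss_box:
 fixes B :: "'a::euclidean_space => real set"
 assumes [measurable]: "!!b. b : Basis ==> B b : sets borel"
 shows "{x. ALL b:Basis. x \<bullet> b : B b} : sets borel"
  "emeasure gauss {x. ALL b:Basis. x \<bullet> b : B b} = (PROD b:Basis. emeasure Normal (B b))"
proof -
 show m: "{x. ALL b:Basis. x \<bullet> b : B b} : sets borel"
 proof -
  have "{x:space borel. ALL b:Basis. x \<bullet> b : B b} : sets (borel::'a measure)" by measurable
  then show ?thesis by simp
 qed
 have "emeasure gauss {x. ALL b:Basis. x \<bullet> b : B b}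
   = (\<integral>\<^sup>+x. ennreal (gdens x) * indicator {x. ALL b:Basis. x \<bullet> b : B b} x \<partial>lborel)"
  unfolding gauss_def using m by (subst emeasure_density) auto
 also have "... = (\<integral>\<^sup>+x. (PROD b:Basis. ennreal (nd (x \<bullet> b)) * indicator (B b) (x \<bullet> b)) \<partial>lborel)"
 proof (rule nn_integral_cong)
  fix x :: 'a
  have "(PROD b:Basis. indicator (B b) (x \<bullet> b)) = (indicator {x. ALL b:Basis. x \<bullet> b : B b} x :: ennreal)"
   by (auto simp: indicator_def intro!: prod_zero)
  then show "ennreal (gdens x) * indicator {x. ALL b:Basis. x \<bullet> b : B b} x
    = (PROD b:Basis. ennreal (nd (x \<bullet> b)) * indicator (B b) (x \<bullet> b))"
   by (simp add: gdens_def prod.distrib prod_ennreal)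
 qed
 also have "... = (PROD b:Basis. (\<integral>\<^sup>+x. ennreal (nd x) * indicator (B b) x \<partial>lborel))"
  by (rule nn_integral_lborel_prod) auto
 also have "... = (PROD b:Basis. emeasure Normal (B b))"
  by (intro prod.cong refl) (simp add: emeasure_density)
 finally show "emeasure gauss {x. ALL b:Basis. x \<bullet> b : B b} = (PROD b:Basis. emeasure Normal (B b))" .
qed

lemma emeasure_Normal_UNIV: "emeasure Normal UNIV = 1"
 using prob_space.emeasure_space_1[OF prob_space_Normal] by simp

lemma prob_space_gauss: "prob_space (gauss :: 'a::euclidean_space measure)"
proof
 show "emeasure gauss (space (gauss::'a measure)) = 1"
  using emeasure_gauss_box(2)[of "%_. UNIV"] by (simp add: emeasure_Normal_UNIV)
qed

lemma emeasure_gauss_coord: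
 assumes "b : Basis" "A : sets borel"
 shows "emeasure gauss ((%x. x \<bullet> b) -` A) = emeasure Normal A"
proof -
 have "(%x. x \<bullet> b) -` A = {x. ALL c:Basis. x \<bullet> c : (if c = b then A else UNIV)}"
  using assms(1) by auto
 moreover have "emeasure gauss {x. ALL c:Basis. x \<bullet> c : (if c = b then A else UNIV)}
   = (PROD c:Basis. emeasure Normal (if c = b then A else UNIV))"
  by (rule emeasure_gauss_box(2)) (use assms in auto)
 moreover have "... = (PROD c:Basis. if c = b then emeasure Normal A else 1)"
  by (intro prod.cong refl) (auto simp: emeasure_Normal_UNIV)
 ultimately show ?thesis using assms(1) by simp
qed

lemma gauss_distributed_coord:
 assumes "b : Basis"
 shows "distributed gauss lborel (%x. x \<bullet> b) nd"
 unfolding distributed_def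
proof (intro conjI)
 show "distr gauss lborel (%x. x \<bullet> b) = Normal"
 proof (rule measure_eqI)
  fix A assume "A : sets (distr gauss lborel (%x. x \<bullet> b))"
  then have A: "A : sets borel" by simp
  have "emeasure (distr gauss lborel (%x. x \<bullet> b)) A = emeasure gauss ((%x. x \<bullet> b) -` A)"
   using A by (subst emeasure_distr) (auto cong: measurable_cong_sets)
  then show "emeasure (distr gauss lborel (%x. x \<bullet> b)) A = emeasure Normal A"
   using emeasure_gauss_coord[OF assms A] by simp
 qed simp
 show "(%x. x \<bullet> b) : measurable gauss lborel" by measurable
 show "(%x. ennreal (nd x)) : borel_measurable lborel" by measurable
qed

lemma gauss_indep_coord:
 "prob_space.indep_vars gauss (%_. borel) (%b x. x \<bullet> b) (Basis::'a::euclidean_space set)"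
proof -
 interpret prob_space "gauss::'a measure" by (rule prob_space_gauss)
 show ?thesis
  unfolding indep_vars_def2
 proof (intro conjI ballI)
  show "random_variable borel (%x. x \<bullet> b)" for b by measurable
  show "indep_sets (%b. {(%x. x \<bullet> b) -` A Int space gauss |A. A : sets borel}) (Basis::'a set)"
  proof (rule indep_setsI)
   show "{(%x. x \<bullet> b) -` A Int space gauss |A. A : sets borel} <= events" for b :: 'a
    using measurable_sets[of "%x. x \<bullet> b" gauss borel] by auto
   fix S :: "'a => 'a set" and J
   assume J: "J ~= {}" "J <= Basis" "finite J"
    and S: "ALL j:J. S j : {(%x. x \<bullet> j) -` A Int space gauss |A. A : sets borel}"
   then have "ALL j:J. EX A. S j = (%x. x \<bullet> j) -` A & A : sets borel" by auto
   then obtain A where A: "ALL j:J. S j = (%x. x \<bullet> j) -` A j & A j : sets borel" by metis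
   define B where "B b = (if b : J then A b else UNIV)" for b
   have B: "B b : sets borel" for b using A by (auto simp: B_def)
   have "(INT j:J. S j) = {x. ALL b:Basis. x \<bullet> b : B b}"
    using A J(1,2) by (auto simp: B_def)
   then have "emeasure gauss (INT j:J. S j) = (PROD b:Basis. emeasure Normal (B b))"
    using emeasure_gauss_box(2)[of B] B by simp
   also have "... = (PROD b:J. emeasure Normal (B b))"
    by (rule prod.mono_neutral_right) (use J in \<open>auto simp: B_def emeasure_Normal_UNIV\<close>)
   also have "... = (PROD b:J. emeasure gauss (S b))"
    using A J(2) by (intro prod.cong refl) (simp add: B_def emeasure_gauss_coord subset_iff)
   also have "... = ennreal (PROD b:J. prob (S b))"
    by (simp add: emeasure_eq_measure prod_ennreal)
   finally show "prob (INT j:J. S j) = (PROD b:J. prob (S b))"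
    by (simp add: emeasure_eq_measure prod_nonneg)
  qed
 qed
qed

text \<open>Rotation invariance, obtained from the independence of the coordinates and the stability
  of normal laws under independent sums.\<close>

lemma gauss_distributed_unit:
 fixes v :: "'a::euclidean_space"
 assumes v: "norm v = 1"
 shows "distributed gauss lborel (%x. v \<bullet> x) nd"
proof -
 interpret prob_space "gauss::'a measure" by (rule prob_space_gauss)
 \<comment> \<open>Coordinates with coefficient 0 are dropped, since the sum rule for normal laws
   asks for positive standard deviations.\<close>
 define I where "I = {b:Basis. v \<bullet> b ~= 0}"
 have I: "finite I" "I <= Basis" by (auto simp: I_def)
 have ss: "(SUM b:I. (v \<bullet> b)^2) = 1"
 proof -
  have "(SUM b:I. (v \<bullet> b)^2) = (SUM b:Basis. (v \<bullet> b)^2)"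
   by (rule sum.mono_neutral_left) (auto simp: I_def)
  also have "... = v \<bullet> v" by (subst (2) euclidean_inner) (simp add: power2_eq_square)
  finally show ?thesis using v by (simp add: norm_eq_1)
 qed
 have "I ~= {}" using ss by auto
 have ind: "indep_vars (%_. borel) (%b x. (v \<bullet> b) * (x \<bullet> b)) I"
  by (rule indep_vars_compose2[OF indep_vars_subset[OF gauss_indep_coord I(2)],
     where Y="%b s. (v \<bullet> b) * s"]) auto
 have "distributed gauss lborel (%x. SUM b:I. (v \<bullet> b) * (x \<bullet> b))
   (normal_density (SUM b:I. 0) (sqrt (SUM b:I. \<bar>v \<bullet> b\<bar>\<^sup>2)))"
 proof (rule sum_indep_normal[OF I(1) \<open>I ~= {}\<close> ind])
  fix b assume b: "b : I"
  then show "0 < \<bar>v \<bullet> b\<bar>" by (simp add: I_def)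
  have "distributed gauss lborel (%x. 0 + (v \<bullet> b) * (x \<bullet> b)) (normal_density (0 + (v \<bullet> b) * 0) (\<bar>v \<bullet> b\<bar> * 1))"
   by (rule normal_density_affine[OF gauss_distributed_coord]) (use b I in \<open>auto simp: I_def\<close>)
  then show "distributed gauss lborel (%x. (v \<bullet> b) * (x \<bullet> b)) (normal_density 0 \<bar>v \<bullet> b\<bar>)" by simp
 qed
 moreover have "(SUM b:I. (v \<bullet> b) * (x \<bullet> b)) = v \<bullet> x" for x
 proof -
  have "(SUM b:I. (v \<bullet> b) * (x \<bullet> b)) = (SUM b:Basis. (v \<bullet> b) * (x \<bullet> b))"
   by (rule sum.mono_neutral_left) (auto simp: I_def)
  then show ?thesis by (simp add: euclidean_inner[of v x])
 qed
 ultimately show ?thesis using ss by simp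
qed

lemma gauss_law:
 fixes v :: "'a::euclidean_space" and g :: "real => real"
 assumes v: "norm v = 1" and [measurable]: "g : borel_measurable borel"
 shows "(LINT x|gauss. g (v \<bullet> x)) = (LINT s|Normal. g s)"
  and "integrable gauss (%x. g (v \<bullet> x)) \<longleftrightarrow> integrable Normal g"
proof -
 note D = gauss_distributed_unit[OF v]
 show "(LINT x|gauss. g (v \<bullet> x)) = (LINT s|Normal. g s)"
  using distributed_integral[OF D, of g] by (simp add: integral_density)
 show "integrable gauss (%x. g (v \<bullet> x)) \<longleftrightarrow> integrable Normal g"
  using distributed_integrable[OF D, of g] by (simp add: integrable_density)
qed

lemma integrable_Normal_power: "integrable Normal (%s. s ^ k)" "integrable Normal (%s. \<bar>s\<bar> ^ k)"
 using integrable_std_normal_moment[of k] integrable_std_normal_moment_abs[of k]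
 by (simp_all add: integrable_density)

lemma integral_Normal_1: "(LINT s|Normal. s) = 0"
 using std_normal_moment_odd[of 0] by (simp add: integral_density has_bochner_integral_iff)

lemma integral_Normal_2: "(LINT s|Normal. s^2) = 1"
 using std_normal_moment_even[of 1] by (simp add: integral_density has_bochner_integral_iff power2_eq_square)

lemma integrable_Normal_exp: "integrable Normal (%s. exp (a * s))"
proof -
 have "integrable lborel (%s. exp (a^2 / 2) * normal_density a 1 s)"
  by (intro integrable_mult_right integrable_normal_density) simp
 moreover have "exp (a^2 / 2) * normal_density a 1 s = nd s * exp (a * s)" for s
 proof -
  have "exp (a^2 / 2) * exp (- (s - a)\<^sup>2 / 2) = exp (- s\<^sup>2 / 2) * exp (a * s)"
   unfolding exp_add[symmetric] by (rule arg_cong[where f=exp]) (simp add: power2_eq_square field_simps)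
  then show ?thesis by (simp add: normal_density_def)
 qed
 ultimately show ?thesis by (simp add: integrable_density)
qed

lemma gauss_integrable_const [simp]: "integrable (gauss::'a::euclidean_space measure) (%x. c::real)"
proof -
 interpret prob_space "gauss::'a measure" by (rule prob_space_gauss)
 show ?thesis by simp
qed

lemma gauss_integral_const [simp]: "(LINT x|(gauss::'a::euclidean_space measure). c) = (c::real)"
proof -
 interpret prob_space "gauss::'a measure" by (rule prob_space_gauss)
 show ?thesis using prob_space by simp
qed

lemma gauss_integrable_bounded:
 fixes g :: "'a::euclidean_space => real"
 assumes "g : borel_measurable borel" "!!x. \<bar>g x\<bar> <= C"
 shows "integrable gauss g"
 by (rule Lintegrable_bound[OF gauss_integrable_const[of C]])
   (use assms in \<open>auto intro!: AE_I2 order_trans[OF _ abs_ge_self] cong: measurable_cong_sets\<close>)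

lemma gauss_integrable_norm_sq: "integrable gauss (%x::'a::euclidean_space. (norm x)^2)"
proof -
 have "integrable gauss (%x::'a. (b \<bullet> x)^2)" if "b : Basis" for b
  by (subst gauss_law(2)[where g="%s. s^2"]) (use that integrable_Normal_power in auto)
 then have "integrable gauss (%x::'a. SUM b:Basis. (b \<bullet> x)^2)" by auto
 moreover have "(norm x)^2 = (SUM b:Basis. (b \<bullet> x)^2)" for x :: 'a
  unfolding power2_norm_eq_inner by (subst euclidean_inner) (simp add: power2_eq_square inner_commute)
 ultimately show ?thesis by simp
qed

lemma gauss_integral_norm_sq: "(LINT x|gauss. (norm (x::'a::euclidean_space))^2) = DIM('a)"
proof -
 have i: "integrable gauss (%x::'a. (b \<bullet> x)^2)" "(LINT x|gauss. (b \<bullet> x)^2) = 1" if "b : Basis" for b :: 'a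
 proof -
  show "integrable gauss (%x::'a. (b \<bullet> x)^2)"
   by (subst gauss_law(2)[where g="%s. s^2"]) (use that integrable_Normal_power in auto)
  show "(LINT x|gauss. (b \<bullet> x)^2) = 1"
   by (subst gauss_law(1)[where g="%s. s^2"]) (use that integral_Normal_2 in auto)
 qed
 have "(norm x)^2 = (SUM b:Basis. (b \<bullet> x)^2)" for x :: 'a
  unfolding power2_norm_eq_inner by (subst euclidean_inner) (simp add: power2_eq_square inner_commute)
 then have "(LINT x|gauss. (norm (x::'a))^2) = (LINT x|(gauss::'a measure). (SUM b:Basis. (b \<bullet> x)^2))" by simp
 also have "... = (SUM b:(Basis::'a set). 1)"
  by (subst Lintegral_sum) (use i in auto)
 finally show ?thesis by simp
qed

lemma gauss_integrable_linear_growth: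
 fixes g :: "'a::euclidean_space => real"
 assumes "g : borel_measurable borel" "!!x. \<bar>g x\<bar> <= A + B * (norm x)^2"
 shows "integrable gauss g"
proof (rule Lintegrable_bound)
 show "integrable gauss (%x::'a. A + B * (norm x)^2)"
  by (intro Lintegrable_add integrable_mult_right gauss_integrable_norm_sq gauss_integrable_const)
 show "AE x in gauss. norm (g x) <= norm (A + B * (norm x)^2)"
  using assms(2) by (auto intro!: AE_I2 order_trans[OF _ abs_ge_self])
qed (use assms in \<open>auto cong: measurable_cong_sets\<close>)

section \<open>Gaussian integration by parts\<close>

lemma gauss_integral_lborel:
 fixes g :: "'a::euclidean_space => real"
 assumes [measurable]: "g : borel_measurable borel"
 shows "(LINT x|gauss. g x) = (LINT x|lborel. gdens x * g x)"
  "integrable gauss g \<longleftrightarrow> integrable lborel (%x. gdens x * g x)"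
proof -
 have p: "AE x in lborel. 0 <= gdens (x::'a)" using gdens_pos by (auto intro: less_imp_le)
 show "(LINT x|gauss. g x) = (LINT x|lborel. gdens x * g x)"
  unfolding gauss_def by (subst integral_density[OF _ _ p]) auto
 show "integrable gauss g \<longleftrightarrow> integrable lborel (%x. gdens x * g x)"
  unfolding gauss_def by (subst integrable_density[OF _ _ p]) auto
qed

text \<open>The Cameron-Martin formula: translate the variable and complete the square in the
  density.\<close>

lemma gauss_shift:
 fixes g :: "'a::euclidean_space => real"
 assumes [measurable]: "g : borel_measurable borel" and i: "i : Basis"
 shows "(LINT x|gauss. g (x + h *\<^sub>R i)) = (LINT x|gauss. g x * exp (h * (x \<bullet> i) - h\<^sup>2 / 2))"
proof -
 have ii: "i \<bullet> i = 1" using i by simp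
 define F where "F x = gdens (x - h *\<^sub>R i) * g x" for x
 have F: "F : borel_measurable borel" unfolding F_def by measurable
 have "(LINT x|gauss. g (x + h *\<^sub>R i)) = (LINT x|lborel. F (h *\<^sub>R i + 1 *\<^sub>R x))"
  by (subst gauss_integral_lborel) (auto simp: F_def add.commute)
 also have "... = (LINT x|lborel. F x)"
  using lborel_affine_int(2)[of 1 F "h *\<^sub>R i"] F by simp
 also have "... = (LINT x|lborel. gdens x * (g x * exp (h * (x \<bullet> i) - h\<^sup>2 / 2)))"
 proof (rule Lintegral_cong[OF refl])
  fix x :: 'a
  have "- ((x - h *\<^sub>R i) \<bullet> (x - h *\<^sub>R i)) / 2 = - (x \<bullet> x) / 2 + (h * (x \<bullet> i) - h\<^sup>2 / 2)"
   using ii by (simp add: inner_diff inner_commute power2_eq_square field_simps)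
  then have "gdens (x - h *\<^sub>R i) = gdens x * exp (h * (x \<bullet> i) - h\<^sup>2 / 2)"
   unfolding gdens_exp by (simp only: exp_add mult.assoc)
  then show "F x = gdens x * (g x * exp (h * (x \<bullet> i) - h\<^sup>2 / 2))" by (simp add: F_def)
 qed
 finally show ?thesis by (subst gauss_integral_lborel(1)[where g="%x. g x * exp (h * (x \<bullet> i) - h\<^sup>2 / 2)"]) simp_all
qed

text \<open>Stein's identity, obtained by differentiating the two sides of
  \<open>gauss_shift\<close> at h = 0. The left side produces the derivative of g, the right side
  the factor x . i, and no boundary terms have to be discussed.\<close>

lemma gauss_stein:
 fixes g g' :: "'a::euclidean_space => real"
 assumes gm: "g : borel_measurable borel" and i: "i : Basis"
  and der: "!!x. ((%t. g (x + t *\<^sub>R i)) has_real_derivative g' x) (at 0)"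
  and bd: "!!x. \<bar>g x\<bar> <= C" "!!x. \<bar>g' x\<bar> <= C'"
 shows "integrable gauss (%x. (x \<bullet> i) * g x)" "integrable gauss g'"
  "(LINT x|gauss. (x \<bullet> i) * g x) = (LINT x|gauss. g' x)"
proof -
 note gm[measurable]
 have der': "((%t. g (x + t *\<^sub>R i)) has_real_derivative g' (x + t *\<^sub>R i)) (at t)" for x t
 proof -
  have "((%s. g ((x + t *\<^sub>R i) + s *\<^sub>R i)) has_real_derivative g' (x + t *\<^sub>R i)) (at 0)" by (rule der)
  then have "((%s. g (x + (t + s) *\<^sub>R i)) has_real_derivative g' (x + t *\<^sub>R i)) (at 0)"
   by (simp add: algebra_simps)
  then show ?thesis using DERIV_shift[of "%s. g (x + s *\<^sub>R i)" "g' (x + t *\<^sub>R i)" 0 t]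
   by (simp add: add.commute)
 qed
 have i1: "integrable gauss (%x. g (x + t *\<^sub>R i))" for t
  by (rule gauss_integrable_bounded[where C=C]) (use bd in auto)
 note L = DERIV_integral_dominated[where a="-1" and b=1 and t=0 and M=gauss
   and f="%t x. g (x + t *\<^sub>R i)" and f'="%t x. g' (x + t *\<^sub>R i)" and B="%_. C'"]
 have L1: "integrable gauss g'"
  using L(1) i1 der' bd(2) by simp
 have L2: "((%t. LINT x|gauss. g (x + t *\<^sub>R i)) has_real_derivative (LINT x|gauss. g' x)) (at 0)"
  using L(2) i1 der' bd(2) by simp
 have ex: "integrable gauss (%x::'a. exp (a * (i \<bullet> x)))" for a
  by (subst gauss_law(2)[where g="%s. exp (a * s)"]) (use i integrable_Normal_exp in auto)
 define f where "f t x = g x * exp (t * (x \<bullet> i) - t\<^sup>2 / 2)" for t x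
 define f' where "f' t x = g x * (exp (t * (x \<bullet> i) - t\<^sup>2 / 2) * ((x \<bullet> i) - t))" for t x
 define B where "B x = C * (exp (2 * (i \<bullet> x)) + exp (-2 * (i \<bullet> x)))" for x
 have C0: "C >= 0" using bd(1)[of 0] by linarith
 \<comment> \<open>A majorant uniform in |t| < 1: the exponential is at most exp |s|, the linear
   factor is at most another exp |s|, and exp (2 |s|) is split into two integrable
   exponentials.\<close>
 have eb: "exp (t * s - t\<^sup>2 / 2) * (\<bar>s\<bar> + 1) <= (exp (2 * s) + exp (-2 * s))"
  if t: "-1 < t" "t < 1" for t s :: real
 proof -
  have "t * s <= \<bar>t\<bar> * \<bar>s\<bar>" by (metis abs_ge_self abs_mult)
  also have "... <= 1 * \<bar>s\<bar>" using t by (intro mult_right_mono) auto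
  finally have "t * s - t\<^sup>2 / 2 <= \<bar>s\<bar>" by (smt (verit) zero_le_power2 divide_nonneg_nonneg)
  then have "exp (t * s - t\<^sup>2 / 2) <= exp \<bar>s\<bar>" by simp
  moreover have "\<bar>s\<bar> + 1 <= exp \<bar>s\<bar>" using exp_ge_add_one_self[of "\<bar>s\<bar>"] by linarith
  ultimately have "exp (t * s - t\<^sup>2 / 2) * (\<bar>s\<bar> + 1) <= exp \<bar>s\<bar> * exp \<bar>s\<bar>"
   by (intro mult_mono) auto
  also have "... = exp (2 * \<bar>s\<bar>)" by (simp add: exp_add[symmetric])
  also have "... <= exp (2 * s) + exp (-2 * s)" by (cases "s >= 0") auto
  finally show ?thesis .
 qed
 have Bint: "integrable gauss B" unfolding B_def
  by (intro integrable_mult_right Lintegrable_add ex)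
 have fb: "\<bar>f t x\<bar> <= B x" "\<bar>f' t x\<bar> <= B x" if t: "-1 < t" "t < 1" for t x
 proof -
  have "\<bar>g x\<bar> * (exp (t * (x \<bullet> i) - t\<^sup>2 / 2) * (\<bar>x \<bullet> i\<bar> + 1)) <= C * (exp (2 * (x \<bullet> i)) + exp (-2 * (x \<bullet> i)))"
   by (rule mult_mono[OF bd(1) eb[OF t] C0]) simp
  then have *: "\<bar>g x\<bar> * (exp (t * (x \<bullet> i) - t\<^sup>2 / 2) * (\<bar>x \<bullet> i\<bar> + 1)) <= B x"
   by (simp add: B_def inner_commute mult_ac)
  have "exp (t * (x \<bullet> i) - t\<^sup>2 / 2) * 1 <= exp (t * (x \<bullet> i) - t\<^sup>2 / 2) * (\<bar>x \<bullet> i\<bar> + 1)"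
   by (intro mult_left_mono) auto
  then have "\<bar>f t x\<bar> <= \<bar>g x\<bar> * (exp (t * (x \<bullet> i) - t\<^sup>2 / 2) * (\<bar>x \<bullet> i\<bar> + 1))"
   unfolding f_def abs_mult by (intro mult_left_mono) auto
  then show "\<bar>f t x\<bar> <= B x" using * by linarith
  have "\<bar>x \<bullet> i - t\<bar> <= \<bar>x \<bullet> i\<bar> + 1" using t by linarith
  then have "\<bar>f' t x\<bar> <= \<bar>g x\<bar> * (exp (t * (x \<bullet> i) - t\<^sup>2 / 2) * (\<bar>x \<bullet> i\<bar> + 1))"
   unfolding f'_def abs_mult by (intro mult_left_mono) auto
  then show "\<bar>f' t x\<bar> <= B x" using * by linarith
 qed
 have i2: "integrable gauss (f t)" if t: "-1 < t" "t < 1" for t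
 proof (rule Lintegrable_bound[OF Bint])
  show "f t : borel_measurable gauss" unfolding f_def by measurable
  show "AE x in gauss. norm (f t x) <= norm (B x)"
   using fb(1)[OF t] by (auto intro!: AE_I2 order_trans[OF _ abs_ge_self])
 qed
 have dd: "((%t. f t x) has_real_derivative f' t x) (at t)" for t x
  unfolding f_def f'_def by (auto intro!: derivative_eq_intros)
 have R1: "integrable gauss (f' 0)"
  by (rule DERIV_integral_dominated(1)[where a="-1" and b=1 and f=f and B=B, OF _ _ i2 dd fb(2) Bint]) auto
 have R2: "((%t. LINT x|gauss. f t x) has_real_derivative (LINT x|gauss. f' 0 x)) (at 0)"
  by (rule DERIV_integral_dominated(2)[where a="-1" and b=1 and f=f and B=B, OF _ _ i2 dd fb(2) Bint]) auto
 have f0: "f' 0 = (%x. (x \<bullet> i) * g x)" by (rule ext) (simp add: f'_def)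
 have "(%t. LINT x|gauss. f t x) = (%t. LINT x|gauss. g (x + t *\<^sub>R i))"
  unfolding f_def using gauss_shift[OF gm i] by simp
 then have "(LINT x|gauss. f' 0 x) = (LINT x|gauss. g' x)"
  using R2 L2 DERIV_unique by metis
 then show "integrable gauss (%x. (x \<bullet> i) * g x)" "integrable gauss g'"
  "(LINT x|gauss. (x \<bullet> i) * g x) = (LINT x|gauss. g' x)"
  using R1 L1 by (simp_all add: f0)
qed

lemma measure_gauss_UNIV [simp]: "measure (gauss::'a::euclidean_space measure) UNIV = 1"
 using prob_space.prob_space[OF prob_space_gauss] by simp

lemma le_one_plus_sq: "(r::real) <= 1 + r^2"
proof -
 have "0 <= (r - 1/2)\<^sup>2" by simp
 then show ?thesis by (simp add: power2_eq_square algebra_simps)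
qed

section \<open>The Ornstein-Uhlenbeck semigroup and its covariances\<close>

definition nice :: "nat => ('a::euclidean_space => real) => bool" where
 "nice k G \<longleftrightarrow> Ck_on k UNIV G & (EX R. ALL x. norm x > R --> G x = 0)"

lemma nice_Ck: "nice k G ==> Ck_on k UNIV G"
 by (simp add: nice_def)

lemma nice_le: "nice k G ==> j <= k ==> nice j G"
 unfolding nice_def using Ck_on_le[OF open_UNIV] by blast

lemma nice_partial:
 assumes "nice (Suc k) G" "i : Basis" shows "nice k (pd i G)"
proof -
 obtain R where "!!x. norm x > R ==> G x = 0" using assms(1) by (auto simp: nice_def)
 then have "ALL x. norm x > R --> pd i G x = 0"
  using partial_deriv_zero_outside[of R G _ i] by blast
 then show ?thesis using assms by (auto simp: nice_def)
qed

lemma nice_continuous: "nice k G ==> continuous_on UNIV G"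
 using Ck_on_continuous[OF open_UNIV nice_Ck] .

lemma nice_measurable: "nice k G ==> G : borel_measurable borel"
 using borel_measurable_continuous_onI[OF nice_continuous] .

lemma nice_bounded:
 assumes "nice k G" shows "EX C>=0. ALL x. \<bar>G x\<bar> <= C"
proof -
 obtain R where R: "!!x. norm x > R ==> G x = 0" using assms by (auto simp: nice_def)
 show ?thesis by (rule bounded_continuous_compact_support[OF nice_continuous[OF assms] R])
qed

lemma nice_differentiable: "nice (Suc k) G ==> G differentiable (at x)"
 using nice_Ck[of "Suc k" G] by (simp add: differentiable_on_def)

lemma nice_add: "nice k F ==> nice k G ==> nice k (%x. a * F x + b * G x)"
proof -
 assume F: "nice k F" and G: "nice k G"
 obtain R S where "ALL x. norm x > R --> F x = 0" "ALL x. norm x > S --> G x = 0"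
  using F G by (auto simp: nice_def)
 then have "ALL x. norm x > max R S --> a * F x + b * G x = 0" by simp
 moreover have "Ck_on k UNIV (%x. a * F x + b * G x)"
  by (intro Ck_on_add Ck_on_cmult nice_Ck F G open_UNIV)
 ultimately show ?thesis unfolding nice_def by blast
qed

lemma nice_partial_bound:
 fixes G :: "'a::euclidean_space => real"
 assumes "nice (Suc k) G"
 shows "EX C>=0. ALL i:Basis. ALL x. \<bar>pd i G x\<bar> <= C"
proof -
 have "ALL i:Basis. EX C>=0. ALL x. \<bar>pd i G x\<bar> <= C"
  using nice_bounded[OF nice_partial[OF assms]] by blast
 then obtain C where C: "ALL i:Basis. C i >= 0 & (ALL x. \<bar>pd i G x\<bar> <= C i)" by metis
 have "C i <= (SUM i:Basis. C i)" if "i : Basis" for i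
  by (rule member_le_sum) (use that C in auto)
 then have le: "\<bar>pd i G x\<bar> <= (SUM i:Basis. C i)" if "i : Basis" for i x
  using C that by (meson order_trans)
 have "(SUM i:Basis. C i) >= 0" by (rule sum_nonneg) (use C in auto)
 with le show ?thesis by blast
qed

text \<open>Mehler's form of the Ornstein-Uhlenbeck semigroup at time t, with \<rho> = exp (-2
  t).\<close>

definition oumean :: "('a::euclidean_space => real) => real => 'a => real" where
 "oumean G \<rho> z = (LINT y|gauss. G (sqrt \<rho> *\<^sub>R z + sqrt (1 - \<rho>) *\<^sub>R y))"

text \<open>In Hermite expansions this is the sum over k of \<rho>^k times the inner product of the
  order-k components. For G = H it is a power series in \<rho> with nonnegative coefficients, hence
  the signs used in \<open>gauss_second_poincare\<close>.\<close>

definition oucov :: "('a::euclidean_space => real) => ('a => real) => real => real" where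
 "oucov G H \<rho> = (LINT z|gauss. oumean G \<rho> z * oumean H \<rho> z)"

lemma oumean_integrable:
 fixes G :: "'a::euclidean_space => real"
 assumes [measurable]: "G : borel_measurable borel" and "!!x. \<bar>G x\<bar> <= C"
 shows "integrable gauss (%y. G (sqrt \<rho> *\<^sub>R z + sqrt (1 - \<rho>) *\<^sub>R y))"
 by (rule gauss_integrable_bounded[where C=C]) (use assms in auto)

lemma oumean_bound:
 fixes G :: "'a::euclidean_space => real"
 assumes G: "G : borel_measurable borel" "!!x. \<bar>G x\<bar> <= C"
 shows "\<bar>oumean G \<rho> z\<bar> <= C"
proof -
 have "\<bar>oumean G \<rho> z\<bar> <= (LINT y|gauss. \<bar>G (sqrt \<rho> *\<^sub>R z + sqrt (1 - \<rho>) *\<^sub>R y)\<bar>)"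
  unfolding oumean_def by (rule integral_abs_bound)
 also have "... <= (LINT y|(gauss::'a measure). C)"
  by (rule integral_mono[OF integrable_abs[OF oumean_integrable[OF G]]]) (use G in auto)
 finally show ?thesis by simp
qed

lemma oumean_measurable [measurable]:
 fixes G :: "'a::euclidean_space => real"
 assumes [measurable]: "G : borel_measurable borel"
 shows "oumean G \<rho> : borel_measurable borel"
proof -
 interpret prob_space "gauss::'a measure" by (rule prob_space_gauss)
 show ?thesis unfolding oumean_def[abs_def] by measurable
qed

lemma oumean_z_deriv:
 fixes G :: "'a::euclidean_space => real"
 assumes G: "nice 1 G" and i: "i : Basis"
 shows "((%t. oumean G \<rho> (z + t *\<^sub>R i)) has_real_derivative sqrt \<rho> * oumean (pd i G) \<rho> z) (at 0)"
proof -
 have G1: "nice (Suc 0) G" using G by simp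
 note Gm = nice_measurable[OF G] and dm = nice_measurable[OF nice_partial[OF G1 i]]
 obtain C where C: "ALL x. \<bar>G x\<bar> <= C" using nice_bounded[OF G] by blast
 obtain C' where C': "ALL x. \<bar>pd i G x\<bar> <= C'" using nice_bounded[OF nice_partial[OF G1 i]] by blast
 define p where "p t y = sqrt \<rho> *\<^sub>R (z + t *\<^sub>R i) + sqrt (1 - \<rho>) *\<^sub>R y" for t y
 have d: "((%t. G (p t y)) has_real_derivative sqrt \<rho> * pd i G (p t y)) (at t)" for t y
 proof -
  let ?x = "sqrt \<rho> *\<^sub>R z + sqrt (1 - \<rho>) *\<^sub>R y"
  have e: "p t y = ?x + t *\<^sub>R (sqrt \<rho> *\<^sub>R i)" for t by (simp add: p_def algebra_simps)
  show ?thesis unfolding e by (rule has_real_derivative_axis[OF i nice_differentiable[OF G1]])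
 qed
 have i1: "integrable gauss (%y. G (p t y))" for t
  using oumean_integrable[OF Gm, of C \<rho> "z + t *\<^sub>R i"] C by (simp add: p_def)
 have b: "\<bar>sqrt \<rho> * pd i G (p t y)\<bar> <= \<bar>sqrt \<rho>\<bar> * C'" for t y
  using C' by (simp add: abs_mult mult_left_mono)
 have "((%t. LINT y|gauss. G (p t y)) has_real_derivative (LINT y|gauss. sqrt \<rho> * pd i G (p 0 y))) (at 0)"
  by (rule DERIV_integral_dominated(2)[where a="-1" and b=1 and B="%_. \<bar>sqrt \<rho>\<bar> * C'", OF _ _ i1 d b]) auto
 then show ?thesis by (simp add: oumean_def p_def)
qed

text \<open>Differentiating the argument gives a term in z and a term in y; Stein's identity in y
  turns the latter into the average of the second derivatives.\<close>

lemma oumean_rho_deriv: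
 fixes G :: "'a::euclidean_space => real"
 assumes G: "nice 2 G" and r: "0 < \<rho>" "\<rho> < 1"
 shows "((%\<rho>. oumean G \<rho> z) has_real_derivative
   (SUM i:Basis. (z \<bullet> i) / (2 * sqrt \<rho>) * oumean (pd i G) \<rho> z
    - oumean (pd i (pd i G)) \<rho> z / 2)) (at \<rho>)"
proof -
 have G2: "nice (Suc 1) G" using G by (simp add: numeral_2_eq_2)
 have G1: "nice (Suc 0) (pd i G)" if "i : Basis" for i using nice_partial[OF G2 that] by simp
 note Gm = nice_measurable[OF G] and dm = nice_measurable[OF G1]
 obtain C where C: "ALL x. \<bar>G x\<bar> <= C" using nice_bounded[OF G] by blast
 obtain C' where C': "C' >= 0" "ALL i:Basis. ALL x. \<bar>pd i G x\<bar> <= C'"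
  using nice_partial_bound[OF G2] by blast
 define p where "p s y = sqrt s *\<^sub>R z + sqrt (1 - s) *\<^sub>R y" for s y
 define w where "w s y = (1 / (2 * sqrt s)) *\<^sub>R z - (1 / (2 * sqrt (1 - s))) *\<^sub>R y" for s y
 \<comment> \<open>The interval (a, b) keeps away from 0 and 1, where the square roots have no
   bounded derivative.\<close>
 define a where "a = \<rho> / 2"
 define b where "b = (1 + \<rho>) / 2"
 have ab: "0 < a" "a < \<rho>" "\<rho> < b" "b < 1" using r by (auto simp: a_def b_def)
 have d: "((%s. G (p s y)) has_real_derivative (SUM i:Basis. (w s y \<bullet> i) * pd i G (p s y))) (at s)"
  if s: "a < s" "s < b" for s y
 proof -
  have s': "0 < s" "s < 1" using s ab by linarith+
  have r1: "(sqrt has_real_derivative 1 / (2 * sqrt s)) (at s)"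
   by (rule DERIV_cong[OF DERIV_real_sqrt[OF s'(1)]]) (simp add: inverse_eq_divide)
  have r2: "((%s. sqrt (1 - s)) has_real_derivative - (1 / (2 * sqrt (1 - s)))) (at s)"
  proof -
   have "((%s. 1 - s) has_real_derivative -1) (at s)" by (auto intro!: derivative_eq_intros)
   from DERIV_chain'[OF this DERIV_real_sqrt] show ?thesis
    by (rule DERIV_cong) (use s'(2) in \<open>auto simp: inverse_eq_divide\<close>)
  qed
  have "((%s. sqrt s *\<^sub>R z + sqrt (1 - s) *\<^sub>R y) has_vector_derivative
    ((sqrt s *\<^sub>R 0 + (1 / (2 * sqrt s)) *\<^sub>R z) + (sqrt (1 - s) *\<^sub>R 0 + (- (1 / (2 * sqrt (1 - s)))) *\<^sub>R y))) (at s)"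
   by (rule has_vector_derivative_add[OF has_vector_derivative_scaleR[OF r1 has_vector_derivative_const]
     has_vector_derivative_scaleR[OF r2 has_vector_derivative_const]])
  then have "((%s. p s y) has_vector_derivative w s y) (at s)" unfolding p_def w_def by simp
  then have 1: "((%s. p s y) has_derivative (%h. h *\<^sub>R w s y)) (at s)"
   by (simp add: has_vector_derivative_def)
  have 2: "(G has_derivative frechet_derivative G (at (p s y))) (at (p s y))"
   using nice_differentiable[OF G2] frechet_derivative_works by blast
  have 3: "frechet_derivative G (at (p s y)) (h *\<^sub>R w s y) = h * (SUM i:Basis. (w s y \<bullet> i) * pd i G (p s y))" for h
   using partial_deriv_expand[OF 2, of "w s y"] has_derivative_linear[OF 2] by (simp add: linear_scale)
  have "((%s. G (p s y)) has_derivative (%h. h * (SUM i:Basis. (w s y \<bullet> i) * pd i G (p s y)))) (at s)"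
   using has_derivative_compose[OF 1 2] by (simp only: 3)
  moreover have "(%h. h * c) = (*) c" for c :: real by (rule ext) (simp add: mult.commute)
  ultimately show ?thesis unfolding has_field_derivative_def by simp
 qed
 have i1: "integrable gauss (%y. G (p s y))" for s
  using oumean_integrable[OF Gm, of C s z] C by (simp add: p_def)
 define K where "K = 1 / (2 * sqrt a) + 1 / (2 * sqrt (1 - b))"
 have K0: "K >= 0" using ab by (simp add: K_def)
 define B where "B y = real DIM('a) * (K * (norm z + norm y) * C')" for y :: 'a
 have bd: "\<bar>SUM i:Basis. (w s y \<bullet> i) * pd i G (p s y)\<bar> <= B y" if s: "a < s" "s < b" for s y
 proof -
  have "norm (w s y) <= norm ((1 / (2 * sqrt s)) *\<^sub>R z) + norm ((1 / (2 * sqrt (1 - s))) *\<^sub>R y)"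
   unfolding w_def by (rule norm_triangle_ineq4)
  also have "... = 1 / (2 * sqrt s) * norm z + 1 / (2 * sqrt (1 - s)) * norm y"
   using s ab by simp
  also have "... <= K * norm z + K * norm y"
  proof (intro add_mono mult_right_mono)
   have "1 / (2 * sqrt s) <= 1 / (2 * sqrt a)" using s ab by (intro divide_left_mono) auto
   moreover have "1 / (2 * sqrt (1 - b)) >= 0" "1 / (2 * sqrt a) >= 0" using ab by auto
   moreover have "1 / (2 * sqrt (1 - s)) <= 1 / (2 * sqrt (1 - b))" using s ab by (intro divide_left_mono) auto
   ultimately show "1 / (2 * sqrt s) <= K" "1 / (2 * sqrt (1 - s)) <= K" unfolding K_def by linarith+
  qed auto
  finally have nw: "norm (w s y) <= K * (norm z + norm y)" by (simp add: distrib_left)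
  have "\<bar>SUM i:Basis. (w s y \<bullet> i) * pd i G (p s y)\<bar>
    <= (SUM i:(Basis::'a set). K * (norm z + norm y) * C')"
  proof (rule order_trans[OF sum_abs], rule sum_mono)
   fix i :: 'a assume i: "i : Basis"
   show "\<bar>(w s y \<bullet> i) * pd i G (p s y)\<bar> <= K * (norm z + norm y) * C'"
    unfolding abs_mult using Basis_le_norm[OF i, of "w s y"] nw C' i
    by (intro mult_mono) (auto intro: order_trans)
  qed
  then show ?thesis by (simp add: B_def)
 qed
 have Bi: "integrable gauss B"
 proof (rule gauss_integrable_linear_growth)
  show "B : borel_measurable borel" unfolding B_def by measurable
  show "\<bar>B y\<bar> <= real DIM('a) * (K * (norm z + 1) * C') + (real DIM('a) * (K * C')) * (norm y)^2" for y
  proof -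
   have "norm y <= 1 + (norm y)^2" by (rule le_one_plus_sq)
   then have "real DIM('a) * (K * (norm z + norm y) * C') <= real DIM('a) * (K * (norm z + (1 + (norm y)^2)) * C')"
    using K0 C' by (intro mult_left_mono mult_right_mono) auto
   then have "B y <= real DIM('a) * (K * (norm z + (1 + (norm y)^2)) * C')" by (simp add: B_def)
   moreover have "B y >= 0" using K0 C' by (simp add: B_def)
   ultimately show ?thesis by (simp add: algebra_simps)
  qed
 qed
 have D: "((%s. LINT y|gauss. G (p s y)) has_real_derivative
   (LINT y|gauss. (SUM i:Basis. (w \<rho> y \<bullet> i) * pd i G (p \<rho> y)))) (at \<rho>)"
  by (rule DERIV_integral_dominated(2)[where a=a and b=b and B=B, OF ab(2,3) i1 d bd Bi]) auto
 have st: "integrable gauss (%y. (y \<bullet> i) * pd i G (p \<rho> y))"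
   "(LINT y|gauss. (y \<bullet> i) * pd i G (p \<rho> y))
     = sqrt (1 - \<rho>) * oumean (pd i (pd i G)) \<rho> z" if i: "i : Basis" for i
 proof -
  obtain C'' where C'': "ALL x. \<bar>pd i (pd i G) x\<bar> <= C''"
   using nice_bounded[OF nice_partial[OF G1[OF i] i]] by blast
  have m1: "(%y. pd i G (p \<rho> y)) : borel_measurable borel"
   using dm[OF i] unfolding p_def by measurable
  have dd: "((%t. pd i G (p \<rho> (y + t *\<^sub>R i))) has_real_derivative
    sqrt (1 - \<rho>) * pd i (pd i G) (p \<rho> y)) (at 0)" for y
  proof -
   have e: "p \<rho> (y + t *\<^sub>R i) = p \<rho> y + t *\<^sub>R (sqrt (1 - \<rho>) *\<^sub>R i)" for t
    by (simp add: p_def algebra_simps)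
   show ?thesis unfolding e
    using has_real_derivative_axis[OF i nice_differentiable[OF G1[OF i]], of "p \<rho> y" "sqrt (1 - \<rho>)" 0] by simp
  qed
  have b1: "\<bar>pd i G (p \<rho> y)\<bar> <= C'" for y using C' i by blast
  have b2: "\<bar>sqrt (1 - \<rho>) * pd i (pd i G) (p \<rho> y)\<bar> <= \<bar>sqrt (1 - \<rho>)\<bar> * C''" for y
   unfolding abs_mult using C'' by (intro mult_left_mono) auto
  note S = gauss_stein[OF m1 i dd b1 b2]
  show "integrable gauss (%y. (y \<bullet> i) * pd i G (p \<rho> y))" by (rule S(1))
  show "(LINT y|gauss. (y \<bullet> i) * pd i G (p \<rho> y))
     = sqrt (1 - \<rho>) * oumean (pd i (pd i G)) \<rho> z"
   using S(3) by (simp add: oumean_def p_def)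
 qed
 have ig: "integrable gauss (%y. pd i G (p \<rho> y))" if i: "i : Basis" for i
  using oumean_integrable[OF dm[OF i], of C' \<rho> z] C' i by (simp add: p_def)
 have "(LINT y|gauss. (SUM i:Basis. (w \<rho> y \<bullet> i) * pd i G (p \<rho> y)))
   = (LINT y|gauss. (SUM i:Basis. (z \<bullet> i) / (2 * sqrt \<rho>) * pd i G (p \<rho> y)
     - 1 / (2 * sqrt (1 - \<rho>)) * ((y \<bullet> i) * pd i G (p \<rho> y))))"
  by (intro Lintegral_cong sum.cong refl) (simp add: w_def inner_diff_left left_diff_distrib)
 also have "... = (SUM i:Basis. (z \<bullet> i) / (2 * sqrt \<rho>) * oumean (pd i G) \<rho> z
     - 1 / (2 * sqrt (1 - \<rho>)) * (LINT y|gauss. (y \<bullet> i) * pd i G (p \<rho> y)))"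
 proof (subst Lintegral_sum)
  show "integrable gauss (%y. (z \<bullet> i) / (2 * sqrt \<rho>) * pd i G (p \<rho> y)
     - 1 / (2 * sqrt (1 - \<rho>)) * ((y \<bullet> i) * pd i G (p \<rho> y)))" if "i : Basis" for i
   by (intro Lintegrable_diff integrable_mult_right ig st that)
  show "(SUM i:Basis. (LINT y|gauss. (z \<bullet> i) / (2 * sqrt \<rho>) * pd i G (p \<rho> y)
     - 1 / (2 * sqrt (1 - \<rho>)) * ((y \<bullet> i) * pd i G (p \<rho> y))))
   = (SUM i:Basis. (z \<bullet> i) / (2 * sqrt \<rho>) * oumean (pd i G) \<rho> z
     - 1 / (2 * sqrt (1 - \<rho>)) * (LINT y|gauss. (y \<bullet> i) * pd i G (p \<rho> y)))"
   by (intro sum.cong refl, subst Lintegral_diff)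
     (auto intro!: integrable_mult_right ig st simp: oumean_def p_def[symmetric])
 qed
 also have "... = (SUM i:Basis. (z \<bullet> i) / (2 * sqrt \<rho>) * oumean (pd i G) \<rho> z
    - oumean (pd i (pd i G)) \<rho> z / 2)"
  using r by (intro sum.cong refl) (simp add: st(2))
 finally show ?thesis using D by (simp add: oumean_def[abs_def] p_def)
qed

text \<open>Each factor contributes one half. Stein's identity in z applied to the terms with z . i
  produces a second-order term that cancels the one from \<open>oumean_rho_deriv\<close>; only
  products of first derivatives survive.\<close>

lemma oucov_deriv:
 fixes G H :: "'a::euclidean_space => real"
 assumes G: "nice 2 G" and H: "nice 2 H" and r: "0 < \<rho>" "\<rho> < 1"
 shows "(oucov G H has_real_derivative (SUM i:Basis. oucov (pd i G) (pd i H) \<rho>)) (at \<rho>)"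
proof -
 have n1: "nice 1 F" "nice (Suc 1) F" if "nice 2 F" for F :: "'a => real"
  using that nice_le[OF that, of 1] by (simp_all add: numeral_2_eq_2)
 have np: "nice 1 (pd i F)" if "nice 2 F" "i : Basis" for F :: "'a => real" and i
  using nice_partial[OF n1(2)[OF that(1)] that(2)] .
 have npp: "nice 0 (pd i (pd i F))" if "nice 2 F" "i : Basis" for F :: "'a => real" and i
  using nice_partial[of 0, OF _ that(2)] np[OF that] by simp
 have ob: "EX C>=0. ALL s z. \<bar>oumean F s z\<bar> <= C" if F: "nice k F" for F :: "'a => real" and k
 proof -
  obtain C where C: "C >= 0" "ALL x. \<bar>F x\<bar> <= C" using nice_bounded[OF F] by blast
  then have "\<bar>oumean F s z\<bar> <= C" for s z by (intro oumean_bound[OF nice_measurable[OF F]]) auto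
  then show ?thesis using C(1) by blast
 qed
 have obB: "EX C>=0. ALL i:Basis. ALL s z. \<bar>oumean (pd i F) s z\<bar> <= C & \<bar>oumean (pd i (pd i F)) s z\<bar> <= C"
  if F: "nice 2 F" for F :: "'a => real"
 proof -
  have "ALL i:Basis. EX C>=0. ALL s z. \<bar>oumean (pd i F) s z\<bar> <= C & \<bar>oumean (pd i (pd i F)) s z\<bar> <= C"
  proof
   fix i :: 'a assume i: "i : Basis"
   obtain C where C: "C >= 0" "ALL s z. \<bar>oumean (pd i F) s z\<bar> <= C" using ob[OF np[OF F i]] by blast
   obtain D where D: "D >= 0" "ALL s z. \<bar>oumean (pd i (pd i F)) s z\<bar> <= D" using ob[OF npp[OF F i]] by blast
   show "EX C>=0. ALL s z. \<bar>oumean (pd i F) s z\<bar> <= C & \<bar>oumean (pd i (pd i F)) s z\<bar> <= C"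
    by (intro exI[of _ "max C D"]) (use C D in \<open>auto simp: le_max_iff_disj\<close>)
  qed
  then obtain C where C: "ALL i:Basis. C i >= 0 & (ALL s z. \<bar>oumean (pd i F) s z\<bar> <= C i & \<bar>oumean (pd i (pd i F)) s z\<bar> <= C i)"
   by metis
  have "C i <= (SUM i:Basis. C i)" if "i : Basis" for i
   by (rule member_le_sum) (use that C in auto)
  then have le: "\<bar>oumean (pd i F) s z\<bar> <= (SUM i:Basis. C i) & \<bar>oumean (pd i (pd i F)) s z\<bar> <= (SUM i:Basis. C i)"
   if "i : Basis" for i s z using C that by (meson order_trans)
  have "(SUM i:Basis. C i) >= 0" by (rule sum_nonneg) (use C in auto)
  with le show ?thesis by blast
 qed
 obtain CG where CG: "CG >= 0" "ALL s z. \<bar>oumean G s z\<bar> <= CG" using ob[OF G] by blast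
 obtain CH where CH: "CH >= 0" "ALL s z. \<bar>oumean H s z\<bar> <= CH" using ob[OF H] by blast
 obtain DG where DG: "DG >= 0" "ALL i:Basis. ALL s z. \<bar>oumean (pd i G) s z\<bar> <= DG & \<bar>oumean (pd i (pd i G)) s z\<bar> <= DG"
  using obB[OF G] by blast
 obtain DH where DH: "DH >= 0" "ALL i:Basis. ALL s z. \<bar>oumean (pd i H) s z\<bar> <= DH & \<bar>oumean (pd i (pd i H)) s z\<bar> <= DH"
  using obB[OF H] by blast
 define a where "a = \<rho> / 2"
 define b where "b = (1 + \<rho>) / 2"
 have ab: "0 < a" "a < \<rho>" "\<rho> < b" "b < 1" using r by (auto simp: a_def b_def)
 define dm where "dm F s z = (SUM i:Basis. (z \<bullet> i) / (2 * sqrt s) * oumean (pd i F) s z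
    - oumean (pd i (pd i F)) s z / 2)" for F :: "'a => real" and s z
 define K where "K = 1 / (2 * sqrt a)"
 have K0: "K >= 0" using ab by (simp add: K_def)
 have dmb: "\<bar>dm F s z\<bar> <= real DIM('a) * ((K * norm z + 1) * D)"
  if D: "D >= 0" "ALL i:Basis. ALL s z. \<bar>oumean (pd i F) s z\<bar> <= D & \<bar>oumean (pd i (pd i F)) s z\<bar> <= D"
   and s: "a < s" for F s z D
 proof -
  have "\<bar>dm F s z\<bar> <= (SUM i:(Basis::'a set). (K * norm z + 1) * D)"
   unfolding dm_def
  proof (rule order_trans[OF sum_abs], rule sum_mono)
   fix i :: 'a assume i: "i : Basis"
   have k: "1 / (2 * sqrt s) <= K" unfolding K_def using s ab by (intro divide_left_mono) auto
   have "\<bar>(z \<bullet> i) / (2 * sqrt s)\<bar> = 1 / (2 * sqrt s) * \<bar>z \<bullet> i\<bar>" using s ab by (simp add: abs_mult)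
   also have "... <= K * norm z" using k K0 Basis_le_norm[OF i, of z] by (intro mult_mono) auto
   finally have "\<bar>(z \<bullet> i) / (2 * sqrt s) * oumean (pd i F) s z\<bar> <= (K * norm z) * D"
    unfolding abs_mult using D i K0 by (intro mult_mono) auto
   moreover have "\<bar>oumean (pd i (pd i F)) s z\<bar> <= D" using D(2) i by blast
   then have "\<bar>oumean (pd i (pd i F)) s z / 2\<bar> <= D" by simp
   ultimately show "\<bar>(z \<bullet> i) / (2 * sqrt s) * oumean (pd i F) s z
    - oumean (pd i (pd i F)) s z / 2\<bar> <= (K * norm z + 1) * D"
    unfolding distrib_right mult_1_left by linarith
  qed
  then show ?thesis by simp
 qed
 define B where "B z = real DIM('a) * ((K * norm z + 1) * DG) * CH + CG * (real DIM('a) * ((K * norm z + 1) * DH))" for z :: 'a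
 have Bi: "integrable gauss B"
 proof -
  have "integrable gauss (%z::'a. norm z)"
  proof (rule gauss_integrable_linear_growth[where A=1 and B=1])
   show "\<bar>norm x\<bar> <= 1 + 1 * (norm x)^2" for x :: 'a
    using le_one_plus_sq[of "norm x"] by simp
  qed auto
  then show ?thesis unfolding B_def
   by (intro Lintegrable_add integrable_mult_left integrable_mult_right) auto
 qed
 have mm[measurable]: "oumean F s : borel_measurable borel" if "nice k F" for F :: "'a => real" and k s
  using oumean_measurable[OF nice_measurable[OF that]] .
 have i0: "integrable gauss (%z. oumean F s z * oumean F' s z)" if F: "nice k F" "nice j F'" for F F' :: "'a => real" and s k j
 proof -
  obtain C where C: "C >= 0" "ALL s z. \<bar>oumean F s z\<bar> <= C" using ob[OF F(1)] by blast
  obtain C' where C': "C' >= 0" "ALL s z. \<bar>oumean F' s z\<bar> <= C'" using ob[OF F(2)] by blast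
  show ?thesis
  proof (rule gauss_integrable_bounded)
   show "(%z. oumean F s z * oumean F' s z) : borel_measurable borel" using mm[OF F(1)] mm[OF F(2)] by measurable
   show "\<bar>oumean F s z * oumean F' s z\<bar> <= C * C'" for z
    unfolding abs_mult using C C' by (intro mult_mono) auto
  qed
 qed
 have D: "(oucov G H has_real_derivative (LINT z|gauss. dm G \<rho> z * oumean H \<rho> z + oumean G \<rho> z * dm H \<rho> z)) (at \<rho>)"
  unfolding oucov_def[abs_def]
 proof (rule DERIV_integral_dominated(2)[where a=a and b=b and B=B, OF ab(2,3) _ _ _ Bi])
  show "integrable gauss (%z. oumean G s z * oumean H s z)" for s by (rule i0[OF G H])
  show "((%s. oumean G s z * oumean H s z) has_real_derivative dm G s z * oumean H s z + oumean G s z * dm H s z) (at s)"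
   if "a < s" "s < b" for s z
  proof -
   have s: "0 < s" "s < 1" using that ab by auto
   show ?thesis
    using DERIV_mult'[OF oumean_rho_deriv[OF G s, of z] oumean_rho_deriv[OF H s, of z]]
    by (simp only: dm_def add.commute)
  qed
  show "\<bar>dm G s z * oumean H s z + oumean G s z * dm H s z\<bar> <= B z" if "a < s" "s < b" for s z
  proof -
   have "\<bar>dm G s z * oumean H s z\<bar> <= real DIM('a) * ((K * norm z + 1) * DG) * CH"
    unfolding abs_mult using dmb[OF DG that(1)] CH DG K0 by (intro mult_mono) auto
   moreover have "\<bar>oumean G s z * dm H s z\<bar> <= CG * (real DIM('a) * ((K * norm z + 1) * DH))"
    unfolding abs_mult using dmb[OF DH that(1)] CG DH K0 by (intro mult_mono) auto
   ultimately show ?thesis by (simp add: B_def)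
  qed
 qed
 have st: "integrable gauss (%z. (z \<bullet> i) * (oumean (pd i F) \<rho> z * oumean F' \<rho> z))"
  "(LINT z|gauss. (z \<bullet> i) * (oumean (pd i F) \<rho> z * oumean F' \<rho> z))
   = sqrt \<rho> * (LINT z|gauss. oumean (pd i (pd i F)) \<rho> z * oumean F' \<rho> z
     + oumean (pd i F) \<rho> z * oumean (pd i F') \<rho> z)"
  if F: "nice 2 F" "nice 2 F'" and i: "i : Basis" for F F' :: "'a => real" and i
 proof -
  let ?g = "%z. oumean (pd i F) \<rho> z * oumean F' \<rho> z"
  let ?g' = "%z. sqrt \<rho> * (oumean (pd i (pd i F)) \<rho> z * oumean F' \<rho> z
     + oumean (pd i F) \<rho> z * oumean (pd i F') \<rho> z)"
  obtain C1 where C1: "C1 >= 0" "ALL i:Basis. ALL s z. \<bar>oumean (pd i F) s z\<bar> <= C1 & \<bar>oumean (pd i (pd i F)) s z\<bar> <= C1"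
   using obB[OF F(1)] by blast
  obtain C2 where C2: "C2 >= 0" "ALL i:Basis. ALL s z. \<bar>oumean (pd i F') s z\<bar> <= C2 & \<bar>oumean (pd i (pd i F')) s z\<bar> <= C2"
   using obB[OF F(2)] by blast
  obtain C3 where C3: "C3 >= 0" "ALL s z. \<bar>oumean F' s z\<bar> <= C3" using ob[OF F(2)] by blast
  have gm: "?g : borel_measurable borel"
   using mm[OF np[OF F(1) i]] mm[OF F(2)] by measurable
  have dd: "((%t. ?g (z + t *\<^sub>R i)) has_real_derivative ?g' z) (at 0)" for z
   using DERIV_mult'[OF oumean_z_deriv[OF np[OF F(1) i] i, of \<rho> z] oumean_z_deriv[OF n1(1)[OF F(2)] i, of \<rho> z]]
   by (simp add: algebra_simps)
  have b1: "\<bar>?g z\<bar> <= C1 * C3" for z unfolding abs_mult using C1 C3 i by (intro mult_mono) auto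
  have b2: "\<bar>?g' z\<bar> <= \<bar>sqrt \<rho>\<bar> * (C1 * C3 + C1 * C2)" for z
  proof -
   have "\<bar>oumean (pd i (pd i F)) \<rho> z * oumean F' \<rho> z\<bar> <= C1 * C3"
    unfolding abs_mult using C1 C3 i by (intro mult_mono) auto
   moreover have "\<bar>oumean (pd i F) \<rho> z * oumean (pd i F') \<rho> z\<bar> <= C1 * C2"
    unfolding abs_mult using C1 C2 i by (intro mult_mono) auto
   ultimately show ?thesis unfolding abs_mult[of "sqrt \<rho>"] by (intro mult_left_mono) auto
  qed
  note S = gauss_stein[OF gm i dd b1 b2]
  show "integrable gauss (%z. (z \<bullet> i) * ?g z)" by (rule S(1))
  show "(LINT z|gauss. (z \<bullet> i) * ?g z) = sqrt \<rho> * (LINT z|gauss. oumean (pd i (pd i F)) \<rho> z * oumean F' \<rho> z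
     + oumean (pd i F) \<rho> z * oumean (pd i F') \<rho> z)"
   unfolding S(3) by simp
 qed
 have half: "integrable gauss (%z. dm F \<rho> z * oumean F' \<rho> z)"
  "(LINT z|gauss. dm F \<rho> z * oumean F' \<rho> z) = (SUM i:Basis. oucov (pd i F) (pd i F') \<rho>) / 2"
  if F: "nice 2 F" "nice 2 F'" for F F' :: "'a => real"
 proof -
  define h where "h i z = 1 / (2 * sqrt \<rho>) * ((z \<bullet> i) * (oumean (pd i F) \<rho> z * oumean F' \<rho> z))
    - 1/2 * (oumean (pd i (pd i F)) \<rho> z * oumean F' \<rho> z)" for i z
  have e: "dm F \<rho> z * oumean F' \<rho> z = (SUM i:Basis. h i z)" for z
   unfolding dm_def h_def sum_distrib_right by (intro sum.cong refl) (simp add: left_diff_distrib)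
  have hi: "integrable gauss (h i)" if i: "i : Basis" for i
   unfolding h_def
   by (intro Lintegrable_diff integrable_mult_right st(1)[OF F i] i0[OF npp[OF F(1) i] F(2)])
  show "integrable gauss (%z. dm F \<rho> z * oumean F' \<rho> z)" unfolding e
   by (intro Lintegrable_sum hi)
  have "(LINT z|gauss. h i z) = oucov (pd i F) (pd i F') \<rho> / 2" if i: "i : Basis" for i
  proof -
   have "(LINT z|gauss. h i z) = 1 / (2 * sqrt \<rho>) * (LINT z|gauss. (z \<bullet> i) * (oumean (pd i F) \<rho> z * oumean F' \<rho> z))
    - 1/2 * (LINT z|gauss. oumean (pd i (pd i F)) \<rho> z * oumean F' \<rho> z)"
    unfolding h_def
    by (subst Lintegral_diff)
      (intro integrable_mult_right st(1)[OF F i] i0[OF npp[OF F(1) i] F(2)] | simp)+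
   also have "... = 1/2 * (LINT z|gauss. oumean (pd i F) \<rho> z * oumean (pd i F') \<rho> z)"
    unfolding st(2)[OF F i]
     Lintegral_add[OF i0[OF npp[OF F(1) i] F(2)] i0[OF np[OF F(1) i] np[OF F(2) i]]]
    using r by (simp add: field_simps)
   finally show ?thesis by (simp add: oucov_def)
  qed
  then have "(SUM i:Basis. LINT z|gauss. h i z) = (SUM i:Basis. oucov (pd i F) (pd i F') \<rho>) / 2"
   unfolding sum_divide_distrib by (intro sum.cong refl)
  then show "(LINT z|gauss. dm F \<rho> z * oumean F' \<rho> z) = (SUM i:Basis. oucov (pd i F) (pd i F') \<rho>) / 2"
   unfolding e by (subst Lintegral_sum) (use hi in auto)
 qed
 have sy: "oucov F F' \<rho> = oucov F' F \<rho>" for F F' :: "'a => real" by (simp add: oucov_def mult.commute)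
 have "(LINT z|gauss. dm G \<rho> z * oumean H \<rho> z + oumean G \<rho> z * dm H \<rho> z)
   = (LINT z|gauss. dm G \<rho> z * oumean H \<rho> z) + (LINT z|gauss. dm H \<rho> z * oumean G \<rho> z)"
  using half(1)[OF G H] half(1)[OF H G] by (subst Lintegral_add[symmetric]) (auto simp: mult.commute)
 also have "... = (SUM i:Basis. oucov (pd i G) (pd i H) \<rho>)"
  unfolding half(2)[OF G H] half(2)[OF H G] by (simp add: sy[of "pd _ H"])
 finally show ?thesis using D by simp
qed

lemma oumean_tendsto:
 fixes G :: "'a::euclidean_space => real"
 assumes G: "nice k G" and X: "X \<longlonglongrightarrow> a"
 shows "(%n. oumean G (X n) z) \<longlonglongrightarrow> oumean G a z"
 unfolding oumean_def
proof -
 obtain C where C: "ALL x. \<bar>G x\<bar> <= C" using nice_bounded[OF G] by blast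
 note [measurable] = nice_measurable[OF G]
 show "(%n. LINT y|gauss. G (sqrt (X n) *\<^sub>R z + sqrt (1 - X n) *\<^sub>R y))
   \<longlonglongrightarrow> (LINT y|gauss. G (sqrt a *\<^sub>R z + sqrt (1 - a) *\<^sub>R y))"
 proof (rule integral_dominated_convergence[where w="%_. C"])
  show "AE y in gauss. (%n. G (sqrt (X n) *\<^sub>R z + sqrt (1 - X n) *\<^sub>R y))
    \<longlonglongrightarrow> G (sqrt a *\<^sub>R z + sqrt (1 - a) *\<^sub>R y)"
  proof (rule AE_I2)
   fix y :: 'a
   have "isCont G p" for p
    using nice_continuous[OF G] by (simp add: continuous_on_eq_continuous_at)
   then show "(%n. G (sqrt (X n) *\<^sub>R z + sqrt (1 - X n) *\<^sub>R y))
    \<longlonglongrightarrow> G (sqrt a *\<^sub>R z + sqrt (1 - a) *\<^sub>R y)"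
    by (rule isCont_tendsto_compose) (intro tendsto_intros X)
  qed
  show "AE y in gauss. norm (G (sqrt (X n) *\<^sub>R z + sqrt (1 - X n) *\<^sub>R y)) <= C" for n
   using C by (intro AE_I2) simp
 qed (auto intro: gauss_integrable_const)
qed

text \<open>The derivative formula holds inside (0, 1) only, while the covariance is explicit at the
  end points; continuity connects the two.\<close>

lemma oucov_continuous:
 fixes G :: "'a::euclidean_space => real"
 assumes G: "nice k G"
 shows "continuous_on {0..1} (oucov G G)"
 unfolding continuous_on_sequentially
proof (intro allI impI ballI)
 fix X :: "nat => real" and a assume X: "(ALL n. X n : {0..1}) & X \<longlonglongrightarrow> a"
 obtain C where C: "C >= 0" "ALL x. \<bar>G x\<bar> <= C" using nice_bounded[OF G] by blast
 note Gm = nice_measurable[OF G]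
 note [measurable] = oumean_measurable[OF Gm]
 have ob: "\<bar>oumean G s z\<bar> <= C" for s z using oumean_bound[OF Gm] C by blast
 show "((oucov G G) \<circ> X) \<longlonglongrightarrow> oucov G G a"
  unfolding o_def oucov_def
 proof (rule integral_dominated_convergence[where w="%_. C * C"])
  show "AE z in gauss. (%n. oumean G (X n) z * oumean G (X n) z) \<longlonglongrightarrow> oumean G a z * oumean G a z"
   using X by (intro AE_I2 tendsto_mult oumean_tendsto[OF G]) auto
  show "AE z in gauss. norm (oumean G (X n) z * oumean G (X n) z) <= C * C" for n
   unfolding real_norm_def abs_mult using ob C(1) by (intro AE_I2 mult_mono) auto
 qed (auto intro: gauss_integrable_const)
qed

lemma oucov_0: "oucov G G 0 = (LINT x|(gauss::'a::euclidean_space measure). G x)^2"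
 by (simp add: oucov_def oumean_def power2_eq_square)

lemma oucov_1: "oucov G G 1 = (LINT x|(gauss::'a::euclidean_space measure). (G x)^2)"
 by (simp add: oucov_def oumean_def power2_eq_square)

lemma oucov_nonneg: "oucov G G \<rho> >= 0"
 unfolding oucov_def by (rule integral_nonneg_AE) auto

text \<open>The trapezoidal rule overestimates the integral of a convex function; here c' = c1 is
  convex because its second derivative c3 is nonnegative.\<close>

lemma trapezoid_bound:
 fixes c c1 c2 c3 :: "real => real"
 assumes c: "continuous_on {0..1} c" and c1: "continuous_on {0..1} c1"
  and d: "!!x. 0 < x ==> x < 1 ==> (c has_real_derivative c1 x) (at x)"
  and d1: "!!x. 0 < x ==> x < 1 ==> (c1 has_real_derivative c2 x) (at x)"
  and d2: "!!x. 0 < x ==> x < 1 ==> (c2 has_real_derivative c3 x) (at x)"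
  and pos: "!!x. c3 x >= 0"
 shows "c 1 - c 0 <= (c1 0 + c1 1) / 2"
proof -
 have mono: "c2 x <= c2 y" if "0 < x" "x <= y" "y < 1" for x y
 proof (rule DERIV_nonneg_imp_nondecreasing[OF that(2), of c2])
  fix t assume "x <= t" "t <= y"
  then show "EX z. (c2 has_real_derivative z) (at t) & 0 <= z"
   using d2[of t] pos[of t] that by auto
 qed
 have conv: "c1 x - c1 0 <= x * c2 x" if x: "0 < x" "x < 1" for x
 proof -
  have "continuous_on {0..x} c1" by (rule continuous_on_subset[OF c1]) (use x in auto)
  moreover have "c1 differentiable (at t)" if "0 < t" "t < x" for t
   using d1[of t] that x real_differentiable_def by auto
  ultimately obtain l z where z: "0 < z" "z < x" "(c1 has_real_derivative l) (at z)" "c1 x - c1 0 = (x - 0) * l"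
   using MVT[OF x(1)] by blast
  have "l = c2 z" using DERIV_unique[OF z(3) d1] z x by auto
  also have "... <= c2 x" using mono z x by auto
  finally show ?thesis using z(4) x by (simp add: mult_left_mono)
 qed
 \<comment> \<open>The error of the rule on [0, x], up to the constant c 0. Its derivative is half
   of c1 x - c1 0 - x c2 x, which \<open>conv\<close> shows to be nonpositive.\<close>
 define K where "K x = c x - x * (c1 0 + c1 x) / 2" for x
 define K' where "K' x = c1 x - ((c1 0 + c1 x) + x * c2 x) / 2" for x
 have dK: "(K has_real_derivative K' x) (at x)" if x: "0 < x" "x < 1" for x
  unfolding K_def[abs_def] K'_def
  by (rule derivative_eq_intros d[OF x] d1[OF x] refl | simp add: field_simps)+
 have "continuous_on {0..1} K" unfolding K_def[abs_def] by (intro continuous_intros c c1) auto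
 moreover have "K differentiable (at t)" if "0 < t" "t < 1" for t
  using dK[OF that] real_differentiable_def by auto
 ultimately obtain l z where z: "0 < z" "z < 1" "(K has_real_derivative l) (at z)" "K 1 - K 0 = (1 - 0) * l"
  using MVT[of 0 1 K] by auto
 have "l = K' z" using DERIV_unique[OF z(3) dK] z by auto
 also have "... <= 0" using conv[OF z(1,2)] by (simp add: K'_def field_simps)
 finally show ?thesis using z(4) by (simp add: K_def field_simps)
qed

text \<open>In terms of Hermite expansions this is \<open>k \<ge> 2\<close> for the chaoses of order \<open>k \<ge> 2\<close>.\<close>

lemma gauss_second_poincare:
 fixes F :: "'a::euclidean_space => real"
 assumes F: "nice 4 F"
 shows "2 * ((LINT x|gauss. (F x)^2) - (LINT x|gauss. F x)\<^sup>2)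
   <= (SUM i:Basis. (LINT x|gauss. pd i F x)^2) + (SUM i:Basis. LINT x|gauss. (pd i F x)^2)"
proof -
 have n3: "nice 3 (pd i F)" if "i : Basis" for i
  using nice_partial[of 3 F i] F that by simp
 have n2: "nice 2 (pd j (pd i F))" if "i : Basis" "j : Basis" for i j
  using nice_partial[of 2 "pd i F" j] n3[OF that(1)] that by simp
 define c1 where "c1 x = (SUM i:Basis. oucov (pd i F) (pd i F) x)" for x
 define c2 where "c2 x = (SUM i:Basis. SUM j:Basis. oucov (pd j (pd i F)) (pd j (pd i F)) x)" for x
 define c3 where "c3 x = (SUM i:Basis. SUM j:Basis. SUM k:Basis. oucov (pd k (pd j (pd i F)))
   (pd k (pd j (pd i F))) x)" for x
 \<comment> \<open>c1, c2, c3 are successive derivatives of the covariance. Its values at 1 and 0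
   differ by the variance of F, and c1 0, c1 1 are the two sums of the claim. The third derivative
   involves third partial derivatives, which is why F is taken to be C^4.\<close>
 have "oucov F F 1 - oucov F F 0 <= (c1 0 + c1 1) / 2"
 proof (rule trapezoid_bound)
  show "continuous_on {0..1} (oucov F F)" by (rule oucov_continuous[OF F])
  show "continuous_on {0..1} c1" unfolding c1_def[abs_def]
   by (intro continuous_on_sum oucov_continuous[OF n3])
  show "(oucov F F has_real_derivative c1 x) (at x)" if "0 < x" "x < 1" for x
   unfolding c1_def using nice_le[OF F, of 2] by (intro oucov_deriv that) auto
  show "(c1 has_real_derivative c2 x) (at x)" if "0 < x" "x < 1" for x
   unfolding c1_def[abs_def] c2_def using nice_le[OF n3, of _ 2]
   by (intro DERIV_sum oucov_deriv that) auto
  show "(c2 has_real_derivative c3 x) (at x)" if "0 < x" "x < 1" for x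
   unfolding c2_def[abs_def] c3_def by (intro DERIV_sum oucov_deriv that n2)
  show "c3 x >= 0" for x unfolding c3_def by (intro sum_nonneg oucov_nonneg)
 qed
 then show ?thesis by (simp add: oucov_0 oucov_1 c1_def)
qed

section \<open>One-dimensional normal distribution\<close>

text \<open>For \<open>u \<ge> 0\<close>, \<open>ncdf u\<close> is the probability of \<open>\<bar>X\<bar> < u\<close> and \<open>nabs u\<close> the mean of \<open>\<bar>X + u\<bar>\<close>;
 the lower limit \<open>-1\<close> makes \<open>ncdf\<close> differentiable at \<open>0\<close>.\<close>

definition ncdf :: "real => real" where
 "ncdf u = 2 * (integral {-1..u} nd - integral {-1..0} nd)"

definition nabs :: "real => real" where
 "nabs u = u * ncdf u + 2 * nd u"

lemma std_normal_deriv: "(nd has_real_derivative - s * nd s) (at s)"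
 unfolding std_normal_density_def[abs_def]
 by (auto intro!: derivative_eq_intros simp: field_simps)

lemma std_normal_continuous: "continuous_on S nd"
 by (rule DERIV_continuous_on) (use std_normal_deriv in \<open>auto intro: has_field_derivative_at_within\<close>)

lemma ncdf_deriv:
 assumes "u >= 0" shows "(ncdf has_real_derivative 2 * nd u) (at u)"
proof -
 have u: "u : interior {-1..u+1}" using assms by simp
 have "((%u. integral {-1..u} nd) has_real_derivative nd u) (at u within {-1..u+1})"
  by (rule integral_has_real_derivative[OF std_normal_continuous]) (use assms in auto)
 then have "((%u. integral {-1..u} nd) has_real_derivative nd u) (at u)"
  using at_within_interior[OF u] by simp
 then have "((%u. 2 * (integral {-1..u} nd - integral {-1..0} nd))
   has_real_derivative 2 * (nd u - 0)) (at u)"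
  by (intro DERIV_cmult DERIV_diff DERIV_const)
 then show ?thesis by (simp add: ncdf_def[abs_def])
qed

lemma nabs_deriv:
 assumes "u >= 0" shows "(nabs has_real_derivative ncdf u) (at u)"
proof -
 have "((%u. u * ncdf u + 2 * nd u) has_real_derivative
   (u * (2 * nd u) + 1 * ncdf u) + 2 * (- u * nd u)) (at u)"
  by (intro DERIV_add DERIV_mult' DERIV_cmult ncdf_deriv[OF assms] std_normal_deriv DERIV_ident)
 then show ?thesis by (simp add: nabs_def[abs_def])
qed

lemma ncdf_0: "ncdf 0 = 0" by (simp add: ncdf_def)

lemma Normal_integral: "(LINT s|Normal. g s) = (LINT s|lborel. nd s * g s)"
 if "g : borel_measurable borel" for g :: "real => real"
 using that by (subst integral_density) (auto intro!: AE_I2)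

lemma Normal_integrable: "integrable Normal g \<longleftrightarrow> integrable lborel (%s. nd s * g s)"
 if "g : borel_measurable borel" for g :: "real => real"
 using that by (subst integrable_density) (auto intro!: AE_I2)

lemma std_normal_tendsto_0: "(nd \<longlongrightarrow> 0) at_top"
proof -
 have "((%s::real. (1 / sqrt (2 * pi)) * exp (- (s^2 / 2))) \<longlongrightarrow> (1 / sqrt (2 * pi)) * 0) at_top"
 proof (intro tendsto_mult tendsto_const)
  have "filterlim (%s::real. s^2 * (1/2)) at_top at_top"
   by (rule filterlim_at_top_mult_tendsto_pos[OF tendsto_const])
     (auto intro!: filterlim_pow_at_top filterlim_ident)
  then have "filterlim (%s::real. - (s^2 / 2)) at_bot at_top"
   by (simp add: filterlim_uminus_at_bot)
  then show "((%s::real. exp (- (s^2 / 2))) \<longlongrightarrow> 0) at_top"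
   by (rule filterlim_compose[OF exp_at_bot])
 qed
 then show ?thesis by (simp add: std_normal_density_def[abs_def])
qed

lemma std_normal_first_moment_tail:
 assumes "u >= 0"
 shows "has_bochner_integral lborel (%s. indicator {u..} s * (s * nd s)) (nd u)"
proof (rule has_bochner_integral_nn_integral)
 have "(\<integral>\<^sup>+s. ennreal (s * nd s) * indicator {u..} s \<partial>lborel) = ennreal (0 - (- nd u))"
 proof (rule nn_integral_FTC_atLeast)
  show "((%s. - nd s) has_real_derivative s * nd s) (at s)" for s
   using DERIV_minus[OF std_normal_deriv[of s]] by simp
  show "((%s. - nd s) \<longlongrightarrow> 0) at_top"
   using tendsto_minus[OF std_normal_tendsto_0] by simp
  show "0 <= s * nd s" if "u <= s" for s using that assms by simp
 qed measurable
 moreover have "(\<integral>\<^sup>+s. ennreal (indicator {u..} s * (s * nd s)) \<partial>lborel)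
   = (\<integral>\<^sup>+s. ennreal (s * nd s) * indicator {u..} s \<partial>lborel)"
  by (intro nn_integral_cong) (auto simp: indicator_def)
 ultimately show "(\<integral>\<^sup>+s. ennreal (indicator {u..} s * (s * nd s)) \<partial>lborel) = ennreal (nd u)"
  by simp
 show "AE s in lborel. 0 <= indicator {u..} s * (s * nd s)"
  using assms by (auto intro!: AE_I2 simp: indicator_def)
qed (use assms in auto)

lemma Normal_even:
 fixes g :: "real => real"
 assumes g: "has_bochner_integral lborel (%s. indicator {0..} s *\<^sub>R (nd s * g s)) I"
  and even: "!!s. g (- s) = g s" and [measurable]: "g : borel_measurable borel"
 shows "integrable Normal g" "(LINT s|Normal. g s) = 2 * I"
proof -
 have "has_bochner_integral lborel (%s. nd s * g s) (2 *\<^sub>R I)"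
  by (rule has_bochner_integral_even_function[OF g]) (simp add: even std_normal_density_def)
 then show "integrable Normal g" "(LINT s|Normal. g s) = 2 * I"
  by (simp_all add: Normal_integral Normal_integrable has_bochner_integral_iff)
qed

lemma Normal_flip:
 fixes g :: "real => real"
 assumes [measurable]: "g : borel_measurable borel"
 shows "(LINT s|Normal. g (- s)) = (LINT s|Normal. g s)" "integrable Normal (%s. g (- s)) \<longleftrightarrow> integrable Normal g"
proof -
 have "(LINT s|lborel. nd s * g s) = (LINT s|lborel. nd s * g (- s))"
  by (subst lborel_integral_real_affine[where c="-1" and t=0]) (auto simp: std_normal_density_def)
 then show "(LINT s|Normal. g (- s)) = (LINT s|Normal. g s)" by (simp add: Normal_integral)
 have "integrable lborel (%s. nd (0 + -1 * s) * g (0 + -1 * s)) \<longleftrightarrow> integrable lborel (%s. nd s * g s)"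
  by (subst lborel_integrable_real_affine_iff) auto
 then show "integrable Normal (%s. g (- s)) \<longleftrightarrow> integrable Normal g"
  by (simp add: Normal_integrable) (simp add: std_normal_density_def)
qed

lemma Normal_symm:
 fixes g :: "real => real"
 assumes [measurable]: "g : borel_measurable borel" and "integrable Normal g"
 shows "(LINT s|Normal. g s) = (LINT s|Normal. (g s + g (- s)) / 2)"
 using Normal_flip[of g] assms by simp

lemma Normal_integrable_sq_growth:
 fixes g :: "real => real"
 assumes "g : borel_measurable borel" "!!s. \<bar>g s\<bar> <= A + B * s^2"
 shows "integrable Normal g"
proof (rule Lintegrable_bound)
 have "integrable Normal (%s. s ^ 0)" by (rule integrable_Normal_power)
 then have "integrable Normal (%s. A * 1)" by (intro integrable_mult_right) simp
 then show "integrable Normal (%s. A + B * s^2)"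
  by (intro Lintegrable_add integrable_mult_right integrable_Normal_power) simp
 show "AE s in Normal. norm (g s) <= norm (A + B * s^2)"
  using assms(2) by (auto intro!: AE_I2 order_trans[OF _ abs_ge_self])
qed (use assms in simp)

lemma std_normal_ncdf_Icc:
 assumes "u >= 0"
 shows "has_bochner_integral lborel (%s. nd s * indicator {0..u} s) (ncdf u / 2)"
proof -
 have "has_bochner_integral lborel (%s. nd s * indicator {0..u} s) (ncdf u / 2 - ncdf 0 / 2)"
 proof (rule has_bochner_integral_FTC_Icc_real[OF assms])
  show "((%u. ncdf u / 2) has_real_derivative nd s) (at s)" if "0 <= s" for s
   using DERIV_cdivide[OF ncdf_deriv[OF that], of 2] by simp
  show "isCont nd s" for s using std_normal_deriv DERIV_isCont by blast
 qed
 then show ?thesis by (simp add: ncdf_0)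
qed

text \<open>Averaging over s and -s replaces |u + s| by max u |s|, which splits into two elementary
  integrals at |s| = u.\<close>

lemma Normal_abs_shift:
 assumes "u >= 0" shows "(LINT s|Normal. \<bar>u + s\<bar>) = nabs u"
proof -
 have i: "integrable Normal (%s. \<bar>u + s\<bar>)"
 proof (rule Normal_integrable_sq_growth[where A="\<bar>u\<bar> + 1" and B=1])
  show "\<bar>\<bar>u + s\<bar>\<bar> <= \<bar>u\<bar> + 1 + 1 * s^2" for s
   using le_one_plus_sq[of "\<bar>s\<bar>"] by simp
 qed measurable
 have "(LINT s|Normal. \<bar>u + s\<bar>) = (LINT s|Normal. (\<bar>u + s\<bar> + \<bar>u + - s\<bar>) / 2)"
  by (rule Normal_symm[OF _ i]) measurable
 also have "... = (LINT s|Normal. max u \<bar>s\<bar>)"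
  by (intro Lintegral_cong refl) (use assms in \<open>auto simp: max_def\<close>)
 also have "... = 2 * (ncdf u / 2 * u + nd u)"
 proof (rule Normal_even)
  have 1: "has_bochner_integral lborel (%s. nd s * indicator {0..u} s * u
    + indicator {u..} s * (s * nd s)) (ncdf u / 2 * u + nd u)"
   by (intro has_bochner_integral_add has_bochner_integral_mult_left std_normal_ncdf_Icc[OF assms]
     std_normal_first_moment_tail[OF assms])
  show "has_bochner_integral lborel (%s. indicator {0..} s *\<^sub>R (nd s * max u \<bar>s\<bar>))
    (ncdf u / 2 * u + nd u)"
  proof (subst has_bochner_integral_cong_AE[OF _ _ _])
   show "AE s in lborel. indicator {0..} s *\<^sub>R (nd s * max u \<bar>s\<bar>)
     = nd s * indicator {0..u} s * u + indicator {u..} s * (s * nd s)"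
    using AE_lborel_singleton[of u] by eventually_elim (use assms in \<open>auto simp: indicator_def max_def\<close>)
  qed (use 1 in auto)
 qed auto
 finally show ?thesis by (simp add: nabs_def field_simps)
qed

text \<open>Formally this is Stein's identity, E sgn (u + X) being the probability of |X| < u. Since
  the modulus is not smooth it is computed directly: symmetrization gives min (s^2) (u |s|).\<close>

lemma Normal_id_abs_shift:
 assumes "u >= 0" shows "(LINT s|Normal. s * \<bar>u + s\<bar>) = ncdf u"
proof -
 have i: "integrable Normal (%s. s * \<bar>u + s\<bar>)"
 proof (rule Normal_integrable_sq_growth[where A="u" and B="u + 1"])
  show "\<bar>s * \<bar>u + s\<bar>\<bar> <= u + (u + 1) * s^2" for s
  proof -
   have "\<bar>s * \<bar>u + s\<bar>\<bar> <= \<bar>s\<bar> * (u + \<bar>s\<bar>)" unfolding abs_mult using assms by (intro mult_left_mono) auto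
   also have "... = u * \<bar>s\<bar> + s^2" by (simp add: algebra_simps power2_eq_square abs_mult_self_eq)
   also have "... <= u * (1 + \<bar>s\<bar>^2) + s^2" using le_one_plus_sq[of "\<bar>s\<bar>"] assms by (intro add_mono mult_left_mono) auto
   finally show ?thesis by (simp add: algebra_simps)
  qed
 qed measurable
 have "(LINT s|Normal. s * \<bar>u + s\<bar>) = (LINT s|Normal. (s * \<bar>u + s\<bar> + (- s) * \<bar>u + - s\<bar>) / 2)"
  by (rule Normal_symm[OF _ i]) measurable
 also have "... = (LINT s|Normal. min (s^2) (u * \<bar>s\<bar>))"
 proof (intro Lintegral_cong refl)
  fix s :: real
  have m: "\<bar>s\<bar> * min \<bar>s\<bar> u = min (s^2) (u * \<bar>s\<bar>)"
  proof (cases "\<bar>s\<bar> <= u")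
   case True
   then have "\<bar>s\<bar> * \<bar>s\<bar> <= u * \<bar>s\<bar>" by (rule mult_right_mono) simp
   then show ?thesis using True by (simp add: power2_eq_square)
  next
   case False
   then have "u * \<bar>s\<bar> <= \<bar>s\<bar> * \<bar>s\<bar>" by (intro mult_right_mono) auto
   then show ?thesis using False by (simp add: power2_eq_square mult.commute)
  qed
  have "(s * \<bar>u + s\<bar> + (- s) * \<bar>u + - s\<bar>) / 2 = \<bar>s\<bar> * min \<bar>s\<bar> u"
  proof -
   have "\<bar>u + s\<bar> - \<bar>u + - s\<bar> = 2 * (sgn s * min \<bar>s\<bar> u)"
    using assms by (cases "s = 0"; cases "s > 0") (auto simp: min_def)
   moreover have "s * (sgn s * k) = \<bar>s\<bar> * k" for k by (simp add: abs_sgn mult.assoc[symmetric])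
   moreover have "(s * \<bar>u + s\<bar> + (- s) * \<bar>u + - s\<bar>) / 2 = s * (\<bar>u + s\<bar> - \<bar>u + - s\<bar>) / 2"
    by (simp add: right_diff_distrib)
   ultimately show ?thesis by simp
  qed
  with m show "(s * \<bar>u + s\<bar> + (- s) * \<bar>u + - s\<bar>) / 2 = min (s^2) (u * \<bar>s\<bar>)" by simp
 qed
 also have "... = 2 * ((ncdf u / 2 - u * nd u) + u * nd u)"
 proof (rule Normal_even)
  have 0: "has_bochner_integral lborel (%s. (s^2 * nd s) * indicator {0..u} s)
    ((ncdf u / 2 - u * nd u) - (ncdf 0 / 2 - 0 * nd 0))"
  proof (rule has_bochner_integral_FTC_Icc_real[OF assms])
   show "((%u. ncdf u / 2 - u * nd u) has_real_derivative s\<^sup>2 * nd s) (at s)"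
    if "0 <= s" for s
   proof -
    have D: "((%u. ncdf u / 2 - u * nd u) has_real_derivative
      2 * nd s / 2 - (s * (- s * nd s) + 1 * nd s)) (at s)"
     by (intro DERIV_diff DERIV_cdivide ncdf_deriv[OF that] DERIV_mult' std_normal_deriv DERIV_ident)
    show ?thesis by (rule DERIV_cong[OF D]) (simp add: power2_eq_square)
   qed
   show "isCont (%s. s^2 * nd s) s" for s
    using std_normal_deriv[THEN DERIV_isCont] by (intro continuous_intros) auto
  qed
  have 1: "has_bochner_integral lborel (%s. (s^2 * nd s) * indicator {0..u} s
    + u * (indicator {u..} s * (s * nd s))) ((ncdf u / 2 - u * nd u) + u * nd u)"
   using 0 by (intro has_bochner_integral_add has_bochner_integral_mult_right
     std_normal_first_moment_tail[OF assms]) (simp add: ncdf_0)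
  show "has_bochner_integral lborel (%s. indicator {0..} s *\<^sub>R (nd s * min (s^2) (u * \<bar>s\<bar>)))
    ((ncdf u / 2 - u * nd u) + u * nd u)"
  proof (subst has_bochner_integral_cong_AE[OF _ _ _])
   show "AE s in lborel. indicator {0..} s *\<^sub>R (nd s * min (s^2) (u * \<bar>s\<bar>))
     = (s^2 * nd s) * indicator {0..u} s + u * (indicator {u..} s * (s * nd s))"
    using AE_lborel_singleton[of u]
   proof eventually_elim
    fix s assume "s ~= u"
    consider "s < 0" | "0 <= s" "s < u" | "u < s" using \<open>s ~= u\<close> by linarith
    then show "indicator {0..} s *\<^sub>R (nd s * min (s^2) (u * \<bar>s\<bar>))
     = (s^2 * nd s) * indicator {0..u} s + u * (indicator {u..} s * (s * nd s))"
    proof cases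
     case 1
     then show ?thesis using assms by (simp add: indicator_def)
    next
     case 2
     then have "s^2 <= u * \<bar>s\<bar>" by (simp add: power2_eq_square mult_right_mono)
     then show ?thesis using 2 by (simp add: indicator_def)
    next
     case 3
     then have "u * \<bar>s\<bar> <= s\<^sup>2" using assms by (simp add: power2_eq_square mult_right_mono)
     then show ?thesis using 3 assms by (simp add: indicator_def min_absorb2)
    qed
   qed
  qed (use 1 in auto)
 qed auto
 finally show ?thesis by simp
qed

text \<open>The rational factor is the third convergent of the continued fraction of Mills' ratio.
  The derivative of the right-hand side exceeds the density in modulus by the relative amount 6 /
  (s^2 (s^2 + 3)^2), and both sides vanish at infinity.\<close>

lemma ncdf_tail:
 assumes u: "u > 0"
 shows "1 - ncdf u <= 2 * (nd u * (u^2 + 2) / (u ^ 3 + 3 * u))"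
proof -
 define G where "G s = nd s * (s^2 + 2) / (s ^ 3 + 3 * s)" for s
 define G' where "G' s = nd s * (1 + 6 / (s^2 * (s^2 + 3)^2))" for s
 have dG: "(G has_real_derivative - G' s) (at s)" if "s > 0" for s
 proof -
  have nz: "s ^ 3 + 3 * s > 0" using that by (simp add: add_pos_pos)
  have "(G has_real_derivative
   (((nd s * (2 * s) + (- s * nd s) * (s^2 + 2)) * (s ^ 3 + 3 * s)
     - nd s * (s^2 + 2) * (3 * s^2 + 3)) / ((s ^ 3 + 3 * s) * (s ^ 3 + 3 * s)))) (at s)"
   unfolding G_def[abs_def]
   by (intro DERIV_divide DERIV_mult' std_normal_deriv) (use nz in \<open>auto intro!: derivative_eq_intros\<close>)
  moreover have "(((p * (2 * s) + (- s * p) * (s^2 + 2)) * (s ^ 3 + 3 * s)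
     - p * (s^2 + 2) * (3 * s^2 + 3)) / ((s ^ 3 + 3 * s) * (s ^ 3 + 3 * s))) = - (p * (1 + 6 / (s^2 * (s^2 + 3)^2)))" for p
  proof -
   have a: "s ^ 3 + 3 * s = s * (s^2 + 3)" by (simp add: algebra_simps power3_eq_cube power2_eq_square)
   have b: "s * (s^2 + 3) * (s * (s^2 + 3)) = s^2 * (s^2 + 3)^2" by (simp add: power2_eq_square mult_ac)
   have c: "s^2 * (s^2 + 3)^2 ~= 0" using that by (auto simp: add_nonneg_eq_0_iff)
   have "(p * (2 * s) + (- s * p) * (s^2 + 2)) * (s * (s^2 + 3)) - p * (s^2 + 2) * (3 * s^2 + 3)
    = - p * (s^2 * (s^2 + 3)^2 + 6)"
    by (simp add: algebra_simps power2_eq_square)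
   then show ?thesis unfolding a b using c by (simp add: field_simps)
  qed
  ultimately show ?thesis by (simp add: G'_def)
 qed
 have G'ge: "nd s <= G' s" for s
 proof -
  have "nd s * 1 <= G' s" unfolding G'_def by (intro mult_left_mono) auto
  then show ?thesis by simp
 qed
 have limG: "(G \<longlongrightarrow> 0) at_top"
 proof (rule tendsto_sandwich[OF _ _ tendsto_const std_normal_tendsto_0])
  show "\<forall>\<^sub>F s in at_top. 0 <= G s"
   using eventually_ge_at_top[of "0::real"] by eventually_elim (simp add: G_def)
  show "\<forall>\<^sub>F s in at_top. G s <= nd s"
   using eventually_ge_at_top[of "1::real"]
  proof eventually_elim
   fix s :: real assume s: "1 <= s"
   have "s^2 <= s ^ 3" using s by (intro power_increasing) auto
   then have "s^2 + 2 <= s ^ 3 + 3 * s" using s by linarith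
   then have "(s^2 + 2) / (s ^ 3 + 3 * s) <= 1" using s by (simp add: divide_le_eq add_pos_pos)
   then have "nd s * ((s^2 + 2) / (s ^ 3 + 3 * s)) <= nd s * 1"
    by (intro mult_left_mono) auto
   then show "G s <= nd s" by (simp add: G_def)
  qed
 qed
 have "(\<integral>\<^sup>+s. ennreal (nd s) * indicator {u..} s \<partial>lborel)
   <= (\<integral>\<^sup>+s. ennreal (G' s) * indicator {u..} s \<partial>lborel)"
  using G'ge by (intro nn_integral_mono mult_right_mono ennreal_leI) auto
 also have "... = ennreal (0 - (- G u))"
 proof (rule nn_integral_FTC_atLeast)
  show "((%s. - G s) has_real_derivative G' s) (at s)" if "u <= s" for s
   using DERIV_minus[OF dG[of s]] that u by simp
  show "((%s. - G s) \<longlongrightarrow> 0) at_top" using tendsto_minus[OF limG] by simp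
  show "0 <= G' s" for s using G'ge[of s] normal_density_nonneg[of 0 1 s] by linarith
  show "G' : borel_measurable borel" unfolding G'_def by measurable
 qed
 finally have tail: "(\<integral>\<^sup>+s. ennreal (nd s) * indicator {u..} s \<partial>lborel) <= ennreal (G u)" by simp
 have it: "integrable lborel (%s. indicator {u..} s * nd s)"
  using integrable_mult_indicator[OF _ integrable_normal_density[of 1 0], of "{u..}"] by simp
 define T where "T = (LINT s|lborel. indicator {u..} s * nd s)"
 have "ennreal T = (\<integral>\<^sup>+s. ennreal (indicator {u..} s * nd s) \<partial>lborel)"
  unfolding T_def by (rule nn_integral_eq_integral[OF it, symmetric]) auto
 also have "... = (\<integral>\<^sup>+s. ennreal (nd s) * indicator {u..} s \<partial>lborel)"
  by (intro nn_integral_cong) (auto simp: indicator_def)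
 finally have "ennreal T <= ennreal (G u)" using tail by simp
 then have TG: "T <= G u" using u by (subst (asm) ennreal_le_iff) (auto simp: G_def)
 have "(LINT s|Normal. 1) = 2 * (ncdf u / 2 + T)"
 proof (rule Normal_even(2))
  have 1: "has_bochner_integral lborel (%s. nd s * indicator {0..u} s
    + indicator {u..} s * nd s) (ncdf u / 2 + T)"
   by (intro has_bochner_integral_add std_normal_ncdf_Icc) (use u it in \<open>auto simp: T_def has_bochner_integral_iff\<close>)
  show "has_bochner_integral lborel (%s. indicator {0..} s *\<^sub>R (nd s * 1)) (ncdf u / 2 + T)"
  proof (subst has_bochner_integral_cong_AE[OF _ _ _])
   show "AE s in lborel. indicator {0..} s *\<^sub>R (nd s * 1)
     = nd s * indicator {0..u} s + indicator {u..} s * nd s"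
    using AE_lborel_singleton[of u] by eventually_elim (use u in \<open>auto simp: indicator_def\<close>)
  qed (use 1 in auto)
 qed auto
 moreover have "(LINT s|Normal. 1) = (1::real)"
  using prob_space.prob_space[OF prob_space_Normal] by simp
 ultimately have "1 - ncdf u = 2 * T" by simp
 then show ?thesis using TG by (simp add: G_def)
qed

section \<open>Numerical gap for affine functions\<close>

lemma sin_taylor_bound: "\<bar>sin (x::real) - (x - x ^ 3 / 6)\<bar> <= \<bar>x\<bar> ^ 5 / 120"
proof -
 have e: "(SUM m<5. f m) = f 0 + f 1 + f 2 + f 3 + f (4::nat)" for f :: "nat => real"
  by (simp add: eval_nat_numeral)
 have c: "sin_coeff 0 = 0" "sin_coeff 1 = 1" "sin_coeff 2 = 0" "sin_coeff 3 = -1/6" "sin_coeff 4 = 0"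
  by (simp_all add: sin_coeff_def fact_numeral)
 show ?thesis
  using Maclaurin_sin_bound[of x 5] unfolding e c by (simp add: fact_numeral field_simps)
qed

text \<open>Since sin (pi / 6) = 1/2 and sin is increasing there, it suffices to see on which side
  of 1/2 its Taylor polynomial lies at 3.148 / 6 and at 3.09 / 6.\<close>

lemma pi_bounds: "3.09 < pi" "pi < 3.148"
proof -
 define x :: real where "x = 3.148 / 6"
 define y :: real where "y = 3.09 / 6"
 have "x - x ^ 3 / 6 - x ^ 5 / 120 > 1 / 2" by (simp add: x_def power_divide)
 moreover have "\<bar>x\<bar> = x" by (simp add: x_def)
 ultimately have "sin x > sin (pi / 6)"
  using sin_taylor_bound[of x] unfolding sin_30 by linarith
 then show "pi < 3.148"
  using sin_monotone_2pi_le[of x "pi / 6"] pi_gt_zero by (force simp: x_def)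
 have "y - y ^ 3 / 6 + y ^ 5 / 120 < 1 / 2" by (simp add: y_def power_divide)
 moreover have "\<bar>y\<bar> = y" by (simp add: y_def)
 ultimately have "sin y < sin (pi / 6)"
  using sin_taylor_bound[of y] unfolding sin_30 by linarith
 then show "3.09 < pi"
  using sin_monotone_2pi_le[of "pi / 6" y] pi_gt_zero pi_ge_two by (force simp: y_def)
qed

lemma std_normal_0_ge: "0.797 <= 2 * nd 0"
proof -
 have "0.797 * sqrt (2 * pi) <= sqrt 4"
 proof -
  have "0.797 * sqrt (2 * pi) = sqrt (0.797^2 * (2 * pi))" by (simp add: real_sqrt_mult)
  also have "... <= sqrt 4" using pi_bounds by (intro real_sqrt_le_mono) (simp add: power2_eq_square)
  finally show ?thesis .
 qed
 then show ?thesis by (simp add: std_normal_density_def le_divide_eq)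
qed

text \<open>For an even number of terms the Lagrange remainder carries an even power and is
  nonnegative, so the partial sum stays below; 0.797 bounds 2 / sqrt (2 pi) from below.\<close>

lemma std_normal_taylor:
 assumes "even n"
 shows "0.797 * (SUM k<n. (- (u^2 / 2)) ^ k / fact k) <= 2 * nd u"
proof -
 obtain t where t: "exp (- (u^2 / 2)) = (SUM k<n. (- (u^2 / 2)) ^ k / fact k) + exp t / fact n * (- (u^2 / 2)) ^ n"
  using Maclaurin_exp_le[of "- (u^2 / 2)" n] by blast
 have "exp t / fact n * (- (u^2 / 2)) ^ n >= 0" using assms by (intro mult_nonneg_nonneg) (auto simp: zero_le_even_power)
 then have "(SUM k<n. (- (u^2 / 2)) ^ k / fact k) <= exp (- (u^2 / 2))" using t by simp
 then have "0.797 * (SUM k<n. (- (u^2 / 2)) ^ k / fact k) <= 0.797 * exp (- (u^2 / 2))"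
  by (intro mult_left_mono) auto
 also have "... <= (2 * nd 0) * exp (- (u^2 / 2))"
  by (intro mult_right_mono std_normal_0_ge) auto
 also have "... = 2 * nd u" by (simp add: std_normal_density_def)
 finally show ?thesis .
qed

lemma ge_by_deriv:
 fixes f g :: "real => real"
 assumes "a <= u" "g a <= f a"
  and "!!x. a <= x ==> x <= u ==> (f has_real_derivative f' x) (at x)"
  and "!!x. a <= x ==> x <= u ==> (g has_real_derivative g' x) (at x)"
  and "!!x. a <= x ==> x <= u ==> g' x <= f' x"
 shows "g u <= f u"
proof -
 have "f a - g a <= f u - g u"
 proof (rule DERIV_nonneg_imp_nondecreasing[OF assms(1), of "%x. f x - g x"])
  fix x assume x: "a <= x" "x <= u"
  show "EX y. ((%x. f x - g x) has_real_derivative y) (at x) & 0 <= y"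
   using DERIV_diff[OF assms(3)[OF x] assms(4)[OF x]] assms(5)[OF x] by (intro exI conjI) auto
 qed
 then show ?thesis using assms(2) by simp
qed

text \<open>The bound for the density integrated termwise; the denominators are 2^k k! (2 k +
  1).\<close>

lemma ncdf_taylor6:
 assumes "u >= 0"
 shows "0.797 * (u - u^3/6 + u^5/40 - u^7/336 + u^9/3456 - u^11/42240) <= ncdf u"
proof (rule ge_by_deriv[where a=0 and f=ncdf and f'="%u. 2 * nd u"
  and g="%u. 0.797 * (u - u^3/6 + u^5/40 - u^7/336 + u^9/3456 - u^11/42240)"
  and g'="%u. 0.797 * (SUM k<6. (- (u^2 / 2)) ^ k / fact k)"])
 show "((%u. 0.797 * (u - u^3/6 + u^5/40 - u^7/336 + u^9/3456 - u^11/42240)) has_real_derivative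
   0.797 * (SUM k<6. (- (x^2 / 2)) ^ k / fact k)) (at x)" for x :: real
 proof (rule DERIV_cong)
  show "((%u. 0.797 * (u - u^3/6 + u^5/40 - u^7/336 + u^9/3456 - u^11/42240)) has_real_derivative
   0.797 * (1 - 3*x^2/6 + 5*x^4/40 - 7*x^6/336 + 9*x^8/3456 - 11*x^10/42240)) (at x)"
   by (auto intro!: derivative_eq_intros)
  show "0.797 * (1 - 3*x^2/6 + 5*x^4/40 - 7*x^6/336 + 9*x^8/3456 - 11*x^10/42240)
   = 0.797 * (SUM k<6. (- (x^2 / 2)) ^ k / fact k)"
   by (simp add: eval_nat_numeral fact_numeral field_simps)
 qed
 show "0.797 * (SUM k<6. (- (x^2 / 2)) ^ k / fact k) <= 2 * nd x" for x
  by (rule std_normal_taylor) simp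
qed (use assms in \<open>auto simp: ncdf_0 intro: ncdf_deriv\<close>)

text \<open>One further integration, because the derivative of \<open>nabs\<close> is
  \<open>ncdf\<close>; the denominators acquire the factor 2 k + 2.\<close>

lemma nabs_taylor6:
 assumes "u >= 0"
 shows "0.797 * (1 + u^2/2 - u^4/24 + u^6/240 - u^8/2688 + u^10/34560 - u^12/506880) <= nabs u"
proof (rule ge_by_deriv[where a=0 and f=nabs and f'=ncdf
  and g="%u. 0.797 * (1 + u^2/2 - u^4/24 + u^6/240 - u^8/2688 + u^10/34560 - u^12/506880)"
  and g'="%u. 0.797 * (u - u^3/6 + u^5/40 - u^7/336 + u^9/3456 - u^11/42240)"])
 show "((%u. 0.797 * (1 + u^2/2 - u^4/24 + u^6/240 - u^8/2688 + u^10/34560 - u^12/506880)) has_real_derivative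
   0.797 * (x - x^3/6 + x^5/40 - x^7/336 + x^9/3456 - x^11/42240)) (at x)" for x :: real
  by (auto intro!: derivative_eq_intros simp: field_simps)
 show "0.797 * (1 + 0^2/2 - 0^4/24 + 0^6/240 - 0^8/2688 + 0^10/34560 - 0^12/506880) <= nabs 0"
  using std_normal_0_ge by (simp add: nabs_def)
 show "(nabs has_real_derivative ncdf x) (at x)" if "0 <= x" for x using that by (rule nabs_deriv)
qed (rule assms, rule ncdf_taylor6)

lemma ncdf_taylor2:
 assumes "u >= 0" shows "0.797 * (u - u^3/6) <= ncdf u"
proof (rule ge_by_deriv[where a=0 and f=ncdf and f'="%u. 2 * nd u"
  and g="%u. 0.797 * (u - u^3/6)" and g'="%u. 0.797 * (SUM k<2. (- (u^2 / 2)) ^ k / fact k)"])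
 show "((%u. 0.797 * (u - u^3/6)) has_real_derivative
   0.797 * (SUM k<2. (- (x^2 / 2)) ^ k / fact k)) (at x)" for x :: real
  by (auto intro!: derivative_eq_intros simp: numeral_2_eq_2)
 show "0.797 * (SUM k<2. (- (x^2 / 2)) ^ k / fact k) <= 2 * nd x" for x
  by (rule std_normal_taylor) simp
qed (use assms in \<open>auto simp: ncdf_0 intro: ncdf_deriv\<close>)

lemma nabs_taylor2:
 assumes "u >= 0" shows "0.797 * (1 + u^2/2 - u^4/24) <= nabs u"
proof (rule ge_by_deriv[where a=0 and f=nabs and f'=ncdf
  and g="%u. 0.797 * (1 + u^2/2 - u^4/24)" and g'="%u. 0.797 * (u - u^3/6)"])
 show "((%u. 0.797 * (1 + u^2/2 - u^4/24)) has_real_derivative 0.797 * (x - x^3/6)) (at x)" for x :: real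
  by (auto intro!: derivative_eq_intros simp: field_simps)
 show "0.797 * (1 + 0^2/2 - 0^4/24) <= nabs 0" using std_normal_0_ge by (simp add: nabs_def)
 show "(nabs has_real_derivative ncdf x) (at x)" if "0 <= x" for x using that by (rule nabs_deriv)
qed (rule assms, rule ncdf_taylor2)

lemma std_normal_antimono:
 assumes "0 <= s" "s <= t" shows "nd t <= nd s"
proof -
 have "s^2 <= t\<^sup>2" using assms by (intro power_mono) auto
 then show ?thesis by (simp add: std_normal_density_def divide_right_mono)
qed

text \<open>On [p, p + h] the density is at least its value at the right end. Integrating this
  constant once and twice gives a linear and a quadratic minorant, so that each cell leads to
  polynomial inequalities.\<close>

lemma ncdf_nabs_chord:
 assumes p: "0 <= p" and u: "p <= u" "u <= p + h"
  and e: "e <= ncdf p" and a: "a <= nabs p" and f: "f <= 2 * nd (p + h)"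
 shows "e + f * (u - p) <= ncdf u" "a + e * (u - p) + f / 2 * (u - p)^2 <= nabs u"
proof -
 have E: "e + f * (x - p) <= ncdf x" if x: "p <= x" "x <= u" for x
 proof (rule ge_by_deriv[where a=p and f=ncdf and f'="%u. 2 * nd u"
   and g="%u. e + f * (u - p)" and g'="%_. f"])
  show "((%u. e + f * (u - p)) has_real_derivative f) (at y)" for y
   by (auto intro!: derivative_eq_intros)
  show "f <= 2 * nd y" if "p <= y" "y <= x" for y
   using std_normal_antimono[of y "p + h"] f that x u p by simp
 qed (use x e p in \<open>auto intro: ncdf_deriv\<close>)
 then show "e + f * (u - p) <= ncdf u" using u by simp
 show "a + e * (u - p) + f / 2 * (u - p)^2 <= nabs u"
 proof (rule ge_by_deriv[where a=p and f=nabs and f'=ncdf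
   and g="%u. a + e * (u - p) + f / 2 * (u - p)^2" and g'="%u. e + f * (u - p)"])
  show "((%u. a + e * (u - p) + f / 2 * (u - p)^2) has_real_derivative e + f * (x - p)) (at x)" for x
   by (auto intro!: derivative_eq_intros)
 qed (use u a p in \<open>auto intro: nabs_deriv E\<close>)
qed

text \<open>For \<open>N x = m + v \<bullet> x\<close> with \<open>norm v = c\<close> and \<open>u = m / c\<close> the mean of \<open>\<bar>N\<bar>\<close> is \<open>c * nabs u\<close>, and
 \<open>c\<^sup>2 * fhgap l u\<close> is what remains of the balance condition \<open>E (F * \<bar>F\<bar>) = 0\<close> for \<open>F\<close> close to \<open>N\<close>;
 \<open>l\<close> is a free parameter. Its positivity for some \<open>l\<close> excludes such \<open>F\<close>.\<close>

definition fhgap :: "real => real => real" where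
 "fhgap l u = (u * nabs u + ncdf u) - u\<^sup>2 - l\<^sup>2 / 4 * (u^2 + 1 + (u * nabs u + ncdf u))
   - (2 - l) * u * sqrt (1 + u^2 - (nabs u)\<^sup>2 - (ncdf u)\<^sup>2)"

text \<open>The gap does not decrease when \<open>nabs u\<close> or \<open>ncdf u\<close> grows, so
  lower bounds A and E suffice. Z collects the terms outside the root, and the comparison with the
  root is made after squaring.\<close>

lemma fhgap_pos:
 assumes l: "0 <= l" "l <= 1" and u: "0 < u"
  and A: "0 <= A" "A <= nabs u" and E: "0 <= E" "E <= ncdf u"
  and Z: "Z = (1 - l\<^sup>2 / 4) * (u * A + E - u\<^sup>2) - l\<^sup>2 / 4 * (2 * u^2 + 1)" "Z > 0"
  and S: "(2 - l)^2 * u^2 * (1 + u^2 - A\<^sup>2 - E\<^sup>2) < Z^2"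
 shows "fhgap l u > 0"
proof -
 define T where "T = u * nabs u + ncdf u"
 have T: "u * A + E <= T" unfolding T_def using u A E by (intro add_mono mult_left_mono) auto
 have l2: "0 <= 1 - l\<^sup>2 / 4" using l by (simp add: power_le_one order_trans[of _ 1])
 have "Z <= (1 - l\<^sup>2 / 4) * (T - u\<^sup>2) - l\<^sup>2 / 4 * (2 * u^2 + 1)"
  unfolding Z(1) using T l2 by (intro diff_mono mult_left_mono) auto
 also have "... = T - u\<^sup>2 - l\<^sup>2 / 4 * (u^2 + 1 + T)"
 proof -
  have "(1 - k) * (T - u\<^sup>2) - k * (2 * u^2 + 1) = T - u\<^sup>2 - k * (u^2 + 1 + T)" for k
   by (simp add: algebra_simps)
  then show ?thesis by blast
 qed
 finally have ZT: "Z <= T - u\<^sup>2 - l\<^sup>2 / 4 * (u^2 + 1 + T)" .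
 define s where "s = 1 + u^2 - (nabs u)\<^sup>2 - (ncdf u)\<^sup>2"
 have "A^2 <= (nabs u)\<^sup>2" "E^2 <= (ncdf u)\<^sup>2" using A E by (auto intro: power_mono)
 then have "s <= 1 + u^2 - A\<^sup>2 - E\<^sup>2" unfolding s_def by linarith
 then have "(2 - l)^2 * u^2 * s <= (2 - l)\<^sup>2 * u^2 * (1 + u^2 - A\<^sup>2 - E\<^sup>2)" by (intro mult_left_mono) auto
 then have "(2 - l)^2 * u^2 * s < Z^2" using S by simp
 \<comment> \<open>The sign of \<open>s\<close> is unknown at this point; the real
   \<open>sqrt\<close> is strictly increasing on the whole line, negative arguments
   included.\<close>
 then have "sqrt ((2 - l)^2 * u^2 * s) < sqrt (Z^2)" by (rule real_sqrt_less_mono)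
 then have "(2 - l) * u * sqrt s < Z" using l u Z(2) by (simp add: real_sqrt_mult)
 then show ?thesis using ZT unfolding fhgap_def T_def[symmetric] s_def[symmetric] by linarith
qed

text \<open>Polynomials as coefficient lists; \<open>plb h\<close> is a lower bound on \<open>[0, h]\<close>.\<close>

primrec peval :: "real list => real => real" where
 "peval [] t = 0"
| "peval (c # cs) t = c + t * peval cs t"

primrec plb :: "real => real list => real" where
 "plb h [] = 0"
| "plb h (c # cs) = c + min 0 (h * plb h cs)"

fun padd :: "real list => real list => real list" where
 "padd [] ys = ys"
| "padd (x # xs) [] = x # xs"
| "padd (x # xs) (y # ys) = (x + y) # padd xs ys"

primrec pscale :: "real => real list => real list" where
 "pscale c [] = []"
| "pscale c (x # xs) = (c * x) # pscale c xs"

primrec pmul :: "real list => real list => real list" where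
 "pmul [] ys = []"
| "pmul (x # xs) ys = padd (pscale x ys) (0 # pmul xs ys)"

lemma plb_le: "0 <= t ==> t <= h ==> plb h cs <= peval cs t"
proof (induction cs)
 case (Cons c cs)
 have "min 0 (h * plb h cs) <= t * peval cs t"
 proof (cases "plb h cs >= 0")
  case True
  then have "t * peval cs t >= 0" using Cons by (intro mult_nonneg_nonneg) auto
  then show ?thesis by simp
 next
  case False
  have "h * plb h cs <= t * plb h cs" using False Cons.prems by (intro mult_right_mono_neg) auto
  also have "... <= t * peval cs t" using Cons by (intro mult_left_mono) auto
  finally show ?thesis by simp
 qed
 then show ?case by simp
qed simp

lemma peval_padd: "peval (padd xs ys) t = peval xs t + peval ys t"
 by (induction xs ys rule: padd.induct) (auto simp: algebra_simps)

lemma peval_pscale: "peval (pscale c xs) t = c * peval xs t"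
 by (induction xs) (auto simp: algebra_simps)

lemma peval_pmul: "peval (pmul xs ys) t = peval xs t * peval ys t"
 by (induction xs) (auto simp: algebra_simps peval_padd peval_pscale)

lemmas peval_simps = peval_padd peval_pscale peval_pmul

text \<open>The quantity Z of \<open>fhgap_pos\<close>, and in \<open>pS\<close> the factor 1 + u^2
  - A^2 - E^2, as coefficient lists in t = u - p: their positivity on a cell becomes one evaluation
  of \<open>plb\<close>.\<close>

definition pZ :: "real => real list => real list => real list => real list" where
 "pZ l U A E = padd (pscale (1 - l\<^sup>2 / 4) (padd (padd (pmul U A) E) (pscale (-1) (pmul U U))))
   (pscale (- l\<^sup>2 / 4) (padd [1] (pscale 2 (pmul U U))))"

definition pS :: "real list => real list => real list => real list" where
 "pS U A E = padd (padd [1] (pmul U U)) (pscale (-1) (padd (pmul A A) (pmul E E)))"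

text \<open>The lists [e, f] and [a, e, f/2] are the minorants of \<open>ncdf_nabs_chord\<close>,
  and 49/16 is (2 - 1/4)^2.\<close>

lemma fhgap_pos_interval:
 assumes p: "0 < p" and u: "p <= u" "u <= p + h"
  and e: "e <= ncdf p" and a: "a <= nabs p" and f: "f <= 2 * nd (p + h)"
  and nn: "0 <= e" "0 <= a" "0 <= f"
  and Z: "plb h (pZ (1/4) [p, 1] [a, e, f/2] [e, f]) > 0"
  and S: "plb h (padd (pmul (pZ (1/4) [p, 1] [a, e, f/2] [e, f]) (pZ (1/4) [p, 1] [a, e, f/2] [e, f]))
    (pscale (- 49/16) (pmul (pmul [p, 1] [p, 1]) (pS [p, 1] [a, e, f/2] [e, f])))) > 0"
 shows "fhgap (1/4) u > 0"
proof -
 define t where "t = u - p"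
 have t: "0 <= t" "t <= h" using u by (auto simp: t_def)
 have U: "peval [p, 1] t = u" by (simp add: t_def)
 define A where "A = peval [a, e, f/2] t"
 define E where "E = peval [e, f] t"
 have A: "A = a + e * (u - p) + f / 2 * (u - p)^2" by (simp add: A_def t_def power2_eq_square field_simps)
 have E: "E = e + f * (u - p)" by (simp add: E_def t_def algebra_simps)
 note ch = ncdf_nabs_chord[OF less_imp_le[OF p] u e a f]
 note z = less_le_trans[OF Z plb_le[OF t]] and s = less_le_trans[OF S plb_le[OF t]]
 show ?thesis
 proof (rule fhgap_pos[where A=A and E=E and Z="peval (pZ (1/4) [p, 1] [a, e, f/2] [e, f]) t"])
  show "0 <= A" "0 <= E" unfolding A E using nn u by auto
  show "A <= nabs u" "E <= ncdf u" unfolding A E using ch by auto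
  show "peval (pZ (1/4) [p, 1] [a, e, f/2] [e, f]) t > 0" by (rule z)
  show "peval (pZ (1/4) [p, 1] [a, e, f/2] [e, f]) t = (1 - (1/4)\<^sup>2 / 4) * (u * A + E - u\<^sup>2) - (1/4)\<^sup>2 / 4 * (2 * u^2 + 1)"
   unfolding pZ_def peval_simps U A_def[symmetric] E_def[symmetric]
   by (simp add: power2_eq_square algebra_simps)
  show "(2 - 1/4)^2 * u^2 * (1 + u^2 - A\<^sup>2 - E\<^sup>2) < (peval (pZ (1/4) [p, 1] [a, e, f/2] [e, f]) t)^2"
   using s unfolding peval_simps(1,2) pS_def
   by (simp only: peval_simps U A_def[symmetric] E_def[symmetric])
     (simp add: power2_eq_square algebra_simps)
 qed (use p u in auto)
qed

text \<open>At u = 0 all terms vanish to first order, so the factor u is divided out before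
  estimating: \<open>u * E\<close> is the minorant of \<open>ncdf u\<close>, and the polynomial
  \<open>?P\<close> is the required inequality divided by u^2.\<close>

lemma fhgap_pos_small:
 assumes u: "0 < u" "u <= 0.3"
 shows "fhgap 0 u > 0"
proof -
 define A where "A = peval [0.797, 0, 0.797/2, 0, -0.797/24] u"
 define E where "E = peval [0.797, 0, -0.797/6] u"
 let ?X = "padd (padd [0.797, 0, 0.797/2, 0, -0.797/24] [0.797, 0, -0.797/6]) [0, -1]"
 let ?P = "padd (pmul ?X ?X) (pscale (-4) (pS [0,1] [0.797, 0, 0.797/2, 0, -0.797/24] (0 # [0.797, 0, -0.797/6])))"
 have A: "A = 0.797 * (1 + u^2/2 - u^4/24)" by (simp add: A_def eval_nat_numeral algebra_simps)
 have E: "u * E = 0.797 * (u - u^3/6)" by (simp add: E_def eval_nat_numeral algebra_simps)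
 have P: "plb 0.3 ?P > 0" by (simp add: pS_def)
 have PA: "plb 0.3 [0.797, 0, 0.797/2, 0, -0.797/24] > 0" "plb 0.3 [0.797, 0, -0.797/6] > 0" by simp_all
 have X: "plb 0.3 ?X > 0" by simp
 have A0: "A > 0" "E > 0" unfolding A_def E_def
  using less_le_trans[OF PA(1) plb_le] less_le_trans[OF PA(2) plb_le] u by simp_all
 have Xp: "peval ?X u > 0" using less_le_trans[OF X plb_le] u by simp
 have Xe: "peval ?X u = A + E - u" unfolding peval_simps A_def E_def by simp
 have Pp: "peval ?P u > 0" using less_le_trans[OF P plb_le] u by simp
 have Pe: "peval ?P u = (A + E - u)^2 - 4 * (1 + u^2 - A\<^sup>2 - (u * E)\<^sup>2)"
 proof -
  have E': "peval (0 # [0.797, 0, -0.797/6]) u = u * E" unfolding E_def by simp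
  have l: "peval [1] u = 1" "peval [0, 1] u = u" by simp_all
  show ?thesis unfolding peval_padd[of "pmul ?X ?X"] peval_pmul[of ?X]
   unfolding Xe pS_def unfolding peval_simps
   unfolding A_def[symmetric] E' l by (simp add: power2_eq_square)
 qed
 show ?thesis
 proof (rule fhgap_pos[where A=A and E="u * E" and Z="u * (A + E - u)"])
  show "A <= nabs u" unfolding A using nabs_taylor2 u by simp
  show "u * E <= ncdf u" unfolding E using ncdf_taylor2 u by simp
  show "u * (A + E - u) = (1 - 0\<^sup>2 / 4) * (u * A + u * E - u\<^sup>2) - 0\<^sup>2 / 4 * (2 * u^2 + 1)"
   by (simp add: power2_eq_square algebra_simps)
  show "u * (A + E - u) > 0" using Xp Xe u by simp
  have "u^2 * (4 * (1 + u^2 - A\<^sup>2 - (u * E)\<^sup>2)) < u^2 * (A + E - u)^2"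
   using Pp Pe u by (intro mult_strict_left_mono) auto
  moreover have e: "(2 - 0)^2 * u^2 * w = u^2 * (4 * w)" for w by (simp add: power2_eq_square)
  ultimately show "(2 - 0)^2 * u^2 * (1 + u^2 - A\<^sup>2 - (u * E)\<^sup>2) < (u * (A + E - u))^2"
   unfolding power_mult_distrib[of u "A + E - u"] e by blast
 qed (use u A0 in auto)
qed

text \<open>Write f = 2 nd u. The tail bound yields u A + E - u^2 = 1 - y with the tiny y = 2 f / (u
  (u^2 + 3)), and the same y gives 1 + u^2 - A^2 - E^2 <= 2 y. What remains is 8 u^2 y < (1 -
  y)^2.\<close>

lemma fhgap_pos_large:
 assumes u: "u >= 1.7"
 shows "fhgap 0 u > 0"
proof -
 have u0: "u > 0" using u by simp
 define f where "f = 2 * nd u"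
 have f0: "f > 0" by (simp add: f_def normal_density_pos)
 have q: "1 - ncdf u <= f * (u^2 + 2) / (u * (u^2 + 3))"
  using ncdf_tail[OF u0] by (simp add: f_def power3_eq_cube power2_eq_square algebra_simps)
 define E where "E = 1 - f * (u^2 + 2) / (u * (u^2 + 3))"
 define A where "A = u * E + f"
 define y where "y = 2 * f / (u * (u^2 + 3))"
 have E: "E <= ncdf u" using q by (simp add: E_def)
 have A: "A <= nabs u" using E u0 by (simp add: A_def nabs_def f_def)
 have D: "u^2 + 3 > 0" by (simp add: add_nonneg_pos)
 have aeq: "A = u + f / (u^2 + 3)"
 proof -
  have "u * (1 - f * k / (u * d)) + f = u + f * (d - k) / d" if "d > 0" for d k
   using that u0 by (simp add: field_simps)
  from this[OF D, of "u^2 + 2"] show ?thesis by (simp add: A_def E_def)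
 qed
 have yeq: "u * A + E - u\<^sup>2 = 1 - y"
 proof -
  have "u * (u + f / d) + (1 - f * (u^2 + 2) / (u * d)) - u\<^sup>2 = 1 - 2 * f / (u * d)" if "d > 0" for d
   using that u0 by (simp add: field_simps power2_eq_square)
  from this[OF D] show ?thesis unfolding aeq E_def y_def .
 qed
 \<comment> \<open>u nd u decreases beyond u = 1. Its value at 1.7 is controlled through exp 1.445,
   where 1.445 = 1.7^2 / 2, and larger u through the tangent bound for exp.\<close>
 have fu: "f * u <= 0.323"
 proof -
  obtain t where "exp (1.445::real) = (SUM k<9. 1.445 ^ k / fact k) + exp t / fact 9 * 1.445 ^ 9"
   using Maclaurin_exp_le[of "1.445" 9] by blast
  moreover have "exp t / fact 9 * (1.445::real) ^ 9 >= 0" by simp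
  moreover have "(SUM k<9. (1.445::real) ^ k / fact k) >= 4.2373"
  proof -
   have e: "(SUM m<9. f m) = f 0 + f 1 + f 2 + f 3 + f 4 + f 5 + f 6 + f 7 + f (8::nat)" for f :: "nat => real"
    by (simp add: eval_nat_numeral)
   show ?thesis unfolding e by (simp add: fact_numeral power_divide)
  qed
  ultimately have ex: "exp (1.445::real) >= 4.2373" by linarith
  have le: "1 + (u^2 / 2 - 1.445) <= exp (u^2 / 2 - 1.445)" by (rule exp_ge_add_one_self)
  have "(u - 1.7) * (u + 1.7) >= (u - 1.7) * 3.4" using u by (intro mult_left_mono) auto
  then have "u^2 - 2.89 >= 3.4 * (u - 1.7)" by (simp add: power2_eq_square algebra_simps)
  then have "u / 1.7 <= 1 + (u^2 / 2 - 1.445)" using u by simp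
  then have u1: "u / 1.7 <= exp (u^2 / 2 - 1.445)" using le by linarith
  have "4.2373 * (u / 1.7) <= exp 1.445 * exp (u^2 / 2 - 1.445)"
   using ex u1 u by (intro mult_mono) auto
  also have "... = exp (u^2 / 2)" by (simp add: exp_add[symmetric])
  finally have k: "4.2373 * (u / 1.7) <= exp (u^2 / 2)" .
  have c: "2 / sqrt (2 * pi) <= 0.805"
  proof -
   have "sqrt (2 * pi) >= sqrt (2.485^2)" using pi_bounds by (intro real_sqrt_le_mono) (simp add: power2_eq_square)
   then have s: "sqrt (2 * pi) >= 2.485" by simp
   then have "2 / sqrt (2 * pi) <= 2 / 2.485" by (intro divide_left_mono) auto
   then show ?thesis by simp
  qed
  have "f * u = (2 / sqrt (2 * pi)) * (u * exp (- (u^2 / 2)))" by (simp add: f_def std_normal_density_def)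
  also have "... <= 0.805 * (1.7 / 4.2373)"
  proof (rule mult_mono[OF c])
   have "u * exp (- (u^2 / 2)) = u / exp (u^2 / 2)" by (simp add: exp_minus inverse_eq_divide)
   also have "... <= 1.7 / 4.2373" using k by (simp add: divide_le_eq)
   finally show "u * exp (- (u^2 / 2)) <= 1.7 / 4.2373" .
  qed (use u in auto)
  also have "... <= 0.323" by simp
  finally show ?thesis .
 qed
 have u2: "u^2 >= 2.89" using power_mono[OF u, of 2] by (simp add: power2_eq_square)
 have y0: "0 <= y" using f0 u0 by (simp add: y_def)
 have uy: "u^2 * y <= 0.1097"
 proof -
  have "u^2 * y = 2 * (f * u) / (u^2 + 3)" unfolding y_def using u0 by (simp add: power2_eq_square)
  also have "... <= 2 * 0.323 / 5.89" using fu u2 f0 u0 by (intro frac_le) auto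
  also have "... <= 0.1097" by simp
  finally show ?thesis .
 qed
 have "2.89 * y <= u\<^sup>2 * y" using u2 y0 by (intro mult_right_mono) auto
 then have y1: "y <= 0.038" using uy by simp
 have S: "1 + u^2 - A\<^sup>2 - E\<^sup>2 <= 2 * y"
 proof -
  \<comment> \<open>An identity in A, E, u that isolates 1 - (u A + E - u^2) = y; the two remaining
    squares are dropped.\<close>
  have "1 + u^2 - A\<^sup>2 - E\<^sup>2 = 2 * (1 - (u * A + E - u\<^sup>2)) - (1 - E)\<^sup>2 - (A - u)\<^sup>2"
   by (simp add: power2_eq_square algebra_simps)
  also have "... <= 2 * y" unfolding yeq by simp
  finally show ?thesis .
 qed
 show ?thesis
 proof (rule fhgap_pos[where A=A and E=E and Z="1 - y"])
  show "0 <= A" unfolding aeq using u0 f0 by (simp add: add_nonneg_nonneg)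
  show "0 <= E"
  proof -
   have "f * 1.7 <= f * u" using u f0 by (intro mult_left_mono) auto
   then have "f <= 0.19" using fu by simp
   have "(u^2 + 2) / (u * (u^2 + 3)) <= 1"
   proof -
    have "1 * (u^2 + 3) <= u * (u^2 + 3)" using u by (intro mult_right_mono) auto
    moreover have "0 < u * (u^2 + 3)" using u0 D by simp
    ultimately show ?thesis by (subst divide_le_eq_1_pos) auto
   qed
   then have "f * ((u^2 + 2) / (u * (u^2 + 3))) <= f * 1" using f0 by (intro mult_left_mono) auto
   then show ?thesis unfolding E_def using \<open>f <= 0.19\<close> by simp
  qed
  show "1 - y = (1 - 0\<^sup>2 / 4) * (u * A + E - u\<^sup>2) - 0\<^sup>2 / 4 * (2 * u^2 + 1)" using yeq by simp
  show "1 - y > 0" using y1 by simp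
  have "u^2 * (1 + u^2 - A\<^sup>2 - E\<^sup>2) <= u\<^sup>2 * (2 * y)" using S by (intro mult_left_mono) auto
  then have "(2 - 0)^2 * u^2 * (1 + u^2 - A\<^sup>2 - E\<^sup>2) <= 8 * 0.1097" using uy by simp
  also have "... < 0.962^2" by (simp add: power2_eq_square)
  also have "... <= (1 - y)\<^sup>2" using y1 by (intro power_mono) auto
  finally show "(2 - 0)^2 * u^2 * (1 + u^2 - A\<^sup>2 - E\<^sup>2) < (1 - y)^2" .
 qed (use A E u0 in auto)
qed

lemma fhgap_pos_cell:
 fixes p h e a f :: real
 defines "Z \<equiv> pZ (1/4) [p, 1] [a, e, f/2] [e, f]"
 assumes u: "p <= u" "u <= p + h" and nn: "0 < p" "0 <= e" "0 <= a" "0 <= f"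
  and e: "e <= 0.797 * (p - p^3/6 + p^5/40 - p^7/336 + p^9/3456 - p^11/42240)"
  and a: "a <= 0.797 * (1 + p^2/2 - p^4/24 + p^6/240 - p^8/2688 + p^10/34560 - p^12/506880)"
  and f: "f <= 0.797 * (SUM k<8. (- ((p + h)^2 / 2)) ^ k / fact k)"
  and Z: "plb h Z > 0"
  and S: "plb h (padd (pmul Z Z) (pscale (- 49/16) (pmul (pmul [p, 1] [p, 1]) (pS [p, 1] [a, e, f/2] [e, f])))) > 0"
 shows "fhgap (1/4) u > 0"
 by (rule fhgap_pos_interval[OF nn(1) u _ _ _ nn(2-4) Z[unfolded Z_def] S[unfolded Z_def]])
   (use order_trans[OF e ncdf_taylor6] order_trans[OF a nabs_taylor6] order_trans[OF f std_normal_taylor] nn in auto)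

lemma sum_lessThan_8: "(SUM m<8. f m) = f 0 + f 1 + f 2 + f 3 + f 4 + f 5 + f 6 + f (7::nat)" for f :: "nat => real"
 by (simp add: eval_nat_numeral)

lemmas cell_simps = pZ_def pS_def power_divide sum_lessThan_8 fact_numeral

text \<open>The ends use l = 0: for fixed l > 0 the gap is negative at u = 0 and tends to minus
  infinity for large u. On the cells l = 1/4 enlarges the margin enough for crude chords. The
  instantiations list p, u, h and then decimal lower bounds for \<open>ncdf p\<close>,
  \<open>nabs p\<close> and twice the density at p + h.\<close>

lemma fhgap_pos_ex:
 assumes "u > 0" shows "fhgap 0 u > 0 \<or> fhgap (1/4) u > 0"
proof -
 consider "u <= 0.3" | "0.3 <= u" "u <= 0.6" | "0.6 <= u" "u <= 0.8" | "0.8 <= u" "u <= 0.95"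
  | "0.95 <= u" "u <= 1.1" | "1.1 <= u" "u <= 1.25" | "1.25 <= u" "u <= 1.4" | "1.4 <= u" "u <= 1.6"
  | "1.6 <= u" "u <= 1.8" | "u >= 1.7" by linarith
 then show ?thesis
 proof cases
  case 1
  then show ?thesis using assms fhgap_pos_small by blast
 next
  case 2
  then have "fhgap (1/4) u > 0"
   by (intro fhgap_pos_cell[of "0.3" u "0.3" "0.235" "0.832" "0.665"]) (simp_all add: cell_simps)
  then show ?thesis ..
 next
  case 3
  then have "fhgap (1/4) u > 0"
   by (intro fhgap_pos_cell[of "0.6" u "0.2" "0.450" "0.936" "0.578"]) (simp_all add: cell_simps)
  then show ?thesis ..
 next
  case 4
  then have "fhgap (1/4) u > 0"
   by (intro fhgap_pos_cell[of "0.8" u "0.15" "0.575" "1.039" "0.507"]) (simp_all add: cell_simps)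
  then show ?thesis ..
 next
  case 5
  then have "fhgap (1/4) u > 0"
   by (intro fhgap_pos_cell[of "0.95" u "0.15" "0.657" "1.131" "0.435"]) (simp_all add: cell_simps)
  then show ?thesis ..
 next
  case 6
  then have "fhgap (1/4) u > 0"
   by (intro fhgap_pos_cell[of "1.1" u "0.15" "0.727" "1.235" "0.364"]) (simp_all add: cell_simps)
  then show ?thesis ..
 next
  case 7
  then have "fhgap (1/4) u > 0"
   by (intro fhgap_pos_cell[of "1.25" u "0.15" "0.787" "1.349" "0.299"]) (simp_all add: cell_simps)
  then show ?thesis ..
 next
  case 8
  then have "fhgap (1/4) u > 0"
   by (intro fhgap_pos_cell[of "1.4" u "0.2" "0.837" "1.471" "0.221"]) (simp_all add: cell_simps)
  then show ?thesis ..
 next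
  case 9
  then have "fhgap (1/4) u > 0"
   by (intro fhgap_pos_cell[of "1.6" u "0.2" "0.888" "1.644" "0.156"]) (simp_all add: cell_simps)
  then show ?thesis ..
 qed (use fhgap_pos_large in blast)
qed

section \<open>A stable Friedland-Hayman inequality\<close>

text \<open>A lower expansion of F |F| for F = N + h with a tilted slope where N > 0; for N and N +
  h nonnegative the difference of the sides is 2 (h + l N / 2)^2. The part l N h disappears on
  integration, h being orthogonal to N, so the coefficient of |N| h drops from 2 to 2 - l at the
  price of the term with l^2.\<close>

lemma fh_pointwise:
 fixes N h l :: real
 assumes l: "0 <= l" "l <= 1"
 shows "N * \<bar>N\<bar> - l\<^sup>2 / 2 * (max 0 N)^2 + ((2 - l) * \<bar>N\<bar> - l * N) * h - h\<^sup>2 <= (N + h) * \<bar>N + h\<bar>"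
proof (cases "N >= 0")
 case True
 show ?thesis
 proof (cases "N + h >= 0")
  case True2: True
  have "0 <= 2 * (h + l * N / 2)^2" by simp
  also have "... = (N + h) * (N + h) - (N * N - l\<^sup>2 / 2 * N^2 + ((2 - l) * N - l * N) * h - h\<^sup>2)"
   by (simp add: power2_eq_square field_simps)
  finally show ?thesis using True True2 by simp
 next
  case False
  have "(4 - 2 * l) * N * (- h) >= (4 - 2 * l) * N * N" using False True l by (intro mult_left_mono) auto
  then have "(4 - 2 * l) * N * (- h) - 2 * N * N + l^2 / 2 * N^2 >= (4 - 2 * l) * N * N - 2 * N * N + l^2 / 2 * N^2" by simp
  also have "(4 - 2 * l) * N * N - 2 * N * N + l^2 / 2 * N^2 = 2 * (N * (1 - l / 2))^2"
   by (simp add: power2_eq_square field_simps)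
  also have "... >= 0" by simp
  finally have "0 <= (4 - 2 * l) * N * (- h) - 2 * N * N + l^2 / 2 * N^2" .
  also have "... = - (N + h) * (N + h) - (N * N - l\<^sup>2 / 2 * N^2 + ((2 - l) * N - l * N) * h - h\<^sup>2)"
   by (simp add: power2_eq_square field_simps)
  finally have "N * N - l\<^sup>2 / 2 * N^2 + ((2 - l) * N - l * N) * h - h\<^sup>2 <= - (N + h) * (N + h)" by simp
  moreover have "(N + h) * \<bar>N + h\<bar> = - (N + h) * (N + h)" using False by (simp only: abs_if) simp
  moreover have "\<bar>N\<bar> = N" "max 0 N = N" using True by auto
  ultimately show ?thesis by (simp only:)
 qed
next
 case False
 have "N * \<bar>N\<bar> - l\<^sup>2 / 2 * (max 0 N)^2 + ((2 - l) * \<bar>N\<bar> - l * N) * h - h\<^sup>2 = - (N + h)\<^sup>2"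
  using False by (simp add: power2_eq_square algebra_simps)
 also have "... <= (N + h) * \<bar>N + h\<bar>"
 proof -
  have "- x\<^sup>2 <= x * \<bar>x\<bar>" for x :: real by (cases "x >= 0") (auto simp: power2_eq_square)
  then show ?thesis .
 qed
 finally show ?thesis .
qed

text \<open>The expansion at the constant m. At a zero of m + k the quadratic minorant lies 2 m^2
  below the true value, and this deficit is what the measure of the zero set contributes.\<close>

lemma fh_pointwise_const:
 fixes m k :: real
 assumes m: "0 <= m"
 shows "m^2 + 2 * m * k - k\<^sup>2 + (if m + k = 0 then 2 * m^2 else 0) <= (m + k) * \<bar>m + k\<bar>"
proof -
 consider "m + k = 0" | "m + k > 0" | "m + k < 0" by linarith
 then show ?thesis
 proof cases
  case 1
  then have "k = - m" by simp
  then show ?thesis by (simp add: power2_eq_square)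
 next
  case 2
  then show ?thesis by (simp add: power2_eq_square algebra_simps)
 next
  case 3
  define w where "w = m * (- k)"
  have a: "m * m <= w" unfolding w_def using 3 m by (intro mult_left_mono) auto
  have b: "0 <= m * m" by simp
  have c: "(- (m + k)) * (m + k) = m^2 + 2 * m * k - k\<^sup>2 + (4 * w - 2 * (m * m))"
   by (simp add: w_def power2_eq_square algebra_simps)
  have "0 <= 4 * w - 2 * (m * m)" using a b by linarith
  then have "m^2 + 2 * m * k - k\<^sup>2 + 0 <= (- (m + k)) * (m + k)" unfolding c by linarith
  moreover have "(- (m + k)) * (m + k) = (m + k) * \<bar>m + k\<bar>" using 3 by simp
  moreover have "(if m + k = 0 then 2 * m^2 else 0) = 0" using 3 by simp
  ultimately show ?thesis by (simp only:)
 qed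
qed

lemma gauss_integrable_indicator:
 "Z : sets borel ==> integrable gauss (indicator Z :: 'a::euclidean_space => real)"
 by (rule gauss_integrable_bounded[where C=1]) (auto simp: indicator_def)

section \<open>A class of functions with integrable products\<close>

definition lin_growth :: "('a::euclidean_space => real) => bool" where
 "lin_growth g \<longleftrightarrow> g : borel_measurable borel & (EX A>=0. ALL x. \<bar>g x\<bar> <= A * (1 + norm x))"

lemma lin_growth_measurable: "lin_growth g ==> g : borel_measurable borel"
 by (simp add: lin_growth_def)

lemma lin_growth_mult_integrable:
 assumes f: "lin_growth f" and g: "lin_growth g"
 shows "integrable gauss (%x. f x * g x)"
proof -
 obtain A where A: "A >= 0" "!!x. \<bar>f x\<bar> <= A * (1 + norm x)" using f by (auto simp: lin_growth_def)
 obtain B where B: "B >= 0" "!!x. \<bar>g x\<bar> <= B * (1 + norm x)" using g by (auto simp: lin_growth_def)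
 note [measurable] = lin_growth_measurable[OF f] lin_growth_measurable[OF g]
 show ?thesis
 proof (rule gauss_integrable_linear_growth)
  show "\<bar>f x * g x\<bar> <= 2 * (A * B) + (2 * (A * B)) * (norm x)^2" for x
  proof -
   have "\<bar>f x * g x\<bar> <= (A * (1 + norm x)) * (B * (1 + norm x))"
    unfolding abs_mult using A B by (intro mult_mono) auto
   also have "... = (A * B) * (1 + norm x)^2" by (simp add: power2_eq_square mult_ac)
   also have "... <= (A * B) * (2 + 2 * (norm x)^2)"
   proof (intro mult_left_mono)
    have "0 <= (1 - norm x)\<^sup>2" by simp
    then show "(1 + norm x)^2 <= 2 + 2 * (norm x)^2" by (simp add: power2_eq_square algebra_simps)
   qed (use A B in auto)
   finally show ?thesis by (simp add: algebra_simps)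
  qed
 qed measurable
qed

lemma lin_growth_const: "lin_growth (%x::'a::euclidean_space. c)"
 unfolding lin_growth_def
proof (intro conjI exI[of _ "\<bar>c\<bar>"] allI)
 show "\<bar>c\<bar> <= \<bar>c\<bar> * (1 + norm x)" for x :: 'a by (simp add: distrib_left)
qed auto

lemma lin_growth_integrable: "lin_growth g ==> integrable gauss g"
 using lin_growth_mult_integrable[OF _ lin_growth_const, of g 1] by simp

lemma lin_growth_add:
 assumes f: "lin_growth f" and g: "lin_growth g"
 shows "lin_growth (%x. f x + g x)"
proof -
 obtain A where A: "A >= 0" "!!x. \<bar>f x\<bar> <= A * (1 + norm x)" using f by (auto simp: lin_growth_def)
 obtain B where B: "B >= 0" "!!x. \<bar>g x\<bar> <= B * (1 + norm x)" using g by (auto simp: lin_growth_def)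
 note [measurable] = lin_growth_measurable[OF f] lin_growth_measurable[OF g]
 show ?thesis unfolding lin_growth_def
 proof (intro conjI exI[of _ "A + B"] allI)
  show "(%x. f x + g x) : borel_measurable borel" by measurable
  show "\<bar>f x + g x\<bar> <= (A + B) * (1 + norm x)" for x
   using A(2)[of x] B(2)[of x] unfolding distrib_right[of A B] by linarith
 qed (use A B in auto)
qed

lemma lin_growth_cmult:
 assumes f: "lin_growth f" shows "lin_growth (%x. c * f x)"
proof -
 obtain A where A: "A >= 0" "!!x. \<bar>f x\<bar> <= A * (1 + norm x)" using f by (auto simp: lin_growth_def)
 note [measurable] = lin_growth_measurable[OF f]
 show ?thesis unfolding lin_growth_def
 proof (intro conjI exI[of _ "\<bar>c\<bar> * A"] allI)
  show "(%x. c * f x) : borel_measurable borel" by measurable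
  show "\<bar>c * f x\<bar> <= \<bar>c\<bar> * A * (1 + norm x)" for x
   unfolding abs_mult mult.assoc using A(2)[of x] by (intro mult_left_mono) auto
 qed (use A in auto)
qed

lemma lin_growth_abs:
 assumes f: "lin_growth f" shows "lin_growth (%x. \<bar>f x\<bar>)"
proof -
 note [measurable] = lin_growth_measurable[OF f]
 show ?thesis using f unfolding lin_growth_def by auto
qed

lemma lin_growth_max:
 assumes f: "lin_growth f" shows "lin_growth (%x. max 0 (f x))"
proof -
 have "lin_growth (%x. (1/2) * (f x + \<bar>f x\<bar>))"
  by (intro lin_growth_cmult lin_growth_add lin_growth_abs f)
 moreover have "(1/2) * (f x + \<bar>f x\<bar>) = max 0 (f x)" for x by (simp add: max_def)
 ultimately show ?thesis by simp
qed

lemma lin_growth_inner: "lin_growth (%x. v \<bullet> x)"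
 unfolding lin_growth_def
proof (intro conjI exI[of _ "norm v"] allI)
 show "\<bar>v \<bullet> x\<bar> <= norm v * (1 + norm x)" for x
  using Cauchy_Schwarz_ineq2[of v x] norm_ge_zero[of v] by (simp add: distrib_left del: norm_ge_zero)
qed auto

lemma lin_growth_nice:
 assumes "nice k F" shows "lin_growth F"
proof -
 obtain C where C: "C >= 0" "ALL x. \<bar>F x\<bar> <= C" using nice_bounded[OF assms] by blast
 show ?thesis unfolding lin_growth_def
 proof (intro conjI exI[of _ C] allI nice_measurable[OF assms])
  show "\<bar>F x\<bar> <= C * (1 + norm x)" for x
  proof -
   have "C * 1 <= C * (1 + norm x)" using C(1) by (intro mult_left_mono) auto
   moreover have "\<bar>F x\<bar> <= C" using C(2) by blast
   ultimately show ?thesis by linarith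
  qed
 qed (use C in auto)
qed

text \<open>The discriminant of the nonnegative quadratic E (f - t g)^2 in t.\<close>

lemma gauss_cauchy_schwarz:
 assumes f: "lin_growth f" and g: "lin_growth g"
 shows "(LINT x|gauss. f x * g x)^2 <= (LINT x|gauss. f x * f x) * (LINT x|gauss. g x * g x)"
proof -
 define a where "a = (LINT x|gauss. f x * f x)"
 define b where "b = (LINT x|gauss. f x * g x)"
 define d where "d = (LINT x|gauss. g x * g x)"
 have q: "0 <= a - 2 * t * b + t^2 * d" for t
 proof -
  have "0 <= (LINT x|gauss. (f x + (- t) * g x) * (f x + (- t) * g x))"
   by (rule integral_nonneg_AE) auto
  also have "... = (LINT x|gauss. f x * f x + ((- 2 * t) * (f x * g x) + t^2 * (g x * g x)))"
   by (intro Lintegral_cong refl) (simp add: power2_eq_square algebra_simps)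
  also have "... = a + ((- 2 * t) * b + t^2 * d)"
   unfolding a_def b_def d_def
   using lin_growth_mult_integrable[OF f f] lin_growth_mult_integrable[OF f g] lin_growth_mult_integrable[OF g g]
   by (subst Lintegral_add) (auto simp: Lintegral_add)
  finally show ?thesis by simp
 qed
 have d0: "d >= 0" unfolding d_def by (rule integral_nonneg_AE) auto
 show ?thesis
 proof (cases "d = 0")
  case True
  have "b = 0"
  proof (rule ccontr)
   assume b: "b ~= 0"
   have "0 <= a - 2 * ((a + 1) / (2 * b)) * b" using q[of "(a + 1) / (2 * b)"] True by simp
   then show False using b by (simp add: field_simps)
  qed
  then show ?thesis using True by (simp add: a_def[symmetric] b_def[symmetric] d_def[symmetric])
 next
  case False
  then have "d > 0" using d0 by simp
  have "0 <= a - 2 * (b / d) * b + (b / d)^2 * d" by (rule q)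
  also have "... = a - b\<^sup>2 / d" using \<open>d > 0\<close> by (simp add: field_simps power2_eq_square)
  finally have "b^2 <= a * d" using \<open>d > 0\<close> by (simp add: field_simps)
  then show ?thesis by (simp add: a_def b_def d_def)
 qed
qed

text \<open>The situation to be refuted: F is normalized, its positive and negative parts have equal
  L^2 norms, and its energy misses the gain. The sign of the mean is a normalization, since F may be
  replaced by -F.\<close>

locale fh_setting =
 fixes F :: "'a::euclidean_space => real" and \<epsilon> :: real
 assumes F: "nice 4 F"
  and one: "(LINT x|gauss. (F x)^2) = 1"
  and bal: "(LINT x|gauss. F x * \<bar>F x\<bar>) = 0"
  and mean: "(LINT x|gauss. F x) >= 0"
  and small: "(SUM i:Basis. LINT x|gauss. (pd i F x)^2) < 1 + \<epsilon>"
  and eps: "0 < \<epsilon>" "\<epsilon> <= 1/4"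
begin

text \<open>m and v are the Hermite coefficients of order 0 and 1. The remainder h is orthogonal to
  all functions a + b (v . x), and R is its squared norm by Pythagoras
  (\<open>h_sq\<close>).\<close>

definition "m = (LINT x|gauss. F x)"
definition "v = (SUM i:Basis. (LINT x|gauss. pd i F x) *\<^sub>R i)"
definition "c = norm v"
definition "h x = F x - m - v \<bullet> x"
definition "R = 1 - m\<^sup>2 - c\<^sup>2"

lemma lgF: "lin_growth F" by (rule lin_growth_nice[OF F])

lemma lgh: "lin_growth h"
proof -
 have "lin_growth (%x. F x + (- 1) * (m + v \<bullet> x))"
  by (intro lin_growth_add lin_growth_cmult lgF lin_growth_const lin_growth_inner)
 moreover have "(%x. F x + (- 1) * (m + v \<bullet> x)) = h" by (rule ext) (simp add: h_def)
 ultimately show ?thesis by simp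
qed

lemma lgN: "lin_growth (%x. m + v \<bullet> x)"
 by (intro lin_growth_add lin_growth_const lin_growth_inner)

lemma m0: "m >= 0" using mean by (simp add: m_def)

text \<open>Stein's identity: the mean gradient and the first Hermite coefficient are the same
  vector.\<close>

lemma coord_mean: "(LINT x|gauss. (x \<bullet> i) * F x) = v \<bullet> i" if i: "i : Basis" for i
proof -
 have n: "nice (Suc 3) F" using F by simp
 obtain C where C: "ALL x. \<bar>F x\<bar> <= C" using nice_bounded[OF F] by blast
 obtain C' where C': "ALL x. \<bar>pd i F x\<bar> <= C'" using nice_bounded[OF nice_partial[OF n i]] by blast
 have d: "((%t. F (x + t *\<^sub>R i)) has_real_derivative pd i F x) (at 0)" for x
  using has_real_derivative_axis[OF i nice_differentiable[OF n], of x 1 0] by simp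
 have "(LINT x|gauss. (x \<bullet> i) * F x) = (LINT x|gauss. pd i F x)"
  by (rule gauss_stein(3)[OF nice_measurable[OF F] i d]) (use C C' in auto)
 also have "... = v \<bullet> i" using i by (simp add: v_def inner_sum_left_Basis)
 finally show ?thesis .
qed

lemma gauss_inner_moments:
 "(LINT x|(gauss::'a measure). w \<bullet> x) = 0" "(LINT x|(gauss::'a measure). (w \<bullet> x)^2) = (norm w)^2"
proof -
 have "(LINT x|(gauss::'a measure). w \<bullet> x) = 0 & (LINT x|(gauss::'a measure). (w \<bullet> x)^2) = (norm w)^2"
 proof (cases "w = 0")
  case False
  define e where "e = (1 / norm w) *\<^sub>R w"
  have e: "norm e = 1" using False by (simp add: e_def)
  have we: "w \<bullet> x = norm w * (e \<bullet> x)" for x using False by (simp add: e_def)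
  have "(LINT x|gauss. e \<bullet> x) = 0" using gauss_law(1)[OF e, of "%s. s"] integral_Normal_1 by simp
  moreover have "(LINT x|gauss. (e \<bullet> x)^2) = 1" using gauss_law(1)[OF e, of "%s. s^2"] integral_Normal_2 by simp
  ultimately show ?thesis unfolding we by (simp add: power_mult_distrib)
 qed simp
 then show "(LINT x|(gauss::'a measure). w \<bullet> x) = 0" "(LINT x|(gauss::'a measure). (w \<bullet> x)^2) = (norm w)^2" by auto
qed

lemma F_inner: "(LINT x|gauss. F x * (v \<bullet> x)) = c^2"
proof -
 have ii: "integrable gauss (%x. (x \<bullet> i) * F x)" for i
  using lin_growth_mult_integrable[OF lin_growth_inner[of i] lgF] by (simp add: inner_commute)
 have "F x * (v \<bullet> x) = (SUM i:Basis. (v \<bullet> i) * ((x \<bullet> i) * F x))" for x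
  by (subst euclidean_inner[of v x]) (simp add: sum_distrib_left mult_ac)
 then have "(LINT x|gauss. F x * (v \<bullet> x)) = (SUM i:Basis. (v \<bullet> i) * (LINT x|gauss. (x \<bullet> i) * F x))"
  using ii by (simp add: Lintegral_sum)
 also have "... = (SUM i:Basis. (v \<bullet> i) * (v \<bullet> i))" by (intro sum.cong refl) (simp add: coord_mean)
 also have "... = c^2" unfolding c_def power2_norm_eq_inner by (subst (3) euclidean_inner) simp
 finally show ?thesis .
qed

lemma inn_inn: "(LINT x|gauss. (v \<bullet> x) * (v \<bullet> x)) = c^2"
 using gauss_inner_moments(2)[of v] by (simp add: c_def power2_eq_square)

lemma h_mean: "(LINT x|gauss. h x) = 0"
 using lin_growth_integrable[OF lgF] lin_growth_integrable[OF lin_growth_inner[of v]] gauss_inner_moments(1)[of v]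
 by (simp add: h_def m_def)

lemma h_inner: "(LINT x|gauss. (v \<bullet> x) * h x) = 0"
proof -
 have "(LINT x|gauss. (v \<bullet> x) * h x) = (LINT x|gauss. F x * (v \<bullet> x) - (m * (v \<bullet> x) + (v \<bullet> x) * (v \<bullet> x)))"
  by (intro Lintegral_cong refl) (simp add: h_def algebra_simps)
 also have "... = c^2 - (m * 0 + c^2)"
  using lin_growth_mult_integrable[OF lgF lin_growth_inner[of v]] lin_growth_integrable[OF lin_growth_inner[of v]]
   lin_growth_mult_integrable[OF lin_growth_inner[of v] lin_growth_inner[of v]] gauss_inner_moments(1)[of v] inn_inn F_inner
  by (simp add: Lintegral_diff Lintegral_add)
 finally show ?thesis by simp
qed

lemma h_sq: "(LINT x|gauss. h x * h x) = R"
proof -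
 have "(LINT x|gauss. h x * h x) = (LINT x|gauss. F x * F x - (m * F x + F x * (v \<bullet> x)) - (m * h x + (v \<bullet> x) * h x))"
  by (intro Lintegral_cong refl) (simp add: h_def algebra_simps)
 also have "... = 1 - (m * m + c^2) - (m * 0 + 0)"
  using lin_growth_mult_integrable[OF lgF lgF] lin_growth_integrable[OF lgF]
   lin_growth_mult_integrable[OF lgF lin_growth_inner[of v]] lin_growth_integrable[OF lgh]
   lin_growth_mult_integrable[OF lin_growth_inner[of v] lgh] h_mean h_inner F_inner one
  by (simp add: Lintegral_diff Lintegral_add m_def[symmetric] power2_eq_square)
 finally show ?thesis by (simp add: R_def power2_eq_square)
qed

lemma R_nonneg: "R >= 0"
 unfolding h_sq[symmetric] by (rule integral_nonneg_AE) auto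

text \<open>\<open>gauss_second_poincare\<close> reads 2 (1 - m^2) <= c^2 + 1 + \<epsilon> here. The
  bound is not small unless m is, which forces the finer analysis of
  \<open>gap_bound\<close>.\<close>

lemma R_le: "R <= m\<^sup>2 + \<epsilon>"
proof -
 have "(SUM i:Basis. (LINT x|gauss. pd i F x)^2) = c^2"
 proof -
  have "c^2 = (SUM i:Basis. (v \<bullet> i) * (v \<bullet> i))" unfolding c_def power2_norm_eq_inner by (subst euclidean_inner) simp
  also have "... = (SUM i:Basis. (LINT x|gauss. pd i F x)^2)"
   by (intro sum.cong refl) (simp add: v_def inner_sum_left_Basis power2_eq_square)
  finally show ?thesis by simp
 qed
 then have "2 * (1 - m\<^sup>2) <= c\<^sup>2 + (1 + \<epsilon>)"
  using gauss_second_poincare[OF F] one small by (simp add: m_def)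
 then show ?thesis by (simp add: R_def)
qed

lemma c_le: "c^2 <= 1"
 using R_nonneg zero_le_power2[of m] unfolding R_def by linarith

text \<open>Integrated, \<open>fh_pointwise_const\<close> gives 2 m^2 - 1 + 2 \<mu> m^2 <= 0 by
  balance, and \<open>R_le\<close> bounds 1 - 2 m^2 by c^2 + \<epsilon>. The purpose is a lower
  bound for c once m is bounded below.\<close>

lemma zero_set_m:
 assumes Z: "measure gauss {x. F x = 0} >= \<mu>"
 shows "2 * \<mu> * m^2 <= c\<^sup>2 + \<epsilon>"
proof -
 let ?Z = "{x. F x = 0}"
 note [measurable] = nice_measurable[OF F]
 have Zm: "?Z : sets borel" by measurable
 interpret prob_space "gauss::'a measure" by (rule prob_space_gauss)
 have iZ: "integrable gauss (indicator ?Z :: 'a => real)" by (rule gauss_integrable_indicator[OF Zm])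
 define k where "k x = F x - m" for x
 have lgk: "lin_growth k"
  using lin_growth_add[OF lgF lin_growth_const[of "- m"]] by (simp add: k_def[abs_def])
 have "(LINT x|gauss. m^2 + 2 * m * k x - k x * k x + 2 * m^2 * indicator ?Z x) <= (LINT x|gauss. F x * \<bar>F x\<bar>)"
 proof (rule integral_mono)
  show "integrable gauss (%x. F x * \<bar>F x\<bar>)" by (rule lin_growth_mult_integrable[OF lgF lin_growth_abs[OF lgF]])
  show "integrable gauss (%x. m^2 + 2 * m * k x - k x * k x + 2 * m^2 * indicator ?Z x)"
   using iZ lin_growth_integrable[OF lgk] lin_growth_mult_integrable[OF lgk lgk] by auto
  show "m^2 + 2 * m * k x - k x * k x + 2 * m^2 * indicator ?Z x <= F x * \<bar>F x\<bar>" for x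
   using fh_pointwise_const[OF m0, of "k x"] by (simp add: k_def power2_eq_square indicator_def split: if_splits)
 qed
 also have "(LINT x|gauss. m^2 + 2 * m * k x - k x * k x + 2 * m^2 * indicator ?Z x)
   = m^2 + 2 * m * (LINT x|gauss. k x) - (LINT x|gauss. k x * k x) + 2 * m^2 * measure gauss ?Z"
  using iZ lin_growth_integrable[OF lgk] lin_growth_mult_integrable[OF lgk lgk] Zm by simp
 also have "(LINT x|gauss. k x) = 0" using lin_growth_integrable[OF lgF] by (simp add: k_def m_def)
 also have "(LINT x|gauss. k x * k x) = 1 - m\<^sup>2"
 proof -
  have "(LINT x|gauss. k x * k x) = (LINT x|gauss. F x * F x - 2 * m * F x + m * m)"
   by (intro Lintegral_cong refl) (simp add: k_def algebra_simps)
  also have "... = 1 - 2 * m * m + m * m"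
   using lin_growth_integrable[OF lgF] lin_growth_mult_integrable[OF lgF lgF] one
   by (simp add: m_def[symmetric] power2_eq_square)
  finally show ?thesis by (simp add: power2_eq_square)
 qed
 finally have "m^2 - (1 - m\<^sup>2) + 2 * m^2 * measure gauss ?Z <= 0" using bal by simp
 moreover have "m^2 * \<mu> <= m\<^sup>2 * measure gauss ?Z" using Z by (intro mult_left_mono) auto
 ultimately show ?thesis using R_le unfolding R_def by (simp add: mult_ac)
qed

lemma law:
 fixes g :: "real => real"
 assumes "c > 0" "g : borel_measurable borel"
 shows "(LINT x|gauss. g (v \<bullet> x / c)) = (LINT s|Normal. g s)"
  "integrable gauss (%x. g (v \<bullet> x / c)) \<longleftrightarrow> integrable Normal g"
 using gauss_law[of "(1 / c) *\<^sub>R v" g] assms by (auto simp: c_def)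

text \<open>If m is small then c >= 1/2, and an affine function of that slope is small only on a
  thin slab. Most of the zero set of F lies off the slab, where |h| equals the modulus of the affine
  part; so R, and with it m^2 + \<epsilon>, cannot be small.\<close>

lemma m_lower:
 assumes Z: "measure gauss {x. F x = 0} >= \<mu>" and mu: "0 < \<mu>" "\<mu> <= 1"
 shows "m^2 + \<epsilon> >= \<mu> ^ 3 / 32"
proof (cases "m^2 <= 1/8")
 case False
 have "\<mu> ^ 3 <= 1" using mu by (intro power_le_one) auto
 then show ?thesis using False eps by simp
next
 case True
 let ?Z = "{x. F x = 0}"
 note [measurable] = nice_measurable[OF F]
 have Zm: "?Z : sets borel" by measurable
 interpret prob_space "gauss::'a measure" by (rule prob_space_gauss)
 have c2: "c^2 >= 1/2" using R_le True eps unfolding R_def by linarith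
 have "c ~= 0" using c2 by auto
 then have c0: "c > 0" by (simp add: c_def)
 have ch: "c >= 1/2"
 proof (rule ccontr)
  assume "\<not> c >= 1/2"
  then have "c^2 < (1/2)^2" using c0 by (intro power_strict_mono) auto
  then show False using c2 by (simp add: power2_eq_square)
 qed
 \<comment> \<open>The slab has measure at most 2 \<tau> = \<mu> / 2, half of the zero set remains,
   and \<tau>^2 \<mu> / 2 = \<mu>^3 / 32.\<close>
 define \<tau> where "\<tau> = \<mu> / 4"
 define B where "B = {s. \<bar>m / c + s\<bar> < \<tau> / c}"
 have Bm[measurable]: "B : sets borel" unfolding B_def by measurable
 define p where "p = - m / c - \<tau> / c"
 define q where "q = - m / c + \<tau> / c"
 have pq: "p <= q" "q - p = 2 * (\<tau> / c)" using mu c0 by (auto simp: p_def q_def \<tau>_def)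
 have B_eq: "B = {p <..< q}"
  unfolding B_def p_def q_def by (auto simp: abs_less_iff)
 have "(LINT x|gauss. (indicator B (v \<bullet> x / c) :: real)) = (LINT s|Normal. indicator B s)"
  by (rule law(1)[OF c0, of "indicator B"]) measurable
 also have "... = (LINT s|lborel. nd s * indicator B s)"
  by (rule Normal_integral) measurable
 also have "... <= (LINT s|lborel. 1/2 * indicator B s)"
 proof (rule integral_mono)
  show "integrable lborel (%s. nd s * indicator B s)"
   using integrable_mult_indicator[OF _ integrable_normal_density[of 1 0], of B] Bm by (simp add: mult.commute)
  show "integrable lborel (%s. 1/2 * indicator B s :: real)"
   unfolding B_eq using pq by (intro integrable_mult_right integrable_real_indicator) auto
  have "2 <= sqrt (2 * pi)" using pi_ge_two real_sqrt_le_mono[of 4 "2 * pi"] by simp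
  then have k: "1 / sqrt (2 * pi) <= 1 / 2" by (intro divide_left_mono) auto
  have "nd s <= 1/2" for s
  proof -
   have "nd s <= 1 / sqrt (2 * pi) * 1"
    unfolding std_normal_density_def by (intro mult_left_mono) auto
   then show ?thesis using k by linarith
  qed
  then show "nd s * indicator B s <= 1/2 * indicator B s" for s
   by (intro mult_right_mono) auto
 qed
 also have "... = \<tau> / c" using pq by (simp add: B_eq)
 also have "... <= 2 * \<tau>"
 proof -
  have "\<tau> * 1 <= \<tau> * (2 * c)" using ch mu by (intro mult_left_mono) (auto simp: \<tau>_def)
  then show ?thesis using c0 by (simp add: divide_le_eq mult_ac)
 qed
 finally have sb: "(LINT x|gauss. (indicator B (v \<bullet> x / c) :: real)) <= 2 * \<tau>" .
 have bi: "integrable gauss (%x::'a. indicator B (v \<bullet> x / c) :: real)"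
  by (rule gauss_integrable_bounded[where C=1]) (auto simp: indicator_def)
 have zi: "integrable gauss (indicator ?Z :: 'a => real)" by (rule gauss_integrable_indicator[OF Zm])
 have "\<tau>^2 * (\<mu> - 2 * \<tau>) <= \<tau>\<^sup>2 * (measure gauss ?Z - (LINT x|gauss. indicator B (v \<bullet> x / c)))"
  using sb Z by (intro mult_left_mono) auto
 also have "... = (LINT x|gauss. \<tau>^2 * (indicator ?Z x - indicator B (v \<bullet> x / c)))"
  using zi bi Zm by simp
 also have "... <= (LINT x|gauss. h x * h x)"
 proof (rule integral_mono)
  show "integrable gauss (%x. \<tau>^2 * (indicator ?Z x - indicator B (v \<bullet> x / c)))"
   using zi bi by simp
  show "integrable gauss (%x. h x * h x)" by (rule lin_growth_mult_integrable[OF lgh lgh])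
  show "\<tau>^2 * (indicator ?Z x - indicator B (v \<bullet> x / c)) <= h x * h x" for x
  proof (cases "F x = 0 & v \<bullet> x / c \<notin> B")
   case True
   then have "\<tau> / c <= \<bar>m / c + v \<bullet> x / c\<bar>" by (simp add: B_def)
   also have "m / c + v \<bullet> x / c = - h x / c" using True c0 by (simp add: h_def field_simps)
   also have "\<bar>- h x / c\<bar> = \<bar>h x\<bar> / c" using c0 by simp
   finally have "\<tau> <= \<bar>h x\<bar>" using c0 by (simp add: divide_le_cancel)
   then have "\<tau>^2 <= \<bar>h x\<bar>\<^sup>2" using mu by (intro power_mono) (auto simp: \<tau>_def)
   then show ?thesis using True by (simp add: power2_eq_square)
  next
   case False
   then have "\<tau>^2 * (indicator ?Z x - indicator B (v \<bullet> x / c)) <= 0" by (auto simp: indicator_def)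
   also have "0 <= h x * h x" by simp
   finally show ?thesis .
  qed
 qed
 also have "... = R" by (rule h_sq)
 finally have "\<tau>^2 * (\<mu> - 2 * \<tau>) <= m\<^sup>2 + \<epsilon>" using R_le by linarith
 moreover have "\<tau>^2 * (\<mu> - 2 * \<tau>) = \<mu> ^ 3 / 32" by (simp add: \<tau>_def power2_eq_square power3_eq_cube)
 ultimately show ?thesis by simp
qed

text \<open>\<open>fh_pointwise\<close> is integrated with N the affine part of F. Since h is
  orthogonal to affine functions of v . x, only the component of |N| orthogonal to them meets h; its
  norm is c sqrt s. Cauchy-Schwarz with sqrt R <= m + sqrt \<epsilon> leaves exactly c^2 times the
  gap.\<close>

lemma gap_bound:
 assumes c0: "c > 0" and l: "0 <= l" "l <= 1"
 shows "c^2 * fhgap l (m / c) <= 3 * sqrt \<epsilon>"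
proof -
 define u where "u = m / c"
 have u0: "u >= 0" using m0 c0 by (simp add: u_def)
 have mu: "m = c * u" using c0 by (simp add: u_def)
 define N where "N x = m + v \<bullet> x" for x
 have lgN': "lin_growth N" using lgN by (simp add: N_def[abs_def])
 have Nx: "N x = c * (u + v \<bullet> x / c)" for x using c0 by (simp add: N_def u_def field_simps)
 define A where "A = nabs u"
 define e where "e = ncdf u"
 have EA: "(LINT x|gauss. \<bar>N x\<bar>) = c * A"
 proof -
  have "(LINT x|gauss. \<bar>N x\<bar>) = (LINT x|gauss. c * \<bar>u + v \<bullet> x / c\<bar>)" using c0 by (simp add: Nx abs_mult)
  also have "... = c * (LINT x|gauss. \<bar>u + v \<bullet> x / c\<bar>)" by simp
  also have "(LINT x|gauss. \<bar>u + v \<bullet> x / c\<bar>) = (LINT s|Normal. \<bar>u + s\<bar>)" by (rule law(1)[OF c0]) measurable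
  finally show ?thesis using Normal_abs_shift[OF u0] by (simp add: A_def)
 qed
 have Ee: "(LINT x|gauss. (v \<bullet> x) * \<bar>N x\<bar>) = c^2 * e"
 proof -
  have "(v \<bullet> x) * \<bar>N x\<bar> = c^2 * ((v \<bullet> x / c) * \<bar>u + v \<bullet> x / c\<bar>)" for x
   using c0 by (simp add: Nx abs_mult power2_eq_square)
  then have "(LINT x|gauss. (v \<bullet> x) * \<bar>N x\<bar>) = c^2 * (LINT x|gauss. (v \<bullet> x / c) * \<bar>u + v \<bullet> x / c\<bar>)" by simp
  also have "(LINT x|gauss. (v \<bullet> x / c) * \<bar>u + v \<bullet> x / c\<bar>) = (LINT s|Normal. s * \<bar>u + s\<bar>)"
   by (rule law(1)[OF c0]) measurable
  finally show ?thesis using Normal_id_abs_shift[OF u0] by (simp add: e_def)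
 qed
 have EN: "(LINT x|gauss. N x) = m"
  using lin_growth_integrable[OF lin_growth_inner[of v]] gauss_inner_moments(1)[of v] by (simp add: N_def)
 have EN2: "(LINT x|gauss. N x * N x) = m^2 + c^2"
 proof -
  have "(LINT x|gauss. N x * N x) = (LINT x|gauss. m * m + (2 * m * (v \<bullet> x) + (v \<bullet> x) * (v \<bullet> x)))"
   by (intro Lintegral_cong refl) (simp add: N_def algebra_simps)
  also have "... = m * m + (2 * m * 0 + c^2)"
   using lin_growth_integrable[OF lin_growth_inner[of v]]
    lin_growth_mult_integrable[OF lin_growth_inner[of v] lin_growth_inner[of v]] gauss_inner_moments(1)[of v] inn_inn
   by (simp add: Lintegral_add)
  finally show ?thesis by (simp add: power2_eq_square)
 qed
 note iN = lin_growth_integrable[OF lgN'] and iA = lin_growth_integrable[OF lin_growth_abs[OF lgN']]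
  and iNA = lin_growth_mult_integrable[OF lgN' lin_growth_abs[OF lgN']]
  and iNN = lin_growth_mult_integrable[OF lgN' lgN']
  and ilA = lin_growth_mult_integrable[OF lin_growth_inner[of v] lin_growth_abs[OF lgN']]
  and iM = lin_growth_mult_integrable[OF lin_growth_max[OF lgN'] lin_growth_max[OF lgN']]
  and iAh = lin_growth_mult_integrable[OF lin_growth_abs[OF lgN'] lgh]
  and iNh = lin_growth_mult_integrable[OF lgN' lgh]
  and ihh = lin_growth_mult_integrable[OF lgh lgh] and ih = lin_growth_integrable[OF lgh]
  and ilh = lin_growth_mult_integrable[OF lin_growth_inner[of v] lgh]
 define T where "T = u * A + e"
 have ENA: "(LINT x|gauss. N x * \<bar>N x\<bar>) = c^2 * T"
 proof -
  have "(LINT x|gauss. N x * \<bar>N x\<bar>) = (LINT x|gauss. m * \<bar>N x\<bar> + (v \<bullet> x) * \<bar>N x\<bar>)"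
   by (intro Lintegral_cong refl) (simp add: N_def algebra_simps)
  also have "... = m * (c * A) + c^2 * e" using iA ilA by (simp add: EA Ee)
  finally show ?thesis by (simp add: T_def mu power2_eq_square algebra_simps)
 qed
 have EM: "(LINT x|gauss. max 0 (N x) * max 0 (N x)) = (m^2 + c^2 + c^2 * T) / 2"
 proof -
  have "max 0 (N x) * max 0 (N x) = (N x * N x + N x * \<bar>N x\<bar>) / 2" for x by (simp add: max_def)
  then have "(LINT x|gauss. max 0 (N x) * max 0 (N x)) = (LINT x|gauss. (N x * N x + N x * \<bar>N x\<bar>) / 2)"
   by (intro Lintegral_cong refl)
  then show ?thesis using iNN iNA by (simp add: EN2 ENA)
 qed
 have ENh: "(LINT x|gauss. N x * h x) = 0"
 proof -
  have "(LINT x|gauss. N x * h x) = (LINT x|gauss. m * h x + (v \<bullet> x) * h x)"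
   by (intro Lintegral_cong refl) (simp add: N_def algebra_simps)
  then show ?thesis using ih ilh h_mean h_inner by simp
 qed
 define s where "s = 1 + u^2 - A\<^sup>2 - e\<^sup>2"
 \<comment> \<open>|N| minus its projection to the span of 1 and v . x; the projection coefficients
   are c A and e because v . x has variance c^2.\<close>
 define g where "g x = \<bar>N x\<bar> + (- (c * A) + (- e) * (v \<bullet> x))" for x
 have lgg: "lin_growth g" unfolding g_def[abs_def]
  by (intro lin_growth_add lin_growth_abs lgN' lin_growth_const lin_growth_cmult lin_growth_inner)
 have Egg: "(LINT x|gauss. g x * g x) = c^2 * s"
 proof -
  have "(LINT x|gauss. g x * g x) = (LINT x|gauss. (N x * N x + e^2 * ((v \<bullet> x) * (v \<bullet> x)) + (c * A)^2 + 2 * (c * A) * e * (v \<bullet> x))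
    - (2 * (c * A) * \<bar>N x\<bar> + 2 * e * ((v \<bullet> x) * \<bar>N x\<bar>)))"
  proof (intro Lintegral_cong refl)
   fix x
   have "\<bar>N x\<bar> * \<bar>N x\<bar> = N x * N x" by simp
   then show "g x * g x = (N x * N x + e^2 * ((v \<bullet> x) * (v \<bullet> x)) + (c * A)^2 + 2 * (c * A) * e * (v \<bullet> x))
    - (2 * (c * A) * \<bar>N x\<bar> + 2 * e * ((v \<bullet> x) * \<bar>N x\<bar>))"
    unfolding g_def by (simp add: algebra_simps power2_eq_square)
  qed
  also have "... = (m^2 + c^2 + e^2 * c^2 + (c * A)^2 + 2 * (c * A) * e * 0) - (2 * (c * A) * (c * A) + 2 * e * (c^2 * e))"
   using iNN iA ilA lin_growth_integrable[OF lin_growth_inner[of v]]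
    lin_growth_mult_integrable[OF lin_growth_inner[of v] lin_growth_inner[of v]]
   by (simp add: EA Ee EN2 inn_inn gauss_inner_moments(1)[of v] Lintegral_add Lintegral_diff)
  also have "... = c^2 * s" by (simp add: s_def mu power2_eq_square algebra_simps)
  finally show ?thesis .
 qed
 have s0: "s >= 0"
 proof -
  have "0 <= (LINT x|gauss. g x * g x)" by (rule integral_nonneg_AE) auto
  then show ?thesis using c0 by (simp add: Egg zero_le_mult_iff)
 qed
 have s1: "s <= 1"
 proof -
  have "m <= (LINT x|gauss. \<bar>N x\<bar>)" unfolding EN[symmetric] by (rule integral_mono[OF iN iA]) simp
  then have "u <= A" using c0 by (simp add: EA mu)
  then have "u^2 <= A\<^sup>2" using u0 by (intro power_mono) auto
  then show ?thesis unfolding s_def using zero_le_power2[of e] by linarith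
 qed
 have Egh: "(LINT x|gauss. \<bar>N x\<bar> * h x) = (LINT x|gauss. g x * h x)"
 proof -
  have "(LINT x|gauss. g x * h x) = (LINT x|gauss. \<bar>N x\<bar> * h x - (c * A * h x + e * ((v \<bullet> x) * h x)))"
   by (intro Lintegral_cong refl) (simp add: g_def algebra_simps)
  then show ?thesis using iAh ih ilh h_mean h_inner by simp
 qed
 have "(LINT x|gauss. g x * h x)^2 <= (c^2 * s) * R"
  using gauss_cauchy_schwarz[OF lgg lgh] by (simp add: Egg h_sq)
 then have "sqrt ((LINT x|gauss. g x * h x)^2) <= sqrt ((c^2 * s) * R)" by (rule real_sqrt_le_mono)
 then have CS: "\<bar>LINT x|gauss. \<bar>N x\<bar> * h x\<bar> <= c * sqrt s * sqrt R"
  using c0 by (simp add: Egh real_sqrt_mult)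
 have Fe: "F x = N x + h x" for x by (simp add: N_def h_def)
 have "(LINT x|gauss. (N x * \<bar>N x\<bar> - l\<^sup>2 / 2 * (max 0 (N x) * max 0 (N x))) + (2 - l) * (\<bar>N x\<bar> * h x) - l * (N x * h x) - h x * h x)
   <= (LINT x|gauss. F x * \<bar>F x\<bar>)"
 proof (rule integral_mono)
  show "integrable gauss (%x. (N x * \<bar>N x\<bar> - l\<^sup>2 / 2 * (max 0 (N x) * max 0 (N x))) + (2 - l) * (\<bar>N x\<bar> * h x) - l * (N x * h x) - h x * h x)"
   by (intro Lintegrable_diff Lintegrable_add integrable_mult_right iNA iM iAh iNh ihh)
  show "integrable gauss (%x. F x * \<bar>F x\<bar>)" by (rule lin_growth_mult_integrable[OF lgF lin_growth_abs[OF lgF]])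
  show "(N x * \<bar>N x\<bar> - l\<^sup>2 / 2 * (max 0 (N x) * max 0 (N x))) + (2 - l) * (\<bar>N x\<bar> * h x) - l * (N x * h x) - h x * h x <= F x * \<bar>F x\<bar>" for x
  proof -
   have e: "(n * a - k * (p * p)) + (2 - l) * (a * y) - l * (n * y) - y * y
    = n * a - k * p^2 + ((2 - l) * a - l * n) * y - y\<^sup>2" for n a k p y :: real
    by (simp add: power2_eq_square algebra_simps)
   show ?thesis
    unfolding e[of "N x" "\<bar>N x\<bar>" "l^2 / 2" "max 0 (N x)" "h x"] Fe[of x]
    by (rule fh_pointwise[OF l])
  qed
 qed
 also have "(LINT x|gauss. (N x * \<bar>N x\<bar> - l\<^sup>2 / 2 * (max 0 (N x) * max 0 (N x))) + (2 - l) * (\<bar>N x\<bar> * h x) - l * (N x * h x) - h x * h x)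
  = c^2 * T - l\<^sup>2 / 2 * ((m^2 + c^2 + c^2 * T) / 2) + (2 - l) * (LINT x|gauss. \<bar>N x\<bar> * h x) - l * 0 - R"
  using iNA iM iAh iNh ihh
  by (simp add: ENA EM ENh h_sq Lintegral_diff Lintegral_add)
 finally have main: "c^2 * T - l\<^sup>2 / 2 * ((m^2 + c^2 + c^2 * T) / 2) + (2 - l) * (LINT x|gauss. \<bar>N x\<bar> * h x) <= R"
  using bal by simp
 have "(2 - l) * (- (c * sqrt s * sqrt R)) <= (2 - l) * (LINT x|gauss. \<bar>N x\<bar> * h x)"
  using CS l by (intro mult_left_mono) auto
 then have main2: "c^2 * T - l\<^sup>2 / 2 * ((m^2 + c^2 + c^2 * T) / 2) <= R + (2 - l) * (c * sqrt s * sqrt R)"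
  using main by simp
 have sR: "sqrt R <= m + sqrt \<epsilon>"
 proof -
  have "sqrt R <= sqrt (m^2 + \<epsilon>)" using R_le by (rule real_sqrt_le_mono)
  also have "... <= sqrt (m^2) + sqrt \<epsilon>" using eps by (intro sqrt_add_le_add_sqrt) auto
  finally show ?thesis using m0 by simp
 qed
 have c1: "c <= 1" by (rule power2_le_imp_le) (use c_le in auto)
 \<comment> \<open>Of the final 3 sqrt \<epsilon>, two come from this term, as c, s <= 1, and one
   from R <= m^2 + \<epsilon> with \<epsilon> <= sqrt \<epsilon>.\<close>
 have "(2 - l) * (c * sqrt s * sqrt R) <= (2 - l) * (c * sqrt s * (m + sqrt \<epsilon>))"
  using sR l c0 s0 by (intro mult_left_mono) auto
 also have "... = (2 - l) * (c * sqrt s * m) + (2 - l) * (c * sqrt s * sqrt \<epsilon>)" by (simp add: distrib_left)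
 also have "(2 - l) * (c * sqrt s * sqrt \<epsilon>) <= 2 * (1 * 1 * sqrt \<epsilon>)"
  using l c0 c1 s0 s1 eps by (intro mult_mono) auto
 finally have "(2 - l) * (c * sqrt s * sqrt R) <= (2 - l) * (c * sqrt s * m) + 2 * sqrt \<epsilon>" by simp
 moreover have "\<epsilon> <= sqrt \<epsilon>"
 proof -
  have "sqrt \<epsilon> * sqrt \<epsilon> <= sqrt \<epsilon> * 1" using eps by (intro mult_left_mono) auto
  then show ?thesis using eps by simp
 qed
 ultimately have "c^2 * T - l\<^sup>2 / 2 * ((m^2 + c^2 + c^2 * T) / 2) - m\<^sup>2 - (2 - l) * (c * sqrt s * m) <= 3 * sqrt \<epsilon>"
  using main2 R_le by linarith
 also have "c^2 * T - l\<^sup>2 / 2 * ((m^2 + c^2 + c^2 * T) / 2) - m\<^sup>2 - (2 - l) * (c * sqrt s * m) = c^2 * fhgap l u"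
  unfolding fhgap_def A_def[symmetric] e_def[symmetric] T_def[symmetric] s_def[symmetric] mu
  by (simp add: power2_eq_square field_simps)
 finally show ?thesis by (simp add: u_def)
qed

end

lemma fhgap_continuous: "continuous_on {0<..} (fhgap l)"
proof -
 have "continuous_on {0<..} ncdf"
  by (rule DERIV_continuous_on[where D="%u. 2 * nd u"])
    (auto intro!: has_field_derivative_at_within ncdf_deriv)
 moreover have "continuous_on {0<..} nabs"
  by (rule DERIV_continuous_on[where D=ncdf]) (auto intro!: has_field_derivative_at_within nabs_deriv)
 ultimately show ?thesis unfolding fhgap_def[abs_def] by (intro continuous_intros) auto
qed

lemma fhgap_uniform:
 assumes "0 < a" "a <= b"
 shows "EX g>0. ALL u:{a..b}. g <= max (fhgap 0 u) (fhgap (1/4) u)"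
proof -
 have "continuous_on {a..b} (%u. max (fhgap 0 u) (fhgap (1/4) u))"
  by (intro continuous_on_max continuous_on_subset[OF fhgap_continuous]) (use assms in auto)
 then obtain x where x: "x : {a..b}" "ALL y:{a..b}. max (fhgap 0 x) (fhgap (1/4) x) <= max (fhgap 0 y) (fhgap (1/4) y)"
  using continuous_attains_inf[of "{a..b}" "%u. max (fhgap 0 u) (fhgap (1/4) u)"] assms by fastforce
 have "max (fhgap 0 x) (fhgap (1/4) x) > 0" using fhgap_pos_ex[of x] x(1) assms by auto
 then show ?thesis using x(2) by blast
qed

lemma friedland_hayman_normalized:
 assumes mu: "0 < \<mu>" "\<mu> <= 1"
 shows "EX \<epsilon>>0. ALL F::'a::euclidean_space => real. nice 4 F --> (LINT x|gauss. (F x)^2) = 1 -->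
   (LINT x|gauss. F x * \<bar>F x\<bar>) = 0 --> (LINT x|gauss. F x) >= 0 --> measure gauss {x. F x = 0} >= \<mu> -->
   1 + \<epsilon> <= (SUM i:Basis. LINT x|gauss. (pd i F x)^2)"
proof -
 \<comment> \<open>With \<epsilon> <= \<mu>^3 / 64, \<open>m_lower\<close> leaves m >= q0, and then
   \<open>zero_set_m\<close> leaves c >= c0. As m, c <= 1, the quotient m / c stays in the compact
   interval [q0, 1 / c0], where the gap has a positive minimum.\<close>
 define q0 where "q0 = sqrt (\<mu> ^ 3 / 64)"
 have q0: "q0 > 0" "q0^2 = \<mu> ^ 3 / 64" using mu by (auto simp: q0_def)
 define c0 where "c0 = sqrt (\<mu> * q0^2)"
 have c0: "c0 > 0" "c0^2 = \<mu> * q0^2" using mu q0(1) by (auto simp: c0_def)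
 have q1: "q0 <= 1 / c0"
 proof -
  have "\<mu> ^ 3 <= 1" using mu by (intro power_le_one) auto
  then have a: "q0^2 <= 1" using q0(2) by simp
  then have "q0 <= 1" by (intro power2_le_imp_le[of q0 1]) auto
  moreover have "c0^2 <= 1" using a c0(2) mu by (simp add: mult_le_one)
  then have "c0 <= 1" by (intro power2_le_imp_le[of c0 1]) auto
  then have "1 <= 1 / c0" using c0 by simp
  ultimately show ?thesis by linarith
 qed
 obtain g where g: "g > 0" "ALL u:{q0..1 / c0}. g <= max (fhgap 0 u) (fhgap (1/4) u)"
  using fhgap_uniform[OF q0(1) q1] by blast
 define \<epsilon> where "\<epsilon> = min (1/4) (min (\<mu> ^ 3 / 64) (min (\<mu> * q0^2) ((c0^2 * g / 4)^2)))"
 have e0: "\<epsilon> > 0" unfolding \<epsilon>_def using mu q0 c0 g by auto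
 have e1: "\<epsilon> <= 1/4" "\<epsilon> <= \<mu> ^ 3 / 64" "\<epsilon> <= \<mu> * q0^2" "\<epsilon> <= (c0^2 * g / 4)\<^sup>2"
  unfolding \<epsilon>_def by auto
 have "1 + \<epsilon> <= (SUM i:Basis. LINT x|gauss. (pd i F x)^2)"
  if FF: "nice 4 F" "(LINT x|gauss. (F x)^2) = 1" "(LINT x|gauss. F x * \<bar>F x\<bar>) = 0"
   "(LINT x|gauss. F x) >= 0" "measure gauss {x. F x = 0} >= \<mu>" for F :: "'a => real"
 proof (rule ccontr)
  assume "\<not> ?thesis"
  then interpret fh_setting F \<epsilon> using FF e0 e1(1) by unfold_locales auto
  have "m^2 >= q0\<^sup>2" using m_lower[OF FF(5) mu] e1(2) unfolding q0(2) by linarith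
  have mm: "q0 <= m" by (rule power2_le_imp_le[OF \<open>m\<^sup>2 >= q0\<^sup>2\<close> m0])
  have "\<mu> * q0^2 <= \<mu> * m^2" using \<open>m\<^sup>2 >= q0\<^sup>2\<close> mu by (intro mult_left_mono) auto
  then have "c0^2 <= c\<^sup>2" using zero_set_m[OF FF(5)] e1(3) c0(2) by linarith
  then have cc: "c0 <= c" by (intro power2_le_imp_le[of c0 c]) (auto simp: c_def)
  have c1: "c <= 1" by (rule power2_le_imp_le) (use c_le in auto)
  have q1: "m <= 1"
  proof (rule power2_le_imp_le)
   show "m^2 <= 1\<^sup>2" using R_nonneg zero_le_power2[of c] unfolding R_def one_power2 by linarith
  qed simp
  have cp: "c > 0" using cc c0 by linarith
  have "m / c : {q0..1 / c0}"
  proof -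
   have "q0 * c <= m * 1" using mm c1 q0 cp by (intro mult_mono) auto
   moreover have "m / c <= 1 / c0" by (rule frac_le) (use q1 cc c0 in simp_all)
   ultimately show ?thesis using cp by (simp add: le_divide_eq)
  qed
  then have "g <= max (fhgap 0 (m / c)) (fhgap (1/4) (m / c))" using g(2) by blast
  then have "g <= fhgap 0 (m / c) \<or> g <= fhgap (1/4) (m / c)" by linarith
  then have "EX l. 0 <= l & l <= 1 & g <= fhgap l (m / c)"
  proof
   assume "g <= fhgap 0 (m / c)"
   then show ?thesis by (intro exI[of _ 0]) simp
  next
   assume "g <= fhgap (1/4) (m / c)"
   then show ?thesis by (intro exI[of _ "1/4"]) simp
  qed
  then obtain l where l: "0 <= l" "l <= 1" "g <= fhgap l (m / c)" by blast
  have "c0^2 * g <= c\<^sup>2 * fhgap l (m / c)"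
   using \<open>c0\<^sup>2 <= c\<^sup>2\<close> l(3) g(1) by (intro mult_mono) auto
  also have "... <= 3 * sqrt \<epsilon>" by (rule gap_bound[OF cp l(1,2)])
  also have "sqrt \<epsilon> <= c0\<^sup>2 * g / 4"
   using real_sqrt_le_mono[OF e1(4)] g(1) by simp
  finally have "c0^2 * g <= 3 * (c0^2 * g / 4)" by simp
  moreover have "c0^2 * g > 0" using c0(1) g(1) by simp
  ultimately show False by linarith
 qed
 then show ?thesis using e0 by (intro exI[of _ \<epsilon>]) blast
qed

theorem friedland_hayman_stable:
 assumes mu: "0 < \<mu>" "\<mu> <= 1"
 shows "EX \<epsilon>>0. ALL F::'a::euclidean_space => real. nice 4 F -->
   (LINT x|gauss. F x * \<bar>F x\<bar>) = 0 --> measure gauss {x. F x = 0} >= \<mu> -->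
   (1 + \<epsilon>) * (LINT x|gauss. (F x)^2) <= (SUM i:Basis. LINT x|gauss. (pd i F x)^2)"
proof -
 obtain \<epsilon> where e: "\<epsilon> > 0" and H: "!!F::'a => real. nice 4 F ==> (LINT x|gauss. (F x)^2) = 1 ==>
   (LINT x|gauss. F x * \<bar>F x\<bar>) = 0 ==> (LINT x|gauss. F x) >= 0 ==> measure gauss {x. F x = 0} >= \<mu> ==>
   1 + \<epsilon> <= (SUM i:Basis. LINT x|gauss. (pd i F x)^2)"
  using friedland_hayman_normalized[OF mu, where 'a='a] by blast
 have "(1 + \<epsilon>) * (LINT x|gauss. (F x)^2) <= (SUM i:Basis. LINT x|gauss. (pd i F x)^2)"
  if F: "nice 4 F" "(LINT x|gauss. F x * \<bar>F x\<bar>) = 0" "measure gauss {x. F x = 0} >= \<mu>" for F :: "'a => real"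
 proof -
  define W where "W = (LINT x|gauss. (F x)^2)"
  have W0: "W >= 0" unfolding W_def by (rule integral_nonneg_AE) auto
  have D0: "(SUM i:Basis. LINT x|gauss. (pd i F x)^2) >= 0"
   by (intro sum_nonneg integral_nonneg_AE) auto
  show ?thesis
  proof (cases "W = 0")
   case True
   then show ?thesis using D0 by (simp add: W_def)
  next
   case False
   \<comment> \<open>Normalizes the L^2 norm and the sign of the mean; the other hypotheses are
     invariant under nonzero multiples.\<close>
   define a where "a = (if (LINT x|gauss. F x) >= 0 then 1 else -1) / sqrt W"
   have a: "a^2 = 1 / W" "a ~= 0" "a * (LINT x|gauss. F x) >= 0"
    using False W0 by (simp_all add: a_def power_divide zero_le_divide_iff zero_le_mult_iff)
   define G where "G x = a * F x + 0 * F x" for x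
   have G: "nice 4 G" unfolding G_def[abs_def] by (rule nice_add[OF F(1) F(1)])
   have Ga: "G x = a * F x" for x by (simp add: G_def)
   have "1 + \<epsilon> <= (SUM i:Basis. LINT x|gauss. (pd i G x)^2)"
   proof (rule H[OF G])
    show "(LINT x|gauss. (G x)^2) = 1" using a(1) False by (simp add: Ga power_mult_distrib W_def)
    have "G x * \<bar>G x\<bar> = (a * \<bar>a\<bar>) * (F x * \<bar>F x\<bar>)" for x by (simp add: Ga abs_mult)
    then show "(LINT x|gauss. G x * \<bar>G x\<bar>) = 0" using F(2) by simp
    show "(LINT x|gauss. G x) >= 0" using a(3) by (simp add: Ga)
    show "measure gauss {x. G x = 0} >= \<mu>" using F(3) a(2) by (simp add: Ga)
   qed
   also have "... = (SUM i:Basis. a^2 * (LINT x|gauss. (pd i F x)^2))"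
   proof (intro sum.cong refl)
    fix i :: 'a
    have d: "F differentiable (at x)" for x using nice_differentiable[of 3 F] F(1) by simp
    have "pd i G x = a * pd i F x" for x
     using partial_deriv_add[OF d d, of i a 0 x] by (simp add: G_def[abs_def])
    then show "(LINT x|gauss. (pd i G x)^2) = a^2 * (LINT x|gauss. (pd i F x)^2)"
     by (simp add: power_mult_distrib)
   qed
   also have "... = (SUM i:Basis. LINT x|gauss. (pd i F x)^2) / W"
    unfolding a(1) by (simp add: sum_divide_distrib)
   finally have "1 + \<epsilon> <= (SUM i:Basis. LINT x|gauss. (pd i F x)^2) / W" .
   moreover have "W > 0" using False W0 by simp
   ultimately have "(1 + \<epsilon>) * W <= (SUM i:Basis. LINT x|gauss. (pd i F x)^2)"
    by (rule pos_le_divide_eq[THEN iffD1, rotated])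
   then show ?thesis unfolding W_def .
  qed
 qed
 then show ?thesis using e by blast
qed

section \<open>Monotonicity formula\<close>

definition dilsq :: "('a::euclidean_space => real) => real => real" where
 "dilsq f s = (LINT y|gauss. (f (s *\<^sub>R y))^2)"

definition dilenergy :: "('a::euclidean_space => real) => real => real" where
 "dilenergy f s = (SUM i:Basis. LINT y|gauss. (pd i f (s *\<^sub>R y))^2)"

lemma nice_mult: "nice k F ==> nice k G ==> nice k (%x. F x * G x)"
 unfolding nice_def using Ck_on_mult[OF open_UNIV] mult_zero_left by metis

lemma nice_dil_measurable:
 assumes "nice k G" shows "(%y. G (s *\<^sub>R y)) : borel_measurable borel"
proof -
 note [measurable] = nice_measurable[OF assms]
 show ?thesis by measurable
qed

lemma nice_dil_integrable:
 fixes G :: "'a::euclidean_space => real"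
 assumes "nice k G" shows "integrable gauss (%y. G (s *\<^sub>R y))"
proof -
 obtain C where "ALL x. \<bar>G x\<bar> <= C" using nice_bounded[OF assms] by blast
 then show ?thesis by (intro gauss_integrable_bounded[of _ C] nice_dil_measurable[OF assms]) auto
qed

lemma laplacian_nice:
 assumes "nice 4 f" shows "nice 2 (laplacian f)"
proof -
 obtain R where R: "ALL x. norm x > R --> f x = 0" using assms by (auto simp: nice_def)
 have "pd i (pd i f) x = 0" if "norm x > R" for i x
  by (intro partial_deriv_zero_outside[of R] that) (use R partial_deriv_zero_outside[of R f] in auto)
 then have "ALL x. norm x > R --> laplacian f x = 0" unfolding laplacian_def by simp
 moreover have "Ck_on 2 UNIV (laplacian f)"
  by (rule Ck_on_laplacian[OF open_UNIV]) (use assms in \<open>simp add: nice_def\<close>)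
 ultimately show ?thesis unfolding nice_def by blast
qed

text \<open>Differentiating E f (s X)^2 gives E (X . grad (f^2) (s X)). Stein's identity turns this
  into s E (Laplacian of f^2) (s X), and the Laplacian of f^2 is 2 |grad f|^2 + 2 f times that of
  f.\<close>

lemma dilsq_deriv:
 fixes f :: "'a::euclidean_space => real"
 assumes f: "nice 4 f"
 shows "(dilsq f has_real_derivative
  (2 * s) * (dilenergy f s + (LINT y|gauss. f (s *\<^sub>R y) * laplacian f (s *\<^sub>R y)))) (at s)"
proof -
 define F where "F x = f x * f x" for x
 have F: "nice 4 F" unfolding F_def[abs_def] by (rule nice_mult[OF f f])
 have F3: "nice (Suc 3) F" using F by simp
 have F2: "nice (Suc 2) (pd i F)" if "i : Basis" for i
  using nice_partial[OF F3 that] by (simp add: eval_nat_numeral)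
 have f3: "nice 3 (pd i f)" if "i : Basis" for i
  using nice_partial[of 3 f i] f that by simp
 obtain C where C: "C >= 0" "ALL i:Basis. ALL x. \<bar>pd i F x\<bar> <= C"
  using nice_partial_bound[OF F3] by blast
 have dF: "F differentiable (at x)" for x by (rule nice_differentiable[OF F3])
 define F' where "F' s y = (SUM i:Basis. (y \<bullet> i) * pd i F (s *\<^sub>R y))" for s :: real and y :: 'a
 define K where "K = real DIM('a) * C"
 have bd: "\<bar>F' s y\<bar> <= K + K * (norm y)^2" for s y
 proof -
  have "\<bar>F' s y\<bar> <= (SUM i:(Basis::'a set). norm y * C)" unfolding F'_def
  proof (rule order_trans[OF sum_abs], rule sum_mono)
   fix i :: 'a assume i: "i : Basis"
   have "\<bar>pd i F (s *\<^sub>R y)\<bar> <= C" using C(2) i by blast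
   then show "\<bar>(y \<bullet> i) * pd i F (s *\<^sub>R y)\<bar> <= norm y * C"
    unfolding abs_mult using Basis_le_norm[OF i, of y] C(1) by (intro mult_mono) auto
  qed
  also have "... = norm y * K" by (simp add: K_def)
  also have "... <= (1 + (norm y)^2) * K"
by (rule mult_right_mono) (use le_one_plus_sq[of "norm y"] in \<open>simp_all add: K_def C\<close>)
  finally show ?thesis by (simp add: algebra_simps)
 qed
 have "((%s. LINT y|gauss. F (s *\<^sub>R y)) has_real_derivative (LINT y|gauss. F' s y)) (at s)"
 proof (rule DERIV_integral_dominated(2)[of "s - 1" s "s + 1" gauss "%s y. F (s *\<^sub>R y)" F' "%y. K + K * (norm y)^2"])
  show "((%s. F (s *\<^sub>R x)) has_real_derivative F' r x) (at r)" for r x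
   using has_real_derivative_line[of F 0 r x] dF unfolding F'_def by simp
  show "integrable gauss (%y::'a. K + K * (norm y)^2)"
   by (intro Lintegrable_add integrable_mult_right gauss_integrable_norm_sq gauss_integrable_const)
  show "integrable gauss (%y. F (r *\<^sub>R y))" for r by (rule nice_dil_integrable[OF F])
 qed (use bd in auto)
 also have "(LINT y|gauss. F' s y) = (SUM i:Basis. s * (LINT y|gauss. pd i (pd i F) (s *\<^sub>R y)))"
 proof -
  have st: "integrable gauss (%y. (y \<bullet> i) * pd i F (s *\<^sub>R y))"
   "(LINT y|gauss. (y \<bullet> i) * pd i F (s *\<^sub>R y)) = s * (LINT y|gauss. pd i (pd i F) (s *\<^sub>R y))"
   if i: "i : Basis" for i
  proof -
   obtain C2 where C2: "ALL x. \<bar>pd i (pd i F) x\<bar> <= C2"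
    using nice_bounded[OF nice_partial[OF F2[OF i] i]] by blast
   have d: "((%t. pd i F (s *\<^sub>R (x + t *\<^sub>R i))) has_real_derivative
     s * pd i (pd i F) (s *\<^sub>R x)) (at 0)" for x
    using has_real_derivative_axis[OF i nice_differentiable[OF F2[OF i]], of "s *\<^sub>R x" s 0]
    by (simp add: scaleR_add_right mult.commute)
   have b1: "\<bar>pd i F (s *\<^sub>R x)\<bar> <= C" for x using C(2) i by blast
   have b2: "\<bar>s * pd i (pd i F) (s *\<^sub>R x)\<bar> <= \<bar>s\<bar> * C2" for x
    unfolding abs_mult using C2 by (intro mult_left_mono) auto
   show "integrable gauss (%y. (y \<bullet> i) * pd i F (s *\<^sub>R y))"
    by (rule gauss_stein(1)[OF nice_dil_measurable[OF F2[OF i]] i d b1 b2])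
   show "(LINT y|gauss. (y \<bullet> i) * pd i F (s *\<^sub>R y)) = s * (LINT y|gauss. pd i (pd i F) (s *\<^sub>R y))"
    using gauss_stein(3)[OF nice_dil_measurable[OF F2[OF i]] i d b1 b2] by simp
  qed
  then show ?thesis unfolding F'_def by (simp add: Lintegral_sum)
 qed
 also have "... = s * (SUM i:Basis. LINT y|gauss. pd i (pd i F) (s *\<^sub>R y))"
  by (simp add: sum_distrib_left)
 also have "(SUM i:Basis. LINT y|gauss. pd i (pd i F) (s *\<^sub>R y)) = (LINT y|gauss. laplacian F (s *\<^sub>R y))"
  unfolding laplacian_def
  by (rule Lintegral_sum[symmetric]) (rule nice_dil_integrable[OF nice_partial[OF F2]])
 also have "(LINT y|gauss. laplacian F (s *\<^sub>R y)) = (LINT y|gauss. 2 * ((SUM i:Basis. (pd i f (s *\<^sub>R y))^2) + f (s *\<^sub>R y) * laplacian f (s *\<^sub>R y)))"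
 proof (rule Lintegral_cong[OF refl])
  fix y :: 'a
  have C2: "Ck_on 2 UNIV f" using nice_Ck[OF nice_le[OF f, of 2]] by simp
  show "laplacian F (s *\<^sub>R y) = 2 * ((SUM i:Basis. (pd i f (s *\<^sub>R y))^2) + f (s *\<^sub>R y) * laplacian f (s *\<^sub>R y))"
   unfolding F_def[abs_def] laplacian_mult[OF open_UNIV UNIV_I C2 C2] by (simp add: power2_eq_square)
 qed
 also have "... = 2 * (dilenergy f s + (LINT y|gauss. f (s *\<^sub>R y) * laplacian f (s *\<^sub>R y)))"
 proof -
  have i1: "integrable gauss (%y. (pd i f (s *\<^sub>R y))^2)" if "i : Basis" for i
   using nice_dil_integrable[OF nice_mult[OF f3[OF that] f3[OF that]]] by (simp add: power2_eq_square)
  have i2: "integrable gauss (%y. f (s *\<^sub>R y) * laplacian f (s *\<^sub>R y))"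
   by (rule nice_dil_integrable[OF nice_mult[OF nice_le[OF f, of 2] laplacian_nice[OF f]]]) simp
  show ?thesis using i1 i2
   by (simp add: dilenergy_def Lintegral_sum Lintegral_add)
 qed
 also have "(%s. LINT y|gauss. F (s *\<^sub>R y)) = dilsq f" by (rule ext) (simp add: dilsq_def F_def power2_eq_square)
 finally show ?thesis by (simp add: mult_ac)
qed

text \<open>\<eta> measures the failure of subharmonicity caused by the cutoff. It costs at most 2
  s^3 \<eta> d in the derivative, hence \<eta> d s^4 / 2 in the function.\<close>

lemma dilsq_bounds:
 fixes f :: "'a::euclidean_space => real"
 assumes f: "nice 4 f" and lap: "ALL x. f x * laplacian f x >= - \<eta> * (norm x)^2"
  and L: "ALL x. \<bar>f x\<bar> <= L * norm x" and c: "dilsq f 1 >= c" and e0: "\<eta> >= 0"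
 shows "dilsq f s <= L\<^sup>2 * s^2 * DIM('a)"
  and "s > 0 ==> EX N'. (dilsq f has_real_derivative N') (at s) & N' >= 2 * s * dilenergy f s - 2 * s ^ 3 * \<eta> * DIM('a)"
  and "s >= 1 ==> dilsq f s >= c - \<eta> * DIM('a) * s ^ 4 / 2"
proof -
 have nsq: "(LINT y|(gauss::'a measure). k * (norm (s *\<^sub>R y))^2) = k * s^2 * DIM('a)"
   "integrable gauss (%y::'a. k * (norm (s *\<^sub>R y))^2)" for k s
  by (simp_all add: power_mult_distrib gauss_integral_norm_sq gauss_integrable_norm_sq)
 show "dilsq f s <= L\<^sup>2 * s^2 * DIM('a)"
 proof -
  have "dilsq f s <= (LINT y|(gauss::'a measure). L^2 * (norm (s *\<^sub>R y))^2)" unfolding dilsq_def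
  proof (rule integral_mono)
   show "integrable gauss (%y. (f (s *\<^sub>R y))^2)"
    using nice_dil_integrable[OF nice_mult[OF f f]] by (simp add: power2_eq_square)
   show "(f (s *\<^sub>R y))^2 <= L\<^sup>2 * (norm (s *\<^sub>R y))^2" for y
    using power_mono[OF L[rule_format], of "s *\<^sub>R y" 2] by (simp add: power_mult_distrib)
  qed (rule nsq)
  then show ?thesis unfolding nsq .
 qed
 have D: "EX N'. (dilsq f has_real_derivative N') (at s) & N' >= 2 * s * dilenergy f s - 2 * s ^ 3 * \<eta> * DIM('a)" if s: "s > 0" for s
 proof -
  define J where "J = (LINT y|gauss. f (s *\<^sub>R y) * laplacian f (s *\<^sub>R y))"
  have "(LINT y|(gauss::'a measure). - \<eta> * (norm (s *\<^sub>R y))^2) <= J" unfolding J_def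
  proof (rule integral_mono)
   show "integrable gauss (%y. f (s *\<^sub>R y) * laplacian f (s *\<^sub>R y))"
    by (rule nice_dil_integrable[OF nice_mult[OF nice_le[OF f, of 2] laplacian_nice[OF f]]]) simp
   show "- \<eta> * (norm (s *\<^sub>R y))^2 <= f (s *\<^sub>R y) * laplacian f (s *\<^sub>R y)" for y using lap by blast
  qed (rule nsq)
  then have "- (\<eta> * s^2 * DIM('a)) <= J" unfolding nsq by simp
  then have "2 * s * (- (\<eta> * s^2 * DIM('a))) <= 2 * s * J" using s by (intro mult_left_mono) auto
  then have "(2 * s) * (dilenergy f s + J) >= 2 * s * dilenergy f s - 2 * s ^ 3 * \<eta> * DIM('a)"
   by (simp add: power2_eq_square power3_eq_cube algebra_simps)
  then show ?thesis using dilsq_deriv[OF f, of s] unfolding J_def by blast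
 qed
 then show "s > 0 ==> EX N'. (dilsq f has_real_derivative N') (at s) & N' >= 2 * s * dilenergy f s - 2 * s ^ 3 * \<eta> * DIM('a)"
  by blast
 assume s: "s >= 1"
 show "dilsq f s >= c - \<eta> * DIM('a) * s ^ 4 / 2"
 proof -
  have "dilsq f 1 + \<eta> * DIM('a) * 1 ^ 4 / 2 <= dilsq f s + \<eta> * DIM('a) * s ^ 4 / 2"
  proof (rule DERIV_nonneg_imp_nondecreasing[of 1 s "%s. dilsq f s + \<eta> * DIM('a) * s ^ 4 / 2"])
   fix r :: real assume r: "1 <= r" "r <= s"
   obtain N' where N: "(dilsq f has_real_derivative N') (at r)" "N' >= 2 * r * dilenergy f r - 2 * r ^ 3 * \<eta> * DIM('a)"
    using D[of r] r by auto
   have "dilenergy f r >= 0" unfolding dilenergy_def by (intro sum_nonneg integral_nonneg_AE) auto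
   then have "2 * r * dilenergy f r >= 0" using r by simp
   then have "N' + 2 * \<eta> * DIM('a) * r ^ 3 >= 0" using N(2) by (simp add: mult_ac)
   moreover have "((%s. dilsq f s + \<eta> * DIM('a) * s ^ 4 / 2) has_real_derivative N' + 2 * \<eta> * DIM('a) * r ^ 3) (at r)"
    by (auto intro!: derivative_eq_intros N(1))
   ultimately show "EX y. ((%s. dilsq f s + \<eta> * DIM('a) * s ^ 4 / 2) has_real_derivative y) (at r) & 0 <= y" by blast
  qed (rule s)
  moreover have "0 <= \<eta> * DIM('a) * 1 ^ 4 / 2" using e0 by simp
  ultimately show ?thesis using c by linarith
 qed
qed

lemma partial_deriv_at_zero_min:
 fixes f :: "'a::euclidean_space => real"
 assumes "f differentiable (at x)" "!!y. f y >= 0" "f x = 0"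
 shows "pd i f x = 0"
proof -
 have d: "(f has_derivative frechet_derivative f (at x)) (at x)" using assms(1) by (simp add: frechet_derivative_works)
 have "frechet_derivative f (at x) = (%h. 0)"
  by (rule differential_zero_maxmin[of x UNIV f]) (use d assms in auto)
 then show ?thesis by (simp add: partial_deriv_def)
qed

text \<open>The stable inequality is applied to a f1 - b f2 at scale s, each piece normalized to
  norm 1. Disjoint supports make it balanced and split its energy into the two quotients; the 2 on
  the left is its squared norm.\<close>

lemma acf_separation:
 assumes \<epsilon>: "\<epsilon> > 0" and FH: "ALL F::'a::euclidean_space => real. nice 4 F -->
   (LINT x|gauss. F x * \<bar>F x\<bar>) = 0 --> measure gauss {x. F x = 0} >= \<mu> -->
   (1 + \<epsilon>) * (LINT x|gauss. (F x)^2) <= (SUM i:Basis. LINT x|gauss. (pd i F x)^2)"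
  and f: "nice 4 f1" "nice 4 (f2::'a => real)" "ALL x. f1 x >= 0" "ALL x. f2 x >= 0" "ALL x. f1 x = 0 \<or> f2 x = 0"
  and z: "measure gauss {y. f1 (s *\<^sub>R y) = 0 & f2 (s *\<^sub>R y) = 0} >= \<mu>"
  and N: "dilsq f1 s > 0" "dilsq f2 s > 0"
 shows "2 * (1 + \<epsilon>) <= s\<^sup>2 * (dilenergy f1 s / dilsq f1 s + dilenergy f2 s / dilsq f2 s)"
proof -
 define a where "a = 1 / sqrt (dilsq f1 s)"
 define b where "b = 1 / sqrt (dilsq f2 s)"
 have ab: "a > 0" "b > 0" "a^2 = 1 / dilsq f1 s" "b^2 = 1 / dilsq f2 s"
  using N by (auto simp: a_def b_def power_divide)
 define H where "H x = a * f1 x + (- b) * f2 x" for x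
 have H: "nice 4 H" unfolding H_def[abs_def] by (rule nice_add[OF f(1,2)])
 define F where "F x = H (0 + s *\<^sub>R x)" for x
 have sq: "integrable gauss (%y. (f1 (s *\<^sub>R y))^2)" "integrable gauss (%y. (f2 (s *\<^sub>R y))^2)"
  using nice_dil_integrable[OF nice_mult[OF f(1) f(1)]] nice_dil_integrable[OF nice_mult[OF f(2) f(2)]]
  by (simp_all add: power2_eq_square)
 have s0: "s ~= 0"
 proof
  assume "s = 0"
  then have "dilsq f1 s = (f1 0)^2" "dilsq f2 s = (f2 0)^2" by (simp_all add: dilsq_def gauss_integral_const)
  then show False using N f(5) by auto
 qed
 have F: "nice 4 F"
 proof -
  obtain R where R: "ALL x. norm x > R --> H x = 0" using H by (auto simp: nice_def)
  have "F x = 0" if "norm x > R / \<bar>s\<bar>" for x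
   using R that s0 by (simp add: F_def divide_less_eq mult.commute)
  moreover have "Ck_on 4 UNIV F" unfolding F_def[abs_def]
   by (rule Ck_on_affine_arg[OF open_UNIV open_UNIV nice_Ck[OF H]]) auto
  ultimately show ?thesis unfolding nice_def by blast
 qed
 have Fb: "F x * \<bar>F x\<bar> = a^2 * (f1 (s *\<^sub>R x))^2 - b\<^sup>2 * (f2 (s *\<^sub>R x))^2"
  "(F x)^2 = a^2 * (f1 (s *\<^sub>R x))^2 + b^2 * (f2 (s *\<^sub>R x))^2" for x
 proof -
  have "f1 (s *\<^sub>R x) = 0 \<or> f2 (s *\<^sub>R x) = 0" using f(5) by blast
  moreover have "f1 (s *\<^sub>R x) >= 0" "f2 (s *\<^sub>R x) >= 0" using f(3,4) by auto
  ultimately show "F x * \<bar>F x\<bar> = a^2 * (f1 (s *\<^sub>R x))^2 - b\<^sup>2 * (f2 (s *\<^sub>R x))^2"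
   "(F x)^2 = a^2 * (f1 (s *\<^sub>R x))^2 + b^2 * (f2 (s *\<^sub>R x))^2"
   using ab(1,2) by (auto simp: F_def H_def abs_mult power2_eq_square)
 qed
 have "(LINT x|gauss. F x * \<bar>F x\<bar>) = a^2 * dilsq f1 s - b\<^sup>2 * dilsq f2 s"
  unfolding Fb dilsq_def using sq by simp
 then have bal: "(LINT x|gauss. F x * \<bar>F x\<bar>) = 0" using N by (simp add: ab)
 have "(LINT x|gauss. (F x)^2) = a^2 * dilsq f1 s + b^2 * dilsq f2 s"
  unfolding Fb dilsq_def using sq by simp
 then have two: "(LINT x|gauss. (F x)^2) = 2" using N by (simp add: ab)
 have "{x. F x = 0} = {y. f1 (s *\<^sub>R y) = 0 & f2 (s *\<^sub>R y) = 0}"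
 proof (intro Collect_cong)
  fix x
  have "f1 (s *\<^sub>R x) = 0 \<or> f2 (s *\<^sub>R x) = 0" using f(5) by blast
  then show "F x = 0 \<longleftrightarrow> f1 (s *\<^sub>R x) = 0 & f2 (s *\<^sub>R x) = 0" using ab(1,2) by (auto simp: F_def H_def)
 qed
 then have "(1 + \<epsilon>) * 2 <= (SUM i:Basis. LINT x|gauss. (pd i F x)^2)"
  using FH[rule_format, OF F bal] z two by simp
 also have "... = (SUM i:Basis. LINT x|gauss. (s^2 * a^2) * (pd i f1 (s *\<^sub>R x))^2 + (s^2 * b^2) * (pd i f2 (s *\<^sub>R x))^2)"
 proof (intro sum.cong refl Lintegral_cong)
  fix i x :: 'a assume i: "i : Basis"
  have d: "f1 differentiable (at y)" "f2 differentiable (at y)" "H differentiable (at y)" for y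
   using nice_differentiable[of 3 f1 y] nice_differentiable[of 3 f2 y] nice_differentiable[of 3 H y] f(1,2) H by auto
  \<comment> \<open>At every point one of the two nonnegative functions attains its minimum 0, so
    its gradient vanishes there and no mixed terms remain.\<close>
  have "pd i f1 (s *\<^sub>R x) = 0 \<or> pd i f2 (s *\<^sub>R x) = 0"
   using f(3-5) partial_deriv_at_zero_min[OF d(1)] partial_deriv_at_zero_min[OF d(2)] by metis
  moreover have "pd i F x = s * (a * pd i f1 (s *\<^sub>R x) + (- b) * pd i f2 (s *\<^sub>R x))"
   unfolding F_def[abs_def] using partial_deriv_affine_arg[OF d(3), of i 0 s x] partial_deriv_add[OF d(1,2), of i a "- b" "s *\<^sub>R x"]
   by (simp add: H_def[abs_def])
  ultimately show "(pd i F x)^2 = (s^2 * a^2) * (pd i f1 (s *\<^sub>R x))^2 + (s^2 * b^2) * (pd i f2 (s *\<^sub>R x))^2"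
   by (auto simp: power_mult_distrib)
 qed
 also have "... = (s^2 * a^2) * dilenergy f1 s + (s^2 * b^2) * dilenergy f2 s"
 proof -
  have i: "integrable gauss (%y. (pd i g (s *\<^sub>R y))^2)" if "nice 4 g" "i : Basis" for g i
  proof -
   have n: "nice 3 (pd i g)" using nice_partial[of 3 g i] that by simp
   show ?thesis using nice_dil_integrable[OF nice_mult[OF n n]] by (simp add: power2_eq_square)
  qed
  show ?thesis unfolding dilenergy_def using i[OF f(1)] i[OF f(2)]
   by (simp add: Lintegral_add sum.distrib sum_distrib_left)
 qed
 also have "... = s^2 * (dilenergy f1 s / dilsq f1 s + dilenergy f2 s / dilsq f2 s)"
  unfolding ab by (simp add: distrib_left)
 finally show ?thesis by simp
qed

text \<open>The derivative of \<open>ln (dilsq f1 s) + ln (dilsq f2 s)\<close> is at least \<open>(4 + 4 * \<epsilon>) / s\<close> up to small errors,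
 which is incompatible with \<open>dilsq f s \<le> C * s\<^sup>2\<close> for large \<open>s\<close>.\<close>

lemma no_two_phases:
 assumes mu: "0 < \<mu>" "\<mu> <= 1" and L: "0 < L" and c: "0 < c"
 shows "EX S>=1. EX \<eta>>0. ALL f1 f2 :: 'a::euclidean_space => real.
  (ALL f:{f1, f2}. nice 4 f & (ALL x. f x >= 0) & (ALL x. f x * laplacian f x >= - \<eta> * (norm x)^2) &
    (ALL x. \<bar>f x\<bar> <= L * norm x) & dilsq f 1 >= c) -->
  (ALL x. f1 x = 0 \<or> f2 x = 0) -->
  (ALL s. 1 <= s --> s <= S --> measure gauss {y. f1 (s *\<^sub>R y) = 0 & f2 (s *\<^sub>R y) = 0} >= \<mu>) --> False"
proof -
 obtain \<epsilon> where \<epsilon>: "\<epsilon> > 0" and FH: "ALL F::'a => real. nice 4 F -->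
   (LINT x|gauss. F x * \<bar>F x\<bar>) = 0 --> measure gauss {x. F x = 0} >= \<mu> -->
   (1 + \<epsilon>) * (LINT x|gauss. (F x)^2) <= (SUM i:Basis. LINT x|gauss. (pd i F x)^2)"
  using friedland_hayman_stable[OF mu, where 'a='a] by blast
 define d where "d = real DIM('a)"
 have d: "d > 0" by (simp add: d_def)
 \<comment> \<open>S is so large that the gain 4 \<epsilon> ln S exceeds the room between the lower
   bound of \<open>P 1\<close> and the quadratic upper bound at S; the final 1 pays for the
   accumulated errors \<open>B * S\<close>.\<close>
 define Q where "Q = 2 * ln (L^2 * d) - 2 * ln (c / 2) + 1"
 define S where "S = exp (max 0 (Q / (4 * \<epsilon>)) + 1)"
 have S1: "S >= 1" by (simp add: S_def)
 have SQ: "4 * \<epsilon> * ln S > Q"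
 proof -
  have "4 * \<epsilon> * (Q / (4 * \<epsilon>)) < 4 * \<epsilon> * ln S" using \<epsilon> by (intro mult_strict_left_mono) (auto simp: S_def)
  then show ?thesis using \<epsilon> by simp
 qed
 \<comment> \<open>Makes the loss of \<open>dilsq\<close> at most c / 2 on [1, S] and the total
   logarithmic error \<open>B * S\<close> equal to 1.\<close>
 define \<eta> where "\<eta> = c / (8 * S ^ 4 * d)"
 have e0: "\<eta> > 0" using c d S1 by (simp add: \<eta>_def)
 have eS: "\<eta> * d * S ^ 4 = c / 8" using d S1 by (simp add: \<eta>_def field_simps)
 have False
  if f: "ALL f:{f1, f2}. nice 4 f & (ALL x. f x >= 0) & (ALL x. f x * laplacian f x >= - \<eta> * (norm x)^2) &
    (ALL x. \<bar>f x\<bar> <= L * norm x) & dilsq f 1 >= c"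
   and disj: "ALL x. f1 x = 0 \<or> f2 x = 0"
   and z: "ALL s. 1 <= s --> s <= S --> measure gauss {y. f1 (s *\<^sub>R y) = 0 & f2 (s *\<^sub>R y) = 0} >= \<mu>"
  for f1 f2 :: "'a => real"
 proof -
  have ub: "dilsq f s <= L\<^sup>2 * s^2 * d" if "f : {f1, f2}" for f s
   unfolding d_def using dilsq_bounds(1)[of f \<eta> L c s] f that e0 by auto
  have S4: "\<eta> * d * s ^ 4 <= c / 8" if "1 <= s" "s <= S" for s
  proof -
   have "\<eta> * d * s ^ 4 <= \<eta> * d * S ^ 4" using that e0 d by (intro mult_left_mono power_mono) auto
   then show ?thesis using eS by simp
  qed
  have lb: "dilsq f s >= c / 2" if "f : {f1, f2}" "1 <= s" "s <= S" for f s
  proof -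
   have "dilsq f s >= c - \<eta> * d * s ^ 4 / 2"
    unfolding d_def using dilsq_bounds(3)[of f \<eta> L c s] f that e0 by auto
   then show ?thesis using S4[OF that(2,3)] c by linarith
  qed
  have dv: "EX D. ((%s. ln (dilsq f s)) has_real_derivative D) (at s) & D >= 2 * s * (dilenergy f s / dilsq f s) - 4 * S ^ 3 * \<eta> * d / c"
   if ff: "f : {f1, f2}" and s: "1 <= s" "s <= S" for f s
  proof -
   have s0: "s > 0" using s by simp
   obtain N' where N: "(dilsq f has_real_derivative N') (at s)" "N' >= 2 * s * dilenergy f s - 2 * s ^ 3 * \<eta> * d"
    unfolding d_def using dilsq_bounds(2)[of f \<eta> L c, OF _ _ _ _ _ s0] f ff e0 by auto
   have p: "dilsq f s > 0" using lb[OF that] c by simp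
   have "((%s. ln (dilsq f s)) has_real_derivative (1 / dilsq f s) * N') (at s)"
    using DERIV_chain[OF DERIV_ln_divide[OF p] N(1)] by (simp add: o_def)
   moreover have "(1 / dilsq f s) * N' >= (1 / dilsq f s) * (2 * s * dilenergy f s - 2 * s ^ 3 * \<eta> * d)"
    using N(2) p by (intro mult_left_mono) auto
   moreover have "(1 / dilsq f s) * (2 * s ^ 3 * \<eta> * d) <= (2 / c) * (2 * S ^ 3 * \<eta> * d)"
   proof (rule mult_mono)
    show "1 / dilsq f s <= 2 / c" using lb[OF that] c p by (simp add: field_simps)
    show "2 * s ^ 3 * \<eta> * d <= 2 * S ^ 3 * \<eta> * d" using s e0 d by (intro mult_right_mono mult_left_mono power_mono) auto
   qed (use c s e0 d in auto)
   ultimately show ?thesis by (intro exI[of _ "(1 / dilsq f s) * N'"]) (simp add: right_diff_distrib mult_ac)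
  qed
  define B where "B = 8 * S ^ 3 * \<eta> * d / c"
  define P where "P s = ln (dilsq f1 s) + ln (dilsq f2 s) - (4 + 4 * \<epsilon>) * ln s + B * s" for s
  have "P 1 <= P S"
  proof (rule DERIV_nonneg_imp_nondecreasing[of 1 S P])
   fix s :: real assume s: "1 <= s" "s <= S"
   obtain D1 where D1: "((%s. ln (dilsq f1 s)) has_real_derivative D1) (at s)" "D1 >= 2 * s * (dilenergy f1 s / dilsq f1 s) - 4 * S ^ 3 * \<eta> * d / c"
    using dv[of f1 s] s by auto
   obtain D2 where D2: "((%s. ln (dilsq f2 s)) has_real_derivative D2) (at s)" "D2 >= 2 * s * (dilenergy f2 s / dilsq f2 s) - 4 * S ^ 3 * \<eta> * d / c"
    using dv[of f2 s] s by auto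
   have "2 * (1 + \<epsilon>) <= s\<^sup>2 * (dilenergy f1 s / dilsq f1 s + dilenergy f2 s / dilsq f2 s)"
    by (rule acf_separation[OF \<epsilon> FH]) (use f disj z s lb[of f1 s] lb[of f2 s] c in auto)
   then have "(2 / s) * (2 * (1 + \<epsilon>)) <= (2 / s) * (s^2 * (dilenergy f1 s / dilsq f1 s + dilenergy f2 s / dilsq f2 s))"
    using s by (intro mult_left_mono) auto
   also have "... = 2 * s * (dilenergy f1 s / dilsq f1 s) + 2 * s * (dilenergy f2 s / dilsq f2 s)"
    using s by (simp add: power2_eq_square distrib_left)
   finally have "(2 / s) * (2 * (1 + \<epsilon>)) <= D1 + D2 + B"
   proof -
    assume *: "(2 / s) * (2 * (1 + \<epsilon>)) <= 2 * s * (dilenergy f1 s / dilsq f1 s) + 2 * s * (dilenergy f2 s / dilsq f2 s)"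
    have "B = 2 * (4 * S ^ 3 * \<eta> * d / c)" by (simp add: B_def)
    then show ?thesis using * D1(2) D2(2) by linarith
   qed
   then have "(4 + 4 * \<epsilon>) * (1 / s) <= D1 + D2 + B" by (simp add: distrib_left add_divide_distrib)
   moreover have "(P has_real_derivative (D1 + D2 - (4 + 4 * \<epsilon>) * (1 / s) + B * 1)) (at s)" unfolding P_def[abs_def]
    by (intro DERIV_add DERIV_diff D1(1) D2(1) DERIV_cmult DERIV_ident DERIV_ln_divide) (use s in auto)
   ultimately show "EX y. (P has_real_derivative y) (at s) & 0 <= y"
    by (intro exI[of _ "D1 + D2 - (4 + 4 * \<epsilon>) * (1 / s) + B * 1"]) simp
  qed (rule S1)
  moreover have "P 1 >= 2 * ln (c / 2)"
  proof -
   have "ln (dilsq f1 1) >= ln (c / 2)" "ln (dilsq f2 1) >= ln (c / 2)"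
    using lb[of f1 1] lb[of f2 1] c S1 by auto
   moreover have "B >= 0" using c S1 e0 d by (simp add: B_def)
   ultimately show ?thesis unfolding P_def by simp
  qed
  moreover have "P S <= 2 * ln (L^2 * d) - 4 * \<epsilon> * ln S + 1"
  proof -
   have "ln (dilsq f S) <= ln (L^2 * d) + 2 * ln S" if "f : {f1, f2}" for f
   proof -
    have "ln (dilsq f S) <= ln ((L^2 * d) * S^2)"
     using ub[OF that, of S] lb[OF that, of S] c S1 by (intro ln_mono) (auto simp: mult_ac)
    also have "... = ln (L^2 * d) + 2 * ln S" using L d S1 by (subst ln_mult) (auto simp: ln_realpow)
    finally show ?thesis .
   qed
   then have "ln (dilsq f1 S) <= ln (L^2 * d) + 2 * ln S" "ln (dilsq f2 S) <= ln (L^2 * d) + 2 * ln S" by auto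
   moreover have "B * S = 1"
   proof -
    have "B * S = 8 * (\<eta> * d * S ^ 4) / c" by (simp add: B_def power_Suc eval_nat_numeral)
    then show ?thesis using eS c by simp
   qed
   ultimately show ?thesis unfolding P_def by (simp add: distrib_right)
  qed
  ultimately show False using SQ unfolding Q_def by linarith
 qed
 then show ?thesis using S1 e0 by (intro exI[of _ S] conjI exI[of _ \<eta>]) blast+
qed

section \<open>Localization by a cutoff\<close>

definition cutoff :: "real => 'a::euclidean_space => real" where
 "cutoff M x = posrat 1 5 0 (1 - (1 / M^2) * (x \<bullet> x))"

lemma cutoff_bounds:
 assumes M: "M > 0"
 shows "0 <= cutoff M x" "cutoff M x <= 1" "norm x >= M ==> cutoff M x = 0"
  "norm x < M ==> cutoff M x > 0" "M >= 4 ==> norm x <= 2 ==> cutoff M x >= 1/32"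
proof -
 have e: "cutoff M x = (max 0 (1 - (norm x / M)\<^sup>2)) ^ 5"
  by (simp add: cutoff_def posrat_def power_divide power2_norm_eq_inner)
 show "0 <= cutoff M x" unfolding e by simp
 show "cutoff M x <= 1" unfolding e by (rule power_le_one) auto
 show "cutoff M x = 0" if "norm x >= M"
 proof -
  have "1 <= (norm x / M)\<^sup>2" using that M by (simp add: one_le_power)
  then show ?thesis unfolding e by (simp add: max_def)
 qed
 show "cutoff M x > 0" if "norm x < M"
 proof -
  have "(norm x / M)^2 < 1" using that M by (simp add: power_less_one_iff abs_square_less_1)
  then show ?thesis unfolding e by simp
 qed
 show "cutoff M x >= 1/32" if "M >= 4" "norm x <= 2"
 proof -
  have "norm x / M <= 2 / 4" using that by (intro frac_le) auto
  then have "(norm x / M)^2 <= (1/2)\<^sup>2" using M by (intro power_mono) auto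
  moreover have "(1/2::real)^2 = 1/4" by (simp add: power2_eq_square)
  ultimately have "1/2 <= 1 - (norm x / M)\<^sup>2" by linarith
  then have "1/2 <= max 0 (1 - (norm x / M)\<^sup>2)" by (rule max.coboundedI2)
  then have "(1/2) ^ 5 <= cutoff M x" unfolding e by (rule power_mono) simp
  then show ?thesis by (simp add: power_divide)
 qed
qed

lemma cutoff_arg_Ck: "Ck_on k UNIV (%x::'a::euclidean_space. 1 - (1 / M^2) * (x \<bullet> x))"
 by (intro Ck_on_diff Ck_on_cmult Ck_on_norm_sq Ck_on_const open_UNIV)

lemma cutoff_Ck: "Ck_on 4 UNIV (cutoff M)"
 unfolding cutoff_def[abs_def]
 by (rule Ck_on_compose_real[OF open_UNIV open_UNIV cutoff_arg_Ck posrat_Ck]) auto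

text \<open>With q = 1 - |x|^2 / M^2 the cutoff is a convex function of q. In its Laplacian the term
  with the squared gradient of q is therefore nonnegative, and only the term with the Laplacian - 2
  d / M^2 of q has to be bounded.\<close>

lemma cutoff_derivs:
 fixes x :: "'a::euclidean_space"
 assumes M: "M > 0"
 shows "i : Basis ==> \<bar>pd i (cutoff M) x\<bar> <= 10 * norm x / M^2"
  "laplacian (cutoff M) x >= - 10 * real DIM('a) / M^2"
proof -
 define q where "q = (%x::'a. 1 - (1 / M^2) * (x \<bullet> x))"
 have qc: "Ck_on 2 UNIV q" unfolding q_def by (rule cutoff_arg_Ck)
 have dq: "q differentiable (at x)" for x by (rule Ck_on_2_partial(1)[OF qc]) auto
 have pq: "pd i q x = - 2 / M^2 * (x \<bullet> i)" for i x
 proof -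
  have "((%x. 1 - k * (x \<bullet> x)) has_derivative (%h. - (k * (x \<bullet> h + h \<bullet> x)))) (at x)" for k
   by (auto intro!: derivative_eq_intros)
  from partial_deriv_eq[OF this[of "1 / M^2"]] show ?thesis by (simp add: q_def inner_commute)
 qed
 have lq: "laplacian q x = - 2 * real DIM('a) / M^2" for x
 proof -
  have "pd i (pd i q) x = - 2 / M^2" if i: "i : Basis" for i
  proof -
   have "pd i q = (%x. - 2 / M^2 * (x \<bullet> i))" by (rule ext) (rule pq)
   then show ?thesis
    using partial_deriv_eq[OF bounded_linear_imp_has_derivative[OF
      bounded_linear_const_mult[OF bounded_linear_inner_left]], of i "- 2 / M^2" i x] i
    by simp
  qed
  then show ?thesis by (simp add: laplacian_def)
 qed
 have d1: "(posrat 1 5 0 has_real_derivative 5 * posrat 1 4 0 s) (at s)" for s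
  using posrat_deriv[of 1 5 0 s] by simp
 have d2: "((%s. 5 * posrat 1 4 0 s) has_real_derivative 20 * posrat 1 3 0 s) (at s)" for s
  using DERIV_cmult[OF posrat_deriv[of 1 4 0 s], of 5] by simp
 have P4: "0 <= posrat 1 4 0 (q x)" "posrat 1 4 0 (q x) <= 1"
  unfolding posrat_def by (auto simp: q_def intro!: power_le_one)
 have ce: "cutoff M = (%x::'a. posrat 1 5 0 (q x))" by (rule ext) (simp add: cutoff_def q_def)
 show "\<bar>pd i (cutoff M) x\<bar> <= 10 * norm x / M^2" if i: "i : Basis"
 proof -
  have "\<bar>pd i (cutoff M) x\<bar> = posrat 1 4 0 (q x) * (10 * \<bar>x \<bullet> i\<bar> / M^2)"
   unfolding ce partial_deriv_compose_real[OF dq d1] pq using P4(1) by (simp add: abs_mult)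
  also have "... <= 1 * (10 * norm x / M^2)"
   using P4 Basis_le_norm[OF i, of x] by (intro mult_mono divide_right_mono) auto
  finally show ?thesis by simp
 qed
 show "laplacian (cutoff M) x >= - 10 * real DIM('a) / M^2"
 proof -
  have "laplacian (cutoff M) x = 5 * posrat 1 4 0 (q x) * (- 2 * real DIM('a) / M^2)
    + 20 * posrat 1 3 0 (q x) * (SUM i:Basis. (pd i q x)^2)"
   unfolding ce laplacian_compose_real[OF open_UNIV UNIV_I qc d1 d2] lq ..
  moreover have "20 * posrat 1 3 0 (q x) * (SUM i:Basis. (pd i q x)^2) >= 0"
   by (intro mult_nonneg_nonneg sum_nonneg posrat_nonneg) auto
  moreover have "posrat 1 4 0 (q x) * (10 * real DIM('a) / M^2) <= 1 * (10 * real DIM('a) / M^2)"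
   using P4 by (intro mult_right_mono) auto
  ultimately show ?thesis by simp
 qed
qed

text \<open>The value of the Gaussian density on the sphere of radius 2, its minimum over the
  ball.\<close>

definition gdens_min :: "'a::euclidean_space itself => real" where
 "gdens_min _ = (1 / sqrt (2 * pi)) ^ DIM('a) * exp (- 2)"

lemma gdens_min_pos: "gdens_min TYPE('a::euclidean_space) > 0"
 by (simp add: gdens_min_def)

lemma gauss_measure_ge:
 fixes B :: "'a::euclidean_space set"
 assumes [measurable]: "B : sets borel" and B: "B <= ball 0 2"
 shows "gdens_min TYPE('a) * measure lborel B <= measure gauss B"
proof -
 have fin: "emeasure lborel B < \<infinity>" by (rule emeasure_bounded_finite) (use B bounded_subset in blast)
 have i: "integrable lborel (indicator B :: 'a => real)" using fin by simp
 have "gdens_min TYPE('a) * measure lborel B = (LINT x|lborel. gdens_min TYPE('a) * indicator B x)" by simp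
 also have "... <= (LINT x|lborel. gdens x * indicator B x)"
 proof (rule integral_mono)
  show "integrable lborel (%x. gdens x * indicator B x)"
   using gauss_integral_lborel(2)[of "indicator B"] gauss_integrable_indicator[OF assms(1)] by simp
  show "gdens_min TYPE('a) * indicator B x <= gdens x * indicator B x" for x :: 'a
  proof (cases "x : B")
   case True
   then have "norm x <= 2" using B by auto
   then have "x \<bullet> x <= 2\<^sup>2" unfolding power2_norm_eq_inner[symmetric] by (intro power_mono) auto
   then show ?thesis using True by (simp add: gdens_min_def gdens_exp)
  qed simp
 qed (use i in simp)
 also have "... = measure gauss B"
  using gauss_integral_lborel(1)[of "indicator B :: 'a => real"] by simp
 finally show ?thesis .
qed

text \<open>What one rescaled component must provide. The last clause gives a lower bound for its
  Gaussian mass; the radius 2 M leaves room for a cutoff supported in the ball of radius M.\<close>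

definition phase :: "real => real => real => real => ('a::euclidean_space => real) => bool" where
 "phase L c \<rho> M w \<longleftrightarrow> Ck_on 4 (ball 0 (2 * M)) w &
  (ALL y:ball 0 (2 * M). 0 <= w y & w y <= L * norm y & laplacian w y >= 0 & (ALL i:Basis. \<bar>pd i w y\<bar> <= L)) &
  (EX x:ball 0 1. ALL y:ball x \<rho>. w y >= c)"

text \<open>By the product rule the Laplacian of f is at least - 30 d L |x| / M^2: 10 from the
  Laplacian of the cutoff, 20 from the mixed gradient term. Multiplication by f <= L |x| makes the
  error quadratic in |x|, as \<open>dilsq_bounds\<close> expects.\<close>

lemma phase_cutoff:
 fixes w :: "'a::euclidean_space => real" and L c \<rho> M :: real
 assumes w: "phase L c \<rho> M w" and M: "M >= 4" and L: "L > 0" and c: "c > 0" and \<rho>: "0 < \<rho>" "\<rho> <= 1"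
 defines "f \<equiv> %x. if norm x < 2 * M then cutoff M x * w x else 0"
 shows "nice 4 f" "ALL x. f x >= 0" "ALL x. f x * laplacian f x >= - (30 * real DIM('a) * L^2 / M^2) * (norm x)^2"
  "ALL x. \<bar>f x\<bar> <= L * norm x"
  "dilsq f 1 >= (c / 32)\<^sup>2 * (gdens_min TYPE('a) * measure lborel (ball (0::'a) \<rho>))"
proof -
 have Mp: "M > 0" using M by simp
 have wC: "Ck_on 4 (ball 0 (2 * M)) w" and wb: "!!y. norm y < 2 * M ==> 0 <= w y & w y <= L * norm y"
  and wl: "!!y. norm y < 2 * M ==> laplacian w y >= 0"
  and wd: "!!y i. norm y < 2 * M ==> i : Basis ==> \<bar>pd i w y\<bar> <= L"
  using w unfolding phase_def by auto
 obtain x0 where x0: "norm x0 < 1" "ALL y:ball x0 \<rho>. w y >= c" using w unfolding phase_def by auto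
 have out: "f x = 0" if "norm x >= M" for x using cutoff_bounds(3)[OF Mp that] by (simp add: f_def)
 have fC: "Ck_on 4 UNIV f"
 proof -
  have "Ck_on 4 (ball 0 (2 * M)) f"
   by (rule Ck_on_cong[where f="%x. cutoff M x * w x"])
     (auto simp: f_def intro!: Ck_on_mult wC Ck_on_subset[OF _ cutoff_Ck])
  moreover have "Ck_on 4 (- cball 0 M) f"
   by (rule Ck_on_cong[where f="%x. 0"]) (auto simp: out)
  moreover have "ball 0 (2 * M) \<union> - cball 0 M = (UNIV :: 'a set)" using Mp by auto
  ultimately show ?thesis using Ck_on_Un[of "ball 0 (2 * M)" "- cball 0 M" 4 f] by auto
 qed
 then show nf: "nice 4 f" unfolding nice_def by (intro conjI exI[of _ M]) (use out in auto)
 show "ALL x. f x >= 0" using wb cutoff_bounds(1)[OF Mp] unfolding f_def by (auto intro: mult_nonneg_nonneg)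
 show "ALL x. \<bar>f x\<bar> <= L * norm x"
 proof
  fix x
  show "\<bar>f x\<bar> <= L * norm x"
  proof (cases "norm x < 2 * M")
   case True
   have "cutoff M x * w x <= 1 * (L * norm x)"
    using wb[OF True] cutoff_bounds(1,2)[OF Mp, of x] by (intro mult_mono) auto
   moreover have "cutoff M x * w x >= 0" using wb[OF True] cutoff_bounds(1)[OF Mp, of x] by simp
   ultimately show ?thesis using True by (simp add: f_def)
  next
   case False
   then show ?thesis using L by (simp add: f_def)
  qed
 qed
 show "ALL x. f x * laplacian f x >= - (30 * real DIM('a) * L^2 / M^2) * (norm x)^2"
 proof
  fix x :: 'a
  show "f x * laplacian f x >= - (30 * real DIM('a) * L^2 / M^2) * (norm x)^2"
  proof (cases "norm x < 2 * M")
   case True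
   define X where "X = cutoff M x"
   define W where "W = w x"
   define d where "d = real DIM('a)"
   define G where "G = (SUM i:Basis. pd i (cutoff M) x * pd i w x)"
   have X: "0 <= X" "X <= 1" unfolding X_def using cutoff_bounds[OF Mp] by auto
   have W: "0 <= W" "W <= L * norm x" unfolding W_def using wb[OF True] by auto
   have c2: "Ck_on 2 (ball 0 (2 * M)) w" by (rule Ck_on_le[OF _ wC]) auto
   have k2: "Ck_on 2 (ball 0 (2 * M)) (cutoff M :: 'a => real)"
    by (rule Ck_on_subset[OF _ Ck_on_le[OF open_UNIV cutoff_Ck]]) auto
   have "laplacian f x = laplacian (%x. cutoff M x * w x) x"
    by (rule laplacian_cong_open[of "ball 0 (2 * M)"]) (use True in \<open>auto simp: f_def\<close>)
   also have "... = X * laplacian w x + W * laplacian (cutoff M) x + 2 * G"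
    unfolding X_def W_def G_def by (rule laplacian_mult[OF _ _ k2 c2]) (use True in auto)
   finally have lf: "laplacian f x = X * laplacian w x + W * laplacian (cutoff M) x + 2 * G" .
   have "\<bar>G\<bar> <= (SUM i:(Basis::'a set). (10 * norm x / M^2) * L)" unfolding G_def
   proof (rule order_trans[OF sum_abs], rule sum_mono)
    fix i :: 'a assume i: "i : Basis"
    show "\<bar>pd i (cutoff M) x * pd i w x\<bar> <= (10 * norm x / M^2) * L"
     unfolding abs_mult by (intro mult_mono cutoff_derivs[OF Mp] wd[OF True] i) auto
   qed
   then have G: "G >= - (d * (10 * norm x / M^2 * L))" by (simp add: d_def)
   have "W * laplacian (cutoff M) x >= W * (- 10 * d / M^2)"
    unfolding d_def by (intro mult_left_mono cutoff_derivs[OF Mp] W)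
   moreover have "W * (- 10 * d / M^2) >= - (d * (10 * norm x / M^2 * L))"
   proof -
    have "W * (10 * d / M^2) <= (L * norm x) * (10 * d / M^2)" using W by (intro mult_right_mono) (auto simp: d_def)
    then show ?thesis by (simp add: mult_ac)
   qed
   moreover have "X * laplacian w x >= 0" using X wl[OF True] by simp
   moreover have "a + (b + 2 * g) >= - (3 * e)" if "t <= b" "- e <= t" "0 <= a" "- e <= g" for a b e g t :: real
    using that by linarith
   ultimately have "laplacian f x >= - (3 * (d * (10 * norm x / M^2 * L)))" unfolding lf add.assoc using G by blast
   then have "laplacian f x >= - (30 * d * L / M^2 * norm x)" by (simp add: mult_ac)
   then have 1: "(X * W) * (- (30 * d * L / M^2 * norm x)) <= (X * W) * laplacian f x"
    using X W by (intro mult_left_mono) auto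
   have 2: "(X * W) * (30 * d * L / M^2 * norm x) <= (1 * (L * norm x)) * (30 * d * L / M^2 * norm x)"
    using X W L by (intro mult_right_mono mult_mono) (auto simp: d_def)
   have 3: "f x = X * W" using True by (simp add: f_def X_def W_def)
   have 4: "(1 * (L * norm x)) * (30 * d * L / M^2 * norm x) = (30 * d * L^2 / M^2) * (norm x)^2"
    by (simp add: power2_eq_square)
   have "- A * N <= F * l" if "w * (- k) <= w * l" "w * k <= B" "F = w" "B = A * N" for A N F l w k B :: real
    using that by simp
   from this[OF 1 2 3 4] show ?thesis unfolding d_def by simp
  next
   case False
   then have "f x = 0" by (simp add: f_def)
   then show ?thesis by simp
  qed
 qed
 show "dilsq f 1 >= (c / 32)\<^sup>2 * (gdens_min TYPE('a) * measure lborel (ball (0::'a) \<rho>))"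
 proof -
  have bs: "norm y < 2" if "y : ball x0 \<rho>" for y
   using that x0(1) \<rho> norm_triangle_ineq4[of x0 "x0 - y"] by (simp add: dist_norm)
  have "ball x0 \<rho> <= ball 0 2" using bs by auto
  then have "gdens_min TYPE('a) * measure lborel (ball x0 \<rho>) <= measure gauss (ball x0 \<rho>)"
   by (intro gauss_measure_ge) auto
  moreover have "measure lborel (ball x0 \<rho>) = measure lborel (ball (0::'a) \<rho>)"
   using content_ball_conv_unit_ball[of \<rho> x0] content_ball_conv_unit_ball[of \<rho> "0::'a"] \<rho> by (metis less_imp_le)
  ultimately have "(c / 32)^2 * (gdens_min TYPE('a) * measure lborel (ball (0::'a) \<rho>)) <= (c / 32)\<^sup>2 * measure gauss (ball x0 \<rho>)"
   by (intro mult_left_mono) auto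
  also have "... = (LINT y|gauss. (c / 32)^2 * indicator (ball x0 \<rho>) y)" by simp
  also have "... <= (LINT y|gauss. f y * f y)"
  proof (rule integral_mono)
   show "integrable gauss (%y. (c / 32)^2 * indicator (ball x0 \<rho>) y :: real)"
    by (intro integrable_mult_right gauss_integrable_indicator) auto
   show "integrable gauss (%y. f y * f y)" using nice_dil_integrable[OF nice_mult[OF nf nf], of 1] by simp
   show "(c / 32)^2 * indicator (ball x0 \<rho>) y <= f y * f y" for y
   proof (cases "y : ball x0 \<rho>")
    case True
    have "(1/32) * c <= cutoff M y * w y"
     using True x0(2) bs[OF True] cutoff_bounds(5)[OF Mp M, of y] c by (intro mult_mono) auto
    then have "c / 32 <= f y" using bs[OF True] M by (simp add: f_def)
    then have "(c / 32)^2 <= (f y)\<^sup>2" using c by (intro power_mono) auto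
    then show ?thesis using True by (simp add: power2_eq_square)
   qed simp
  qed
  finally show ?thesis by (simp add: dilsq_def power2_eq_square)
 qed
qed

lemma no_two_phases_local:
 fixes \<mu> L c \<rho> :: real
 assumes mu: "0 < \<mu>" and L: "0 < L" and c: "0 < c" and \<rho>: "0 < \<rho>" "\<rho> <= 1"
 shows "EX S>=1. EX M>=S. ALL w1 w2 :: 'a::euclidean_space => real.
  phase L c \<rho> M w1 --> phase L c \<rho> M w2 --> (ALL x. w1 x = 0 \<or> w2 x = 0) -->
  (ALL s. 1 <= s --> s <= S --> (EX B:sets borel. B <= ball 0 1 & measure lborel B >= \<mu> &
    (ALL y:B. w1 (s *\<^sub>R y) = 0 & w2 (s *\<^sub>R y) = 0))) --> False"
proof -
 define m where "m = min 1 (gdens_min TYPE('a) * \<mu>)"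
 have m: "0 < m" "m <= 1" using mu gdens_min_pos[where 'a='a] by (auto simp: m_def)
 define c' where "c' = (c / 32)^2 * (gdens_min TYPE('a) * measure lborel (ball (0::'a) \<rho>))"
 have c': "c' > 0" using c \<rho> gdens_min_pos[where 'a='a] content_ball_pos[of \<rho> "0::'a"] by (simp add: c'_def)
 obtain S \<eta> where S: "S >= 1" and \<eta>: "\<eta> > 0" and H: "ALL f1 f2 :: 'a => real.
  (ALL f:{f1, f2}. nice 4 f & (ALL x. f x >= 0) & (ALL x. f x * laplacian f x >= - \<eta> * (norm x)^2) &
    (ALL x. \<bar>f x\<bar> <= L * norm x) & dilsq f 1 >= c') -->
  (ALL x. f1 x = 0 \<or> f2 x = 0) -->
  (ALL s. 1 <= s --> s <= S --> measure gauss {y. f1 (s *\<^sub>R y) = 0 & f2 (s *\<^sub>R y) = 0} >= m) --> False"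
  using no_two_phases[OF m L c', where 'a='a] by blast
 define K where "K = 30 * real DIM('a) * L^2"
 \<comment> \<open>M >= K / \<eta> and M >= 1 give K / M^2 <= \<eta>; M >= 4 keeps the ball of
   radius 2 where the cutoff is at least 1/32.\<close>
 define M where "M = max (max S 4) (K / \<eta> + 1)"
 have M: "M >= S" "M >= 4" by (auto simp: M_def)
 have "K / M^2 <= \<eta>"
 proof -
  have "K / \<eta> <= M" by (simp add: M_def)
  moreover have "M * 1 <= M * M" using M by (intro mult_left_mono) auto
  ultimately have "K / \<eta> <= M\<^sup>2" by (simp add: power2_eq_square)
  then have "K <= M\<^sup>2 * \<eta>" using \<eta> by (simp add: pos_divide_le_eq)
  then show ?thesis using M by (simp add: pos_divide_le_eq mult.commute)
 qed
 then have KM: "- \<eta> * (norm x)^2 <= - (30 * real DIM('a) * L^2 / M^2) * (norm x)^2" for x :: 'a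
  unfolding K_def by (intro mult_right_mono) auto
 have False if w: "phase L c \<rho> M w1" "phase L c \<rho> M w2" "ALL x. w1 x = 0 \<or> w2 x = 0"
  and B: "ALL s. 1 <= s --> s <= S --> (EX B:sets borel. B <= ball 0 1 & measure lborel B >= \<mu> &
    (ALL y:B. w1 (s *\<^sub>R y) = 0 & w2 (s *\<^sub>R y) = 0))" for w1 w2 :: "'a => real"
 proof -
  define f1 where "f1 = (%x. if norm x < 2 * M then cutoff M x * w1 x else 0)"
  define f2 where "f2 = (%x. if norm x < 2 * M then cutoff M x * w2 x else 0)"
  have P: "nice 4 f & (ALL x. f x >= 0) & (ALL x. f x * laplacian f x >= - \<eta> * (norm x)^2) &
    (ALL x. \<bar>f x\<bar> <= L * norm x) & dilsq f 1 >= c'"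
   if "phase L c \<rho> M w" "f = (%x. if norm x < 2 * M then cutoff M x * w x else 0)" for f and w :: "'a => real"
  proof -
   note p = phase_cutoff[OF that(1) M(2) L c \<rho>]
   show ?thesis unfolding that(2) c'_def
    by (intro conjI p(1,2,4,5) allI order_trans[OF KM p(3)[rule_format]])
  qed
  have f: "ALL f:{f1, f2}. nice 4 f & (ALL x. f x >= 0) & (ALL x. f x * laplacian f x >= - \<eta> * (norm x)^2) &
    (ALL x. \<bar>f x\<bar> <= L * norm x) & dilsq f 1 >= c'"
   using P[OF w(1) f1_def] P[OF w(2) f2_def] by blast
  have disj: "ALL x. f1 x = 0 \<or> f2 x = 0" using w(3) by (auto simp: f1_def f2_def)
  have "measure gauss {y. f1 (s *\<^sub>R y) = 0 & f2 (s *\<^sub>R y) = 0} >= m" if s: "1 <= s" "s <= S" for s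
  proof -
   obtain B where B: "B : sets borel" "B <= ball 0 1" "measure lborel B >= \<mu>"
    "ALL y:B. w1 (s *\<^sub>R y) = 0 & w2 (s *\<^sub>R y) = 0" using B s by meson
   have n: "nice 4 f1" "nice 4 f2" using f by auto
   note [measurable] = nice_dil_measurable[OF n(1), of s] nice_dil_measurable[OF n(2), of s]
   have Z: "{y. f1 (s *\<^sub>R y) = 0 & f2 (s *\<^sub>R y) = 0} : sets borel" by measurable
   interpret G: prob_space "gauss :: 'a measure" by (rule prob_space_gauss)
   have "m <= gdens_min TYPE('a) * \<mu>" by (simp add: m_def)
   also have "... <= gdens_min TYPE('a) * measure lborel B" using B(3) gdens_min_pos[where 'a='a] by simp
   also have "... <= measure gauss B" by (rule gauss_measure_ge) (use B in auto)
   also have "... <= measure gauss {y. f1 (s *\<^sub>R y) = 0 & f2 (s *\<^sub>R y) = 0}"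
   proof (rule G.finite_measure_mono)
    have "f1 (s *\<^sub>R y) = 0 & f2 (s *\<^sub>R y) = 0" if "y : B" for y
     using bspec[OF B(4) that] by (simp only: f1_def f2_def mult_zero_right if_cancel simp_thms)
    then show "B <= {y. f1 (s *\<^sub>R y) = 0 & f2 (s *\<^sub>R y) = 0}" by blast
   qed (use Z in simp)
   finally show ?thesis .
  qed
  then show False by (intro H[THEN spec, THEN spec, THEN mp, THEN mp, THEN mp, OF f disj]) blast
 qed
 then show ?thesis using S M(1) by (intro exI[of _ S] conjI exI[of _ M]) blast+
qed

section \<open>Mollification\<close>

text \<open>The functions s^-n exp (-1/s), whose span is closed under differentiation; smoothness of
  all of them is then a single induction.\<close>

definition ebump :: "nat => real => real" where
 "ebump n s = (if s <= 0 then 0 else inverse s ^ n * exp (- inverse s))"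

text \<open>With x = 1/t and k = n + 2, the inequality (1 + x/k)^k <= exp x bounds x^k exp (-x) by
  k^k; the two extra powers of x give the factor t^2, hence a zero derivative at 0.\<close>

lemma ebump_quadratic: "\<bar>ebump n t\<bar> <= real (n + 2) ^ (n + 2) * t^2"
proof (cases "t <= 0")
 case False
 define k where "k = n + 2"
 have k: "k > 0" by (simp add: k_def)
 define x where "x = inverse t"
 have x: "x > 0" "t = inverse x" using False by (auto simp: x_def)
 have "(x / k) ^ k <= (1 + x / k) ^ k" using x by (intro power_mono) auto
 also have "... <= exp x" using exp_ge_one_plus_x_over_n_power_n[of k x] k x by simp
 finally have "x ^ k <= real k ^ k * exp x" using k by (simp add: power_divide pos_divide_le_eq mult.commute)
 then have "x ^ k * exp (- x) <= real k ^ k * exp x * exp (- x)" by (intro mult_right_mono) auto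
 also have "real k ^ k * exp x * exp (- x) = real k ^ k" by (simp add: mult.assoc mult_exp_exp)
 finally have "x ^ k * exp (- x) <= real k ^ k" .
 then have "x ^ k * exp (- x) * t^2 <= real k ^ k * t^2" by (intro mult_right_mono) auto
 moreover have "x ^ k * exp (- x) * t^2 = x ^ n * exp (- x)"
 proof -
  have "x ^ k * exp (- x) * t^2 = x ^ n * exp (- x) * (x * t)^2"
   by (simp add: k_def power_add power2_eq_square)
  then show ?thesis using x by simp
 qed
 ultimately have "x ^ n * exp (- x) <= real k ^ k * t^2" by (simp only:)
 moreover have "ebump n t = x ^ n * exp (- x)" "0 <= x ^ n * exp (- x)" using False x(1) by (auto simp: ebump_def x_def)
 ultimately show ?thesis unfolding k_def by (simp only: abs_of_nonneg)
qed (simp add: ebump_def)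

lemma ebump_deriv: "(ebump n has_real_derivative ebump (n + 2) s - real n * ebump (n + 1) s) (at s)"
proof -
 consider "s > 0" | "s < 0" | "s = 0" by linarith
 then show ?thesis
 proof cases
  case 1
  define x where "x = inverse s"
  have "((%x. x ^ n * exp (- x)) has_real_derivative real n * x ^ (n - 1) * exp (- x) - x ^ n * exp (- x)) (at (inverse s))"
   unfolding x_def by (auto intro!: derivative_eq_intros)
  moreover have "(inverse has_real_derivative - (x * x)) (at s)"
   unfolding x_def using 1 by (auto intro!: derivative_eq_intros)
  ultimately have "((%s. inverse s ^ n * exp (- inverse s)) has_real_derivative
    (real n * x ^ (n - 1) * exp (- x) - x ^ n * exp (- x)) * - (x * x)) (at s)"
   by (rule DERIV_chain2)
  also have "(real n * x ^ (n - 1) * exp (- x) - x ^ n * exp (- x)) * - (x * x) = ebump (n + 2) s - real n * ebump (n + 1) s"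
   using 1 by (cases n) (simp_all add: ebump_def x_def[symmetric] algebra_simps)
  finally have "((%s. inverse s ^ n * exp (- inverse s)) has_real_derivative ebump (n + 2) s - real n * ebump (n + 1) s) (at s)" .
  then show ?thesis
   by (rule has_field_derivative_transform_within_open[of _ _ _ "{0<..}"]) (use 1 in \<open>auto simp: ebump_def\<close>)
 next
  case 2
  have "((%s. 0) has_real_derivative ebump (n + 2) s - real n * ebump (n + 1) s) (at s)"
   using 2 by (simp add: ebump_def)
  then show ?thesis
   by (rule has_field_derivative_transform_within_open[of _ _ _ "{..<0}"]) (use 2 in \<open>auto simp: ebump_def\<close>)
 next
  case 3
  have "(ebump n has_real_derivative 0) (at 0)" by (rule DERIV_zero_of_quadratic_bound[OF ebump_quadratic])
  moreover have "ebump (n + 2) 0 - real n * ebump (n + 1) 0 = 0" by (simp add: ebump_def)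
  ultimately show ?thesis using 3 by simp
 qed
qed

lemma ebump_Ck: "Ck_on k UNIV (ebump n)"
proof (induction k arbitrary: n)
 case 0
 show ?case by (simp add: DERIV_continuous_on[OF has_field_derivative_at_within[OF ebump_deriv]])
next
 case (Suc k)
 show ?case
  by (rule Ck_on_real_step[OF ebump_deriv]) (intro Ck_on_diff Ck_on_cmult open_UNIV Suc.IH)
qed

definition bump :: "'a::euclidean_space => real" where "bump y = ebump 0 (1 - y \<bullet> y)"

lemma bump_bounds: "bump y >= 0" "norm y >= 1 ==> bump y = 0" "norm y < 1 ==> bump y > 0"
proof -
 have e: "y \<bullet> y = (norm y)^2" by (simp add: power2_norm_eq_inner)
 show "bump y >= 0" by (simp add: bump_def ebump_def)
 show "bump y = 0" if "norm y >= 1"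
  using one_le_power[OF that, of 2] by (simp add: bump_def ebump_def e)
 show "bump y > 0" if "norm y < 1"
  using that by (simp add: bump_def ebump_def e power_less_one_iff abs_square_less_1 not_le)
qed

lemma bump_nice: "nice k (bump :: 'a::euclidean_space => real)"
 unfolding nice_def
proof (intro conjI exI[of _ 1] allI impI)
 show "Ck_on k UNIV (bump :: 'a => real)" unfolding bump_def[abs_def]
  by (rule Ck_on_compose_real[OF open_UNIV open_UNIV _ ebump_Ck])
    (intro Ck_on_diff Ck_on_norm_sq Ck_on_const open_UNIV subset_UNIV)+
qed (simp add: bump_bounds)

lemma nice_integrable:
 fixes G :: "'a::euclidean_space => real"
 assumes "nice k G" shows "integrable lborel G"
proof -
 obtain R where "ALL x. norm x > R --> G x = 0" using assms by (auto simp: nice_def)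
 moreover obtain C where "ALL x. \<bar>G x\<bar> <= C" using nice_bounded[OF assms] by blast
 ultimately show ?thesis by (intro integrable_bounded_support[of G C R] nice_measurable[OF assms]) auto
qed

lemma nice_mvt:
 fixes G :: "'a::euclidean_space => real"
 assumes "nice (Suc k) G"
 shows "EX t. 0 < t & t < 1 & G (x + h) - G x = (SUM i:Basis. (h \<bullet> i) * pd i G (x + t *\<^sub>R h))"
proof -
 have "EX t>0. t < 1 & G (x + 1 *\<^sub>R h) - G (x + 0 *\<^sub>R h) = (1 - 0) * (SUM i:Basis. (h \<bullet> i) * pd i G (x + t *\<^sub>R h))"
  by (rule MVT2) (auto intro!: has_real_derivative_line nice_differentiable[OF assms])
 then show ?thesis by auto
qed

lemma nice_lipschitz:
 fixes G :: "'a::euclidean_space => real"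
 assumes "nice (Suc k) G"
 shows "EX C>=0. ALL x h. \<bar>G (x + h) - G x\<bar> <= C * norm h"
proof -
 obtain C where C: "C >= 0" "ALL i:Basis. ALL x. \<bar>pd i G x\<bar> <= C"
  using nice_partial_bound[OF assms] by blast
 have "\<bar>G (x + h) - G x\<bar> <= (DIM('a) * C) * norm h" for x h
 proof -
  obtain t where t: "G (x + h) - G x = (SUM i:Basis. (h \<bullet> i) * pd i G (x + t *\<^sub>R h))"
   using nice_mvt[OF assms] by blast
  have "\<bar>G (x + h) - G x\<bar> <= (SUM i:(Basis::'a set). norm h * C)"
   unfolding t using C by (intro order_trans[OF sum_abs] sum_mono) (auto simp: abs_mult intro!: mult_mono Basis_le_norm)
  then show ?thesis by (simp add: mult_ac)
 qed
 then show ?thesis using C(1) by (intro exI[of _ "DIM('a) * C"]) auto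
qed

lemma nice_taylor:
 fixes G :: "'a::euclidean_space => real"
 assumes "nice (Suc (Suc k)) G"
 shows "EX C>=0. ALL x h. \<bar>G (x + h) - G x - (SUM i:Basis. (h \<bullet> i) * pd i G x)\<bar> <= C * (norm h)^2"
proof -
 have "ALL i:Basis. EX C>=0. ALL x h. \<bar>pd i G (x + h) - pd i G x\<bar> <= C * norm h"
  using nice_lipschitz[OF nice_partial[OF assms]] by blast
 then obtain C where C: "ALL i:Basis. C i >= 0 & (ALL x h. \<bar>pd i G (x + h) - pd i G x\<bar> <= C i * norm h)"
  by metis
 have "\<bar>G (x + h) - G x - (SUM i:Basis. (h \<bullet> i) * pd i G x)\<bar> <= (SUM i:Basis. C i) * (norm h)^2" for x h
 proof -
  obtain t where t: "0 < t" "t < 1" "G (x + h) - G x = (SUM i:Basis. (h \<bullet> i) * pd i G (x + t *\<^sub>R h))"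
   using nice_mvt[OF assms] by blast
  have "G (x + h) - G x - (SUM i:Basis. (h \<bullet> i) * pd i G x)
   = (SUM i:Basis. (h \<bullet> i) * (pd i G (x + t *\<^sub>R h) - pd i G x))"
   unfolding t by (simp add: right_diff_distrib sum_subtractf)
  also have "\<bar>...\<bar> <= (SUM i:Basis. norm h * (C i * norm h))"
  proof (rule order_trans[OF sum_abs], rule sum_mono)
   fix i :: 'a assume i: "i : Basis"
   have "\<bar>pd i G (x + t *\<^sub>R h) - pd i G x\<bar> <= C i * norm (t *\<^sub>R h)" using C i by blast
   also have "... <= C i * norm h" using t C i by (intro mult_left_mono) (auto simp: mult_left_le_one_le)
   finally show "\<bar>(h \<bullet> i) * (pd i G (x + t *\<^sub>R h) - pd i G x)\<bar> <= norm h * (C i * norm h)"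
    unfolding abs_mult by (intro mult_mono Basis_le_norm i) auto
  qed
  also have "... = (SUM i:Basis. C i) * (norm h)^2" unfolding sum_distrib_right
   by (intro sum.cong refl) (simp add: power2_eq_square)
  finally show ?thesis .
 qed
 moreover have "(SUM i:Basis. C i) >= 0" using C by (intro sum_nonneg) auto
 ultimately show ?thesis by blast
qed

section \<open>Convolution with a smooth kernel\<close>

definition conv :: "('a::euclidean_space => real) => ('a => real) => 'a => real" where
 "conv \<psi> K x = (LINT z|lborel. \<psi> z * K (x - z))"

lemma conv_integrable:
 assumes \<psi>: "integrable lborel \<psi>" and K: "nice k K"
 shows "integrable lborel (%z. \<psi> z * K (x - z))"
proof -
 obtain C where C: "C >= 0" "ALL x. \<bar>K x\<bar> <= C" using nice_bounded[OF K] by blast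
 note [measurable] = nice_measurable[OF K] borel_measurable_integrable[OF \<psi>]
 show ?thesis
 proof (rule Lintegrable_bound[of _ "%z. C * \<bar>\<psi> z\<bar>"])
  show "integrable lborel (%z. C * \<bar>\<psi> z\<bar>)" using \<psi> by simp
  show "(%z. \<psi> z * K (x - z)) : borel_measurable lborel" by measurable
  show "AE z in lborel. norm (\<psi> z * K (x - z)) <= norm (C * \<bar>\<psi> z\<bar>)"
  proof (rule AE_I2)
   fix z
   have "\<bar>\<psi> z\<bar> * \<bar>K (x - z)\<bar> <= \<bar>\<psi> z\<bar> * C" using C by (intro mult_left_mono) auto
   then show "norm (\<psi> z * K (x - z)) <= norm (C * \<bar>\<psi> z\<bar>)"
    unfolding real_norm_def abs_mult using C(1) by (simp add: mult.commute)
  qed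
 qed
qed

text \<open>All derivatives fall on K, whose first-order Taylor remainder is uniformly quadratic
  (\<open>nice_taylor\<close>); so \<psi> only has to be integrable.\<close>

lemma conv_has_derivative:
 fixes K :: "'a::euclidean_space => real"
 assumes \<psi>: "integrable lborel \<psi>" and K: "nice (Suc (Suc k)) K"
 shows "(conv \<psi> K has_derivative (%h. SUM i:Basis. (h \<bullet> i) * conv \<psi> (pd i K) x)) (at x)"
 unfolding has_derivative_at
proof
 show "bounded_linear (%h. SUM i:Basis. (h \<bullet> i) * conv \<psi> (pd i K) x)"
  by (intro bounded_linear_sum bounded_linear_mult_const bounded_linear_inner_left)
 obtain C where C: "C >= 0" "ALL x h. \<bar>K (x + h) - K x - (SUM i:Basis. (h \<bullet> i) * pd i K x)\<bar> <= C * (norm h)^2"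
  using nice_taylor[OF K] by blast
 define A where "A = C * (LINT z|lborel. \<bar>\<psi> z\<bar>)"
 have bd: "norm (conv \<psi> K (x + h) - conv \<psi> K x - (SUM i:Basis. (h \<bullet> i) * conv \<psi> (pd i K) x)) <= A * (norm h)^2" for h
 proof -
  define E where "E z = K (x - z + h) - K (x - z) - (SUM i:Basis. (h \<bullet> i) * pd i K (x - z))" for z
  have i: "integrable lborel (%z. \<psi> z * K (x + h - z))" "integrable lborel (%z. \<psi> z * K (x - z))"
   "!!i. i : Basis ==> integrable lborel (%z. \<psi> z * pd i K (x - z))"
   using conv_integrable[OF \<psi> K] conv_integrable[OF \<psi> nice_partial[OF K]] by auto
  have e: "\<psi> z * E z = \<psi> z * K (x + h - z) - \<psi> z * K (x - z) - (SUM i:Basis. (h \<bullet> i) * (\<psi> z * pd i K (x - z)))" for z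
   by (simp add: E_def right_diff_distrib sum_distrib_left add_diff_eq diff_add_eq mult_ac add_ac)
  have ie: "integrable lborel (%z. \<psi> z * E z)" unfolding e using i by auto
  have "(LINT z|lborel. \<psi> z * E z) = conv \<psi> K (x + h) - conv \<psi> K x - (SUM i:Basis. (h \<bullet> i) * conv \<psi> (pd i K) x)"
   unfolding e conv_def using i by (simp add: Lintegral_sum)
  moreover have "\<bar>LINT z|lborel. \<psi> z * E z\<bar> <= (LINT z|lborel. \<bar>\<psi> z\<bar> * (C * (norm h)^2))"
  proof (rule order_trans[OF integral_abs_bound], rule integral_mono)
   show "integrable lborel (%z. \<bar>\<psi> z * E z\<bar>)" using ie by simp
   show "integrable lborel (%z. \<bar>\<psi> z\<bar> * (C * (norm h)^2))" using \<psi> by simp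
   show "\<bar>\<psi> z * E z\<bar> <= \<bar>\<psi> z\<bar> * (C * (norm h)^2)" for z
    unfolding abs_mult E_def using C(2) by (intro mult_left_mono) auto
  qed
  ultimately show ?thesis by (simp add: A_def mult_ac)
 qed
 show "(%h. norm (conv \<psi> K (x + h) - conv \<psi> K x - (SUM i:Basis. (h \<bullet> i) * conv \<psi> (pd i K) x)) / norm h) \<midarrow>0\<rightarrow> 0"
 proof (rule Lim_null_comparison)
  show "\<forall>\<^sub>F h in at 0. norm (norm (conv \<psi> K (x + h) - conv \<psi> K x - (SUM i:Basis. (h \<bullet> i) * conv \<psi> (pd i K) x)) / norm h) <= A * norm h"
   unfolding eventually_at_filter
  proof (intro always_eventually allI impI)
   fix h :: 'a assume "h ~= 0"
   then show "norm (norm (conv \<psi> K (x + h) - conv \<psi> K x - (SUM i:Basis. (h \<bullet> i) * conv \<psi> (pd i K) x)) / norm h) <= A * norm h"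
    using bd[of h] by (simp add: pos_divide_le_eq power2_eq_square mult_ac)
  qed
  show "(%h::'a. A * norm h) \<midarrow>0\<rightarrow> 0" by (auto intro!: tendsto_eq_intros)
 qed
qed

lemma conv_partial_deriv:
 assumes "integrable lborel \<psi>" "nice (Suc (Suc k)) K" "i : Basis"
 shows "pd i (conv \<psi> K) = conv \<psi> (pd i K)"
 using partial_deriv_eq[OF conv_has_derivative[OF assms(1,2)], of i] assms(3)
 by (intro ext) (simp add: inner_Basis if_distrib if_distribR sum.delta cong: if_cong)

lemma conv_Ck:
 assumes \<psi>: "integrable lborel \<psi>" and K: "!!j. nice j K"
 shows "Ck_on k UNIV (conv \<psi> K)"
 using K
proof (induction k arbitrary: K)
 case 0
 show ?case using has_derivative_continuous[OF conv_has_derivative[OF \<psi> 0[of "Suc (Suc 0)"]]]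
  by (simp add: continuous_at_imp_continuous_on)
next
 case (Suc k)
 have "conv \<psi> K differentiable_on UNIV"
  using conv_has_derivative[OF \<psi> Suc.prems[of "Suc (Suc 0)"]] by (auto simp: differentiable_on_def differentiable_def)
 moreover have "Ck_on k UNIV (pd i (conv \<psi> K))" if i: "i : Basis" for i
  unfolding conv_partial_deriv[OF \<psi> Suc.prems[of "Suc (Suc 0)"] i]
  by (rule Suc.IH[OF nice_partial[OF Suc.prems i]])
 ultimately show ?case by simp
qed

lemma conv_laplacian:
 assumes \<psi>: "integrable lborel \<psi>" and K: "!!j. nice j K"
 shows "laplacian (conv \<psi> K) x = conv \<psi> (laplacian K) x"
proof -
 have "laplacian (conv \<psi> K) x = (SUM i:Basis. conv \<psi> (pd i (pd i K)) x)"
  unfolding laplacian_def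
  using conv_partial_deriv[OF \<psi> K[of "Suc (Suc 0)"]] conv_partial_deriv[OF \<psi> nice_partial[OF K, of _ "Suc (Suc 0)"]]
  by (intro sum.cong refl) simp
 also have "... = conv \<psi> (laplacian K) x"
  unfolding conv_def laplacian_def sum_distrib_left
  by (rule Lintegral_sum[symmetric]) (rule conv_integrable[OF \<psi> nice_partial[OF nice_partial[OF K]]])
 finally show ?thesis .
qed

lemma lipschitz_DERIV_bound:
 fixes f :: "real => real"
 assumes d: "(f has_real_derivative D) (at 0)" and e: "e > 0" and L: "!!t. \<bar>t\<bar> < e ==> \<bar>f t - f 0\<bar> <= L * \<bar>t\<bar>"
 shows "\<bar>D\<bar> <= L"
proof (rule tendsto_upperbound)
 show "((%h. \<bar>(f (0 + h) - f 0) / h\<bar>) \<longlongrightarrow> \<bar>D\<bar>) (at 0)" using d unfolding DERIV_def by (rule tendsto_rabs)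
 show "\<forall>\<^sub>F h in at 0. \<bar>(f (0 + h) - f 0) / h\<bar> <= L"
  unfolding eventually_at
 proof (intro exI[of _ e] conjI e ballI impI)
  fix h :: real assume "h ~= 0 & dist h 0 < e"
  then show "\<bar>(f (0 + h) - f 0) / h\<bar> <= L" using L[of h] by (simp add: pos_divide_le_eq)
 qed
qed simp

text \<open>Averaging preserves the Lipschitz bound, which gives both the distance to \<phi> and the
  gradient bound. The Laplacian at x is \<phi> tested against the Laplacian of the nonnegative test
  function z -> K (x - z).\<close>

lemma mollification:
 fixes \<phi> :: "'a::euclidean_space => real"
 assumes lip: "L-lipschitz_on (ball 0 1) \<phi>" and sub: "distr_subharmonic_on (ball 0 1) \<phi>" and \<tau>: "\<tau> > 0"
 shows "EX g. Ck_on 4 UNIV g & (ALL x. norm x + \<tau> < 1 -->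
   laplacian g x >= 0 & \<bar>g x - \<phi> x\<bar> <= L * \<tau> & (ALL i:Basis. \<bar>pd i g x\<bar> <= L))"
proof -
 \<comment> \<open>Extension by zero makes the convolution global; at points with norm x + \<tau> <
   1 only values inside the unit ball enter.\<close>
 define \<psi> where "\<psi> x = (if x : ball 0 1 then \<phi> x else 0)" for x
 have L0: "L >= 0" using lip by (rule lipschitz_on_nonneg)
 have Ld: "\<bar>\<phi> x - \<phi> y\<bar> <= L * norm (x - y)" if "norm x < 1" "norm y < 1" for x y
  using lipschitz_onD[OF lip, of x y] that by (simp add: dist_norm)
 have \<psi>m: "\<psi> : borel_measurable borel"
 proof (rule measurable_of_continuous_on_open[of "ball 0 1"])
  have "continuous_on (ball 0 1) \<phi>" by (rule lipschitz_on_continuous_on[OF lip])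
  then show "continuous_on (ball 0 1) \<psi>" by (rule continuous_on_eq) (simp add: \<psi>_def)
 qed (auto simp: \<psi>_def)
 have \<psi>b: "\<bar>\<psi> x\<bar> <= \<bar>\<phi> 0\<bar> + L" for x
 proof (cases "norm x < 1")
  case True
  have "L * norm x <= L * 1" using True L0 by (intro mult_left_mono) auto
  then show ?thesis using Ld[OF True, of 0] True by (simp add: \<psi>_def)
 qed (use L0 in \<open>auto simp: \<psi>_def\<close>)
 have \<psi>i: "integrable lborel \<psi>"
  by (rule integrable_bounded_support[OF \<psi>m \<psi>b, of 1]) (simp add: \<psi>_def)
 define m where "m = (LINT y|lborel. bump (y::'a))"
 have m0: "m > 0"
 proof -
  have "m >= 0" unfolding m_def by (rule integral_nonneg_AE) (simp add: bump_bounds)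
  moreover have "m ~= 0"
  proof
   assume "m = 0"
   then have "AE y in lborel. bump (y::'a) = 0"
    unfolding m_def by (subst (asm) integral_nonneg_eq_0_iff_AE) (auto simp: bump_bounds nice_integrable[OF bump_nice])
   then have "AE y in lborel. y \<notin> ball (0::'a) 1" by eventually_elim (use bump_bounds(3) in force)
   then have "emeasure lborel (ball (0::'a) 1) = 0"
    by (subst (asm) AE_iff_measurable[OF _ refl]) (auto simp: ball_def)
   then show False using content_ball_pos[of 1 "0::'a"] by (simp add: measure_def)
  qed
  ultimately show ?thesis by simp
 qed
 define K where "K = (%y::'a. 1 / (\<tau> ^ DIM('a) * m) * bump (0 + (1 / \<tau>) *\<^sub>R y))"
 have K0: "K y >= 0" for y using m0 \<tau> by (simp add: K_def bump_bounds)
 have Ks: "K y = 0" if "norm y >= \<tau>" for y using that \<tau> by (simp add: K_def bump_bounds)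
 have Kn: "nice j K" for j
  unfolding nice_def
 proof (intro conjI exI[of _ \<tau>] allI impI)
  show "Ck_on j UNIV K" unfolding K_def
   by (intro Ck_on_cmult open_UNIV Ck_on_affine_arg[OF open_UNIV open_UNIV nice_Ck[OF bump_nice]] UNIV_I)
 qed (simp add: Ks)
 define g where "g = conv \<psi> K"
 have bi: "integrable lborel (%y. \<psi> (x + (- \<tau>) *\<^sub>R y) * bump y)" "m * g x = (LINT y|lborel. \<psi> (x + (- \<tau>) *\<^sub>R y) * bump y)" for x
 proof -
  note [measurable] = \<psi>m nice_measurable[OF Kn]
  have t: "- \<tau> ~= 0" using \<tau> by simp
  have fm: "(%z. \<psi> z * K (x - z)) : borel_measurable borel" by measurable
  have e: "\<psi> (x + (- \<tau>) *\<^sub>R y) * K (x - (x + (- \<tau>) *\<^sub>R y)) = 1 / (\<tau> ^ DIM('a) * m) * (\<psi> (x + (- \<tau>) *\<^sub>R y) * bump y)" for y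
   using \<tau> by (simp add: K_def)
  have "integrable lborel (%y. 1 / (\<tau> ^ DIM('a) * m) * (\<psi> (x + (- \<tau>) *\<^sub>R y) * bump y))"
   using lborel_affine_int(1)[OF t fm, of x] conv_integrable[OF \<psi>i Kn] unfolding e by blast
  then have "integrable lborel (%y. (\<tau> ^ DIM('a) * m) * (1 / (\<tau> ^ DIM('a) * m) * (\<psi> (x + (- \<tau>) *\<^sub>R y) * bump y)))"
   by (rule integrable_mult_right)
  then show "integrable lborel (%y. \<psi> (x + (- \<tau>) *\<^sub>R y) * bump y)" using m0 \<tau> by simp
  show "m * g x = (LINT y|lborel. \<psi> (x + (- \<tau>) *\<^sub>R y) * bump y)"
   using lborel_affine_int(2)[OF t fm, of x] m0 \<tau> unfolding e g_def conv_def by simp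
 qed
 have bI: "integrable lborel (bump :: 'a => real)" by (rule nice_integrable[OF bump_nice])
 have avg: "\<bar>LINT y|lborel. d y * bump y\<bar> <= C * m"
  if i: "integrable lborel (%y. d y * bump y)" and d: "!!y. norm y < 1 ==> \<bar>d y\<bar> <= C" for d :: "'a => real" and C
 proof -
  have "\<bar>LINT y|lborel. d y * bump y\<bar> <= (LINT y|(lborel :: 'a measure). C * bump y)"
  proof (rule order_trans[OF integral_abs_bound], rule integral_mono)
   show "\<bar>d y * bump y\<bar> <= C * bump y" for y
    using d[of y] bump_bounds(1,2)[of y] by (cases "norm y < 1") (auto simp: abs_mult intro!: mult_right_mono)
  qed (use i bI in auto)
  then show ?thesis by (simp add: m_def)
 qed
 have nx: "norm (x + (- \<tau>) *\<^sub>R y) < 1" if "norm x + \<tau> < 1" "norm y < 1" for x y :: 'a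
 proof -
  have "\<tau> * norm y <= \<tau> * 1" using that \<tau> by (intro mult_left_mono) auto
  moreover have "norm ((- \<tau>) *\<^sub>R y) = \<tau> * norm y" using \<tau> by simp
  ultimately show ?thesis using that(1) norm_triangle_ineq[of x "(- \<tau>) *\<^sub>R y"] by linarith
 qed
 have near: "\<bar>g x - \<phi> x\<bar> <= L * \<tau>" if x: "norm x + \<tau> < 1" for x
 proof -
  have "\<bar>LINT y|lborel. (\<psi> (x + (- \<tau>) *\<^sub>R y) - \<phi> x) * bump y\<bar> <= (L * \<tau>) * m"
  proof (rule avg)
   show "integrable lborel (%y. (\<psi> (x + (- \<tau>) *\<^sub>R y) - \<phi> x) * bump y)"
    unfolding left_diff_distrib using bi(1) bI by simp
   show "\<bar>\<psi> (x + (- \<tau>) *\<^sub>R y) - \<phi> x\<bar> <= L * \<tau>" if y: "norm y < 1" for y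
   proof -
    have "\<bar>\<psi> (x + (- \<tau>) *\<^sub>R y) - \<phi> x\<bar> <= L * norm ((- \<tau>) *\<^sub>R y)"
     using Ld[OF nx[OF x y], of x] x \<tau> nx[OF x y] by (simp add: \<psi>_def)
    also have "... <= L * (\<tau> * 1)" using y \<tau> L0 by (intro mult_left_mono) (auto intro!: mult_left_le)
    finally show ?thesis by simp
   qed
  qed
  also have "(LINT y|lborel. (\<psi> (x + (- \<tau>) *\<^sub>R y) - \<phi> x) * bump y) = m * (g x - \<phi> x)"
   unfolding left_diff_distrib right_diff_distrib bi(2) using bi(1)[of x] bI by (simp add: m_def)
  finally show ?thesis using m0 by (simp add: abs_mult mult.commute)
 qed
 have glip: "\<bar>g x - g x'\<bar> <= L * norm (x - x')" if x: "norm x + \<tau> < 1" "norm x' + \<tau> < 1" for x x'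
 proof -
  have "\<bar>LINT y|lborel. (\<psi> (x + (- \<tau>) *\<^sub>R y) - \<psi> (x' + (- \<tau>) *\<^sub>R y)) * bump y\<bar> <= (L * norm (x - x')) * m"
  proof (rule avg)
   show "integrable lborel (%y. (\<psi> (x + (- \<tau>) *\<^sub>R y) - \<psi> (x' + (- \<tau>) *\<^sub>R y)) * bump y)"
    unfolding left_diff_distrib using bi(1) by simp
   show "\<bar>\<psi> (x + (- \<tau>) *\<^sub>R y) - \<psi> (x' + (- \<tau>) *\<^sub>R y)\<bar> <= L * norm (x - x')" if y: "norm y < 1" for y
    using Ld[OF nx[OF x(1) y] nx[OF x(2) y]] nx[OF x(1) y] nx[OF x(2) y] by (simp add: \<psi>_def)
  qed
  also have "(LINT y|lborel. (\<psi> (x + (- \<tau>) *\<^sub>R y) - \<psi> (x' + (- \<tau>) *\<^sub>R y)) * bump y) = m * (g x - g x')"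
   unfolding left_diff_distrib right_diff_distrib bi(2) using bi(1) by simp
  finally show ?thesis using m0 by (simp add: abs_mult mult.commute)
 qed
 have gC: "Ck_on k UNIV g" for k unfolding g_def by (rule conv_Ck[OF \<psi>i Kn])
 have pd: "\<bar>pd i g x\<bar> <= L" if x: "norm x + \<tau> < 1" and i: "i : Basis" for x i
 proof (rule lipschitz_DERIV_bound)
  have "g differentiable (at y)" for y using gC[of "Suc 0"] by (simp add: differentiable_on_def)
  from has_real_derivative_axis[OF i this, of x 1 0]
  show "((%t. g (x + t *\<^sub>R i)) has_real_derivative pd i g x) (at 0)" by simp
  show "1 - \<tau> - norm x > 0" using x by simp
  show "\<bar>g (x + t *\<^sub>R i) - g (x + 0 *\<^sub>R i)\<bar> <= L * \<bar>t\<bar>" if t: "\<bar>t\<bar> < 1 - \<tau> - norm x" for t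
  proof -
   have "norm (x + t *\<^sub>R i) + \<tau> < 1" using t norm_triangle_ineq[of x "t *\<^sub>R i"] i by simp
   then show ?thesis using glip[of "x + t *\<^sub>R i" x] x i by simp
  qed
 qed
 have lap: "laplacian g x >= 0" if x: "norm x + \<tau> < 1" for x
 proof -
  define J where "J = (%z. K (x + (- 1) *\<^sub>R z))"
  have KC: "Ck_on k UNIV K" for k by (rule nice_Ck[OF Kn])
  have JC: "Ck_on k UNIV J" for k unfolding J_def
   by (rule Ck_on_affine_arg[OF open_UNIV open_UNIV KC]) simp
  have s: "{z. J z ~= 0} <= cball x \<tau>"
  proof
   fix z assume "z : {z. J z ~= 0}"
   then have "\<not> norm (x - z) >= \<tau>" using Ks[of "x - z"] by (auto simp: J_def)
   then show "z : cball x \<tau>" by (simp add: dist_norm)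
  qed
  have cb: "cball x \<tau> <= ball 0 1"
  proof
   fix z assume "z : cball x \<tau>"
   then show "z : ball 0 1" using x norm_triangle_ineq4[of x "x - z"] by (simp add: dist_norm)
  qed
  have "test_function_on (ball 0 1) J" unfolding test_function_on_def
  proof (intro conjI allI JC)
   show "compact (closure {z. J z ~= 0})"
    using s bounded_subset[OF bounded_cball s] by (simp add: compact_closure)
   show "closure {z. J z ~= 0} <= ball 0 1" using closure_minimal[OF s closed_cball] cb by blast
  qed
  moreover have "ALL z. J z >= 0" by (simp add: J_def K0)
  ultimately have "set_lebesgue_integral lborel (ball 0 1) (%z. \<phi> z * laplacian J z) >= 0" using sub unfolding distr_subharmonic_on_def by blast
  also have "set_lebesgue_integral lborel (ball 0 1) (%z. \<phi> z * laplacian J z) = conv \<psi> (laplacian K) x"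
   unfolding conv_def set_lebesgue_integral_def
  proof (intro Lintegral_cong refl)
   fix z
   have "laplacian J z = laplacian K (x - z)" unfolding J_def
    using laplacian_affine_arg[OF open_UNIV KC UNIV_I, of x "-1" z] by simp
   then show "indicator (ball 0 1) z *\<^sub>R (\<phi> z * laplacian J z) = \<psi> z * laplacian K (x - z)"
    by (simp add: \<psi>_def)
  qed
  also have "... = laplacian g x" unfolding g_def by (rule conv_laplacian[OF \<psi>i Kn, symmetric])
  finally show ?thesis .
 qed
 show ?thesis using gC[of 4] near pd lap by (intro exI[of _ g] conjI allI impI ballI) auto
qed

section \<open>Connectivity of the positivity set\<close>

lemma norm_le_norm_dist: "norm y <= norm x + dist x y"
 using norm_triangle_ineq4[of x "x - y"] by (simp add: dist_norm)

locale optimal_domain =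
 fixes \<Omega> :: "'a::euclidean_space set"
  and \<phi> :: "'a => real"
  and L \<kappa> \<mu> \<Lambda> \<eta> :: real
 assumes open_dom: "open \<Omega>" and dom_sub: "\<Omega> <= ball 0 1" and zero_front: "0 : frontier \<Omega>"
  and phi_pos: "!!x. x : \<Omega> ==> \<phi> x > 0" and phi_zero: "!!x. x : ball 0 1 - \<Omega> ==> \<phi> x = 0"
  and L_pos: "L > 0" and phi_lip: "L-lipschitz_on (ball 0 1) \<phi>"
  and kappa_pos: "\<kappa> > 0"
  and phi_dist: "!!x. x : ball 0 (1/2) ==> \<phi> x >= \<kappa> * infdist x (ball 0 1 - \<Omega>)"
  and phi_sub: "distr_subharmonic_on (ball 0 1) \<phi>"
  and mu_pos: "\<mu> > 0"
  and ext_dens: "!!x0 r. x0 : frontier \<Omega> Int ball 0 1 ==> 0 < r ==> r < 1 - norm x0 ==>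
     measure lborel (ball x0 r - \<Omega>) >= \<mu> * measure lborel (ball x0 r)"
  and Lam_pos: "\<Lambda> > 0"
  and strip: "!!x0 r t. x0 : frontier \<Omega> Int ball 0 1 ==> 0 < r ==> r < 1 - norm x0 ==> 0 < t ==>
     measure lborel ({x. 0 < \<phi> x & \<phi> x < r * t} Int ball x0 r)
      <= \<Lambda> * t * measure lborel (ball (0::'a) r)"
  and eta_pos: "\<eta> > 0"
  and nondeg: "!!x0 r. x0 : frontier \<Omega> Int ball 0 1 ==> 0 < r ==> r < 1 - norm x0 ==>
     (SUP x\<in>ball x0 r. \<phi> x) >= \<eta> * r"
begin

lemma frontier_zero: "z : frontier \<Omega> ==> norm z < 1 ==> z \<notin> \<Omega> & \<phi> z = 0"
 using open_dom phi_zero by (auto simp: frontier_def interior_open)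

lemma phi_pos_iff: "norm x < 1 ==> \<phi> x > 0 \<longleftrightarrow> x : \<Omega>"
 using phi_pos[of x] phi_zero[of x] by fastforce

lemma phi_diff: "norm x < 1 ==> norm y < 1 ==> \<bar>\<phi> x - \<phi> y\<bar> <= L * dist x y"
 using lipschitz_onD[OF phi_lip, of x y] by (simp add: dist_real_def)

lemma rescaled_exterior:
 assumes z: "z : frontier \<Omega>" and r: "0 < r" "r < 1 - norm z"
 shows "EX B:sets borel. B <= ball 0 1 & measure lborel B >= \<mu> * measure lborel (ball (0::'a) 1) & (ALL y:B. z + r *\<^sub>R y \<notin> \<Omega>)"
proof -
 define B where "B = {y : ball 0 1. z + r *\<^sub>R y \<notin> \<Omega>}"
 have zb: "z : frontier \<Omega> Int ball 0 1" using z r by simp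
 have [measurable]: "\<Omega> : sets borel" using open_dom by simp
 have Bm [measurable]: "B : sets borel" unfolding B_def by measurable
 define I where "I = (indicator (ball z r - \<Omega>) :: 'a => real)"
 have Im: "I : borel_measurable borel" unfolding I_def
  by (intro borel_measurable_indicator sets.Diff) (use open_dom in auto)
 have e: "I (z + r *\<^sub>R y) = indicator B y" for y
  using r by (auto simp: I_def B_def indicator_def dist_norm)
 have "measure lborel (ball z r - \<Omega>) = r ^ DIM('a) * measure lborel B"
  using lborel_affine_int(2)[OF _ Im, of r z] r unfolding e by (simp add: I_def)
 then have "\<mu> * (r ^ DIM('a) * measure lborel (ball (0::'a) 1)) <= r ^ DIM('a) * measure lborel B"
  using ext_dens[OF zb r] content_ball_conv_unit_ball[of r z] r by simp
 then have "r ^ DIM('a) * (\<mu> * measure lborel (ball (0::'a) 1)) <= r ^ DIM('a) * measure lborel B" by (simp add: mult_ac)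
 then have "\<mu> * measure lborel (ball (0::'a) 1) <= measure lborel B"
  by (rule mult_left_le_imp_le) (use r in simp)
 then show ?thesis using Bm by (intro bexI[of _ B]) (auto simp: B_def)
qed

text \<open>Thresholds in units of \<delta> / 32: mollification error 1, level of U 3, truncation
  level 4, lower bound of g near x0 30. Since 4 > 3, w vanishes near the relative boundary of its
  component and stays C^4; near x0 it is at least 30 - 6 * 4 = 6 units. Where w > 0, g exceeds 4
  units, so the additive error is absorbed by doubling L.\<close>

lemma component_phase:
 fixes g :: "'a => real"
 assumes \<delta>: "\<delta> > 0" and \<tau>: "0 < \<tau>" "\<tau> <= 1" "L * \<tau> <= \<delta> / 32" and M: "M >= 1"
  and g: "Ck_on 4 UNIV g" "!!x. norm x < 2 * M ==> laplacian g x >= 0"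
   "!!x i. norm x < 2 * M ==> i : Basis ==> \<bar>pd i g x\<bar> <= L"
   "!!x. norm x < 2 * M ==> g x <= L * norm x + \<delta> / 32"
  and U: "U = {x : ball 0 (2 * M). g x > 3 * \<delta> / 32}"
  and x0: "norm x0 < 1" "!!y. y : ball x0 \<tau> ==> g y >= 15 * \<delta> / 16"
  and w: "w = (%y. if y : connected_component_set U x0 then smooth_pos (\<delta> / 8) (g y) else 0)"
 shows "phase (2 * L) (3 * \<delta> / 16) \<tau> M w"
proof -
 define A where "A = connected_component_set U x0"
 define e where "e = \<delta> / 8"
 have e: "e > 0" using \<delta> by (simp add: e_def)
 have gc: "continuous_on UNIV g" by (rule Ck_on_continuous[OF open_UNIV g(1)])
 have oU: "open U"
 proof -
  have "U = ball 0 (2 * M) Int {x. 3 * \<delta> / 32 < g x}" by (auto simp: U)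
  then show ?thesis by (simp only:) (intro open_Int open_ball open_Collect_less continuous_on_const gc)
 qed
 have oA: "open A" unfolding A_def by (rule open_connected_component[OF oU])
 have AU: "A <= U" unfolding A_def by (rule connected_component_subset)
 have oUA: "open (U - A)"
 proof -
  have "closedin (top_of_set U) A" unfolding A_def by (rule closedin_connected_component)
  then have "openin (top_of_set U) (U - A)" by (simp add: openin_diff)
  then show ?thesis using oU openin_open_eq by blast
 qed
 \<comment> \<open>The remaining components together with the region below the truncation level;
   with A it covers the ball, and w vanishes on it.\<close>
 define V where "V = (U - A) \<union> {x. g x < e}"
 have oV: "open V" unfolding V_def by (intro open_Un oUA open_Collect_less gc continuous_on_const)
 have cover: "ball 0 (2 * M) <= A \<union> V"
  using e by (auto simp: V_def U e_def)
 have wA: "w y = smooth_pos e (g y)" if "y : A" for y using that by (simp add: w A_def e_def)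
 have wV: "w y = 0" if "y : V" for y
  using that e smooth_pos_bounds(2)[OF e, of "g y"] by (auto simp: w V_def A_def[symmetric] e_def[symmetric])
 have sC: "Ck_on 4 UNIV (%y. smooth_pos e (g y))"
  by (rule Ck_on_compose_real[OF open_UNIV open_UNIV g(1) smooth_pos_Ck[OF e]]) auto
 have "Ck_on 4 A w" by (rule Ck_on_cong[OF oA _ Ck_on_subset[OF subset_UNIV sC]]) (simp add: wA)
 moreover have "Ck_on 4 V w" by (rule Ck_on_cong[OF oV, of "%y. 0"]) (simp_all add: wV)
 ultimately have wC: "Ck_on 4 (ball 0 (2 * M)) w"
  by (intro Ck_on_subset[OF cover] Ck_on_Un oA oV)
 have gd: "g differentiable (at x)" for x using Ck_on_le[OF open_UNIV g(1), of "Suc 0"] by (simp add: differentiable_on_def)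
 have g2: "Ck_on 2 UNIV g" by (rule Ck_on_le[OF open_UNIV g(1)]) simp
 have pt: "0 <= w y & w y <= 2 * L * norm y & laplacian w y >= 0 & (ALL i:Basis. \<bar>pd i w y\<bar> <= 2 * L)"
  if y: "norm y < 2 * M" for y
 proof (cases "y : A")
  case True
  have "w y <= 2 * L * norm y"
  proof (cases "g y <= e")
   case True
   then show ?thesis using wA[OF \<open>y : A\<close>] smooth_pos_bounds(2)[OF e True] L_pos by simp
  next
   case False
   have "w y <= g y" using wA[OF \<open>y : A\<close>] smooth_pos_bounds(3)[OF e, of "g y"] False e by simp
   then show ?thesis using g(4)[OF y] False e L_pos unfolding e_def by simp
  qed
  moreover have "0 <= w y" using wA[OF True] smooth_pos_bounds(1)[OF e] by simp
  moreover have "laplacian w y >= 0"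
  proof -
   have "laplacian w y = laplacian (%y. smooth_pos e (g y)) y"
    by (rule laplacian_cong_open[OF oA True wA])
   also have "... = smooth_pos1 e (g y) * laplacian g y + smooth_pos2 e (g y) * (SUM i:Basis. (pd i g y)^2)"
    by (rule laplacian_compose_real[OF open_UNIV UNIV_I g2 smooth_pos_deriv[OF e]])
   also have "... >= 0"
    by (intro add_nonneg_nonneg mult_nonneg_nonneg sum_nonneg smooth_pos1_bounds[OF e] smooth_pos2_nonneg[OF e] g(2)[OF y]) auto
   finally show ?thesis .
  qed
  moreover have "\<bar>pd i w y\<bar> <= 2 * L" if i: "i : Basis" for i
  proof -
   have "pd i w y = pd i (%y. smooth_pos e (g y)) y"
    by (rule partial_deriv_cong_open[OF oA True wA])
   also have "... = smooth_pos1 e (g y) * pd i g y"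
    by (rule partial_deriv_compose_real[OF gd smooth_pos_deriv(1)[OF e]])
   finally have "\<bar>pd i w y\<bar> = smooth_pos1 e (g y) * \<bar>pd i g y\<bar>"
    using smooth_pos1_bounds(1)[OF e] by (simp add: abs_mult)
   also have "... <= 1 * L" using smooth_pos1_bounds[OF e] g(3)[OF y i] by (intro mult_mono) auto
   finally show ?thesis using L_pos by simp
  qed
  ultimately show ?thesis by blast
 next
  case False
  then have yV: "y : V" using cover y by auto
  have "laplacian w y = laplacian (%y. 0) y" by (rule laplacian_cong_open[OF oV yV wV])
  moreover have "pd i w y = pd i (%y. 0) y" for i by (rule partial_deriv_cong_open[OF oV yV wV])
  ultimately show ?thesis using wV[OF yV] L_pos by (simp add: partial_deriv_def)
 qed
 have bA: "ball x0 \<tau> <= A"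
 proof -
  have "ball x0 \<tau> <= U"
  proof
   fix y assume y: "y : ball x0 \<tau>"
   have "norm y <= norm x0 + dist x0 y" by (rule norm_le_norm_dist)
   then have "norm y < 2 * M" using y x0(1) \<tau>(2) M by simp
   then show "y : U" using x0(2)[OF y] \<delta> by (simp add: U)
  qed
  then show ?thesis unfolding A_def using \<tau> by (intro connected_component_maximal) auto
 qed
 have "w y >= 3 * \<delta> / 16" if y: "y : ball x0 \<tau>" for y
 proof -
  have "w y >= g y - 6 * e" using wA[of y] bA y smooth_pos_bounds(4)[OF e, of "g y"] by auto
  then show ?thesis using x0(2)[OF y] unfolding e_def by simp
 qed
 then have "EX x:ball 0 1. ALL y:ball x \<tau>. w y >= 3 * \<delta> / 16" using x0(1) by (intro bexI[of _ x0]) auto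
 then show ?thesis unfolding phase_def using wC pt by simp
qed

text \<open>The set U is taken for the rescaled mollification g. The error \<delta> / 32 keeps the
  exterior of \<Omega> out of U and leaves \<phi> > \<delta> r / 16 on U. The 1 in 2 M + 1 is the
  room needed for mollifying at scale at most r.\<close>

lemma positivity_connected:
 assumes \<delta>: "\<delta> > 0"
 shows "EX M>=1. ALL z:frontier \<Omega>. ALL r>0. norm z + M * r <= 1 -->
  (ALL x1:ball z r. ALL x2:ball z r. \<phi> x1 >= \<delta> * r --> \<phi> x2 >= \<delta> * r -->
   (EX A. connected A & x1 : A & x2 : A & A <= ball z (M * r) & (ALL y:A. \<phi> y > \<delta> / 16 * r)))"
proof -
 define \<tau> where "\<tau> = min 1 (\<delta> / (32 * L))"
 have \<tau>: "0 < \<tau>" "\<tau> <= 1" using \<delta> L_pos by (auto simp: \<tau>_def)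
 have "L * \<tau> <= L * (\<delta> / (32 * L))" using L_pos by (intro mult_left_mono) (auto simp: \<tau>_def)
 then have L\<tau>: "L * \<tau> <= \<delta> / 32" using L_pos by simp
 define \<mu>' where "\<mu>' = \<mu> * measure lborel (ball (0::'a) 1)"
 have mu': "\<mu>' > 0" using mu_pos content_ball_pos[of 1 "0::'a"] by (simp add: \<mu>'_def)
 have L2: "2 * L > 0" and c0: "3 * \<delta> / 16 > 0" using L_pos \<delta> by auto
 obtain S M where S: "S >= 1" "M >= S" and H: "ALL w1 w2 :: 'a => real.
  phase (2 * L) (3 * \<delta> / 16) \<tau> M w1 --> phase (2 * L) (3 * \<delta> / 16) \<tau> M w2 --> (ALL x. w1 x = 0 \<or> w2 x = 0) -->
  (ALL s. 1 <= s --> s <= S --> (EX B:sets borel. B <= ball 0 1 & measure lborel B >= \<mu>' &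
    (ALL y:B. w1 (s *\<^sub>R y) = 0 & w2 (s *\<^sub>R y) = 0))) --> False"
  using no_two_phases_local[OF mu' L2 c0 \<tau>, where 'a='a] by blast
 have M: "M >= 1" using S by simp
 have "EX A. connected A & x1 : A & x2 : A & A <= ball z ((2 * M + 1) * r) & (ALL y:A. \<phi> y > \<delta> / 16 * r)"
  if z: "z : frontier \<Omega>" and r: "r > 0" "norm z + (2 * M + 1) * r <= 1"
   and x: "x1 : ball z r" "x2 : ball z r" "\<phi> x1 >= \<delta> * r" "\<phi> x2 >= \<delta> * r" for z r x1 x2
 proof -
  have rM: "r * (2 * M) + r <= 1 - norm z" using r(2) by (simp add: algebra_simps)
  have nz: "norm z < 1"
  proof -
   have "r * (2 * M) >= 0" using r M by simp
   then show ?thesis using rM r(1) by linarith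
  qed
  have \<tau>r: "\<tau> * r > 0" using \<tau> r by simp
  obtain G where GC: "Ck_on 4 UNIV G" and G: "!!x. norm x + \<tau> * r < 1 ==>
   laplacian G x >= 0 & \<bar>G x - \<phi> x\<bar> <= L * (\<tau> * r) & (ALL i:Basis. \<bar>pd i G x\<bar> <= L)"
   using mollification[OF phi_lip phi_sub \<tau>r] by blast
  define h where "h x = G (z + r *\<^sub>R x)" for x
  define g where "g x = (1 / r) * h x + 0 * h x" for x
  have hC: "Ck_on 4 UNIV h" unfolding h_def[abs_def] by (rule Ck_on_affine_arg[OF open_UNIV open_UNIV GC UNIV_I])
  have gC: "Ck_on 4 UNIV g" unfolding g_def[abs_def] by (intro Ck_on_add Ck_on_cmult hC open_UNIV)
  have inb: "norm (z + r *\<^sub>R x) + \<tau> * r < 1" "norm (z + r *\<^sub>R x) < 1" if "norm x < 2 * M" for x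
  proof -
   have "norm (z + r *\<^sub>R x) <= norm z + r * norm x" using norm_triangle_ineq[of z "r *\<^sub>R x"] r by simp
   moreover have "r * norm x < r * (2 * M)" using that r by (intro mult_strict_left_mono) auto
   moreover have "\<tau> * r <= 1 * r" using \<tau> r by (intro mult_right_mono) auto
   ultimately show "norm (z + r *\<^sub>R x) + \<tau> * r < 1" using rM by linarith
   then show "norm (z + r *\<^sub>R x) < 1" using \<tau>r by linarith
  qed
  have lap: "laplacian g x >= 0" if "norm x < 2 * M" for x
  proof -
   have h2: "Ck_on 2 UNIV h" and G2: "Ck_on 2 UNIV G"
    using Ck_on_le[OF open_UNIV hC, of 2] Ck_on_le[OF open_UNIV GC, of 2] by auto
   have "laplacian g x = (1 / r) * (r^2 * laplacian G (z + r *\<^sub>R x))"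
    using laplacian_add[OF open_UNIV UNIV_I h2 h2, of "1 / r" 0 x] laplacian_affine_arg[OF open_UNIV G2 UNIV_I, of z r x]
    by (simp add: g_def[abs_def] h_def[abs_def])
   then show ?thesis using G[OF inb(1)[OF that]] r by simp
  qed
  have pd: "\<bar>pd i g x\<bar> <= L" if "norm x < 2 * M" "i : Basis" for x i
  proof -
   have d: "h differentiable (at x)" "G differentiable (at x)" for x
    using Ck_on_le[OF open_UNIV hC, of "Suc 0"] Ck_on_le[OF open_UNIV GC, of "Suc 0"] by (auto simp: differentiable_on_def)
   have "pd i g x = pd i G (z + r *\<^sub>R x)"
    using partial_deriv_add[OF d(1) d(1), of i "1 / r" 0 x] partial_deriv_affine_arg[OF d(2), of i z r x] r
    by (simp add: g_def[abs_def] h_def[abs_def])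
   then show ?thesis using G[OF inb(1)[OF that(1)]] that(2) by simp
  qed
  have near: "\<bar>g x - \<phi> (z + r *\<^sub>R x) / r\<bar> <= \<delta> / 32" if "norm x < 2 * M" for x
  proof -
   have "\<bar>h x - \<phi> (z + r *\<^sub>R x)\<bar> <= (L * \<tau>) * r" using G[OF inb(1)[OF that]] by (simp add: h_def mult_ac)
   also have "... <= (\<delta> / 32) * r" using L\<tau> r by (intro mult_right_mono) auto
   finally have "\<bar>h x - \<phi> (z + r *\<^sub>R x)\<bar> / r <= \<delta> / 32" using r by (simp add: pos_divide_le_eq)
   moreover have "g x - \<phi> (z + r *\<^sub>R x) / r = (h x - \<phi> (z + r *\<^sub>R x)) / r" by (simp add: g_def diff_divide_distrib)
   ultimately show ?thesis using r by simp
  qed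
  have psi_diff: "\<bar>\<phi> (z + r *\<^sub>R x) / r - \<phi> (z + r *\<^sub>R y) / r\<bar> <= L * dist x y" if "norm x < 2 * M" "norm y < 2 * M" for x y
  proof -
   have "\<bar>\<phi> (z + r *\<^sub>R x) - \<phi> (z + r *\<^sub>R y)\<bar> <= L * (r * dist x y)"
    using phi_diff[OF inb(2)[OF that(1)] inb(2)[OF that(2)]] r
    by (simp add: dist_norm scaleR_diff_right[symmetric])
   then have "\<bar>\<phi> (z + r *\<^sub>R x) - \<phi> (z + r *\<^sub>R y)\<bar> / r <= L * dist x y" using r by (simp add: pos_divide_le_eq mult_ac)
   then show ?thesis using r by (simp add: diff_divide_distrib[symmetric])
  qed
  have gl: "g x <= L * norm x + \<delta> / 32" if "norm x < 2 * M" for x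
  proof -
   have "\<bar>\<phi> (z + r *\<^sub>R x) / r\<bar> <= L * norm x"
    using psi_diff[OF that, of 0] M frontier_zero[OF z nz] by simp
   then show ?thesis using near[OF that] by linarith
  qed
  define U where "U = {x : ball 0 (2 * M). g x > 3 * \<delta> / 32}"
  define W where "W x0 = (%y. if y : connected_component_set U x0 then smooth_pos (\<delta> / 8) (g y) else 0)" for x0
  define q where "q x = (1 / r) *\<^sub>R (x - z)" for x
  have zq: "z + r *\<^sub>R q x = x" for x using r by (simp add: q_def)
  have ph: "norm (q x) < 1 & q x : U & phase (2 * L) (3 * \<delta> / 16) \<tau> M (W (q x))" if "x : ball z r" "\<phi> x >= \<delta> * r" for x
  proof -
   have n: "norm (q x) < 1" using that(1) r by (simp add: q_def dist_norm norm_minus_commute)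
   have n2: "norm (q x) < 2 * M" using n M by simp
   have big: "\<phi> x / r >= \<delta>" using that(2) r by (simp add: pos_le_divide_eq)
   have gy: "g y >= 15 * \<delta> / 16" if y: "y : ball (q x) \<tau>" for y
   proof -
    have "norm y <= norm (q x) + dist (q x) y" using norm_triangle_ineq4[of "q x" "q x - y"] by (simp add: dist_norm)
    then have ny: "norm y < 2 * M" using y n \<tau>(2) M by simp
    have "L * dist (q x) y <= L * \<tau>" using y L_pos by (intro mult_left_mono) auto
    then have "\<bar>\<phi> x / r - \<phi> (z + r *\<^sub>R y) / r\<bar> <= \<delta> / 32"
     using psi_diff[OF n2 ny] L\<tau> unfolding zq by linarith
    then show ?thesis using near[OF ny] big \<delta> by linarith
   qed
   have "q x : U" using gy[of "q x"] n2 \<tau> \<delta> by (simp add: U_def)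
   moreover have "phase (2 * L) (3 * \<delta> / 16) \<tau> M (W (q x))"
    by (rule component_phase[OF \<delta> \<tau> L\<tau> M gC lap pd gl U_def n gy W_def])
   ultimately show ?thesis using n by blast
  qed
  have "connected_component_set U (q x1) = connected_component_set U (q x2)"
  \<comment> \<open>Different components would give two disjoint phases, both vanishing on the
    exterior at all scales between r and S r; \<open>no_two_phases_local\<close> excludes
    this.\<close>
  proof (rule ccontr)
   assume "\<not> ?thesis"
   then have "connected_component_set U (q x1) Int connected_component_set U (q x2) = {}"
    using connected_component_nonoverlap[of U "q x1" "q x2"] by blast
   then have disj: "ALL y. W (q x1) y = 0 \<or> W (q x2) y = 0" unfolding W_def by auto
   have "EX B:sets borel. B <= ball 0 1 & measure lborel B >= \<mu>' & (ALL y:B. W (q x1) (s *\<^sub>R y) = 0 & W (q x2) (s *\<^sub>R y) = 0)"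
    if s: "1 <= s" "s <= S" for s
   proof -
    have "r * s <= r * (2 * M)" using s S M r by (intro mult_left_mono) auto
    then have "r * s < 1 - norm z" using rM r(1) by linarith
    moreover have "0 < r * s" using r s by simp
    ultimately obtain B where B: "B : sets borel" "B <= ball 0 1" "measure lborel B >= \<mu>'" "ALL y:B. z + (r * s) *\<^sub>R y \<notin> \<Omega>"
     using rescaled_exterior[OF z] unfolding \<mu>'_def by blast
    have "W x (s *\<^sub>R y) = 0" if y: "y : B" for x y
    proof -
     have "s * norm y <= M * 1" using B(2) y s S by (intro mult_mono) auto
     then have n: "norm (s *\<^sub>R y) < 2 * M" using s M by simp
     have "\<phi> (z + r *\<^sub>R (s *\<^sub>R y)) = 0" using phi_zero[of "z + r *\<^sub>R (s *\<^sub>R y)"] inb(2)[OF n] B(4) y by simp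
     then have "g (s *\<^sub>R y) <= \<delta> / 32" using near[OF n] by simp
     then have "s *\<^sub>R y \<notin> U" using \<delta> by (simp add: U_def)
     then have "s *\<^sub>R y \<notin> connected_component_set U x" using connected_component_subset[of U x] by blast
     then show ?thesis by (simp add: W_def)
    qed
    then show ?thesis using B(1-3) by blast
   qed
   then show False
    by (intro H[THEN spec, THEN spec, THEN mp, THEN mp, THEN mp, OF _ _ disj, THEN mp])
      (use ph[OF x(1) x(3)] ph[OF x(2) x(4)] in simp_all)
  qed
  then have c: "q x2 : connected_component_set U (q x1)" "q x1 : connected_component_set U (q x1)"
   using ph[OF x(1) x(3)] ph[OF x(2) x(4)] connected_component_refl[of "q x1" U] connected_component_refl[of "q x2" U] by auto
  define A where "A = (%y. z + r *\<^sub>R y) ` connected_component_set U (q x1)"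
  have "connected A" unfolding A_def by (intro connected_continuous_image continuous_intros) simp
  moreover have "x1 : A" "x2 : A" unfolding A_def using c zq by (metis image_eqI)+
  moreover have "y : ball z ((2 * M + 1) * r) & \<phi> y > \<delta> / 16 * r" if "y : A" for y
  proof -
   obtain t where t: "t : U" "y = z + r *\<^sub>R t" using \<open>y : A\<close> connected_component_subset[of U "q x1"] unfolding A_def by blast
   then have n: "norm t < 2 * M" "g t > 3 * \<delta> / 32" by (auto simp: U_def)
   have "r * norm t < r * (2 * M + 1)" using n r by (intro mult_strict_left_mono) auto
   then have "y : ball z ((2 * M + 1) * r)" using r by (simp add: t(2) dist_norm mult.commute)
   moreover have "\<phi> y / r > \<delta> / 16" using near[OF n(1)] n(2) unfolding t(2) by linarith
   then have "\<phi> y > \<delta> / 16 * r" using r by (simp add: pos_less_divide_eq)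
   ultimately show ?thesis by blast
  qed
  ultimately show ?thesis by (intro exI[of _ A]) blast
 qed
 then show ?thesis using M by (intro exI[of _ "2 * M + 1"] conjI) (simp, blast)
qed

end

section \<open>Harnack chains\<close>

text \<open>The balls of radius s about the points are disjoint and lie in the ball of radius R + s;
  compare volumes.\<close>

lemma packing_bound:
 fixes P :: "'a::euclidean_space set"
 assumes fin: "finite P" and P: "P <= ball z R" and s: "s > 0" "R > 0"
  and sep: "!!p q. p : P ==> q : P ==> p ~= q ==> dist p q >= 2 * s"
 shows "real (card P) * s ^ DIM('a) <= (R + s) ^ DIM('a)"
proof -
 define m where "m = measure lborel (ball (0::'a) 1)"
 have m: "m > 0" unfolding m_def by (rule content_ball_pos) simp
 have disj: "disjoint_family_on (%p. ball p s) P"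
  unfolding disjoint_family_on_def
 proof (intro ballI impI)
  fix p q assume pq: "p : P" "q : P" "p ~= q"
  show "ball p s Int ball q s = {}"
  proof (rule ccontr)
   assume "ball p s Int ball q s ~= {}"
   then obtain y where "dist p y < s" "dist q y < s" by auto
   then have "dist p q < 2 * s" using dist_triangle2[of p q y] by linarith
   then show False using sep[OF pq] by simp
  qed
 qed
 have fm: "emeasure lborel (ball p s) ~= \<infinity>" for p :: 'a
  using emeasure_bounded_finite[OF bounded_ball, of p s] by simp
 have "measure lborel (ball p s) = s ^ DIM('a) * m" for p :: 'a
  using content_ball_conv_unit_ball[of s p] s by (simp add: m_def)
 then have "real (card P) * (s ^ DIM('a) * m) = (SUM p:P. measure lborel (ball p s))" by simp
 also have "... = measure lborel (UN p:P. ball p s)"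
  by (rule measure_finite_Union[symmetric, OF fin _ disj fm]) auto
 also have "... <= measure lborel (ball z (R + s))"
 proof (rule measure_mono_fmeasurable)
  show "(UN p:P. ball p s) <= ball z (R + s)"
  proof
   fix y assume "y : (UN p:P. ball p s)"
   then obtain p where "p : P" "dist p y < s" by auto
   moreover from this have "dist z p < R" using P by auto
   ultimately show "y : ball z (R + s)" using dist_triangle[of z y p] by simp
  qed
 qed (auto intro!: borel_open open_UN fmeasurableI emeasure_bounded_finite)
 also have "... = (R + s) ^ DIM('a) * m" using content_ball_conv_unit_ball[of "R + s" z] s by (simp add: m_def)
 finally have "(real (card P) * s ^ DIM('a)) * m <= (R + s) ^ DIM('a) * m" by (simp add: mult_ac)
 then show ?thesis using m by simp
qed

lemma harmonic_on_subset: "T <= S ==> harmonic_on S u ==> harmonic_on T u"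
 unfolding harmonic_on_def using Ck_on_subset by blast

lemma harmonic_on_lincomb:
 assumes "open S" "harmonic_on S u" "harmonic_on S v"
 shows "harmonic_on S (%x. a * u x + b * v x)"
 using assms laplacian_add[of S _ u v a b] unfolding harmonic_on_def
 by (auto intro!: Ck_on_add Ck_on_cmult)

lemma harmonic_on_const: "harmonic_on S (%x::'a::euclidean_space. c)"
 by (simp add: harmonic_on_def)

text \<open>If a positive \<open>u\<close> varied too much along \<open>A\<close>, it would take the values
 \<open>q\<^sup>k u(x2)\<close> at points which Harnack's inequality forces to be far apart.\<close>

lemma harnack_connected:
 fixes u :: "'a::euclidean_space => real"
 assumes A: "connected A" "A <= ball z R" "x1 : A" "x2 : A" and \<rho>: "\<rho> > 0" "R > 0"
  and h: "!!y. y : A ==> harmonic_on (ball y \<rho>) u" and nn: "!!y t. y : A ==> t : ball y \<rho> ==> u t >= 0"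
  and N: "(R + \<rho> / 16) ^ DIM('a) < real N * (\<rho> / 16) ^ DIM('a)"
 shows "u x1 <= (2 * harnack_const TYPE('a)) ^ N * u x2"
proof -
 define H where "H = harnack_const TYPE('a)"
 define q where "q = 2 * H"
 have H: "H > 1" unfolding H_def by (rule harnack_const_gt1)
 then have q: "q > H" "q > 1" by (auto simp: q_def)
 \<comment> \<open>u may vanish; adding \<epsilon> makes its values strictly positive, so that the
   levels q^k w x2 increase strictly. At the end \<epsilon> tends to 0.\<close>
 have pos: "u x1 + \<epsilon> <= q ^ N * (u x2 + \<epsilon>)" if e: "\<epsilon> > 0" for \<epsilon>
 proof (rule ccontr)
  assume "\<not> ?thesis"
  then have big: "q ^ N * (u x2 + \<epsilon>) < u x1 + \<epsilon>" by simp
  define w where "w x = 1 * u x + 1 * \<epsilon>" for x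
  have wh: "harmonic_on (ball y \<rho>) w" if "y : A" for y
   unfolding w_def[abs_def] by (rule harmonic_on_lincomb[OF open_ball h[OF that] harmonic_on_const])
  have wn: "w t >= \<epsilon>" if "y : A" "t : ball y \<rho>" for y t using nn[OF that] by (simp add: w_def)
  have wA: "w y > 0" if "y : A" for y using wn[OF that, of y] \<rho> e by simp
  have wc: "continuous_on A w"
  proof (rule continuous_at_imp_continuous_on, rule ballI)
   fix y assume y: "y : A"
   have "Ck_on 2 (ball y \<rho>) w" using wh[OF y] by (simp add: harmonic_on_def)
   then have "continuous_on (ball y \<rho>) w" by (rule Ck_on_continuous[OF open_ball])
   then show "isCont w y" using \<rho> by (simp add: continuous_on_eq_continuous_at)
  qed
  have "EX y:A. w y = q ^ k * w x2" if k: "k <= N" for k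
  proof -
   have "w x2 <= q ^ k * w x2" using q wA[OF A(4)] by (simp add: one_le_power)
   moreover have "q ^ k * w x2 <= q ^ N * w x2" using k q wA[OF A(4)] by (intro mult_right_mono power_increasing) auto
   then have "q ^ k * w x2 <= w x1" using big by (simp add: w_def)
   moreover have "connected (w ` A)" by (rule connected_continuous_image[OF wc A(1)])
   ultimately have "q ^ k * w x2 : w ` A"
    using connectedD_interval[of "w ` A" "w x2" "w x1" "q ^ k * w x2"] A(3,4) by blast
   then show ?thesis by auto
  qed
  then have "ALL k. EX y. k < N --> y : A & w y = q ^ k * w x2" by (meson less_imp_le)
  then obtain y where y: "!!k. k < N ==> y k : A & w (y k) = q ^ k * w x2" by metis
  have far: "dist (y i) (y j) >= 2 * (\<rho> / 16)" if ij: "i < j" "j < N" for i j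
  proof (rule ccontr)
   assume "\<not> ?thesis"
   then have "dist (y i) (y j) <= \<rho> / 8" by simp
   moreover have yi: "y i : A" "w (y i) = q ^ i * w x2" "w (y j) = q ^ j * w x2" using y ij by auto
   ultimately have "w (y j) <= H * w (y i)"
    unfolding H_def using harnack[OF wh[OF yi(1)] _ \<rho>(1), of "y j"] wn[OF yi(1)] e by fastforce
   moreover have "q * w (y i) <= w (y j)"
   proof -
    have "q ^ Suc i * w x2 <= q ^ j * w x2" using ij q wA[OF A(4)] by (intro mult_right_mono power_increasing) auto
    then show ?thesis using yi by simp
   qed
   moreover have "H * w (y i) < q * w (y i)" using q wA[OF yi(1)] by simp
   ultimately show False by linarith
  qed
  have inj: "inj_on y {..<N}"
  proof (rule linorder_inj_onI')
   fix i j assume "i : {..<N}" "j : {..<N}" "i < j"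
   then show "y i ~= y j" using far[of i j] \<rho> by auto
  qed
  have "real (card (y ` {..<N})) * (\<rho> / 16) ^ DIM('a) <= (R + \<rho> / 16) ^ DIM('a)"
  proof (rule packing_bound)
   show "dist p p' >= 2 * (\<rho> / 16)" if pp: "p : y ` {..<N}" "p' : y ` {..<N}" "p ~= p'" for p p'
   proof -
    obtain i j where ij: "p = y i" "p' = y j" "i < N" "j < N" using pp(1,2) by auto
    then consider "i < j" | "j < i" using pp(3) by (cases i j rule: linorder_cases) auto
    then show ?thesis using far[of i j] far[of j i] ij by cases (auto simp: dist_commute)
   qed
  qed (use y A(2) \<rho> in auto)
  then show False using N by (simp add: card_image[OF inj])
 qed
 show ?thesis
 proof (rule field_le_epsilon)
  fix e :: real assume e: "e > 0"
  have qN: "q ^ N > 0" using q by simp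
  have "u x1 + e / q ^ N <= q ^ N * (u x2 + e / q ^ N)" by (rule pos) (use e qN in simp)
  then have "u x1 + e / q ^ N <= q ^ N * u x2 + e" using qN q(2) by (simp add: distrib_left)
  moreover have "e / q ^ N >= 0" using e qN by simp
  ultimately show "u x1 <= (2 * harnack_const TYPE('a)) ^ N * u x2 + e" unfolding q_def H_def by linarith
 qed
qed

lemma ball_subset_shift: "dist z x + r <= R ==> ball x r <= ball (z::'a::euclidean_space) R"
proof
 fix y assume "dist z x + r <= R" "y : ball x r"
 then show "y : ball z R" using dist_triangle[of z y x] by simp
qed

section \<open>Nonnegative solutions and their growth away from the boundary\<close>

context optimal_domain
begin

definition sol :: "'a => real => ('a => real) => bool" where
 "sol z R u \<longleftrightarrow> continuous_on (ball z R) u & harmonic_on (\<Omega> Int ball z R) u & (ALL x:ball z R - \<Omega>. u x = 0)"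

definition psol :: "'a => real => ('a => real) => bool" where
 "psol z R u \<longleftrightarrow> sol z R u & (ALL x:ball z R. u x >= 0)"

lemma sol_subset: "ball x r <= ball z R ==> sol z R u ==> sol x r u"
 unfolding sol_def using continuous_on_subset harmonic_on_subset[of "\<Omega> Int ball x r" "\<Omega> Int ball z R" u] by blast

lemma psol_subset: "ball x r <= ball z R ==> psol z R u ==> psol x r u"
 unfolding psol_def using sol_subset by blast

text \<open>No boundary values are prescribed, because chains are also applied to w + a, which does
  not vanish outside \<Omega>.\<close>

definition hpos :: "'a => real => ('a => real) => bool" where
 "hpos z R u \<longleftrightarrow> harmonic_on (\<Omega> Int ball z R) u & (ALL x:ball z R. u x >= 0)"

lemma psol_hpos: "psol z R u ==> hpos z R u"
 by (simp add: psol_def sol_def hpos_def)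

lemma hpos_subset: "ball x r <= ball z R ==> hpos z R u ==> hpos x r u"
 unfolding hpos_def using harmonic_on_subset[of "\<Omega> Int ball x r" "\<Omega> Int ball z R" u] by blast

lemma sol_lincomb:
 assumes "sol z R u" "sol z R v" shows "sol z R (%x. a * u x + b * v x)"
 using assms harmonic_on_lincomb[of "\<Omega> Int ball z R" u v a b] open_dom unfolding sol_def
 by (auto intro!: continuous_intros)

lemma ball_in_dom: "norm x + r <= 1 ==> L * r <= \<phi> x ==> r > 0 ==> ball x r <= \<Omega>"
proof
 fix y assume a: "norm x + r <= 1" "L * r <= \<phi> x" "r > 0" "y : ball x r"
 then have y: "norm y < 1" using ball_subset_shift[of 0 x r 1] by auto
 have "L * dist x y < L * r" using a L_pos by simp
 then have "\<phi> y > 0" using phi_diff[of x y] a y by simp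
 then show "y : \<Omega>" using phi_pos_iff[OF y] by simp
qed

text \<open>On the connecting set \<phi> exceeds \<delta> r / 16, so by the Lipschitz bound balls of
  radius k r about its points stay in \<Omega>. All lengths are proportional to r, hence the
  exponent N does not depend on the scale.\<close>

lemma comparability:
 assumes \<delta>: "\<delta> > 0"
 shows "EX M>=1. EX C>=1. ALL z:frontier \<Omega>. ALL r>0. ALL u x1 x2. norm z + M * r <= 1 --> hpos z (M * r) u -->
  x1 : ball z r --> x2 : ball z r --> \<phi> x1 >= \<delta> * r --> \<phi> x2 >= \<delta> * r --> u x1 <= C * u x2"
proof -
 obtain M where M: "M >= 1" and conn: "ALL z:frontier \<Omega>. ALL r>0. norm z + M * r <= 1 -->
  (ALL x1:ball z r. ALL x2:ball z r. \<phi> x1 >= \<delta> * r --> \<phi> x2 >= \<delta> * r -->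
   (EX A. connected A & x1 : A & x2 : A & A <= ball z (M * r) & (ALL y:A. \<phi> y > \<delta> / 16 * r)))"
  using positivity_connected[OF \<delta>] by blast
 define k where "k = min 1 (\<delta> / (16 * L))"
 have k: "0 < k" "k <= 1" using \<delta> L_pos by (auto simp: k_def)
 have "L * k <= L * (\<delta> / (16 * L))" using L_pos by (intro mult_left_mono) (auto simp: k_def)
 then have Lk: "L * k <= \<delta> / 16" using L_pos by simp
 obtain N :: nat where "(M + k / 16) ^ DIM('a) / (k / 16) ^ DIM('a) < real N" using reals_Archimedean2 by blast
 then have N: "(M + k / 16) ^ DIM('a) < real N * (k / 16) ^ DIM('a)" using k by (simp add: pos_divide_less_eq)
 define C where "C = (2 * harnack_const TYPE('a)) ^ N"
 have C: "C >= 1" unfolding C_def using harnack_const_gt1[where 'a='a] by (intro one_le_power) simp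
 have "u x1 <= C * u x2"
  if z: "z : frontier \<Omega>" and r: "r > 0" "norm z + (M + 1) * r <= 1" and u: "hpos z ((M + 1) * r) u"
   and x: "x1 : ball z r" "x2 : ball z r" "\<phi> x1 >= \<delta> * r" "\<phi> x2 >= \<delta> * r" for z r u x1 x2
 proof -
  have Mr: "norm z + M * r + r <= 1" using r by (simp add: algebra_simps)
  then have "norm z + M * r <= 1" using r by linarith
  then obtain A where A: "connected A" "x1 : A" "x2 : A" "A <= ball z (M * r)" "ALL y:A. \<phi> y > \<delta> / 16 * r"
   using conn z r(1) x by meson
  have kr: "k * r > 0" "k * r <= r" using k r by auto
  have sub: "ball y (k * r) <= ball z ((M + 1) * r)" "ball y (k * r) <= \<Omega>" if y: "y : A" for y
  proof -
   have d: "dist z y < M * r" using A(4) y by auto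
   then show "ball y (k * r) <= ball z ((M + 1) * r)"
    using kr by (intro ball_subset_shift) (simp add: algebra_simps)
   have "norm y <= norm z + dist z y" by (rule norm_le_norm_dist)
   then have "norm y + k * r <= 1" using d kr Mr by linarith
   moreover have "(L * k) * r <= \<delta> / 16 * r" using Lk r by (intro mult_right_mono) auto
   then have "L * (k * r) <= \<phi> y" using bspec[OF A(5) y] unfolding mult.assoc by linarith
   ultimately show "ball y (k * r) <= \<Omega>" using kr by (intro ball_in_dom)
  qed
  have sc: "(M * r + k * r / 16) ^ DIM('a) = (M + k / 16) ^ DIM('a) * r ^ DIM('a)"
   "(k * r / 16) ^ DIM('a) = (k / 16) ^ DIM('a) * r ^ DIM('a)"
   by (simp_all add: power_mult_distrib[symmetric] distrib_right)
  show ?thesis unfolding C_def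
  proof (rule harnack_connected[OF A(1,4,2,3) kr(1)])
   show "harmonic_on (ball y (k * r)) u" if "y : A" for y
    using harmonic_on_subset[of "ball y (k * r)" "\<Omega> Int ball z ((M + 1) * r)" u] sub[OF that] u
    unfolding hpos_def by blast
   show "u t >= 0" if "y : A" "t : ball y (k * r)" for y t
    using sub(1)[OF that(1)] that(2) u unfolding hpos_def by blast
   show "(M * r + k * r / 16) ^ DIM('a) < real N * (k * r / 16) ^ DIM('a)"
    unfolding sc mult.assoc[symmetric] using N r by (intro mult_strict_right_mono) auto
  qed (use M r in simp)
 qed
 then show ?thesis using M C by (intro exI[of _ "M + 1"] conjI exI[of _ C]) (simp, simp, blast)
qed

lemma corkscrew:
 assumes z: "z : frontier \<Omega>" and r: "0 < r" "norm z + r < 1"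
 shows "EX A:ball z r. \<phi> A >= \<eta> / 2 * r"
proof (rule ccontr)
 assume "\<not> ?thesis"
 then have "!!x. x : ball z r ==> \<phi> x <= \<eta> / 2 * r" by force
 then have "(SUP x\<in>ball z r. \<phi> x) <= \<eta> / 2 * r" using r by (intro cSUP_least) auto
 moreover have "(SUP x\<in>ball z r. \<phi> x) >= \<eta> * r" by (rule nondeg) (use z r in auto)
 moreover have "\<eta> * r > 0" using r eta_pos by simp
 ultimately show False by linarith
qed

lemma frontier_between:
 assumes x: "x : \<Omega>" and y: "norm y < 1" "y \<notin> \<Omega>"
 shows "EX z:frontier \<Omega>. dist x z <= dist x y & norm z < 1"
proof -
 have "closed_segment x y Int frontier \<Omega> ~= {}"
  by (rule connected_Int_frontier) (use x y in auto)
 then obtain z where z: "z : closed_segment x y" "z : frontier \<Omega>" by blast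
 have "dist x z <= dist x y" using dist_in_closed_segment[OF z(1)] by (simp add: dist_commute)
 moreover have "closed_segment x y <= ball 0 1"
  using x y dom_sub by (intro closed_segment_subset) auto
 ultimately show ?thesis using z by (intro bexI[of _ z]) auto
qed

text \<open>Hypothesis (c) bounds the distance to the exterior by \<phi> x / \<kappa>. The factor 2
  yields an actual exterior point with strict inequality, and the segment to it meets the
  frontier.\<close>

lemma near_frontier:
 assumes x: "x : \<Omega>" "norm x < 1/2"
 shows "EX z:frontier \<Omega>. dist x z < 2 / \<kappa> * \<phi> x & norm z < 1"
proof -
 have ne: "ball 0 1 - \<Omega> ~= {}" using frontier_zero[OF zero_front] centre_in_ball[of "0::'a" 1] by (metis DiffI emptyE norm_zero zero_less_one)
 have p: "\<phi> x > 0" using phi_pos[OF x(1)] .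
 have "EX y:ball 0 1 - \<Omega>. dist x y < 2 / \<kappa> * \<phi> x"
 proof (rule ccontr)
  assume "\<not> ?thesis"
  then have "!!y. y : ball 0 1 - \<Omega> ==> 2 / \<kappa> * \<phi> x <= dist x y" by force
  then have "2 / \<kappa> * \<phi> x <= infdist x (ball 0 1 - \<Omega>)"
   unfolding infdist_notempty[OF ne] by (intro cINF_greatest ne)
  then have "\<kappa> * (2 / \<kappa> * \<phi> x) <= \<kappa> * infdist x (ball 0 1 - \<Omega>)" using kappa_pos by (intro mult_left_mono) auto
  also have "... <= \<phi> x" using phi_dist[of x] x by simp
  finally show False using kappa_pos p by simp
 qed
 then obtain y where y: "norm y < 1" "y \<notin> \<Omega>" and xy: "dist x y < 2 / \<kappa> * \<phi> x" by auto
 obtain z where "z : frontier \<Omega>" "dist x z <= dist x y" "norm z < 1" using frontier_between[OF x(1) y] by blast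
 then show ?thesis using xy by (intro bexI[of _ z] conjI) auto
qed

text \<open>One step of a Harnack chain. About a frontier point near x the corkscrew property at
  scale K1 \<phi> x finds a point where \<phi> has doubled: K1 >= 2 / \<kappa> makes the ball reach
  x, K1 >= 4 / \<eta> gives the doubling, and \<open>comparability\<close> applies at the level
  \<phi> x.\<close>

lemma climb:
 "EX K>=1. EX C>=1. ALL x:\<Omega>. norm x + K * \<phi> x < 1/2 --> (EX x'. dist x x' < K * \<phi> x & \<phi> x' >= 2 * \<phi> x &
   (ALL u. hpos x (K * \<phi> x) u --> u x <= C * u x' & u x' <= C * u x))"
proof -
 define K1 where "K1 = max (4 / \<eta>) (2 / \<kappa>)"
 have K1: "K1 > 0" "4 / \<eta> <= K1" "2 / \<kappa> <= K1" using eta_pos kappa_pos by (auto simp: K1_def max_def)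
 have "1 / K1 > 0" using K1 by simp
 then obtain M C where M: "M >= 1" and C: "C >= 1" and comp: "!!z r u x1 x2. z : frontier \<Omega> ==> r > 0 ==>
  norm z + M * r <= 1 ==> hpos z (M * r) u ==>
  x1 : ball z r ==> x2 : ball z r ==> \<phi> x1 >= 1 / K1 * r ==> \<phi> x2 >= 1 / K1 * r ==> u x1 <= C * u x2"
  using comparability[of "1 / K1"] by metis
 define K where "K = max 1 ((M + 1) * K1)"
 have "EX x'. dist x x' < K * \<phi> x & \<phi> x' >= 2 * \<phi> x & (ALL u. hpos x (K * \<phi> x) u --> u x <= C * u x' & u x' <= C * u x)"
  if x: "x : \<Omega>" "norm x + K * \<phi> x < 1/2" for x
 proof -
  define t where "t = \<phi> x"
  define r where "r = K1 * t"
  have t: "t > 0" unfolding t_def by (rule phi_pos[OF x(1)])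
  have r: "r > 0" using K1 t by (simp add: r_def)
  have "((M + 1) * K1) * t <= K * t" using t by (intro mult_right_mono) (auto simp: K_def)
  then have Kr: "M * r + r <= K * t" by (simp add: r_def algebra_simps)
  have Mr: "r <= M * r" using M r by simp
  have nx: "norm x + (M * r + r) < 1/2" using x(2) Kr unfolding t_def by linarith
  then have "norm x < 1/2" using r Mr by linarith
  then obtain z where z: "z : frontier \<Omega>" "dist x z < 2 / \<kappa> * t" using near_frontier[OF x(1)] unfolding t_def by blast
  have "2 / \<kappa> * t <= r" unfolding r_def using K1 t by (intro mult_right_mono) auto
  then have xz: "dist x z < r" using z by simp
  have nz: "norm z + M * r <= 1/2"
   using norm_triangle_ineq4[of x "x - z"] xz nx by (simp add: dist_norm)
  have "norm z + r < 1" using nz Mr by linarith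
  then obtain x' where x': "x' : ball z r" "\<phi> x' >= \<eta> / 2 * r" using corkscrew[OF z(1) r] by blast
  have "(\<eta> / 2) * ((4 / \<eta>) * t) <= \<eta> / 2 * r" unfolding r_def using K1 t eta_pos by (intro mult_left_mono mult_right_mono) auto
  then have big: "\<phi> x' >= 2 * t" using x'(2) eta_pos by simp
  have rt: "1 / K1 * r = t" using K1 by (simp add: r_def)
  have sub: "ball z (M * r) <= ball x (K * t)" using xz Kr by (intro ball_subset_shift) simp
  have xb: "x : ball z r" using xz by (simp add: dist_commute)
  have "dist x x' < K * t" using xz x'(1) dist_triangle[of x x' z] Kr Mr by simp
  moreover have "u x <= C * u x' & u x' <= C * u x" if "hpos x (K * t) u" for u
   using comp[OF z(1) r _ hpos_subset[OF sub that] xb x'(1)] comp[OF z(1) r _ hpos_subset[OF sub that] x'(1) xb]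
    nz big t unfolding rt by (simp add: t_def)
  ultimately show ?thesis using big unfolding t_def by blast
 qed
 moreover have "K >= 1" by (simp add: K_def)
 ultimately show ?thesis using C by blast
qed

text \<open>Induction on the dyadic level of \<phi> x: a climb doubles \<phi> and so reaches the
  previous level, at the cost of one factor C. The radii (1 + 2^-n) R shrink at just the rate that
  leaves room for the climbs.\<close>

lemma growth:
 "EX K>=4. EX C>=1. EX c0>0. c0 <= \<eta> / 2 & (ALL z:frontier \<Omega>. ALL R>0. ALL u A. norm z + K * R < 1/2 --> psol z (K * R) u -->
   A : ball z (2 * R) --> \<phi> A >= c0 * R -->
   (ALL n. ALL x:ball z ((1 + (1/2) ^ n) * R). \<phi> x >= (1/2) ^ n * (c0 * R) --> u x <= C ^ Suc n * u A))"
proof -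
 obtain K1 C1 where K1: "K1 >= 1" and C1: "C1 >= 1" and cl: "ALL x:\<Omega>. norm x + K1 * \<phi> x < 1/2 -->
   (EX x'. dist x x' < K1 * \<phi> x & \<phi> x' >= 2 * \<phi> x & (ALL u. hpos x (K1 * \<phi> x) u --> u x <= C1 * u x' & u x' <= C1 * u x))"
  using climb by blast
 \<comment> \<open>At level h = 2^-(n+1) R the climb has length at most K1 (2 c0 h) <= h / 2, which
   stays inside the previous ball.\<close>
 define c0 where "c0 = min (\<eta> / 2) (1 / (4 * K1))"
 have c0: "c0 > 0" "c0 <= \<eta> / 2" using eta_pos K1 by (auto simp: c0_def)
 have "K1 * c0 <= K1 * (1 / (4 * K1))" using K1 by (intro mult_left_mono) (auto simp: c0_def)
 then have Kc: "K1 * c0 <= 1/4" using K1 by simp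
 have "c0 / 2 > 0" using c0 by simp
 then obtain M C2 where M: "M >= 1" and C2: "C2 >= 1" and comp: "!!z r u x1 x2. z : frontier \<Omega> ==> r > 0 ==>
  norm z + M * r <= 1 ==> hpos z (M * r) u ==>
  x1 : ball z r ==> x2 : ball z r ==> \<phi> x1 >= c0 / 2 * r ==> \<phi> x2 >= c0 / 2 * r ==> u x1 <= C2 * u x2"
  using comparability[of "c0 / 2"] by metis
 define K where "K = max 4 (2 * M)"
 define C where "C = max C1 C2"
 have C: "C >= 1" "C1 <= C" "C2 <= C" using C1 by (auto simp: C_def)
 have "ALL x:ball z ((1 + (1/2) ^ n) * R). \<phi> x >= (1/2) ^ n * (c0 * R) --> u x <= C ^ Suc n * u A"
  if z: "z : frontier \<Omega>" and R: "R > 0" "norm z + K * R < 1/2" and u: "psol z (K * R) u"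
   and A: "A : ball z (2 * R)" "\<phi> A >= c0 * R" for z R u A n
 proof (induction n)
  have KR: "4 * R <= K * R" "2 * M * R <= K * R" using R by (auto intro!: mult_right_mono simp: K_def)
  have nn: "u y >= 0" if "dist z y < 4 * R" for y using u that KR unfolding psol_def by simp
  have uA: "u A >= 0" using nn A R by simp
  {
   case 0
   show ?case
   proof (intro ballI impI)
    fix x assume x: "x : ball z ((1 + (1/2) ^ 0) * R)" "\<phi> x >= (1/2) ^ 0 * (c0 * R)"
    have "u x <= C2 * u A"
    proof (rule comp[OF z])
     show "hpos z (M * (2 * R)) u" by (rule psol_hpos[OF psol_subset[OF _ u]]) (use KR in \<open>auto simp: mult_ac\<close>)
     show "norm z + M * (2 * R) <= 1"
     proof -
      have "M * (2 * R) <= K * R" using KR(2) by (simp add: mult_ac)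
      then show ?thesis using R(2) by linarith
     qed
    qed (use x A R in auto)
    also have "... <= C * u A" using C uA by (intro mult_right_mono) auto
    finally show "u x <= C ^ Suc 0 * u A" by simp
   qed
  next
   case (Suc n)
   show ?case
   proof (intro ballI impI)
    fix x assume x: "x : ball z ((1 + (1/2) ^ Suc n) * R)" "\<phi> x >= (1/2) ^ Suc n * (c0 * R)"
    define h where "h = (1/2) ^ Suc n * R"
    have h: "h > 0" "h <= R / 2" "(1/2) ^ n * R = 2 * h"
     using R power_le_one[of "1/2::real" n] by (auto simp: h_def)
    have xz: "dist z x < R + h" using x(1) by (simp add: h_def algebra_simps)
    have nb: "(1 + (1/2) ^ n) * R = R + 2 * h" "(1/2) ^ n * (c0 * R) = 2 * (c0 * h)" "(1/2) ^ Suc n * (c0 * R) = c0 * h"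
     using h(3) by (simp_all add: algebra_simps h_def)
    show "u x <= C ^ Suc (Suc n) * u A"
    proof (cases "\<phi> x >= 2 * (c0 * h)")
     case True
     then have "u x <= C ^ Suc n * u A" using bspec[OF Suc.IH, of x] xz h unfolding nb by simp
     also have "... <= C ^ Suc (Suc n) * u A" using C uA by (intro mult_right_mono power_increasing) auto
     finally show ?thesis .
    next
     case False
     have "c0 * h > 0" using c0(1) h(1) by simp
     then have px: "\<phi> x > 0" using x(2) unfolding nb by linarith
     have nx: "norm x <= norm z + dist z x" by (rule norm_le_norm_dist)
     then have "norm x < 1" using xz h R(2) KR(1) by linarith
     then have xO: "x : \<Omega>" using px phi_pos_iff by blast
     have "K1 * \<phi> x <= K1 * (2 * (c0 * h))" using False K1 by (intro mult_left_mono) auto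
     also have "... = 2 * h * (K1 * c0)" by simp
     also have "... <= 2 * h * (1/4)" using Kc h by (intro mult_left_mono) auto
     finally have Kx: "K1 * \<phi> x <= h / 2" by simp
     have "norm x + K1 * \<phi> x < 1/2" using nx xz Kx h R(2) KR(1) by linarith
     then obtain x' where x': "dist x x' < K1 * \<phi> x" "\<phi> x' >= 2 * \<phi> x"
      "ALL u. hpos x (K1 * \<phi> x) u --> u x <= C1 * u x' & u x' <= C1 * u x" using cl xO by meson
     have "ball x (K1 * \<phi> x) <= ball z (K * R)" by (rule ball_subset_shift) (use xz Kx h KR in linarith)
     then have "u x <= C1 * u x'" using x'(3) psol_hpos[OF psol_subset[OF _ u]] by blast
     have x'z: "dist z x' < R + 2 * h" using x'(1) xz Kx h dist_triangle[of z x' x] by linarith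
     have "u x' >= 0" using nn x'z h R by simp
     then have "C1 * u x' <= C * u x'" using C by (intro mult_right_mono) auto
     also have "u x' <= C ^ Suc n * u A"
      using bspec[OF Suc.IH, of x'] x'z x'(2) x(2) unfolding nb by simp
     finally have "C1 * u x' <= C * (C ^ Suc n * u A)" using C by simp
     then show ?thesis using \<open>u x <= C1 * u x'\<close> by simp
    qed
   qed
  }
 qed
 moreover have "K >= 4" by (simp add: K_def)
 ultimately show ?thesis using C c0 by (intro exI[of _ K] conjI exI[of _ C] exI[of _ c0]) blast+
qed

end

section \<open>Decay, Carleson estimate and boundary Harnack inequality\<close>

lemma geometric_scale:
 fixes q t b :: real
 assumes q: "0 < q" "q < 1" and t: "t > 0"
 shows "EX n. q ^ n * b <= t & (n = 0 \<or> q * t < q ^ n * b)"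
proof -
 have ex: "EX n. q ^ n * b <= t"
 proof (cases "b <= t")
  case True
  then show ?thesis by (intro exI[of _ 0]) simp
 next
  case False
  then have b: "b > 0" using t by simp
  obtain n where "q ^ n < t / b" using real_arch_pow_inv[of "t / b" q] q t b by auto
  then show ?thesis using b by (intro exI[of _ n]) (simp add: pos_less_divide_eq)
 qed
 define n where "n = (LEAST n. q ^ n * b <= t)"
 have n: "q ^ n * b <= t" unfolding n_def by (rule LeastI_ex[OF ex])
 have "q * t < q ^ n * b" if "n ~= 0"
 proof -
  obtain k where k: "n = Suc k" using \<open>n ~= 0\<close> not0_implies_Suc by blast
  have "\<not> q ^ k * b <= t" by (rule not_less_Least) (use k in \<open>simp add: n_def\<close>)
  then have "q * t < q * (q ^ k * b)" using q by (intro mult_strict_left_mono) auto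
  then show ?thesis by (simp add: k mult.assoc)
 qed
 then show ?thesis using n by (intro exI[of _ n] conjI) auto
qed

lemma norm_scaleR_less: "0 < r ==> norm y < 1 ==> norm (r *\<^sub>R y) < r"
 by simp

context optimal_domain
begin

text \<open>In the mean value inequality for the positive part the exterior contributes 0. By (e) it
  fills a fixed fraction of the ball, in a region where the kernel is at least 9/16, so a fixed
  proportion of the maximum is lost.\<close>

lemma exterior_decay:
 "EX \<theta>>0. \<theta> < 1 & (ALL z:frontier \<Omega>. ALL R>0. ALL u m. norm z + R <= 1 --> sol z R u --> m >= 0 -->
   (ALL x:ball z R. u x <= m) --> (ALL x:ball z (R / 8). u x <= \<theta> * m))"
proof -
 define c where "c = kern_mass TYPE('a)"
 define m1 where "m1 = measure lborel (ball (0::'a) 1)"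
 \<comment> \<open>The mean is taken over radius R/2 about x, while the exterior set lies in the
   ball of radius R/8 about z: the ratio 1/4 of radii appears to the power d, and points of that set
   are within R/4 of x.\<close>
 define \<beta> where "\<beta> = 9/16 * (\<mu> * (1/4) ^ DIM('a) * m1)"
 define \<theta> where "\<theta> = max (1/2) (1 - \<beta> / c)"
 have c: "c > 0" unfolding c_def by (rule kern_mass_pos)
 have m1: "m1 > 0" unfolding m1_def by (rule content_ball_pos) simp
 have \<beta>: "\<beta> > 0" using mu_pos m1 by (simp add: \<beta>_def)
 have \<theta>: "\<theta> > 0" "\<theta> < 1" using \<beta> c by (auto simp: \<theta>_def)
 have "u x <= \<theta> * m" if z: "z : frontier \<Omega>" and R: "R > 0" "norm z + R <= 1" and u: "sol z R u" and m: "m >= 0"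
  and le: "ALL x:ball z R. u x <= m" and x: "x : ball z (R / 8)" for z R u m x
 proof -
  define r where "r = R / 2"
  have r: "0 < r" "r < 7 * R / 8" using R by (auto simp: r_def)
  have sub: "ball x (7 * R / 8) <= ball z R" using x by (intro ball_subset_shift) auto
  have ux: "sol x (7 * R / 8) u" by (rule sol_subset[OF sub u])
  have uc: "continuous_on (ball x (7 * R / 8)) u" using ux by (simp add: sol_def)
  define S where "S = ball z (R / 8) - \<Omega>"
  define B where "B = {y. x + r *\<^sub>R y : S}"
  define I where "I = (indicator S :: 'a => real)"
  have Sm: "S : sets borel" unfolding S_def using open_dom by (intro sets.Diff) auto
  have Im: "I : borel_measurable borel" unfolding I_def using Sm by (rule borel_measurable_indicator)
  have eB: "I (x + r *\<^sub>R y) = indicator B y" for y by (simp add: I_def B_def indicator_def)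
  have fS: "emeasure lborel S < \<infinity>" by (rule emeasure_bounded_finite) (auto simp: S_def intro: bounded_subset[OF bounded_ball])
  have iB: "integrable lborel (indicator B :: 'a => real)"
   using lborel_affine_int(1)[OF _ Im, of r x] r(1) fS Sm unfolding eB by (simp add: I_def)
  have mB: "\<mu> * (1/4) ^ DIM('a) * m1 <= (LINT y|lborel. indicator B y)"
  proof -
   have "(LINT y|lborel. I y) = r ^ DIM('a) * (LINT y|lborel. indicator B y)"
    using lborel_affine_int(2)[OF _ Im, of r x] r unfolding eB by simp
   moreover have "(LINT y|lborel. I y) = measure lborel S" by (simp add: I_def)
   moreover have "measure lborel S >= \<mu> * measure lborel (ball z (R / 8))"
    unfolding S_def by (rule ext_dens) (use z R in auto)
   moreover have "measure lborel (ball z (R / 8)) = r ^ DIM('a) * ((1/4) ^ DIM('a) * m1)"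
    using content_ball_conv_unit_ball[of "R / 8" z] R by (simp add: m1_def r_def power_mult_distrib[symmetric] mult.assoc[symmetric])
   ultimately have "r ^ DIM('a) * (\<mu> * (1/4) ^ DIM('a) * m1) <= r ^ DIM('a) * (LINT y|lborel. indicator B y)"
    by (simp add: mult_ac)
   then show ?thesis by (rule mult_left_le_imp_le) (use r in simp)
  qed
  have "max 0 (u x) * c <= (LINT y|lborel. max 0 (u (x + r *\<^sub>R y)) * kern y)"
   unfolding c_def by (rule submean_pos_part[OF open_dom uc _ _ r]) (use ux in \<open>auto simp: sol_def\<close>)
  also have "... <= (LINT y|lborel. m * kern y - (9/16 * m) * indicator B y)"
  proof (rule integral_mono)
   show "integrable lborel (%y. max 0 (u (x + r *\<^sub>R y)) * kern y)"
    by (rule integrable_kern_scaled(2)[of x "7 * R / 8" "%x. max 0 (u x)" r])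
      (use r in \<open>auto intro!: continuous_on_max continuous_on_const uc\<close>)
   show "integrable lborel (%y. m * kern y - (9/16 * m) * indicator B y)"
    by (intro Lintegrable_diff integrable_mult_right kern_integrable iB)
   show "max 0 (u (x + r *\<^sub>R y)) * kern y <= m * kern y - (9/16 * m) * indicator B y" for y
   proof (cases "y : B")
    case True
    then have yS: "x + r *\<^sub>R y : ball z (R / 8)" "x + r *\<^sub>R y \<notin> \<Omega>" by (auto simp: B_def S_def)
    have "u (x + r *\<^sub>R y) = 0" using yS u R by (simp add: sol_def)
    moreover have "norm (r *\<^sub>R y) < R / 8 + R / 8"
     using dist_triangle[of x "x + r *\<^sub>R y" z] x yS(1) by (simp add: dist_commute) (simp add: dist_norm)
    then have "norm y <= 1/2" using r R by (simp add: r_def field_simps)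
    then have "kern y >= (1 - (1/2)\<^sup>2)\<^sup>2" by (rule kern_bounds(4)) simp
    then have "9/16 <= kern y" by (simp add: power2_eq_square)
    then have "(9/16) * m <= kern y * m" using m by (rule mult_right_mono)
    ultimately show ?thesis using True by (simp add: mult.commute)
   next
    case False
    show ?thesis
    proof (cases "norm y < 1")
     case True
     have "norm (r *\<^sub>R y) < 7 * R / 8" using norm_scaleR_less[OF r(1) True] r(2) by linarith
     then have "x + r *\<^sub>R y : ball x (7 * R / 8)" by (simp add: dist_norm del: norm_scaleR)
     then have "x + r *\<^sub>R y : ball z R" by (rule subsetD[OF sub])
     then have "max 0 (u (x + r *\<^sub>R y)) <= m" using le m by simp
     then have "max 0 (u (x + r *\<^sub>R y)) * kern y <= m * kern y" using kern_bounds(1)[of y] by (rule mult_right_mono)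
     then show ?thesis using False by simp
    qed (use False kern_bounds(3)[of y] in simp)
   qed
  qed
  also have "... = m * c - (9/16 * m) * (LINT y|lborel. indicator B y)"
   by (subst Lintegral_diff)
     (auto simp: c_def kern_mass_def intro!: integrable_mult_right kern_integrable iB)
  also have "... <= m * c - (9/16 * m) * (\<mu> * (1/4) ^ DIM('a) * m1)"
   using mB m by (intro diff_left_mono mult_left_mono) auto
  also have "... = m * ((1 - \<beta> / c) * c)" using c by (simp add: \<beta>_def left_diff_distrib right_diff_distrib)
  also have "... <= m * (\<theta> * c)" using m c by (intro mult_left_mono mult_right_mono) (auto simp: \<theta>_def)
  finally have "max 0 (u x) * c <= (\<theta> * m) * c" by (simp add: mult_ac)
  then have "max 0 (u x) <= \<theta> * m" using c by simp
  then show ?thesis by simp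
 qed
 then show ?thesis using \<theta> by (intro exI[of _ \<theta>]) blast
qed

lemma exterior_decay_iterate:
 "EX \<theta>>0. \<theta> < 1 & (ALL z:frontier \<Omega>. ALL R>0. ALL u m. norm z + R <= 1 --> sol z R u --> m >= 0 -->
   (ALL x:ball z R. u x <= m) --> (ALL k. ALL x:ball z ((1/8) ^ k * R). u x <= \<theta> ^ k * m))"
proof -
 obtain \<theta> where \<theta>: "\<theta> > 0" "\<theta> < 1" and D: "ALL z:frontier \<Omega>. ALL R>0. ALL u m. norm z + R <= 1 --> sol z R u --> m >= 0 -->
   (ALL x:ball z R. u x <= m) --> (ALL x:ball z (R / 8). u x <= \<theta> * m)" using exterior_decay by (elim exE conjE) (rule that; assumption)
 have "ALL x:ball z ((1/8) ^ k * R). u x <= \<theta> ^ k * m"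
  if z: "z : frontier \<Omega>" and R: "R > 0" "norm z + R <= 1" and u: "sol z R u" and m: "m >= 0"
  and le: "ALL x:ball z R. u x <= m" for z R u m k
 proof (induction k)
  case 0
  then show ?case using le by simp
 next
  case (Suc k)
  have kR: "(1/8) ^ k * R > 0" "(1/8) ^ k * R <= R" using R by (auto simp: mult_le_cancel_right1 power_le_one)
  have "ALL x:ball z ((1/8) ^ k * R / 8). u x <= \<theta> * (\<theta> ^ k * m)"
  proof (rule D[rule_format, THEN ballI])
   show "norm z + (1/8) ^ k * R <= 1" using kR(2) R(2) by linarith
   show "sol z ((1/8) ^ k * R) u" by (rule sol_subset[OF _ u]) (use kR in auto)
   show "\<theta> ^ k * m >= 0" using \<theta> m by simp
  qed (use z kR(1) Suc.IH in auto)
  then show ?case by (simp add: mult.assoc)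
 qed
 then show ?thesis using \<theta> by (intro exI[of _ \<theta>]) blast
qed

text \<open>Carleson's estimate. At a maximum point \<open>p\<close> of \<open>(R - |x - z|)\<^sup>N u(x)\<close> either \<open>p\<close> is far from the
 boundary, where the growth bound applies, or the exterior decay forces \<open>u p = 0\<close>.\<close>

lemma carleson:
 "EX K>=4. EX C>=1. EX c0>0. c0 <= \<eta> / 2 & (ALL z:frontier \<Omega>. ALL R>0. ALL u A. norm z + K * R < 1/2 --> psol z (K * R) u -->
   A : ball z (2 * R) --> \<phi> A >= c0 * R --> (ALL x:ball z (R / 2). u x <= C * u A))"
proof -
 obtain K C c0 where K: "K >= 4" and C: "C >= 1" and c0: "c0 > 0" "c0 <= \<eta> / 2"
  and gr: "ALL z:frontier \<Omega>. ALL R>0. ALL u A. norm z + K * R < 1/2 --> psol z (K * R) u -->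
   A : ball z (2 * R) --> \<phi> A >= c0 * R -->
   (ALL n. ALL x:ball z ((1 + (1/2) ^ n) * R). \<phi> x >= (1/2) ^ n * (c0 * R) --> u x <= C ^ Suc n * u A)"
  using growth by (elim exE conjE) (rule that; assumption)
 obtain \<theta> where \<theta>: "\<theta> > 0" "\<theta> < 1" and D: "ALL z:frontier \<Omega>. ALL R>0. ALL u m. norm z + R <= 1 --> sol z R u --> m >= 0 -->
   (ALL x:ball z R. u x <= m) --> (ALL k. ALL x:ball z ((1/8) ^ k * R). u x <= \<theta> ^ k * m)" using exterior_decay_iterate by (elim exE conjE) (rule that; assumption)
 \<comment> \<open>The weight exponent N turns the growth C^n at height 2^-n into at most (2^n)^N,
   which the weight (R - |x - z|)^N absorbs.\<close>
 obtain N0 :: nat where "C < 2 ^ N0" using real_arch_pow[of 2 C] by auto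
 define N where "N = Suc N0"
 have "(2::real) ^ N0 <= 2 ^ N" unfolding N_def by (rule power_increasing) auto
 then have "C <= 2 ^ N" using \<open>C < 2 ^ N0\<close> by linarith
 then have N: "C <= 2 ^ N" "N > 0" by (simp_all add: N_def)
 obtain k where k: "\<theta> ^ k < 1 / (2 * 4 ^ N)" using real_arch_pow_inv[of "1 / (2 * 4 ^ N)" \<theta>] \<theta> by auto
 have k: "\<theta> ^ k * 4 ^ N <= 1/2"
  using mult_right_mono[OF less_imp_le[OF k], of "4 ^ N"] by simp
 \<comment> \<open>If \<phi> p < \<epsilon> s, the frontier is within (2 / \<kappa>) \<epsilon> s =
   8^-k (s / 4) of p, near enough for k rounds of decay.\<close>
 define \<epsilon> where "\<epsilon> = \<kappa> * (1/8) ^ k / 8"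
 have \<epsilon>: "\<epsilon> > 0" using kappa_pos by (simp add: \<epsilon>_def)
 define E where "E = max 1 (2 * c0 / \<epsilon>)"
 have E: "E >= 1" "2 * c0 / \<epsilon> <= E" by (auto simp: E_def)
 define C' where "C' = (4 * E) ^ N"
 have C': "C' >= 1" unfolding C'_def using E by (intro one_le_power) simp
 have "u x <= C' * u A" if z: "z : frontier \<Omega>" and R: "R > 0" "norm z + K * R < 1/2" and u: "psol z (K * R) u"
   and A: "A : ball z (2 * R)" "\<phi> A >= c0 * R" and x: "x : ball z (R / 2)" for z R u A x
 proof -
  have KR: "4 * R <= K * R" using K R by (intro mult_right_mono) auto
  have su: "sol z (K * R) u" and un: "!!y. dist z y < 4 * R ==> u y >= 0" using u KR by (auto simp: psol_def)
  have uA: "u A >= 0" using un A R by simp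
  define F where "F y = (R - dist z y) ^ N * u y" for y
  have cb: "cball z R <= ball z (K * R)"
  proof
   fix y assume "y : cball z R"
   then have "dist z y <= R" by simp
   then show "y : ball z (K * R)" using KR R(1) unfolding mem_ball by linarith
  qed
  have "continuous_on (cball z R) u" using cb su unfolding sol_def by (blast intro: continuous_on_subset)
  then have "continuous_on (cball z R) F" unfolding F_def[abs_def] by (intro continuous_intros)
  then obtain p where p: "p : cball z R" "!!y. y : cball z R ==> F y <= F p"
   using continuous_attains_sup[of "cball z R" F] R by auto
  define s where "s = R - dist z p"
  have s: "0 <= s" "s <= R" using p(1) by (auto simp: s_def)
  have nball: "norm y < 1/2" if "dist z y < 4 * R" for y
  proof -
   have "norm y <= norm z + dist z y" by (rule norm_le_norm_dist)
   then show ?thesis using that R KR by linarith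
  qed
  have up: "u p >= 0" using un p(1) R by simp
  have main: "F p <= (2 * E) ^ N * R ^ N * u A"
  proof (cases "s = 0 \<or> u p = 0")
   case True
   then have "F p = 0" using N by (auto simp: F_def s_def[symmetric])
   then show ?thesis using E R uA by simp
  next
   case False
   then have s0: "s > 0" and upp: "u p > 0" using s up by auto
   have pO: "p : \<Omega>"
   proof (rule ccontr)
    assume "p \<notin> \<Omega>"
    then have "u p = 0" using su subsetD[OF cb p(1)] by (simp add: sol_def)
    then show False using upp by simp
   qed
   have pp: "\<phi> p > 0" by (rule phi_pos[OF pO])
   show ?thesis
   proof (cases "\<phi> p >= \<epsilon> * s")
    case True
    obtain n where n: "(1/2) ^ n * (c0 * R) <= \<phi> p" "n = 0 \<or> (1/2) * \<phi> p < (1/2) ^ n * (c0 * R)"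
     using geometric_scale[of "1/2" "\<phi> p" "c0 * R"] pp by auto
    have sn: "s * 2 ^ n <= E * R"
    proof (cases "n = 0")
     case True
     then have "s * 2 ^ n <= 1 * R" using s by simp
     also have "... <= E * R" using E R by (intro mult_right_mono) auto
     finally show ?thesis .
    next
     case False
     then have "(1/2) * \<phi> p < (1/2) ^ n * (c0 * R)" using n(2) by simp
     then have "2 ^ n * ((1/2) * \<phi> p) < 2 ^ n * ((1/2) ^ n * (c0 * R))" by (intro mult_strict_left_mono) auto
     also have "2 ^ n * ((1/2) ^ n * (c0 * R)) = c0 * R" by (simp add: power_divide)
     finally have "2 ^ n * \<phi> p < 2 * (c0 * R)" by simp
     moreover have "2 ^ n * (\<epsilon> * s) <= 2 ^ n * \<phi> p" using True by (intro mult_left_mono) auto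
     ultimately have "2 ^ n * (\<epsilon> * s) <= 2 * (c0 * R)" by linarith
     then have "\<epsilon> * (s * 2 ^ n) <= 2 * (c0 * R)" by (simp only: mult_ac)
     then have "s * 2 ^ n <= 2 * c0 / \<epsilon> * R" using \<epsilon> by (simp add: pos_le_divide_eq mult_ac)
     also have "... <= E * R" using E R by (intro mult_right_mono) auto
     finally show ?thesis .
    qed
    have "p : ball z ((1 + (1/2) ^ n) * R)"
    proof -
     have "1 * R < (1 + (1/2) ^ n) * R" using R by (intro mult_strict_right_mono) auto
     then show ?thesis using p(1) by simp
    qed
    then have "u p <= C ^ Suc n * u A" using gr z R u A n(1) by blast
    also have "... <= (2 ^ N) ^ Suc n * u A" using N C uA by (intro mult_right_mono power_mono) auto
    finally have "F p <= s ^ N * ((2 ^ N) ^ Suc n * u A)"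
     unfolding F_def s_def[symmetric] using s by (intro mult_left_mono) auto
    also have "((2::real) ^ N) ^ Suc n = 2 ^ N * (2 ^ n) ^ N"
     by (simp add: power_mult[symmetric] mult.commute[of n N])
    also have "s ^ N * (2 ^ N * (2 ^ n) ^ N * u A) = 2 ^ N * (s * 2 ^ n) ^ N * u A"
     unfolding power_mult_distrib by (simp only: mult_ac)
    also have "... <= 2 ^ N * (E * R) ^ N * u A"
     using sn s uA by (intro mult_right_mono mult_left_mono power_mono) auto
    finally show ?thesis by (simp add: power_mult_distrib)
   next
    case False
    have pz: "dist z p <= R" using p(1) by simp
    have np: "norm p < 1/2" using nball pz R by simp
    obtain z' where z': "z' : frontier \<Omega>" "dist p z' < 2 / \<kappa> * \<phi> p" using near_frontier[OF pO np] by blast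
    have "2 / \<kappa> * \<phi> p <= 2 / \<kappa> * (\<epsilon> * s)" using False kappa_pos by (intro mult_left_mono) auto
    also have "... = (1/8) ^ k * (s / 4)" using kappa_pos by (simp add: \<epsilon>_def)
    finally have pz': "dist p z' < (1/8) ^ k * (s / 4)" using z' by simp
    have "(1/8) ^ k * (s / 4) <= 1 * (s / 4)" using s by (intro mult_right_mono power_le_one) auto
    then have pz4: "dist p z' < s / 4" using pz' by simp
    have zz': "dist z z' < R + s / 4" using pz pz4 dist_triangle[of z z' p] by simp
    \<comment> \<open>Maximality of p: on this ball the distance to the sphere is still at least s /
      4, so the weights differ by at most 4^N. The exponent k was chosen so that \<theta>^k 4^N <=
      1/2.\<close>
    have bd: "u y <= 4 ^ N * u p" if y: "y : ball z' (s / 2)" for y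
    proof -
     have "dist p y < 3 * s / 4" using y pz4 dist_triangle[of p y z'] by simp
     then have dy: "R - dist z y >= s / 4" using dist_triangle[of z y p] unfolding s_def by simp
     then have "y : cball z R" using s by simp
     moreover from this have "u y >= 0" using un R by simp
     ultimately have "(s / 4) ^ N * u y <= F y" "F y <= s ^ N * u p"
      using p(2)[of y] dy s by (auto simp: F_def s_def[symmetric] intro!: mult_right_mono power_mono)
     then have "(s / 4) ^ N * u y <= s ^ N * u p" by linarith
     then have "s ^ N * u y <= s ^ N * (4 ^ N * u p)" by (simp add: power_divide pos_divide_le_eq mult_ac)
     then show ?thesis using s0 by simp
    qed
    have "u p <= \<theta> ^ k * (4 ^ N * u p)"
    proof (rule D[rule_format, where z=z' and R="s / 2"])
     have "ball z' (s / 2) <= ball z (K * R)" by (rule ball_subset_shift) (use zz' s KR R in linarith)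
     then show "sol z' (s / 2) u" by (rule sol_subset[OF _ su])
     have "norm z' <= norm z + dist z z'" by (rule norm_le_norm_dist)
     then show "norm z' + s / 2 <= 1" using zz' s KR R by linarith
     have "(1/8) ^ k * (s / 4) <= (1/8) ^ k * (s / 2)" using s by (intro mult_left_mono) auto
     then show "p : ball z' ((1/8) ^ k * (s / 2))"
      unfolding mem_ball dist_commute[of z' p] using pz' by linarith
    qed (use z' s0 up bd in auto)
    also have "... = (\<theta> ^ k * 4 ^ N) * u p" by simp
    also have "... <= (1/2) * u p" using k up by (rule mult_right_mono)
    finally show ?thesis using upp by simp
   qed
  qed
  have xz: "dist z x < R / 2" using x by simp
  have "(R / 2) ^ N * u x <= F x" unfolding F_def using xz R un[of x] by (intro mult_right_mono power_mono) auto
  also have "... <= F p" by (rule p(2)) (use xz R in simp)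
  also note main
  finally have "2 ^ N * ((R / 2) ^ N * u x) <= 2 ^ N * ((2 * E) ^ N * R ^ N * u A)" by (rule mult_left_mono) simp
  also have "2 ^ N * ((R / 2) ^ N * u x) = R ^ N * u x" by (simp add: power_divide)
  also have "2 ^ N * ((2 * E) ^ N * R ^ N * u A) = R ^ N * ((2 * (2 * E)) ^ N * u A)"
   unfolding power_mult_distrib by (simp only: mult_ac)
  finally have "R ^ N * u x <= R ^ N * (C' * u A)" by (simp add: C'_def)
  then show ?thesis using R by simp
 qed
 then show ?thesis using K C' c0 by (intro exI[of _ K] conjI exI[of _ C'] exI[of _ c0]) blast+
qed

text \<open>The negative part of \<open>w\<close> lives in the strip \<open>{0 < \<phi> < \<delta> * \<rho>}\<close> of small measure, and near the boundary
 \<open>w + a\<close> is comparable along one step of a Harnack chain.\<close>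

lemma iteration:
 "EX \<delta>>0. \<delta> <= \<kappa> / 4 & (EX a>0. ALL z:frontier \<Omega>. ALL \<rho>>0. ALL w. norm z + \<rho> < 1/2 --> sol z \<rho> w -->
   (ALL x:ball z \<rho>. w x >= - 1 & (\<phi> x >= \<delta> * \<rho> --> w x >= 1)) -->
   (ALL x:ball z (\<rho> / 2). w x >= - a & (\<phi> x >= \<delta> * (\<rho> / 2) --> w x >= a)))"
proof -
 obtain K C where K: "K >= 1" and C: "C >= 1" and cl: "ALL x:\<Omega>. norm x + K * \<phi> x < 1/2 --> (EX x'. dist x x' < K * \<phi> x & \<phi> x' >= 2 * \<phi> x &
   (ALL u. hpos x (K * \<phi> x) u --> u x <= C * u x' & u x' <= C * u x))" using climb by (elim exE conjE) (rule that; assumption)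
 define c where "c = kern_mass TYPE('a)"
 define m1 where "m1 = measure lborel (ball (0::'a) 1)"
 have c: "c > 0" unfolding c_def by (rule kern_mass_pos)
 have m1: "m1 > 0" unfolding m1_def by (rule content_ball_pos) simp
 define a where "a = 1 / (2 * C)"
 have a: "a > 0" "a <= 1" using C by (auto simp: a_def)
 define B where "B = 8 ^ DIM('a) * (\<Lambda> * m1)"
 have B: "B > 0" using Lam_pos m1 by (simp add: B_def)
 \<comment> \<open>The second bound keeps a climb from the strip within \<rho> / 4; the third makes
   the mean of the negative part over the strip at most a. The first is for
   \<open>positivity\<close>.\<close>
 define \<delta> where "\<delta> = min (\<kappa> / 4) (min (1 / (4 * K)) (a * c / B))"
 have \<delta>: "\<delta> > 0" "\<delta> <= \<kappa> / 4" unfolding \<delta>_def using kappa_pos K a c B by (simp_all only: min.cobounded1) auto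
 have "K * \<delta> <= K * (1 / (4 * K))" using K by (intro mult_left_mono) (auto simp: \<delta>_def)
 then have K\<delta>: "K * \<delta> <= 1/4" using K by simp
 have "B * \<delta> <= B * (a * c / B)" using B by (intro mult_left_mono) (auto simp: \<delta>_def)
 then have B\<delta>: "B * \<delta> <= a * c" using B by simp
 have "w x >= - a & (\<phi> x >= \<delta> * (\<rho> / 2) --> w x >= a)"
  if z: "z : frontier \<Omega>" and \<rho>: "\<rho> > 0" "norm z + \<rho> < 1/2" and w: "sol z \<rho> w"
   and lb: "ALL x:ball z \<rho>. w x >= - 1 & (\<phi> x >= \<delta> * \<rho> --> w x >= 1)" and x: "x : ball z (\<rho> / 2)" for z \<rho> w x
 proof -
  have nb: "norm y < 1" if "y : ball z \<rho>" for y
   using that norm_triangle_ineq4[of z "z - y"] \<rho> by (simp add: dist_norm)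
  \<comment> \<open>-w is at most 1 on the strip and at most 0 elsewhere, so the strip estimate (f)
    bounds its mean; 8^d in \<open>B\<close> is the ratio of \<rho> to r = \<rho> / 8.\<close>
  have low: "w x >= - a" if x: "x : ball z (3 * \<rho> / 4)" for x
  proof -
   define f where "f y = (- 1) * w y + 0 * w y" for y
   define r where "r = \<rho> / 8"
   have r: "0 < r" "r < \<rho> / 4" using \<rho> by (auto simp: r_def)
   have sub: "ball x (\<rho> / 4) <= ball z \<rho>" using x by (intro ball_subset_shift) auto
   have fs: "sol x (\<rho> / 4) f" unfolding f_def[abs_def] by (rule sol_lincomb[OF sol_subset[OF sub w] sol_subset[OF sub w]])
   have fc: "continuous_on (ball x (\<rho> / 4)) f" using fs by (simp add: sol_def)
   define S where "S = ball z \<rho> Int \<Omega> Int \<phi> -` {..<\<rho> * \<delta>}"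
   have "open (ball z \<rho> Int \<phi> -` {..<\<rho> * \<delta>})"
    by (rule continuous_open_preimage)
      (use nb lipschitz_on_continuous_on[OF phi_lip] in \<open>auto elim!: continuous_on_subset\<close>)
   then have "open ((ball z \<rho> Int \<phi> -` {..<\<rho> * \<delta>}) Int \<Omega>)" using open_dom by (rule open_Int)
   then have Sm: "S : sets borel" by (simp add: S_def Int_ac)
   define I where "I = (indicator S :: 'a => real)"
   have Im: "I : borel_measurable borel" unfolding I_def using Sm by (rule borel_measurable_indicator)
   have fS: "emeasure lborel S < \<infinity>" by (rule emeasure_bounded_finite) (auto simp: S_def intro: bounded_subset[OF bounded_ball])
   have iI: "integrable lborel (%y. I (x + r *\<^sub>R y))"
    using lborel_affine_int(1)[OF _ Im, of r x] r(1) fS Sm by (simp add: I_def)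
   have mI: "(LINT y|lborel. I (x + r *\<^sub>R y)) <= B * \<delta>"
   proof -
    have "S <= {x. 0 < \<phi> x & \<phi> x < \<rho> * \<delta>} Int ball z \<rho>" using phi_pos by (auto simp: S_def)
    moreover have "{x. 0 < \<phi> x & \<phi> x < \<rho> * \<delta>} Int ball z \<rho> <= S" using phi_pos_iff nb by (auto simp: S_def)
    ultimately have "S = {x. 0 < \<phi> x & \<phi> x < \<rho> * \<delta>} Int ball z \<rho>" by blast
    then have "measure lborel S <= \<Lambda> * \<delta> * measure lborel (ball (0::'a) \<rho>)"
     using strip[of z \<rho> \<delta>] z \<rho> \<delta> by simp
    also have "measure lborel (ball (0::'a) \<rho>) = r ^ DIM('a) * (8 ^ DIM('a) * m1)"
     using content_ball_conv_unit_ball[of \<rho> "0::'a"] \<rho> by (simp add: m1_def r_def power_divide)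
    finally have "measure lborel S <= r ^ DIM('a) * (B * \<delta>)" by (simp add: B_def mult_ac)
    moreover have "measure lborel S = r ^ DIM('a) * (LINT y|lborel. I (x + r *\<^sub>R y))"
     using lborel_affine_int(2)[OF _ Im, of r x] r by (simp add: I_def)
    ultimately have "r ^ DIM('a) * (LINT y|lborel. I (x + r *\<^sub>R y)) <= r ^ DIM('a) * (B * \<delta>)" by simp
    then show ?thesis by (rule mult_left_le_imp_le) (use r in simp)
   qed
   have "max 0 (f x) * c <= (LINT y|lborel. max 0 (f (x + r *\<^sub>R y)) * kern y)"
    unfolding c_def by (rule submean_pos_part[OF open_dom fc _ _ r]) (use fs in \<open>auto simp: sol_def\<close>)
   also have "... <= (LINT y|lborel. I (x + r *\<^sub>R y))"
   proof (rule integral_mono[OF _ iI])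
    show "integrable lborel (%y. max 0 (f (x + r *\<^sub>R y)) * kern y)"
     by (rule integrable_kern_scaled(2)[of x "\<rho> / 4" "%x. max 0 (f x)" r])
       (use r in \<open>auto intro!: continuous_on_max continuous_on_const fc\<close>)
    show "max 0 (f (x + r *\<^sub>R y)) * kern y <= I (x + r *\<^sub>R y)" for y
    proof (cases "norm y < 1")
     case True
     define p where "p = x + r *\<^sub>R y"
     have "norm (r *\<^sub>R y) < \<rho> / 4" using norm_scaleR_less[OF r(1) True] r(2) by linarith
     then have "p : ball x (\<rho> / 4)" by (simp add: dist_norm p_def del: norm_scaleR)
     then have pb: "p : ball z \<rho>" by (rule subsetD[OF sub])
     have "\<phi> p < \<rho> * \<delta> \<or> \<phi> p >= \<delta> * \<rho>" by (simp add: mult.commute not_less[symmetric])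
     then consider "p : S" | "p \<notin> \<Omega>" | "\<phi> p >= \<delta> * \<rho>" using pb unfolding S_def by blast
     then have "max 0 (f p) <= I p"
     proof cases
      case 1
      then show ?thesis using lb pb by (simp add: f_def I_def)
     next
      case 2
      then have "f p = 0" using w pb by (simp add: f_def sol_def)
      then show ?thesis by (simp add: I_def)
     next
      case 3
      then have "w p >= 1" using lb pb by blast
      then show ?thesis by (simp add: f_def I_def)
     qed
     then have "max 0 (f p) * kern y <= I p * 1" using kern_bounds(1,2)[of y] by (intro mult_mono) (auto simp: I_def)
     then show ?thesis by (simp add: p_def)
    qed (use kern_bounds(3)[of y] in \<open>simp add: I_def\<close>)
   qed
   also note mI
   also note B\<delta>
   finally have "max 0 (f x) <= a" using c by simp
   then show ?thesis by (simp add: f_def)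
  qed
  have "w x >= a" if px: "\<phi> x >= \<delta> * (\<rho> / 2)"
  proof (cases "\<phi> x >= \<delta> * \<rho>")
   case True
   have "x : ball z \<rho>" using x \<rho> by simp
   then have "w x >= 1" using lb True by blast
   then show ?thesis using a by simp
  next
   case False
   have xb: "x : ball z \<rho>" using x \<rho> by simp
   have "\<delta> * (\<rho> / 2) > 0" using \<delta> \<rho> by simp
   then have xO: "x : \<Omega>" using px phi_pos_iff[OF nb[OF xb]] by linarith
   have "K * \<phi> x <= K * (\<delta> * \<rho>)" using False K by (intro mult_left_mono) auto
   also have "... = (K * \<delta>) * \<rho>" by simp
   also have "... <= 1/4 * \<rho>" using K\<delta> \<rho> by (intro mult_right_mono) auto
   finally have Kx: "K * \<phi> x <= \<rho> / 4" by simp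
   have "norm x <= norm z + dist z x" by (rule norm_le_norm_dist)
   moreover have xz: "dist z x < \<rho> / 2" using x by simp
   ultimately have "norm x + K * \<phi> x < 1/2" using Kx \<rho> by linarith
   then obtain x' where x': "dist x x' < K * \<phi> x" "\<phi> x' >= 2 * \<phi> x"
    and cmp: "ALL u. hpos x (K * \<phi> x) u --> u x <= C * u x' & u x' <= C * u x" using cl xO by meson
   have sub: "ball x (K * \<phi> x) <= ball z (3 * \<rho> / 4)" by (rule ball_subset_shift) (use xz Kx in linarith)
   have "x' : ball z \<rho>" using x'(1) sub \<rho> by fastforce
   moreover have "\<phi> x' >= \<delta> * \<rho>" using x'(2) px by simp
   ultimately have wx': "w x' >= 1" using lb by blast
   \<comment> \<open>Nonnegative near x by \<open>low\<close>. One climb reaches a point where w >=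
     1, so w x + a >= 1 / C = 2 a.\<close>
   define u where "u y = 1 * w y + 1 * a" for y
   have "harmonic_on (\<Omega> Int ball z \<rho>) u" unfolding u_def[abs_def]
    using w open_dom by (intro harmonic_on_lincomb harmonic_on_const) (auto simp: sol_def)
   moreover have "\<Omega> Int ball x (K * \<phi> x) <= \<Omega> Int ball z \<rho>" using sub \<rho> by fastforce
   ultimately have "harmonic_on (\<Omega> Int ball x (K * \<phi> x)) u" by (metis harmonic_on_subset)
   moreover have "u y >= 0" if "y : ball x (K * \<phi> x)" for y
    using low[OF subsetD[OF sub that]] by (simp add: u_def)
   ultimately have "hpos x (K * \<phi> x) u" unfolding hpos_def by blast
   then have "u x' <= C * u x" using cmp by blast
   then have "1 <= C * (w x + a)" using wx' a by (simp add: u_def)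
   then have "1 / C <= w x + a" using C by (simp add: pos_divide_le_eq mult.commute)
   moreover have "1 / C = 2 * a" by (simp add: a_def)
   ultimately show ?thesis by simp
  qed
  moreover have "x : ball z (3 * \<rho> / 4)" using x \<rho> by simp
  ultimately show ?thesis using low by blast
 qed
 then show ?thesis using \<delta> a by (intro exI[of _ \<delta>] conjI exI[of _ a]) blast+
qed

text \<open>Iterating about a single frontier point gives positivity only where \<phi> is large
  relative to that scale. For an arbitrary x near z the iteration is centred at a frontier point
  close to x and stopped at the scale where \<phi> x is of the order of \<delta> times it. The
  halved \<delta> transfers the hypothesis to balls of radius \<rho> / 2.\<close>

lemma positivity:
 "EX \<delta>>0. ALL z:frontier \<Omega>. ALL \<rho>>0. ALL w. norm z + \<rho> < 1/2 --> sol z \<rho> w -->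
   (ALL x:ball z \<rho>. w x >= - 1 & (\<phi> x >= \<delta> * \<rho> --> w x >= 1)) --> (ALL x:ball z (\<rho> / 4). w x >= 0)"
proof -
 obtain \<delta> a where \<delta>: "\<delta> > 0" "\<delta> <= \<kappa> / 4" and a: "a > 0" and it: "ALL z:frontier \<Omega>. ALL \<rho>>0. ALL w. norm z + \<rho> < 1/2 --> sol z \<rho> w -->
   (ALL x:ball z \<rho>. w x >= - 1 & (\<phi> x >= \<delta> * \<rho> --> w x >= 1)) -->
   (ALL x:ball z (\<rho> / 2). w x >= - a & (\<phi> x >= \<delta> * (\<rho> / 2) --> w x >= a))" using iteration by (elim exE conjE) (rule that; assumption)
 have iter: "ALL x:ball z ((1/2) ^ n * \<rho>). w x >= - (a ^ n) & (\<phi> x >= \<delta> * ((1/2) ^ n * \<rho>) --> w x >= a ^ n)"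
  if z: "z : frontier \<Omega>" and \<rho>: "\<rho> > 0" "norm z + \<rho> < 1/2" and w: "sol z \<rho> w"
   and lb: "ALL x:ball z \<rho>. w x >= - 1 & (\<phi> x >= \<delta> * \<rho> --> w x >= 1)" for z \<rho> w n
 proof (induction n)
  case 0
  then show ?case using lb by simp
 next
  case (Suc n)
  define r where "r = (1/2) ^ n * \<rho>"
  have r: "r > 0" "r <= \<rho>" using \<rho> by (auto simp: r_def mult_le_cancel_right1 power_le_one)
  define v where "v y = (1 / a ^ n) * w y + 0 * w y" for y
  have an: "a ^ n > 0" using a by simp
  have "sol z r v" unfolding v_def[abs_def] by (intro sol_lincomb sol_subset[OF _ w]) (use r in auto)
  moreover have "ALL x:ball z r. v x >= - 1 & (\<phi> x >= \<delta> * r --> v x >= 1)"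
   using Suc.IH an unfolding r_def[symmetric] by (auto simp: v_def pos_le_divide_eq)
  moreover have "norm z + r < 1/2" using \<rho> r by simp
  ultimately have "ALL x:ball z (r / 2). v x >= - a & (\<phi> x >= \<delta> * (r / 2) --> v x >= a)"
   using it z r(1) by blast
  moreover have "(1/2) ^ Suc n * \<rho> = r / 2" by (simp add: r_def)
  ultimately show ?case using an by (auto simp: v_def pos_le_divide_eq mult.commute)
 qed
 have "w x >= 0" if z: "z : frontier \<Omega>" and \<rho>: "\<rho> > 0" "norm z + \<rho> < 1/2" and w: "sol z \<rho> w"
   and lb: "ALL x:ball z \<rho>. w x >= - 1 & (\<phi> x >= \<delta> / 2 * \<rho> --> w x >= 1)" and x: "x : ball z (\<rho> / 4)" for z \<rho> w x
 proof -
  define r where "r = \<rho> / 2"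
  have r: "r > 0" using \<rho> by (simp add: r_def)
  have xb: "x : ball z \<rho>" using x \<rho> by simp
  consider "x \<notin> \<Omega>" | "\<phi> x >= \<delta> * r" | "x : \<Omega>" "\<phi> x < \<delta> * r" by linarith
  then show ?thesis
  proof cases
   case 1
   then show ?thesis using w xb by (simp add: sol_def)
  next
   case 2
   then have "w x >= 1" using lb xb by (simp add: r_def)
   then show ?thesis by simp
  next
   case 3
   have nx: "norm x <= norm z + dist z x" by (rule norm_le_norm_dist)
   then have "norm x < 1/2" using x \<rho> by simp
   then obtain z' where z': "z' : frontier \<Omega>" "dist x z' < 2 / \<kappa> * \<phi> x" using near_frontier[OF 3(1)] by blast
   have p: "\<phi> x > 0" by (rule phi_pos[OF 3(1)])
   obtain n where n: "(1/2) ^ n * (\<delta> * r) <= \<phi> x" "n = 0 \<or> (1/2) * \<phi> x < (1/2) ^ n * (\<delta> * r)"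
    using geometric_scale[of "1/2" "\<phi> x" "\<delta> * r"] p by auto
   have "n ~= 0" using n(1) 3(2) by (intro notI) simp
   then have "\<phi> x < 2 * ((1/2) ^ n * (\<delta> * r))" using n(2) by simp
   then have "2 / \<kappa> * \<phi> x <= 2 / \<kappa> * (2 * ((1/2) ^ n * (\<delta> * r)))" using kappa_pos by (intro mult_left_mono) auto
   also have "... = (4 / \<kappa> * \<delta>) * ((1/2) ^ n * r)" by simp
   also have "... <= 1 * ((1/2) ^ n * r)" using \<delta> kappa_pos r by (intro mult_right_mono) (auto simp: pos_divide_le_eq mult.commute)
   \<comment> \<open>\<delta> <= \<kappa> / 4 guarantees that x lies in the very ball for whose
     scale \<phi> x is above the threshold.\<close>
   finally have xn: "dist x z' < (1/2) ^ n * r" using z' by simp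
   have "2 / \<kappa> * \<phi> x <= 2 / \<kappa> * (\<delta> * r)" using 3(2) kappa_pos by (intro mult_left_mono) auto
   also have "... = (2 / \<kappa> * \<delta>) * r" by simp
   also have "... <= (1/2) * r" using \<delta> kappa_pos r by (intro mult_right_mono) (auto simp: pos_divide_le_eq mult.commute)
   finally have xr: "dist x z' < r / 2" using z' by simp
   have zz: "dist z z' < \<rho> / 2" using xr x dist_triangle[of z z' x] by (simp add: r_def)
   have sub: "ball z' r <= ball z \<rho>" by (rule ball_subset_shift) (use zz in \<open>simp add: r_def\<close>)
   have "norm z' <= norm z + dist z z'" by (rule norm_le_norm_dist)
   then have nz: "norm z' + r < 1/2" using zz \<rho> by (simp add: r_def)
   have "ALL y:ball z' r. w y >= - 1 & (\<phi> y >= \<delta> * r --> w y >= 1)" using lb sub by (auto simp: r_def)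
   then have "ALL y:ball z' ((1/2) ^ n * r). w y >= - (a ^ n) & (\<phi> y >= \<delta> * ((1/2) ^ n * r) --> w y >= a ^ n)"
    by (rule iter[OF z'(1) r nz sol_subset[OF sub w]])
   moreover have "x : ball z' ((1/2) ^ n * r)" using xn by (simp add: dist_commute)
   moreover have "\<phi> x >= \<delta> * ((1/2) ^ n * r)" using n(1) by (simp add: mult_ac)
   ultimately have "w x >= a ^ n" by blast
   then show ?thesis using zero_le_power[of a n] a by linarith
  qed
 qed
 then show ?thesis using \<delta> by (intro exI[of _ "\<delta> / 2"] conjI) (simp, blast)
qed

text \<open>One of the two inequalities; the other follows by exchanging u and v. Carleson's
  estimate bounds v above by v A, comparability bounds u below by u A away from the boundary, and
  \<open>positivity\<close> carries the comparison up to it.\<close>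

lemma half_boundary_harnack:
 "EX K>=4. EX C>=1. ALL z:frontier \<Omega>. ALL R>0. ALL u v A. norm z + K * R < 1/2 --> psol z (K * R) u --> psol z (K * R) v -->
   A : ball z R --> \<phi> A >= \<eta> / 2 * R --> (ALL x:ball z (R / 8). v x * u A <= C * u x * v A)"
proof -
 obtain K1 C1 c0 where K1: "K1 >= 4" and C1: "C1 >= 1" and c0: "c0 > 0" "c0 <= \<eta> / 2"
  and car: "ALL z:frontier \<Omega>. ALL R>0. ALL u A. norm z + K1 * R < 1/2 --> psol z (K1 * R) u -->
   A : ball z (2 * R) --> \<phi> A >= c0 * R --> (ALL x:ball z (R / 2). u x <= C1 * u A)"
  using carleson by (elim exE conjE) (rule that; assumption)
 obtain \<delta> where \<delta>: "\<delta> > 0" and pos: "ALL z:frontier \<Omega>. ALL \<rho>>0. ALL w. norm z + \<rho> < 1/2 --> sol z \<rho> w -->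
   (ALL x:ball z \<rho>. w x >= - 1 & (\<phi> x >= \<delta> * \<rho> --> w x >= 1)) --> (ALL x:ball z (\<rho> / 4). w x >= 0)"
  using positivity by (elim exE conjE) (rule that; assumption)
 define \<delta>' where "\<delta>' = min (\<delta> / 2) (\<eta> / 2)"
 have \<delta>': "\<delta>' > 0" using \<delta> eta_pos by (simp add: \<delta>'_def)
 obtain M C2 where M: "M >= 1" and C2: "C2 >= 1" and comp: "ALL z:frontier \<Omega>. ALL r>0. ALL u x1 x2. norm z + M * r <= 1 --> hpos z (M * r) u -->
  x1 : ball z r --> x2 : ball z r --> \<phi> x1 >= \<delta>' * r --> \<phi> x2 >= \<delta>' * r --> u x1 <= C2 * u x2"
  using comparability[OF \<delta>'] by (elim exE conjE) (rule that; assumption)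
 define K where "K = max K1 M"
 have K: "K >= 4" using K1 by (simp add: K_def)
 have "v x * u A <= (2 * C1 * C2) * u x * v A"
  if z: "z : frontier \<Omega>" and R: "R > 0" "norm z + K * R < 1/2" and u: "psol z (K * R) u" and v: "psol z (K * R) v"
   and A: "A : ball z R" "\<phi> A >= \<eta> / 2 * R" and x: "x : ball z (R / 8)" for z R u v A x
 proof -
  have KR: "4 * R <= K * R" "K1 * R <= K * R" "M * R <= K * R" using K R by (auto intro!: mult_right_mono simp: K_def)
  have un: "u y >= 0" and vn: "v y >= 0" if "dist z y < 4 * R" for y using u v that KR by (auto simp: psol_def)
  have uA: "u A >= 0" and vA: "v A >= 0" using un vn A R by auto
  have "c0 * R <= \<eta> / 2 * R" using c0 R by (intro mult_right_mono) auto
  then have cA: "c0 * R <= \<phi> A" using A(2) by linarith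
  have vx: "ALL y:ball z (R / 2). v y <= C1 * v A"
  proof (rule car[rule_format, OF z R(1) _ _ _ cA, THEN ballI])
   show "norm z + K1 * R < 1/2" using KR(2) R(2) by linarith
   show "psol z (K1 * R) v" by (rule psol_subset[OF subset_ball[OF KR(2)] v])
  qed (use A R in auto)
  have ux: "u A <= C2 * u y" if y: "y : ball z (R / 2)" "\<phi> y >= \<delta> * (R / 2)" for y
  proof (rule comp[rule_format, OF z R(1)])
   show "hpos z (M * R) u" by (rule psol_hpos[OF psol_subset[OF _ u]]) (use KR in auto)
   have "\<delta>' * R <= \<delta> / 2 * R" "\<delta>' * R <= \<eta> / 2 * R" using R by (auto intro!: mult_right_mono simp: \<delta>'_def)
   then show "\<delta>' * R <= \<phi> A" "\<delta>' * R <= \<phi> y" using y A by auto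
   show "norm z + M * R <= 1" using KR(3) R(2) by linarith
  qed (use R(1) A y in auto)
  have xb: "x : ball z (R / 2)" using x R by simp
  have u0: "u x >= 0" and v0: "v x >= 0" using un vn xb R by auto
  show ?thesis
  proof (cases "u A = 0 \<or> v A = 0")
   case True
   moreover have "v x <= C1 * v A" using vx xb by blast
   ultimately have "v x * u A = 0" using v0 by auto
   moreover have "(2 * C1 * C2) * u x * v A >= 0" using C1 C2 u0 vA by simp
   ultimately show ?thesis by linarith
  next
   case False
   then have uA0: "u A > 0" and vA0: "v A > 0" using uA vA by auto
   \<comment> \<open>The coefficients make the v term at most 1 in modulus and the u term at least 2
     where \<phi> is large, exactly the hypotheses of \<open>positivity\<close>.\<close>
   define w where "w y = (2 * C2 / u A) * u y + (- (1 / (C1 * v A))) * v y" for y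
   have sub: "ball z (R / 2) <= ball z (K * R)" using KR R by (intro subset_ball) linarith
   have "sol z (R / 2) w" unfolding w_def[abs_def]
    by (intro sol_lincomb sol_subset[OF sub]) (use u v in \<open>auto simp: psol_def\<close>)
   moreover have "ALL y:ball z (R / 2). w y >= - 1 & (\<phi> y >= \<delta> * (R / 2) --> w y >= 1)"
   proof
    fix y assume y: "y : ball z (R / 2)"
    have "v y <= C1 * v A" using vx y by blast
    then have a: "1 / (C1 * v A) * v y <= 1" using C1 vA0 by (simp add: pos_divide_le_eq)
    have "u y >= 0" using un y R by simp
    then have b: "(2 * C2 / u A) * u y >= 0" using C2 uA0 by simp
    have "(2 * C2 / u A) * u y >= 2" if "\<phi> y >= \<delta> * (R / 2)"
     using ux[OF y that] uA0 by (simp add: pos_le_divide_eq)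
    then show "w y >= - 1 & (\<phi> y >= \<delta> * (R / 2) --> w y >= 1)" using a b unfolding w_def by fastforce
   qed
   moreover have "norm z + R / 2 < 1/2" using KR R by linarith
   moreover have "x : ball z (R / 2 / 4)" using x by simp
   ultimately have "w x >= 0" using pos z R(1) half_gt_zero by blast
   then have "v x / (C1 * v A) <= 2 * C2 * u x / u A" by (simp add: w_def)
   then have "v x * u A <= 2 * C2 * u x * (C1 * v A)" using C1 uA0 vA0 by (simp add: divide_le_eq le_divide_eq mult_ac)
   then show ?thesis by (simp add: mult_ac)
  qed
 qed
 moreover have "1 * 1 <= (2 * C1) * C2" using C1 C2 by (intro mult_mono) auto
 ultimately show ?thesis
  by (intro exI[of _ K], intro conjI[OF K] exI[of _ "2 * C1 * C2"] conjI) (simp, blast)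
qed

end

section \<open>Oscillation decay\<close>

lemma powr_subadditive:
 fixes a b \<alpha> :: real
 assumes "0 <= a" "0 <= b" "0 < \<alpha>" "\<alpha> <= 1"
 shows "(a + b) powr \<alpha> <= a powr \<alpha> + b powr \<alpha>"
proof (cases "a + b = 0")
 case False
 define s where "s = a + b"
 have s: "s > 0" using False assms by (simp add: s_def)
 have h: "t / s <= t powr \<alpha> / s powr \<alpha>" if "0 <= t" "t <= s" for t
  using powr_mono'[of \<alpha> 1 "t / s"] that assms s by (simp add: powr_divide)
 have "1 = a / s + b / s" using s by (simp add: s_def add_divide_distrib[symmetric])
 also have "... <= (a powr \<alpha> + b powr \<alpha>) / s powr \<alpha>"
  using h[of a] h[of b] assms by (simp add: s_def add_divide_distrib)
 finally show ?thesis using s by (simp add: s_def pos_le_divide_eq)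
qed (use assms in auto)

text \<open>McShane's infimum formula: for \<alpha> <= 1 the power of the distance still satisfies
  the triangle inequality.\<close>

lemma hoelder_extension:
 fixes f :: "'a::metric_space => real"
 assumes \<alpha>: "0 < \<alpha>" "\<alpha> <= 1" and C: "C >= 0"
  and f: "!!x y. x : S ==> y : S ==> \<bar>f x - f y\<bar> <= C * dist x y powr \<alpha>"
 shows "EX g. (ALL x:S. g x = f x) & (ALL x y. \<bar>g x - g y\<bar> <= C * dist x y powr \<alpha>)"
proof (cases "S = {}")
 case True
 then show ?thesis using C by (intro exI[of _ "%x. 0"]) auto
next
 case False
 define g where "g x = (INF y\<in>S. f y + C * dist x y powr \<alpha>)" for x
 have tri: "C * dist x y powr \<alpha> <= C * dist x z powr \<alpha> + C * dist z y powr \<alpha>" for x y z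
 proof -
  have "dist x y powr \<alpha> <= (dist x z + dist z y) powr \<alpha>" using \<alpha> by (intro powr_mono2 dist_triangle) auto
  also have "... <= dist x z powr \<alpha> + dist z y powr \<alpha>" using \<alpha> by (intro powr_subadditive) auto
  finally have "C * dist x y powr \<alpha> <= C * (dist x z powr \<alpha> + dist z y powr \<alpha>)" using C by (intro mult_left_mono) auto
  then show ?thesis by (simp add: distrib_left)
 qed
 obtain y0 where y0: "y0 : S" using False by blast
 have low: "f s - C * dist s x powr \<alpha> <= f y + C * dist x y powr \<alpha>" if "s : S" "y : S" for s x y
  using f[OF that] tri[of s y x] by linarith
 have bdd: "bdd_below ((%y. f y + C * dist x y powr \<alpha>) ` S)" for x
  using low[OF y0] by (intro bdd_belowI2) auto
 have "g x = f x" if x: "x : S" for x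
 proof (rule antisym)
  have "g x <= f x + C * dist x x powr \<alpha>" unfolding g_def by (rule cINF_lower[OF bdd x])
  then show "g x <= f x" by simp
  show "f x <= g x" unfolding g_def using low[OF x, of _ x] by (intro cINF_greatest False) auto
 qed
 moreover have le: "g x <= g y + C * dist x y powr \<alpha>" for x y
 proof -
  have "g x - C * dist x y powr \<alpha> <= f s + C * dist y s powr \<alpha>" if s: "s : S" for s
  proof -
   have "g x <= f s + C * dist x s powr \<alpha>" unfolding g_def by (rule cINF_lower[OF bdd s])
   then show ?thesis using tri[of x s y] by linarith
  qed
  then have "g x - C * dist x y powr \<alpha> <= g y" unfolding g_def[of y] by (intro cINF_greatest False)
  then show ?thesis by simp
 qed
 moreover have "\<bar>g x - g y\<bar> <= C * dist x y powr \<alpha>" for x y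
  using le[of x y] le[of y x] by (simp add: dist_commute abs_le_iff)
 ultimately show ?thesis by blast
qed

text \<open>The bounds a <= u / v <= b without division, so that both differences can be treated as
  nonnegative solutions.\<close>

definition pinched :: "('a => real) => ('a => real) => real => real => 'a set => bool" where
 "pinched u v a b S \<longleftrightarrow> (ALL y:S. a * v y <= u y & u y <= b * v y)"

lemma pinched_subset: "T <= S ==> pinched u v a b S ==> pinched u v a b T"
 unfolding pinched_def by blast

text \<open>At A the ratio lies in one half of [a, b], so u - a v or b v - u is at least (b - a) / 2
  times v there. The one-sided Harnack inequality \<open>P\<close> spreads this over S and improves
  that bound by (b - a) / (2 C).\<close>

lemma oscillation_step:
 fixes u v :: "'a => real"
 assumes ab: "a <= b" and C: "C >= 1" "1 - 1 / (2 * C) <= \<theta>" and A: "v A > 0" and pin: "pinched u v a b S"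
  and P: "!!y. y : S ==> v y * (u A - a * v A) <= C * (u y - a * v y) * v A"
   "!!y. y : S ==> v y * (b * v A - u A) <= C * (b * v y - u y) * v A"
  and v: "!!y. y : S ==> v y >= 0"
 shows "EX a' b'. a' <= b' & b' - a' <= \<theta> * (b - a) & pinched u v a' b' S"
proof -
 define h where "h = (b - a) / (2 * C)"
 have "h * 1 <= h * (2 * C)" using ab C by (intro mult_left_mono) (auto simp: h_def)
 then have h: "0 <= h" "h <= b - a" using ab C by (auto simp: h_def)
 have th: "b - a - h <= \<theta> * (b - a)"
 proof -
  have "b - a - h = (1 - 1 / (2 * C)) * (b - a)" by (simp add: h_def left_diff_distrib)
  then show ?thesis using C(2) ab by (simp add: mult_right_mono)
 qed
 have gain: "h * v y <= w" if "v y * wA <= C * w * v A" "wA >= (b - a) / 2 * v A" "v y >= 0" for w wA y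
 proof -
  have "v y * ((b - a) / 2 * v A) <= v y * wA" using that by (intro mult_left_mono)
  then have "(v y * ((b - a) / 2)) * v A <= (C * w) * v A" using that(1) by (simp add: mult.assoc)
  then have "v y * ((b - a) / 2) <= C * w" using A by simp
  then show ?thesis using C by (simp add: h_def field_simps)
 qed
 show ?thesis
 proof (cases "u A - a * v A >= (b - a) / 2 * v A")
  case True
  have "(a + h) * v y <= u y" if "y : S" for y
   using gain[OF P(1)[OF that] True v[OF that]] by (simp add: distrib_right)
  then have "pinched u v (a + h) b S" using pin unfolding pinched_def by blast
  then show ?thesis using h th by (intro exI[of _ "a + h"] exI[of _ b]) auto
 next
  case False
  then have f: "b * v A - u A >= (b - a) / 2 * v A" by (simp add: field_simps)
  have "u y <= (b - h) * v y" if "y : S" for y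
   using gain[OF P(2)[OF that] f v[OF that]] by (simp add: left_diff_distrib)
  then have "pinched u v a (b - h) S" using pin unfolding pinched_def by blast
  then show ?thesis using h th by (intro exI[of _ a] exI[of _ "b - h"]) auto
 qed
qed

text \<open>Away from the boundary \<open>harnack\<close> provides the comparison; it is used once
  for v and once for the difference, hence H^2.\<close>

lemma interior_oscillation:
 fixes u v :: "'a::euclidean_space => real"
 defines "H \<equiv> harnack_const TYPE('a)"
 assumes r: "r > 0" and u: "harmonic_on (ball x r) u" and v: "harmonic_on (ball x r) v" and vp: "!!y. y : ball x r ==> v y > 0"
  and ab: "a <= b" and pin: "pinched u v a b (ball x r)" and \<theta>: "1 - 1 / (2 * H^2) <= \<theta>"
 shows "EX a' b'. a' <= b' & b' - a' <= \<theta> * (b - a) & pinched u v a' b' (ball x (r / 16))"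
proof -
 have H: "H > 1" unfolding H_def by (rule harnack_const_gt1)
 have key: "v y * w x <= H\<^sup>2 * w y * v x" if w: "harmonic_on (ball x r) w" and wn: "!!t. t : ball x r ==> w t >= 0"
  and y: "y : ball x (r / 16)" for w y
 proof -
  have "v y <= H * v x" unfolding H_def by (rule harnack[OF v _ r]) (use vp y r in \<open>auto intro: less_imp_le\<close>)
  have sub: "ball y (15 * r / 16) <= ball x r" using y by (intro ball_subset_shift) auto
  have wx: "w x <= H * w y" unfolding H_def
  proof (rule harnack[OF harmonic_on_subset[OF sub w]])
   show "dist y x <= (15 * r / 16) / 8" using y r by (simp add: dist_commute)
  qed (use wn sub r in auto)
  have "w x >= 0" using wn r by simp
  then have "v y * w x <= (H * v x) * (H * w y)"
   using \<open>v y <= H * v x\<close> wx vp[of x] r H by (intro mult_mono) auto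
  then show ?thesis by (simp add: power2_eq_square mult_ac)
 qed
 have w1: "harmonic_on (ball x r) (%t. 1 * u t + (- a) * v t)" "harmonic_on (ball x r) (%t. b * v t + (- 1) * u t)"
  by (intro harmonic_on_lincomb open_ball u v)+
 show ?thesis
 proof (rule oscillation_step[of a b "H^2" \<theta> v x u])
  show "1 <= H\<^sup>2" using H by (intro one_le_power) simp
  show "pinched u v a b (ball x (r / 16))" by (rule pinched_subset[OF _ pin]) (use r in auto)
  show "v y * (u x - a * v x) <= H\<^sup>2 * (u y - a * v y) * v x" if "y : ball x (r / 16)" for y
   using key[OF w1(1) _ that] pin unfolding pinched_def by simp
  show "v y * (b * v x - u x) <= H\<^sup>2 * (b * v y - u y) * v x" if "y : ball x (r / 16)" for y
   using key[OF w1(2) _ that] pin unfolding pinched_def by simp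
  show "v y >= 0" if "y : ball x (r / 16)" for y using that vp[of y] r by simp
 qed (use ab \<theta> vp r in auto)
qed

section \<open>Oscillation of the quotient and its Hoelder continuity\<close>

context optimal_domain
begin

lemma boundary_oscillation:
 "EX K>=4. EX C>=1. ALL z:frontier \<Omega>. ALL R>0. ALL u v a b \<theta>. norm z + K * R < 1/2 --> sol z (K * R) u --> psol z (K * R) v -->
   (ALL x:\<Omega> Int ball z (K * R). v x > 0) --> a <= b --> pinched u v a b (\<Omega> Int ball z (K * R)) --> 1 - 1 / (2 * C) <= \<theta> -->
   (EX a' b'. a' <= b' & b' - a' <= \<theta> * (b - a) & pinched u v a' b' (\<Omega> Int ball z (R / 8)))"
proof -
 obtain K C where K: "K >= 4" and C: "C >= 1" and hb: "ALL z:frontier \<Omega>. ALL R>0. ALL u v A. norm z + K * R < 1/2 --> psol z (K * R) u --> psol z (K * R) v -->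
   A : ball z R --> \<phi> A >= \<eta> / 2 * R --> (ALL x:ball z (R / 8). v x * u A <= C * u x * v A)"
  using half_boundary_harnack by (elim exE conjE) (rule that; assumption)
 have "EX a' b'. a' <= b' & b' - a' <= \<theta> * (b - a) & pinched u v a' b' (\<Omega> Int ball z (R / 8))"
  if z: "z : frontier \<Omega>" and R: "R > 0" "norm z + K * R < 1/2" and u: "sol z (K * R) u" and v: "psol z (K * R) v"
   and vp: "ALL x:\<Omega> Int ball z (K * R). v x > 0" and ab: "a <= b" and pin: "pinched u v a b (\<Omega> Int ball z (K * R))"
   and \<theta>: "1 - 1 / (2 * C) <= \<theta>" for z R u v a b \<theta>
 proof -
  have KR: "4 * R <= K * R" using K R by (intro mult_right_mono) auto
  have sub: "ball z (R / 8) <= ball z (K * R)" "ball z R <= ball z (K * R)" using KR R(1) by (intro subset_ball; linarith)+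
  have "norm z + R < 1" using R KR by linarith
  then obtain A where A: "A : ball z R" "\<phi> A >= \<eta> / 2 * R" using corkscrew[OF z R(1)] by blast
  have nA: "norm A < 1"
  proof -
   have "norm A <= norm z + dist z A" by (rule norm_le_norm_dist)
   moreover have "dist z A < R" using A(1) by simp
   ultimately show ?thesis using R KR by linarith
  qed
  have "\<eta> / 2 * R > 0" using eta_pos R by simp
  then have AO: "A : \<Omega>" using A(2) phi_pos_iff[OF nA] by linarith
  have sv: "sol z (K * R) v" using v by (simp add: psol_def)
  \<comment> \<open>Nonnegativity holds in \<Omega> by the pinching and outside \<Omega> because u
    and v vanish there; u itself need not be nonnegative.\<close>
  have p1: "psol z (K * R) (%t. 1 * u t + (- a) * v t)" "psol z (K * R) (%t. b * v t + (- 1) * u t)"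
  proof -
   have "1 * u t + (- a) * v t >= 0 & b * v t + (- 1) * u t >= 0" if t: "t : ball z (K * R)" for t
   proof (cases "t : \<Omega>")
    case True
    then show ?thesis using pin t by (simp add: pinched_def)
   next
    case False
    then have "u t = 0" "v t = 0" using u sv t by (auto simp: sol_def)
    then show ?thesis by simp
   qed
   then show "psol z (K * R) (%t. 1 * u t + (- a) * v t)" "psol z (K * R) (%t. b * v t + (- 1) * u t)"
    unfolding psol_def by (intro conjI ballI sol_lincomb[OF u sv] sol_lincomb[OF sv u]; blast)+
  qed
  show ?thesis
  proof (rule oscillation_step[of a b C \<theta> v A u])
   show "v A > 0" using vp AO A(1) sub(2) by blast
   show "pinched u v a b (\<Omega> Int ball z (R / 8))" by (rule pinched_subset[OF _ pin]) (use sub in blast)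
   show "v y * (u A - a * v A) <= C * (u y - a * v y) * v A" if y: "y : \<Omega> Int ball z (R / 8)" for y
    using hb[rule_format, OF z R p1(1) v A, of y] y by simp
   show "v y * (b * v A - u A) <= C * (b * v y - u y) * v A" if y: "y : \<Omega> Int ball z (R / 8)" for y
    using hb[rule_format, OF z R p1(2) v A, of y] y by simp
   show "v y >= 0" if y: "y : \<Omega> Int ball z (R / 8)" for y using y vp sub(1) by (force intro: less_imp_le)
  qed (rule ab C \<theta>)+
 qed
 then show ?thesis by (intro exI[of _ K], intro conjI[OF K] exI[of _ C] conjI[OF C]) blast
qed

definition ratio_at :: "'a => real => ('a => real) => ('a => real) => bool" where
 "ratio_at x r u v \<longleftrightarrow> sol x r u & psol x r v & (ALL y:\<Omega> Int ball x r. v y > 0)"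

lemma ratio_at_subset: "ball x r <= ball z R ==> ratio_at z R u v ==> ratio_at x r u v"
 unfolding ratio_at_def using sol_subset psol_subset by blast

text \<open>Two regimes for a ball about an interior point: for L r <= \<phi> x it lies in \<Omega>,
  for r >= D \<phi> x a frontier point is close compared with r. D L <= K ensures that after leaving
  the boundary regime the next smaller scale is already interior.\<close>

lemma oscillation:
 "EX K>=16. EX \<theta>>=1/2. \<theta> < 1 & (EX D>0. D * L <= K & (ALL x:\<Omega>. ALL r>0. ALL u v a b. norm x + r < 1/2 --> (L * r <= \<phi> x \<or> r >= D * \<phi> x) -->
   ratio_at x r u v --> a <= b --> pinched u v a b (\<Omega> Int ball x r) -->
   (EX a' b'. a' <= b' & b' - a' <= \<theta> * (b - a) & pinched u v a' b' (\<Omega> Int ball x (r / K)))))"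
proof -
 obtain M C where M: "M >= 4" and C: "C >= 1" and bo: "ALL z:frontier \<Omega>. ALL R>0. ALL u v a b \<theta>. norm z + M * R < 1/2 --> sol z (M * R) u --> psol z (M * R) v -->
   (ALL x:\<Omega> Int ball z (M * R). v x > 0) --> a <= b --> pinched u v a b (\<Omega> Int ball z (M * R)) --> 1 - 1 / (2 * C) <= \<theta> -->
   (EX a' b'. a' <= b' & b' - a' <= \<theta> * (b - a) & pinched u v a' b' (\<Omega> Int ball z (R / 8)))"
  using boundary_oscillation by (elim exE conjE) (rule that; assumption)
 define H where "H = harnack_const TYPE('a)"
 have H: "H^2 >= 1" unfolding H_def using harnack_const_gt1[where 'a='a] by (intro one_le_power) simp
 define \<theta> where "\<theta> = max (1 - 1 / (2 * C)) (1 - 1 / (2 * H^2))"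
 have "1 / (2 * C) <= 1 / 2" using C by simp
 then have "1 / 2 <= 1 - 1 / (2 * C)" by linarith
 then have t1: "\<theta> >= 1/2" unfolding \<theta>_def by (rule max.coboundedI1)
 have "1 / (2 * C) > 0" "1 / (2 * H^2) > 0" using C H by auto
 then have t2: "\<theta> < 1" unfolding \<theta>_def by simp
 have \<theta>: "\<theta> >= 1/2" "\<theta> < 1" "1 - 1 / (2 * C) <= \<theta>" "1 - 1 / (2 * H^2) <= \<theta>"
  using t1 t2 by (auto simp: \<theta>_def)
 \<comment> \<open>Then the frontier point z is within r / (32 M) = R / 16 of x, with R = r / (2 M),
   and the ball of radius r / K about x fits into the ball of radius R / 8 about z.\<close>
 define D where "D = 64 * M / \<kappa>"
 have D: "D > 0" using M kappa_pos by (simp add: D_def)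
 define K where "K = max (32 * M) (D * L)"
 have K: "K >= 32 * M" "K >= 16" "D * L <= K" using M by (auto simp: K_def)
 have "EX a' b'. a' <= b' & b' - a' <= \<theta> * (b - a) & pinched u v a' b' (\<Omega> Int ball x (r / K))"
  if x: "x : \<Omega>" and r: "r > 0" "norm x + r < 1/2" and good: "L * r <= \<phi> x \<or> r >= D * \<phi> x"
   and uv: "ratio_at x r u v" and ab: "a <= b" and pin: "pinched u v a b (\<Omega> Int ball x r)" for x r u v a b
  using good
 proof
  assume "L * r <= \<phi> x"
  then have sub: "ball x r <= \<Omega>" using r by (intro ball_in_dom) auto
  then have e: "\<Omega> Int ball x r = ball x r" by blast
  have "EX a' b'. a' <= b' & b' - a' <= \<theta> * (b - a) & pinched u v a' b' (ball x (r / 16))"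
  proof (rule interior_oscillation[OF r(1)])
   show "harmonic_on (ball x r) u" "harmonic_on (ball x r) v"
    using uv unfolding ratio_at_def psol_def sol_def e by auto
   show "v y > 0" if "y : ball x r" for y using uv that unfolding ratio_at_def e by blast
  qed (use ab pin \<theta>(4) in \<open>auto simp: e H_def\<close>)
  moreover have "r / K <= r / 16" using K r by (intro divide_left_mono) auto
  then have "\<Omega> Int ball x (r / K) <= ball x (r / 16)" using subset_ball[of "r / K" "r / 16" x] by blast
  ultimately show ?thesis by (meson pinched_subset)
 next
  assume "r >= D * \<phi> x"
  then have "(2 / \<kappa> * \<phi> x) * (32 * M) <= r" by (simp add: D_def mult_ac)
  then have small: "2 / \<kappa> * \<phi> x <= r / (32 * M)" using M by (simp add: pos_le_divide_eq)
  have "norm x < 1/2" using r by simp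
  then obtain z where z: "z : frontier \<Omega>" "dist x z < 2 / \<kappa> * \<phi> x" using near_frontier[OF x] by blast
  define R where "R = r / (2 * M)"
  have "r / (32 * M) <= r / (32 * 1)" using M r by (intro divide_left_mono mult_left_mono) auto
  then have R: "R > 0" "M * R = r / 2" "R / 8 = r / (32 * M) + r / (32 * M)" "r / (32 * M) <= r / 32"
   using M r by (auto simp: R_def)
  have xz: "dist x z < r / (32 * M)" using z small by simp
  have sub: "ball z (M * R) <= ball x r"
   by (rule ball_subset_shift) (use xz R r in linarith)
  have "norm z <= norm x + dist x z" by (rule norm_le_norm_dist)
  then have nz: "norm z + M * R < 1/2" using xz R r by linarith
  have uvz: "ratio_at z (M * R) u v" by (rule ratio_at_subset[OF sub uv])
  have "EX a' b'. a' <= b' & b' - a' <= \<theta> * (b - a) & pinched u v a' b' (\<Omega> Int ball z (R / 8))"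
  proof (rule bo[rule_format, OF z(1) R(1) nz _ _ _ ab _ \<theta>(3)])
   show "sol z (M * R) u" "psol z (M * R) v" "!!x. x : \<Omega> Int ball z (M * R) ==> v x > 0"
    using uvz unfolding ratio_at_def by auto
   show "pinched u v a b (\<Omega> Int ball z (M * R))" by (rule pinched_subset[OF _ pin]) (use sub in blast)
  qed
  moreover have "r / K <= r / (32 * M)" using K M r by (intro divide_left_mono) auto
  then have "ball x (r / K) <= ball z (R / 8)"
   by (intro ball_subset_shift) (use xz R in \<open>simp add: dist_commute\<close>)
  then have "\<Omega> Int ball x (r / K) <= \<Omega> Int ball z (R / 8)" by blast
  ultimately show ?thesis by (meson pinched_subset)
 qed
 then show ?thesis using K \<theta> D
  by (intro exI[of _ K], intro conjI[OF K(2)] exI[of _ \<theta>], intro conjI \<theta>(1,2) exI[of _ D]) blast+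
qed

text \<open>Between the boundary regime and the interior regime at most one scale is lost.\<close>

lemma oscillation_iterate:
 "EX K>=16. EX \<theta>>=1/2. \<theta> < 1 & (ALL x:\<Omega>. ALL r>0. ALL u v a b. norm x + r < 1/2 -->
   ratio_at x r u v --> a <= b --> pinched u v a b (\<Omega> Int ball x r) -->
   (ALL n. EX a' b'. a' <= b' & \<theta> * (b' - a') <= \<theta> ^ n * (b - a) & pinched u v a' b' (\<Omega> Int ball x ((1 / K) ^ n * r))))"
proof -
 obtain K \<theta> D where K: "K >= 16" and \<theta>: "\<theta> >= 1/2" "\<theta> < 1" and D: "D > 0" "D * L <= K"
  and os: "ALL x:\<Omega>. ALL r>0. ALL u v a b. norm x + r < 1/2 --> (L * r <= \<phi> x \<or> r >= D * \<phi> x) -->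
   ratio_at x r u v --> a <= b --> pinched u v a b (\<Omega> Int ball x r) -->
   (EX a' b'. a' <= b' & b' - a' <= \<theta> * (b - a) & pinched u v a' b' (\<Omega> Int ball x (r / K)))"
  using oscillation by (elim exE conjE) (rule that; assumption)
 have "EX a' b'. a' <= b' & \<theta> * (b' - a') <= \<theta> ^ n * (b - a) & pinched u v a' b' (\<Omega> Int ball x ((1 / K) ^ n * r))"
  if x: "x : \<Omega>" and r: "r > 0" "norm x + r < 1/2" and uv: "ratio_at x r u v" and ab: "a <= b"
   and pin: "pinched u v a b (\<Omega> Int ball x r)" for x r u v a b n
 proof -
  define rr where "rr n = (1 / K) ^ n * r" for n
  have rr: "rr n > 0" "rr n <= r" "rr (Suc n) = rr n / K" for n
   using K r by (auto simp: rr_def mult_le_cancel_right1 power_le_one)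
  have step: "EX a'' b''. a'' <= b'' & b'' - a'' <= \<theta> * (b' - a') & pinched u v a'' b'' (\<Omega> Int ball x (rr (Suc n)))"
   if "L * rr n <= \<phi> x \<or> rr n >= D * \<phi> x" "a' <= b'" "pinched u v a' b' (\<Omega> Int ball x (rr n))" for a' b' n
  proof -
   have "norm x + rr n < 1/2" using rr(2)[of n] r by linarith
   moreover have "ratio_at x (rr n) u v" by (rule ratio_at_subset[OF subset_ball[OF rr(2)] uv])
   ultimately show ?thesis unfolding rr(3) using os x rr(1)[of n] that by blast
  qed
  \<comment> \<open>The disjunction records whether the single loss has occurred. Its second branch
    carries the fact that x is already in the interior regime, which then persists at all smaller
    scales.\<close>
  have "EX a' b'. a' <= b' & pinched u v a' b' (\<Omega> Int ball x (rr n)) &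
    (b' - a' <= \<theta> ^ n * (b - a) \<or> L * rr n <= \<phi> x & \<theta> * (b' - a') <= \<theta> ^ n * (b - a))" for n
  proof (induction n)
   case 0
   then show ?case using ab pin by (intro exI[of _ a] exI[of _ b]) (simp add: rr_def)
  next
   case (Suc n)
   then obtain a' b' where I: "a' <= b'" "pinched u v a' b' (\<Omega> Int ball x (rr n))"
    "b' - a' <= \<theta> ^ n * (b - a) \<or> L * rr n <= \<phi> x & \<theta> * (b' - a') <= \<theta> ^ n * (b - a)" by blast
   have m: "\<theta> * s <= \<theta> ^ Suc n * (b - a)" if "s <= \<theta> ^ n * (b - a)" for s
    using mult_left_mono[OF that, of \<theta>] \<theta> by (simp add: mult.assoc)
   have lower: "L * rr (Suc n) <= \<phi> x" if "L * rr n <= \<phi> x \<or> rr n <= D * \<phi> x"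
   proof -
    have p: "\<phi> x > 0" by (rule phi_pos[OF x])
    have "L * rr n <= K * \<phi> x"
     using that
    proof
     assume "L * rr n <= \<phi> x"
     also have "\<phi> x <= K * \<phi> x" using K p by simp
     finally show ?thesis .
    next
     assume "rr n <= D * \<phi> x"
     then have "L * rr n <= L * (D * \<phi> x)" using L_pos by (intro mult_left_mono) auto
     also have "... = (D * L) * \<phi> x" by simp
     also have "... <= K * \<phi> x" using D p by (intro mult_right_mono) auto
     finally show ?thesis .
    qed
    then show ?thesis unfolding rr(3) using K by (simp add: pos_divide_le_eq mult.commute)
   qed
   show ?case
   proof (cases "L * rr n <= \<phi> x \<or> rr n >= D * \<phi> x")
    case True
    obtain a'' b'' where J: "a'' <= b''" "b'' - a'' <= \<theta> * (b' - a')" "pinched u v a'' b'' (\<Omega> Int ball x (rr (Suc n)))"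
     using step[OF True I(1,2)] by blast
    have "b'' - a'' <= \<theta> ^ Suc n * (b - a) \<or> L * rr (Suc n) <= \<phi> x & \<theta> * (b'' - a'') <= \<theta> ^ Suc n * (b - a)"
     using I(3)
    proof
     assume "b' - a' <= \<theta> ^ n * (b - a)"
     then show ?thesis using m J(2) by (meson order_trans)
    next
     assume *: "L * rr n <= \<phi> x & \<theta> * (b' - a') <= \<theta> ^ n * (b - a)"
     then have "b'' - a'' <= \<theta> ^ n * (b - a)" using J(2) by linarith
     then show ?thesis using m lower * by blast
    qed
    then show ?thesis using J(1,3) by blast
   next
    case False
    then have "b' - a' <= \<theta> ^ n * (b - a)" using I(3) by blast
    then have "\<theta> * (b' - a') <= \<theta> ^ Suc n * (b - a)" by (rule m)
    moreover have "L * rr (Suc n) <= \<phi> x" using False by (intro lower) simp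
    moreover have "rr (Suc n) <= rr n" unfolding rr(3) using rr(1)[of n] K by (simp add: pos_divide_le_eq)
    then have "\<Omega> Int ball x (rr (Suc n)) <= \<Omega> Int ball x (rr n)" using subset_ball by blast
    then have "pinched u v a' b' (\<Omega> Int ball x (rr (Suc n)))" using I(2) by (rule pinched_subset)
    ultimately show ?thesis using I(1) by blast
   qed
  qed
  then obtain a' b' where I: "a' <= b'" "pinched u v a' b' (\<Omega> Int ball x (rr n))"
    "b' - a' <= \<theta> ^ n * (b - a) \<or> \<theta> * (b' - a') <= \<theta> ^ n * (b - a)" by blast
  have "\<theta> * (b' - a') <= 1 * (b' - a')" using I(1) \<theta> by (intro mult_right_mono) auto
  then have "\<theta> * (b' - a') <= b' - a'" by simp
  then have "\<theta> * (b' - a') <= \<theta> ^ n * (b - a)" using I(3) order_trans by blast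
  then show ?thesis using I(1,2) unfolding rr_def by blast
 qed
 then show ?thesis by (intro exI[of _ K], intro conjI[OF K] exI[of _ \<theta>], intro conjI \<theta>) blast
qed

theorem boundary_harnack: "boundary_harnack_principle \<Omega>"
proof -
 obtain K \<theta> where K: "K >= 16" and \<theta>: "\<theta> >= 1/2" "\<theta> < 1" and it: "ALL x:\<Omega>. ALL r>0. ALL u v a b. norm x + r < 1/2 -->
   ratio_at x r u v --> a <= b --> pinched u v a b (\<Omega> Int ball x r) -->
   (ALL n. EX a' b'. a' <= b' & \<theta> * (b' - a') <= \<theta> ^ n * (b - a) & pinched u v a' b' (\<Omega> Int ball x ((1 / K) ^ n * r)))"
  using oscillation_iterate by (elim exE conjE) (rule that; assumption)
 obtain M C where M: "M >= 4" and C: "C >= 1" and hb: "ALL z:frontier \<Omega>. ALL R>0. ALL u v A. norm z + M * R < 1/2 --> psol z (M * R) u --> psol z (M * R) v -->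
   A : ball z R --> \<phi> A >= \<eta> / 2 * R --> (ALL x:ball z (R / 8). v x * u A <= C * u x * v A)"
  using half_boundary_harnack by (elim exE conjE) (rule that; assumption)
 \<comment> \<open>The exponent with (1/K)^\<alpha> = \<theta>; it depends on the domain but not on
   u and v, as the common exponent in the principle requires.\<close>
 define \<alpha> where "\<alpha> = - ln \<theta> / ln K"
 have lnK: "ln K > 0" using K by simp
 have "ln \<theta> < 0" using \<theta> by simp
 then have a0: "\<alpha> > 0" using lnK by (simp add: \<alpha>_def divide_neg_pos)
 \<comment> \<open>Needed for \<alpha> <= 1, without which the extension formula would fail; K >= 16
   and \<theta> >= 1/2 were arranged for this.\<close>
 have "ln (1 / K) <= ln \<theta>"
 proof (subst ln_le_cancel_iff)
  have "1 / K <= 1 / 16" using K by (intro divide_left_mono) auto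
  then show "1 / K <= \<theta>" using \<theta> by linarith
 qed (use K \<theta> in auto)
 then have "- ln \<theta> <= ln K" using K by (simp add: ln_div)
 then have a1: "\<alpha> <= 1" unfolding \<alpha>_def divide_le_eq_1_pos[OF lnK] .
 have pw: "((1 / K) ^ n) powr \<alpha> = \<theta> ^ n" for n
 proof -
  have "((1 / K) ^ n) powr \<alpha> = exp (real n * (\<alpha> * ln (1 / K)))" using K by (simp add: powr_def ln_realpow mult_ac)
  also have "\<alpha> * ln (1 / K) = ln \<theta>" using lnK K by (simp add: \<alpha>_def ln_div)
  also have "exp (real n * ln \<theta>) = \<theta> ^ n" using \<theta> by (simp add: exp_of_nat_mult)
  finally show ?thesis .
 qed
 define R where "R = 1 / (4 * M)"
 define \<rho> where "\<rho> = R / 16"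
 have R: "R > 0" "M * R < 1/2" "R <= 1/16" using M by (auto simp: R_def divide_simps)
 have \<rho>: "\<rho> > 0" "\<rho> < 1/4" using R by (auto simp: \<rho>_def)
 have "EX g. (ALL x:\<Omega> Int ball 0 \<rho>. g x = u x / v x) & hoelder_on \<alpha> (ball 0 \<rho> Int closure \<Omega>) g"
  if uc: "continuous_on (ball 0 1) u" and vc: "continuous_on (ball 0 1) v"
   and up: "ALL x:\<Omega> Int ball 0 1. u x > 0" and vp: "ALL x:\<Omega> Int ball 0 1. v x > 0"
   and uh: "harmonic_on (\<Omega> Int ball 0 1) u" and vh: "harmonic_on (\<Omega> Int ball 0 1) v"
   and u0: "ALL x:ball 0 1 - \<Omega>. u x = 0" and v0: "ALL x:ball 0 1 - \<Omega>. v x = 0" for u v :: "'a => real"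
 proof -
  have su: "sol 0 1 u" "sol 0 1 v" using uc vc uh vh u0 v0 by (auto simp: sol_def)
  have "u x >= 0 & v x >= 0" if "x : ball 0 1" for x
   using that up vp u0 v0 by (cases "x : \<Omega>") (auto intro: less_imp_le)
  then have pu: "psol 0 1 u" "psol 0 1 v" using su by (auto simp: psol_def)
  have rat: "ratio_at 0 1 u v" using su pu vp by (simp add: ratio_at_def)
  have "norm (0::'a) + R < 1" using R by simp
  then obtain A where A: "A : ball 0 R" "\<phi> A >= \<eta> / 2 * R" using corkscrew[OF zero_front R(1)] by blast
  have nA: "norm A < 1" using A(1) R by simp
  have "\<eta> / 2 * R > 0" using eta_pos R by simp
  then have AO: "A : \<Omega>" using A(2) phi_pos_iff[OF nA] by linarith
  have uvA: "u A > 0" "v A > 0" using up vp AO nA by auto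
  define B where "B = C * u A / v A"
  have B: "B >= 0" using C uvA by (simp add: B_def)
  have sub1: "ball 0 (M * R) <= ball (0::'a) 1" using R by (intro subset_ball) simp
  \<comment> \<open>The initial pinching: the one-sided inequality with the roles of u and v
    exchanged.\<close>
  have pin0: "pinched u v 0 B (\<Omega> Int ball 0 (R / 8))"
   unfolding pinched_def
  proof
   fix y assume y: "y : \<Omega> Int ball 0 (R / 8)"
   have "u y * v A <= C * v y * u A"
    by (rule hb[rule_format, OF zero_front R(1) _ psol_subset[OF sub1 pu(2)] psol_subset[OF sub1 pu(1)] A]) (use R y in auto)
   then have "u y <= B * v y" using uvA by (simp add: B_def pos_le_divide_eq mult_ac)
   moreover have "u y > 0" using up y R by simp
   ultimately show "0 * v y <= u y & u y <= B * v y" by simp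
  qed
  define q where "q x = u x / v x" for x
  \<comment> \<open>One factor \<theta> is the scale lost in the iteration, the other arises because
    the dyadic ball containing y is one level coarser than the one comparable to the distance of x
    and y.\<close>
  define E where "E = B / \<theta>^2 / \<rho> powr \<alpha>"
  have E: "E >= 0" using B by (simp add: E_def)
  have near: "\<bar>q x - q y\<bar> <= b - a" if "pinched u v a b (\<Omega> Int ball z r)" "x : \<Omega> Int ball z r" "y : \<Omega> Int ball z r"
   "norm x < 1" "norm y < 1" for x y z r a b
  proof -
   have "a <= q t & q t <= b" if t: "t : \<Omega> Int ball z r" "norm t < 1" for t
   proof -
    have "v t > 0" using vp t by simp
    then show ?thesis using \<open>pinched u v a b (\<Omega> Int ball z r)\<close> t unfolding pinched_def q_def
     by (simp add: pos_le_divide_eq pos_divide_le_eq)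
   qed
   from this[of x] this[of y] show ?thesis using that(2-5) by (simp add: abs_le_iff)
  qed
  have hoel: "\<bar>q x - q y\<bar> <= E * dist x y powr \<alpha>" if x: "x : \<Omega> Int ball 0 \<rho>" and y: "y : \<Omega> Int ball 0 \<rho>" for x y
  proof (cases "x = y")
   case False
   define t where "t = dist x y"
   have t: "t > 0" using False by (simp add: t_def)
   have xy1: "norm x < 1" "norm y < 1" using x y \<rho> by auto
   obtain n where n: "(1 / K) ^ n * \<rho> <= t" "n = 0 \<or> (1 / K) * t < (1 / K) ^ n * \<rho>"
    using geometric_scale[of "1 / K" t \<rho>] K t by auto
   have th2: "B <= B / \<theta>^2"
    using B \<theta> power_le_one[of \<theta> 2] by (simp add: pos_le_divide_eq mult_left_le)
   show ?thesis
   proof (cases n)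
    case 0
    then have "\<rho> <= t" using n(1) by simp
    then have "\<rho> powr \<alpha> <= t powr \<alpha>" using \<rho> a0 by (intro powr_mono2) auto
    then have "E * \<rho> powr \<alpha> <= E * t powr \<alpha>" using E by (intro mult_left_mono)
    moreover have "E * \<rho> powr \<alpha> = B / \<theta>^2" using \<rho> by (simp add: E_def)
    moreover have "\<bar>q x - q y\<bar> <= B - 0" by (rule near[OF pin0]) (use x y xy1 \<rho> in \<open>auto simp: \<rho>_def\<close>)
    ultimately show ?thesis using th2 unfolding t_def by linarith
   next
    case (Suc k)
    have tk: "t < (1 / K) ^ k * \<rho>"
    proof -
     have "(1 / K) * t < (1 / K) * ((1 / K) ^ k * \<rho>)" using n(2) Suc by (simp add: mult.assoc)
     then show ?thesis by (rule mult_left_less_imp_less) (use K in simp)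
    qed
    have xr: "norm x + \<rho> < 1/2" using x \<rho> by simp
    have sub: "ball x \<rho> <= ball 0 (R / 8)" "ball x \<rho> <= ball 0 1"
     using x R by (auto intro!: ball_subset_shift simp: \<rho>_def)
    have "pinched u v 0 B (\<Omega> Int ball x \<rho>)" by (rule pinched_subset[OF _ pin0]) (use sub in blast)
    then obtain a' b' where I: "\<theta> * (b' - a') <= \<theta> ^ k * (B - 0)" "pinched u v a' b' (\<Omega> Int ball x ((1 / K) ^ k * \<rho>))"
     using it x \<rho>(1) xr ratio_at_subset[OF sub(2) rat] B by (metis IntD1)
    have "\<bar>q x - q y\<bar> <= b' - a'"
     by (rule near[OF I(2)]) (use x y xy1 tk t in \<open>auto simp: t_def intro: le_less_trans[OF zero_le_dist]\<close>)
    then have "\<theta> * \<bar>q x - q y\<bar> <= \<theta> * (b' - a')" using \<theta> by (intro mult_left_mono) auto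
    also note I(1)
    finally have "\<theta> * \<bar>q x - q y\<bar> <= \<theta> ^ k * B" by simp
    then have "\<theta>^2 * \<bar>q x - q y\<bar> <= \<theta> ^ n * B"
     using mult_left_mono[of "\<theta> * \<bar>q x - q y\<bar>" "\<theta> ^ k * B" \<theta>] \<theta> Suc by (simp add: power2_eq_square mult.assoc)
    moreover have "\<theta> ^ n * \<rho> powr \<alpha> <= t powr \<alpha>"
    proof -
     have "\<theta> ^ n * \<rho> powr \<alpha> = ((1 / K) ^ n * \<rho>) powr \<alpha>" unfolding powr_mult pw ..
     also have "... <= t powr \<alpha>" using n(1) a0 K \<rho> by (intro powr_mono2) auto
     finally show ?thesis .
    qed
    then have "\<theta> ^ n <= t powr \<alpha> / \<rho> powr \<alpha>" using \<rho> by (simp add: pos_le_divide_eq)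
    then have "\<theta> ^ n * B <= t powr \<alpha> / \<rho> powr \<alpha> * B" using B by (rule mult_right_mono)
    ultimately have "\<theta>^2 * \<bar>q x - q y\<bar> <= t powr \<alpha> / \<rho> powr \<alpha> * B" by linarith
    moreover have "\<theta>^2 > 0" using \<theta> by simp
    ultimately have "\<bar>q x - q y\<bar> <= (t powr \<alpha> / \<rho> powr \<alpha> * B) / \<theta>^2"
     by (simp only: pos_le_divide_eq mult.commute)
    then show ?thesis unfolding t_def[symmetric] E_def by (simp add: mult_ac)
   qed
  qed simp
  \<comment> \<open>The estimate on \<Omega> alone suffices: the extension is Hoelder continuous on
    the whole space, in particular up to the frontier.\<close>
  obtain g where g: "ALL x:\<Omega> Int ball 0 \<rho>. g x = q x" "ALL x y. \<bar>g x - g y\<bar> <= E * dist x y powr \<alpha>"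
   using hoelder_extension[OF a0 a1 E hoel] by blast
  have "hoelder_on \<alpha> (ball 0 \<rho> Int closure \<Omega>) g"
   unfolding hoelder_on_def dist_real_def using g(2) by blast
  then show ?thesis using g(1) unfolding q_def by blast
 qed
 moreover have "\<rho> < 1/2" using \<rho> by simp
 ultimately show ?thesis unfolding boundary_harnack_principle_def
  using a0 \<rho>(1) by (intro exI[of _ \<alpha>] conjI allI impI exI[of _ \<rho>]) (blast | assumption)+
qed

end

theorem theorem1p2:
  fixes \<Omega> :: "'a::euclidean_space set"
    and \<phi> :: "'a \<Rightarrow> real"
    and L \<kappa> \<mu> \<Lambda> \<eta> :: real
  assumes "open \<Omega>" and "\<Omega> \<subseteq> ball 0 1" and "0 \<in> frontier \<Omega>"
    and "continuous_on (ball 0 1) \<phi>"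
    and a: "\<And>x. x \<in> \<Omega> \<Longrightarrow> \<phi> x > 0" "\<And>x. x \<in> ball 0 1 - \<Omega> \<Longrightarrow> \<phi> x = 0"
    and b: "L > 0" "L-lipschitz_on (ball 0 1) \<phi>"
    and c: "\<kappa> > 0"
      "\<And>x. x \<in> ball 0 (1/2) \<Longrightarrow> \<phi> x \<ge> \<kappa> * infdist x (ball 0 1 - \<Omega>)"
    and d: "distr_subharmonic_on (ball 0 1) \<phi>"
    and e: "\<mu> > 0"
      "\<And>x0 r. x0 \<in> frontier \<Omega> \<inter> ball 0 1 \<Longrightarrow> 0 < r \<Longrightarrow> r < 1 - norm x0 \<Longrightarrow>
         measure lborel (ball x0 r - \<Omega>) \<ge> \<mu> * measure lborel (ball x0 r)"
    and f: "\<Lambda> > 0"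
      "\<And>x0 r t. x0 \<in> frontier \<Omega> \<inter> ball 0 1 \<Longrightarrow> 0 < r \<Longrightarrow> r < 1 - norm x0 \<Longrightarrow> 0 < t \<Longrightarrow>
         measure lborel ({x. 0 < \<phi> x \<and> \<phi> x < r * t} \<inter> ball x0 r)
           \<le> \<Lambda> * t * measure lborel (ball (0::'a) r)"
    and g: "\<eta> > 0"
      "\<And>x0 r. x0 \<in> frontier \<Omega> \<inter> ball 0 1 \<Longrightarrow> 0 < r \<Longrightarrow> r < 1 - norm x0 \<Longrightarrow>
         (SUP x\<in>ball x0 r. \<phi> x) \<ge> \<eta> * r"
  shows "boundary_harnack_principle \<Omega>"
proof -
  interpret optimal_domain \<Omega> \<phi> L \<kappa> \<mu> \<Lambda> \<eta>
    by unfold_locales (fact assms)+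
  show ?thesis by (rule boundary_harnack)
qed

end
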